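(* Let $d\in\{2,3\}$, and fix the coefficients $\overline\sigma_t,\overline\sigma_a>0$, the parameter $\vartheta\in(0,1)$, a positive, centrally paired angular quadrature $\{(\vec\omega_m,w_m)\}_{m=1}^{N_\omega}$ satisfying the moment conditions, and a family of polytopic meshes $\{\mathcal T_h\}_{h>0}$ of $\Omega$ with nonempty physical boundary face set $\mathcal E_h^\partial$, satisfying the polynomial inverse estimate and the whole-boundary trace inverse estimate with constants $C_{\rm inv},C_{\rm tr}$ independent of $K$, $h$, $p$ and the number of faces of $K$ (all as in the context). Homogeneous vacuum inflow is imposed on each physical boundary face through the zero exterior trace. (1) For every mesh $\mathcal T_h$ of the family, every $p\ge1$ and every $0<\epsilon<(\overline\sigma_t/\overline\sigma_a)^{1/2}$, the source-iteration error propagator $\mathsf G_h^\epsilon$ is self-adjoint in the inner product $a_{{\rm ex},h}^\epsilon(\cdot,\cdot)$, and $$\|\mathsf G_h^\epsilon\|_{\rm ex}=\rho(\mathsf G_h^\epsilon)=c_\epsilon\,\lambda_{\max}(\mathsf H_h^\epsilon)\le 1-\epsilon^2\frac{\overline\sigma_a}{\overline\sigma_t}.$$ Moreover $\lambda_{\max}(\mathsf H_h^\epsilon)<1$, so that this factor is strictly smaller than $c_\epsilon$. (2) There are constants $C>0$ and $\mathrm{Kn}_0>0$, depending only on $d$, $\overline\sigma_t$, $\overline\sigma_a$, $\vartheta$, the angular quadrature, and the constants $C_{\rm inv},C_{\rm tr}$ (in particular independent of $h$, $\epsilon$, $p$ and the number of element faces), with $$\mathrm{Kn}_0\le\min\Big\{\frac{\vartheta^2}{C_{\rm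 tr}},\frac1{2C}\Big\},$$ such that, whenever $\mathrm{Kn}_{h,p}^\epsilon\le\mathrm{Kn}_0$, the following hold: (a) $\tau_e^\epsilon=\beta_e$ for all $e\in\mathcal E_h$; (b) $a_{{\rm MIP},h}^\epsilon$ is symmetric positive definite, and its contribution on the physical boundary faces is $$\sum_{e\in\mathcal E_h^\partial}\Big[\tau_e^\epsilon\langle u,v\rangle_e-\frac\epsilon2\langle\overline D\nabla u\cdot\vec n_e,v\rangle_e-\frac\epsilon2\langle\overline D\nabla v\cdot\vec n_e,u\rangle_e\Big];$$ (c) for all $u,v\in V_h$, $$|a_{{\rm ex},h}^\epsilon(u,v)-a_{{\rm MIP},h}^\epsilon(u,v)|\le C\,\mathrm{Kn}_{h,p}^\epsilon\,\|u\|_{\rm MIP}\|v\|_{\rm MIP};$$ (d) the MIP-DSA error propagator $\mathsf E_h^\epsilon$ satisfies $$\|\mathsf E_h^\epsilon\|_{\rm ex}\le C\,\mathrm{Kn}_{h,p}^\epsilon\,\rho(\mathsf G_h^\epsilon),$$ and hence $$\rho(\mathsf E_h^\epsilon)\le\|\mathsf E_h^\epsilon\|_{\rm ex}\le\tfrac12\rho(\mathsf G_h^\epsilon)<\|\mathsf G_h^\epsilon\|_{\rm ex}=\rho(\mathsf G_h^\epsilon).$$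
   Context: Domain and coefficients. $\Omega\subset\mathbb R^d$, $d\in\{2,3\}$, is a bounded connected Lipschitz polytopal domain. $\overline\sigma_t,\overline\sigma_a>0$ are constants and $0<\epsilon<(\overline\sigma_t/\overline\sigma_a)^{1/2}$. Set $\sigma_t^\epsilon=\overline\sigma_t/\epsilon$, $\sigma_s^\epsilon=\overline\sigma_t/\epsilon-\epsilon\overline\sigma_a$, $c_\epsilon=\sigma_s^\epsilon/\sigma_t^\epsilon=1-\epsilon^2\overline\sigma_a/\overline\sigma_t$, $\overline D=1/(d\overline\sigma_t)$. Mesh. $\{\mathcal T_h\}$ is a family of finite, connected, face-to-face partitions of $\Omega$ into bounded Lipschitz polytopes (not necessarily convex); $h_K=\operatorname{diam}(K)$. $\mathcal E_h^\circ$, $\mathcal E_h^\partial$ are the sets of interior and physical boundary faces, $\mathcal E_h=\mathcal E_h^\circ\cup\mathcal E_h^\partial$. An interior face $e$ has adjacent elements $K^+,K^-$ and a fixed unit normal $\vec n_e$ directed from $K^+$ to $K^-$; a boundary face has a unique adjacent element $K^+$ and $\vec n_e$ is the outward unit normal. $\mathcal T_e=\{K\in\mathcal T_h: e\subset\partial K\}$. With $v^\pm$ the traces from $K^\pm$, set $[v]=v^+-v^-$ and $\{v\}=\frac12(v^++v^-)$ on interior faces; on boundary faces the zero exterior trace $v^-:=0$ is used, so $[v]=v^+$, $\{v\}=\frac12v^+$ (same convention for vector quantities, so $\{\overline D\nabla v\cdot\vec n_e\}=\frac12\overline D\nabla v^+\cdot\vec n_e$ there). $(\cdot,\cdot)_K$,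 $(\cdot,\cdot)_\Omega$, $\langle\cdot,\cdot\rangle_e$ are $L^2$ inner products on $K$, $\Omega$, $e$, and $\|\cdot\|_{0,S}$ is the $L^2(S)$ norm. For $p\ge1$, $V_h=\{v\in L^2(\Omega): v|_K\in\mathbb P_p(K)\ \forall K\in\mathcal T_h\}$ (polynomials of degree at most $p$). Admissible meshes. There are constants $C_{\rm inv},C_{\rm tr}>0$ independent of $K,h,p$ and of the number and relative sizes of faces of $K$ such that, for all $K\in\mathcal T_h$, $p\ge1$, $v\in\mathbb P_p(K)$: $\|\nabla v\|_{0,K}\le C_{\rm inv}p^2h_K^{-1}\|v\|_{0,K}$ (polynomial inverse estimate) and $\|v\|_{0,\partial K}^2\le C_{\rm tr}p^2h_K^{-1}\|v\|_{0,K}^2$ (whole-boundary trace inverse estimate). The effective cell Knudsen number is $\mathrm{Kn}_{h,p}^\epsilon=\max_{K\in\mathcal T_h}\frac{p^2}{\sigma_t^\epsilon h_K}=\max_K\frac{p^2\epsilon}{\overline\sigma_th_K}$. Quadrature. $\{(\vec\omega_m,w_m)\}_{m=1}^{N_\omega}\subset\mathbb S^{d-1}\times(0,1)$ is a set of distinct pairs with $\sum_mw_m=1$, $\sum_mw_m\vec\omega_m=\vec0$, $\sum_mw_m\vec\omega_m\otimes\vec\omega_m=\frac1dI$, and central pairing: for every $m$ there is an index $\overline m$ with $\vec\omega_{\overline m}=-\vec\omega_m$, $w_{\overline m}=w_m$. Transport form. On a face $e$, $u_m^{\rm up}=u^+$ if $\vec\omega_m\cdot\vec n_e\ge0$ and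 $u_m^{\rm up}=u^-$ if $\vec\omega_m\cdot\vec n_e<0$ (with $u^-=0$ on boundary faces). For $u,v\in V_h$, $$b_{m,h}^\epsilon(u,v)=-\sum_K(u,\vec\omega_m\cdot\nabla v)_K+\sum_{e\in\mathcal E_h}\langle(\vec\omega_m\cdot\vec n_e)u_m^{\rm up},[v]\rangle_e+(\sigma_t^\epsilon u,v)_\Omega.$$ Each directional problem with form $b_{m,h}^\epsilon$ is uniquely solvable in $V_h$. MIP form. $\beta_e=\frac12\sum_mw_m|\vec\omega_m\cdot\vec n_e|$; $\tau_{{\rm SIP},e}=\frac{C_{\rm tr}p^2}{2\vartheta^2}\max_{K\in\mathcal T_e}\frac{\overline D}{h_K}$ with fixed $\vartheta\in(0,1)$; $\tau_e^\epsilon=\max\{\epsilon\tau_{{\rm SIP},e},\beta_e\}$; and $$a_{{\rm MIP},h}^\epsilon(u,v)=\epsilon\sum_K[(\overline D\nabla u,\nabla v)_K+(\overline\sigma_au,v)_K]+\sum_e\tau_e^\epsilon\langle[u],[v]\rangle_e-\epsilon\sum_e\langle\{\overline D\nabla u\cdot\vec n_e\},[v]\rangle_e-\epsilon\sum_e\langle\{\overline D\nabla v\cdot\vec n_e\},[u]\rangle_e,$$ sums over $K\in\mathcal T_h$, $e\in\mathcal E_h$. It is symmetric positive definite, and $\|v\|_{\rm MIP}^2=a_{{\rm MIP},h}^\epsilon(v,v)$. Scalar response and exact correction. For $g\in V_h$ let $\widehat\Psi_{m,h}^\epsilon(g)\in V_h$ solve $\epsilon b_{m,h}^\epsilon(\widehat\Psi_{m,h}^\epsilon(g),v)=(\overline\sigma_tg,v)_\Omega$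 for all $v\in V_h$, and put $\mathsf H_h^\epsilon g=\sum_mw_m\widehat\Psi_{m,h}^\epsilon(g)$. The map $\mathsf H_h^\epsilon:V_h\to V_h$ is self-adjoint and positive definite in $(\overline\sigma_t\cdot,\cdot)_\Omega$, hence invertible; $\lambda_{\max}(\mathsf H_h^\epsilon)$ is its largest eigenvalue. The exact correction form, which is symmetric positive definite, is $$a_{{\rm ex},h}^\epsilon(u,v)=\frac1\epsilon\big(\overline\sigma_t[(\mathsf H_h^\epsilon)^{-1}u-c_\epsilon u],v\big)_\Omega,$$ with $\|v\|_{\rm ex}^2=a_{{\rm ex},h}^\epsilon(v,v)$. For linear $\mathsf A:V_h\to V_h$, $\|\mathsf A\|_{\rm ex}=\sup_{0\ne v\in V_h}\|\mathsf Av\|_{\rm ex}/\|v\|_{\rm ex}$, and $\rho(\mathsf A)$ is the spectral radius. Iterations. Let $q_h\in V_h$ and let $(\{\psi_{m,h}^\star\},\phi_h^\star)\in V_h^{N_\omega}\times V_h$ be the unique solution of $b_{m,h}^\epsilon(\psi_{m,h}^\star,v)=(\sigma_s^\epsilon\phi_h^\star+q_h,v)_\Omega$ for all $v\in V_h$ and all $m$, with $\phi_h^\star=\sum_mw_m\psi_{m,h}^\star$. Given $\phi_h^k\in V_h$, the predictor is $\phi_h^{k+1/2}=\sum_mw_m\psi_{m,h}^{k+1/2}$, where $b_{m,h}^\epsilon(\psi_{m,h}^{k+1/2},v)=(\sigma_s^\epsilon\phi_h^k+q_h,v)_\Omega$ for all $v\in V_h$. With $e_h^k=\phi_h^\star-\phi_h^k$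 and $e_h^{k+1/2}=\phi_h^\star-\phi_h^{k+1/2}$, the source-iteration error propagator $\mathsf G_h^\epsilon:V_h\to V_h$ is the linear map with $e_h^{k+1/2}=\mathsf G_h^\epsilon e_h^k$. MIP-DSA computes $\delta_h^{k+1}\in V_h$ from $a_{{\rm MIP},h}^\epsilon(\delta_h^{k+1},v)=(\sigma_s^\epsilon(\phi_h^{k+1/2}-\phi_h^k),v)_\Omega$ for all $v\in V_h$ and sets $\phi_h^{k+1}=\phi_h^{k+1/2}+\delta_h^{k+1}$; the MIP-DSA error propagator $\mathsf E_h^\epsilon:V_h\to V_h$ is the linear map with $e_h^{k+1}=\mathsf E_h^\epsilon e_h^k$, where here $e_h^{k+1}=\phi_h^\star-\phi_h^{k+1}$. *)

theory Defs
  imports "HOL-Analysis.Analysis"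
begin

section \<open>Fixed data: coefficients, penalty parameter, quadrature, mesh constants\<close>

text \<open>
  Everything the constants in the main result may depend on (besides the dimension
  \<open>DIM('a)\<close>) is collected in one record. Only the values of \<open>dir\<close> and \<open>wt\<close> at the
  indices \<open>1, \<dots>, n_dir\<close> are used.
\<close>

record 'a dsa_data =
  sig_t :: real
  sig_a :: real
  theta :: real
  C_inv :: real
  C_tr :: real
  n_dir :: nat
  dir :: "nat \<Rightarrow> 'a"
  wt :: "nat \<Rightarrow> real"

definition dirs :: "'a dsa_data \<Rightarrow> nat set" where
  "dirs P = {1..n_dir P}"

definition admissible_quadrature :: "'a::euclidean_space dsa_data \<Rightarrow> bool" where
  "admissible_quadrature P \<longleftrightarrow>
     (\<forall>m\<in>dirs P. norm (dir P m) = 1 \<and> 0 < wt P m \<and> wt P m < 1) \<and>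
     inj_on (\<lambda>m. (dir P m, wt P m)) (dirs P) \<and>
     (\<Sum>m\<in>dirs P. wt P m) = 1 \<and>
     (\<Sum>m\<in>dirs P. wt P m *\<^sub>R dir P m) = 0 \<and>
     (\<forall>i\<in>Basis. \<forall>j\<in>Basis.
        (\<Sum>m\<in>dirs P. wt P m * ((dir P m \<bullet> i) * (dir P m \<bullet> j))) =
        (if i = j then 1 / real DIM('a) else 0)) \<and>
     (\<forall>m\<in>dirs P. \<exists>m'\<in>dirs P. dir P m' = - dir P m \<and> wt P m' = wt P m)"

definition admissible_data :: "'a::euclidean_space dsa_data \<Rightarrow> bool" where
  "admissible_data P \<longleftrightarrow>
     0 < sig_t P \<and> 0 < sig_a P \<and> 0 < theta P \<and> theta P < 1 \<and>
     0 < C_inv P \<and> 0 < C_tr P \<and> admissible_quadrature P"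

definition sigma_t :: "'a dsa_data \<Rightarrow> real \<Rightarrow> real" where
  "sigma_t P \<epsilon> = sig_t P / \<epsilon>"

definition sigma_s :: "'a dsa_data \<Rightarrow> real \<Rightarrow> real" where
  "sigma_s P \<epsilon> = sig_t P / \<epsilon> - \<epsilon> * sig_a P"

definition c_ratio :: "'a dsa_data \<Rightarrow> real \<Rightarrow> real" where
  "c_ratio P \<epsilon> = sigma_s P \<epsilon> / sigma_t P \<epsilon>"

definition D_bar :: "'a::euclidean_space dsa_data \<Rightarrow> real" where
  "D_bar P = 1 / (real DIM('a) * sig_t P)"


section \<open>Polytopal Lipschitz sets and meshes\<close>

text \<open>
  Locally, up to choosing a direction \<open>\<nu>\<close>, the set is the strict subgraph of a Lipschitz
  function of the coordinates orthogonal to \<open>\<nu>\<close>.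
\<close>

definition lipschitz_boundary :: "'a::euclidean_space set \<Rightarrow> bool" where
  "lipschitz_boundary S \<longleftrightarrow>
     (\<forall>z\<in>frontier S. \<exists>U \<nu> L g. open U \<and> z \<in> U \<and> norm \<nu> = 1 \<and>
        L-lipschitz_on {y. y \<bullet> \<nu> = 0} (g :: 'a \<Rightarrow> real) \<and>
        S \<inter> U = {x \<in> U. x \<bullet> \<nu> < g (x - (x \<bullet> \<nu>) *\<^sub>R \<nu>)})"

text \<open>
  Not necessarily convex: the closure is a finite union of convex polytopes.
  Domains and mesh elements are open sets.
\<close>

definition lipschitz_polytope :: "'a::euclidean_space set \<Rightarrow> bool" where
  "lipschitz_polytope S \<longleftrightarrow>
     S \<noteq> {} \<and> open S \<and> bounded S \<and>
     (\<exists>\<Q>. finite \<Q> \<and> (\<forall>Q\<in>\<Q>. polytope Q) \<and> closure S = \<Union>\<Q>) \<and>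
     lipschitz_boundary S"

definition polytopal_domain :: "'a::euclidean_space set \<Rightarrow> bool" where
  "polytopal_domain \<Omega> \<longleftrightarrow> lipschitz_polytope \<Omega> \<and> connected \<Omega>"

definition flat_face :: "'a::euclidean_space set \<Rightarrow> bool" where
  "flat_face e \<longleftrightarrow>
     aff_dim e = int DIM('a) - 1 \<and>
     (\<exists>\<Q>. finite \<Q> \<and> (\<forall>Q\<in>\<Q>. polytope Q \<and> aff_dim Q = int DIM('a) - 1) \<and> e = \<Union>\<Q>)"

text \<open>\<open>K_minus\<close> is meaningful on interior faces only.\<close>

record 'a mesh =
  dom_of :: "'a set"
  cells :: "'a set set"
  int_faces :: "'a set set"
  bd_faces :: "'a set set"
  nrm :: "'a set \<Rightarrow> 'a"
  K_plus :: "'a set \<Rightarrow> 'a set"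
  K_minus :: "'a set \<Rightarrow> 'a set"

definition faces :: "'a mesh \<Rightarrow> 'a set set" where
  "faces M = int_faces M \<union> bd_faces M"

definition cells_at :: "'a::euclidean_space mesh \<Rightarrow> 'a set \<Rightarrow> 'a set set" where
  "cells_at M e = {K \<in> cells M. e \<subseteq> frontier K}"

text \<open>
  The mesh is face-to-face in the sense that each element boundary is a union of whole mesh
  faces, and each face belongs to exactly two elements (interior faces) or to exactly one
  element and to the boundary of the domain (boundary faces). Distinct faces overlap only
  in a set of surface measure zero, and the normal at a face points out of \<open>K_plus\<close>.
  The last conjunct is connectedness of the element adjacency graph.
\<close>

definition polytopic_mesh :: "'a::euclidean_space mesh \<Rightarrow> bool" where
  "polytopic_mesh M \<longleftrightarrow>
     finite (cells M) \<and>
     (\<forall>K\<in>cells M. lipschitz_polytope K \<and> K \<subseteq> dom_of M) \<and>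
     disjoint (cells M) \<and>
     closure (dom_of M) = (\<Union>K\<in>cells M. closure K) \<and>
     finite (faces M) \<and> int_faces M \<inter> bd_faces M = {} \<and>
     (\<forall>e\<in>faces M. flat_face e) \<and>
     (\<forall>e\<in>faces M. \<forall>f\<in>faces M. e \<noteq> f \<longrightarrow> rel_interior e \<inter> rel_interior f = {}) \<and>
     (\<forall>K\<in>cells M. frontier K = \<Union>{e \<in> faces M. e \<subseteq> frontier K}) \<and>
     (\<forall>e\<in>int_faces M. K_plus M e \<noteq> K_minus M e \<and>
        cells_at M e = {K_plus M e, K_minus M e}) \<and>
     (\<forall>e\<in>bd_faces M. cells_at M e = {K_plus M e} \<and> e \<subseteq> frontier (dom_of M)) \<and>
     (\<forall>e\<in>faces M. norm (nrm M e) = 1 \<and> (\<forall>x\<in>e. \<forall>y\<in>e. nrm M e \<bullet> (x - y) = 0)) \<and>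
     (\<forall>e\<in>int_faces M. \<forall>x\<in>rel_interior e. \<exists>r>0. \<forall>t. 0 < t \<and> t < r \<longrightarrow>
        x - t *\<^sub>R nrm M e \<in> K_plus M e \<and> x + t *\<^sub>R nrm M e \<in> K_minus M e) \<and>
     (\<forall>e\<in>bd_faces M. \<forall>x\<in>rel_interior e. \<exists>r>0. \<forall>t. 0 < t \<and> t < r \<longrightarrow>
        x - t *\<^sub>R nrm M e \<in> K_plus M e \<and> x + t *\<^sub>R nrm M e \<notin> dom_of M) \<and>
     (\<forall>K\<in>cells M. \<forall>K'\<in>cells M.
        (K, K') \<in> ((\<lambda>e. (K_plus M e, K_minus M e)) ` int_faces M \<union>
                   (\<lambda>e. (K_minus M e, K_plus M e)) ` int_faces M)\<^sup>*)"


section \<open>Integrals and piecewise polynomials\<close>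

text \<open>
  Surface measure on a flat face: the image of Lebesgue measure on the unit-thickness slab
  over the face under orthogonal projection onto the hyperplane of the face. By Fubini this is
  \<open>(d-1)\<close>-dimensional Lebesgue measure on the face.
\<close>

definition surface_measure :: "'a::euclidean_space set \<Rightarrow> 'a measure" where
  "surface_measure e =
     (let \<pi> = closest_point (affine hull e) in
      distr (restrict_space lborel {y. \<pi> y \<in> e \<and> dist y (\<pi> y) \<le> 1 / 2}) borel \<pi>)"

definition ip :: "'a::euclidean_space set \<Rightarrow> ('a \<Rightarrow> 'b::real_inner) \<Rightarrow> ('a \<Rightarrow> 'b) \<Rightarrow> real" where
  "ip S f g = (LINT x:S|lborel. f x \<bullet> g x)"

definition face_ip :: "'a::euclidean_space set \<Rightarrow> ('a \<Rightarrow> real) \<Rightarrow> ('a \<Rightarrow> real) \<Rightarrow> real" where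
  "face_ip e f g = (LINT x:e|surface_measure e. f x * g x)"

definition grad :: "('a::real_inner \<Rightarrow> real) \<Rightarrow> 'a \<Rightarrow> 'a" where
  "grad f x = (THE D. GDERIV f x :> D)"

definition polys :: "nat \<Rightarrow> ('a::euclidean_space \<Rightarrow> real) set" where
  "polys p = {q. \<exists>c. q = (\<lambda>x. \<Sum>\<alpha> \<in> {\<alpha> \<in> Basis \<rightarrow>\<^sub>E {..p}. (\<Sum>i\<in>Basis. \<alpha> i) \<le> p}.
                              c \<alpha> * (\<Prod>i\<in>Basis. (x \<bullet> i) ^ \<alpha> i))}"

text \<open>
  The broken polynomial space. An \<open>L\<^sup>2\<close> class is represented by its unique member that is
  polynomial on each (open) element and zero off the elements, in particular on the mesh
  skeleton, a null set; so \<open>v = (\<lambda>_. 0)\<close> expresses that the class is zero.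
\<close>

definition Vh :: "'a::euclidean_space mesh \<Rightarrow> nat \<Rightarrow> ('a \<Rightarrow> real) set" where
  "Vh M p = {v. (\<forall>K\<in>cells M. \<exists>q\<in>polys p. \<forall>x\<in>K. v x = q x) \<and>
                (\<forall>x. x \<notin> \<Union>(cells M) \<longrightarrow> v x = 0)}"

definition trace_plus :: "'a::euclidean_space mesh \<Rightarrow> 'a set \<Rightarrow> ('a \<Rightarrow> real) \<Rightarrow> 'a \<Rightarrow> real" where
  "trace_plus M e v x = Lim (at x within K_plus M e) v"

definition trace_minus :: "'a::euclidean_space mesh \<Rightarrow> 'a set \<Rightarrow> ('a \<Rightarrow> real) \<Rightarrow> 'a \<Rightarrow> real" where
  "trace_minus M e v x = (if e \<in> int_faces M then Lim (at x within K_minus M e) v else 0)"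

definition jump :: "'a::euclidean_space mesh \<Rightarrow> 'a set \<Rightarrow> ('a \<Rightarrow> real) \<Rightarrow> 'a \<Rightarrow> real" where
  "jump M e v x = trace_plus M e v x - trace_minus M e v x"

definition avg :: "'a::euclidean_space mesh \<Rightarrow> 'a set \<Rightarrow> ('a \<Rightarrow> real) \<Rightarrow> 'a \<Rightarrow> real" where
  "avg M e v x = (trace_plus M e v x + trace_minus M e v x) / 2"


section \<open>Admissible mesh families\<close>

definition inverse_estimate :: "real \<Rightarrow> 'a::euclidean_space mesh \<Rightarrow> bool" where
  "inverse_estimate C M \<longleftrightarrow>
     (\<forall>K\<in>cells M. \<forall>p\<ge>1. \<forall>v\<in>polys p.
        sqrt (ip K (grad v) (grad v)) \<le> C * (real p)\<^sup>2 / diameter K * sqrt (ip K v v))"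

definition trace_inverse_estimate :: "real \<Rightarrow> 'a::euclidean_space mesh \<Rightarrow> bool" where
  "trace_inverse_estimate C M \<longleftrightarrow>
     (\<forall>K\<in>cells M. \<forall>p\<ge>1. \<forall>v\<in>polys p.
        (\<Sum>e | e \<in> faces M \<and> e \<subseteq> frontier K. face_ip e v v)
          \<le> C * (real p)\<^sup>2 / diameter K * ip K v v)"

definition admissible_family ::
    "'a::euclidean_space dsa_data \<Rightarrow> 'a set \<Rightarrow> 'a mesh set \<Rightarrow> bool" where
  "admissible_family P \<Omega> \<M> \<longleftrightarrow>
     (\<forall>M\<in>\<M>. dom_of M = \<Omega> \<and> polytopic_mesh M \<and> bd_faces M \<noteq> {} \<and>
        inverse_estimate (C_inv P) M \<and> trace_inverse_estimate (C_tr P) M)"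

definition Knudsen :: "'a::euclidean_space dsa_data \<Rightarrow> real \<Rightarrow> 'a mesh \<Rightarrow> nat \<Rightarrow> real" where
  "Knudsen P \<epsilon> M p = Max ((\<lambda>K. (real p)\<^sup>2 / (sigma_t P \<epsilon> * diameter K)) ` cells M)"


section \<open>Linear algebra on a space of functions\<close>

definition linear_on_space ::
    "('a \<Rightarrow> real) set \<Rightarrow> (('a \<Rightarrow> real) \<Rightarrow> ('a \<Rightarrow> real)) \<Rightarrow> bool" where
  "linear_on_space V A \<longleftrightarrow>
     (\<forall>u\<in>V. \<forall>v\<in>V. \<forall>a b. A (\<lambda>x. a * u x + b * v x) = (\<lambda>x. a * A u x + b * A v x))"

definition spd_on :: "('a \<Rightarrow> real) set \<Rightarrow> (('a \<Rightarrow> real) \<Rightarrow> ('a \<Rightarrow> real) \<Rightarrow> real) \<Rightarrow> bool" where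
  "spd_on V a \<longleftrightarrow>
     (\<forall>u\<in>V. \<forall>v\<in>V. \<forall>w\<in>V. \<forall>s t. a (\<lambda>x. s * u x + t * v x) w = s * a u w + t * a v w) \<and>
     (\<forall>u\<in>V. \<forall>v\<in>V. a u v = a v u) \<and>
     (\<forall>v\<in>V. v \<noteq> (\<lambda>_. 0) \<longrightarrow> 0 < a v v)"

definition self_adjoint_on ::
    "('a \<Rightarrow> real) set \<Rightarrow> (('a \<Rightarrow> real) \<Rightarrow> ('a \<Rightarrow> real) \<Rightarrow> real) \<Rightarrow>
     (('a \<Rightarrow> real) \<Rightarrow> ('a \<Rightarrow> real)) \<Rightarrow> bool" where
  "self_adjoint_on V a A \<longleftrightarrow> A ` V \<subseteq> V \<and> (\<forall>u\<in>V. \<forall>v\<in>V. a (A u) v = a u (A v))"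

definition form_norm :: "(('a \<Rightarrow> real) \<Rightarrow> ('a \<Rightarrow> real) \<Rightarrow> real) \<Rightarrow> ('a \<Rightarrow> real) \<Rightarrow> real" where
  "form_norm a v = sqrt (a v v)"

definition op_norm_on ::
    "('a \<Rightarrow> real) set \<Rightarrow> (('a \<Rightarrow> real) \<Rightarrow> ('a \<Rightarrow> real) \<Rightarrow> real) \<Rightarrow>
     (('a \<Rightarrow> real) \<Rightarrow> ('a \<Rightarrow> real)) \<Rightarrow> real" where
  "op_norm_on V a A = (SUP v \<in> V - {\<lambda>_. 0}. form_norm a (A v) / form_norm a v)"

definition max_eigenvalue_on ::
    "('a \<Rightarrow> real) set \<Rightarrow> (('a \<Rightarrow> real) \<Rightarrow> ('a \<Rightarrow> real)) \<Rightarrow> real" where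
  "max_eigenvalue_on V A = Max {l. \<exists>v\<in>V. v \<noteq> (\<lambda>_. 0) \<and> A v = (\<lambda>x. l * v x)}"

text \<open>
  Complex eigenvalues of a real operator: \<open>A (u + \<i> v) = l (u + \<i> v)\<close> on the
  complexification, split into real and imaginary parts.
\<close>

definition complex_eigenvalues_on ::
    "('a \<Rightarrow> real) set \<Rightarrow> (('a \<Rightarrow> real) \<Rightarrow> ('a \<Rightarrow> real)) \<Rightarrow> complex set" where
  "complex_eigenvalues_on V A =
     {l. \<exists>u\<in>V. \<exists>v\<in>V. (u \<noteq> (\<lambda>_. 0) \<or> v \<noteq> (\<lambda>_. 0)) \<and>
           A u = (\<lambda>x. Re l * u x - Im l * v x) \<and>
           A v = (\<lambda>x. Im l * u x + Re l * v x)}"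

definition spectral_radius_on ::
    "('a \<Rightarrow> real) set \<Rightarrow> (('a \<Rightarrow> real) \<Rightarrow> ('a \<Rightarrow> real)) \<Rightarrow> real" where
  "spectral_radius_on V A = (SUP l \<in> complex_eigenvalues_on V A. cmod l)"


section \<open>Transport and MIP forms\<close>

definition upwind ::
    "'a::euclidean_space mesh \<Rightarrow> 'a \<Rightarrow> 'a set \<Rightarrow> ('a \<Rightarrow> real) \<Rightarrow> 'a \<Rightarrow> real" where
  "upwind M \<omega> e u x = (if \<omega> \<bullet> nrm M e \<ge> 0 then trace_plus M e u x else trace_minus M e u x)"

definition b_form ::
    "'a::euclidean_space dsa_data \<Rightarrow> real \<Rightarrow> 'a mesh \<Rightarrow> nat \<Rightarrow>
     ('a \<Rightarrow> real) \<Rightarrow> ('a \<Rightarrow> real) \<Rightarrow> real" where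
  "b_form P \<epsilon> M m u v =
     - (\<Sum>K\<in>cells M. ip K u (\<lambda>x. dir P m \<bullet> grad v x))
     + (\<Sum>e\<in>faces M.
          face_ip e (\<lambda>x. (dir P m \<bullet> nrm M e) * upwind M (dir P m) e u x) (jump M e v))
     + ip (dom_of M) (\<lambda>x. sigma_t P \<epsilon> * u x) v"

definition beta :: "'a::euclidean_space dsa_data \<Rightarrow> 'a mesh \<Rightarrow> 'a set \<Rightarrow> real" where
  "beta P M e = (\<Sum>m\<in>dirs P. wt P m * \<bar>dir P m \<bullet> nrm M e\<bar>) / 2"

definition tau_SIP :: "'a::euclidean_space dsa_data \<Rightarrow> 'a mesh \<Rightarrow> nat \<Rightarrow> 'a set \<Rightarrow> real" where
  "tau_SIP P M p e =
     C_tr P * (real p)\<^sup>2 / (2 * (theta P)\<^sup>2) * Max ((\<lambda>K. D_bar P / diameter K) ` cells_at M e)"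

definition tau ::
    "'a::euclidean_space dsa_data \<Rightarrow> real \<Rightarrow> 'a mesh \<Rightarrow> nat \<Rightarrow> 'a set \<Rightarrow> real" where
  "tau P \<epsilon> M p e = max (\<epsilon> * tau_SIP P M p e) (beta P M e)"

definition mip_faces ::
    "'a::euclidean_space dsa_data \<Rightarrow> real \<Rightarrow> 'a mesh \<Rightarrow> nat \<Rightarrow> 'a set set \<Rightarrow>
     ('a \<Rightarrow> real) \<Rightarrow> ('a \<Rightarrow> real) \<Rightarrow> real" where
  "mip_faces P \<epsilon> M p F u v =
     (\<Sum>e\<in>F. tau P \<epsilon> M p e * face_ip e (jump M e u) (jump M e v))
     - \<epsilon> * (\<Sum>e\<in>F. face_ip e (avg M e (\<lambda>y. D_bar P * (grad u y \<bullet> nrm M e))) (jump M e v))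
     - \<epsilon> * (\<Sum>e\<in>F. face_ip e (avg M e (\<lambda>y. D_bar P * (grad v y \<bullet> nrm M e))) (jump M e u))"

definition a_MIP ::
    "'a::euclidean_space dsa_data \<Rightarrow> real \<Rightarrow> 'a mesh \<Rightarrow> nat \<Rightarrow>
     ('a \<Rightarrow> real) \<Rightarrow> ('a \<Rightarrow> real) \<Rightarrow> real" where
  "a_MIP P \<epsilon> M p u v =
     \<epsilon> * (\<Sum>K\<in>cells M. ip K (\<lambda>x. D_bar P *\<^sub>R grad u x) (grad v) + ip K (\<lambda>x. sig_a P * u x) v)
     + mip_faces P \<epsilon> M p (faces M) u v"


section \<open>Scalar response and exact correction form\<close>

definition Psi_hat ::
    "'a::euclidean_space dsa_data \<Rightarrow> real \<Rightarrow> 'a mesh \<Rightarrow> nat \<Rightarrow> nat \<Rightarrow>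
     ('a \<Rightarrow> real) \<Rightarrow> ('a \<Rightarrow> real)" where
  "Psi_hat P \<epsilon> M p m g =
     (THE \<psi>. \<psi> \<in> Vh M p \<and>
        (\<forall>v\<in>Vh M p. \<epsilon> * b_form P \<epsilon> M m \<psi> v = ip (dom_of M) (\<lambda>x. sig_t P * g x) v))"

definition H_op ::
    "'a::euclidean_space dsa_data \<Rightarrow> real \<Rightarrow> 'a mesh \<Rightarrow> nat \<Rightarrow>
     ('a \<Rightarrow> real) \<Rightarrow> ('a \<Rightarrow> real)" where
  "H_op P \<epsilon> M p g = (\<lambda>x. \<Sum>m\<in>dirs P. wt P m * Psi_hat P \<epsilon> M p m g x)"

definition a_ex ::
    "'a::euclidean_space dsa_data \<Rightarrow> real \<Rightarrow> 'a mesh \<Rightarrow> nat \<Rightarrow>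
     ('a \<Rightarrow> real) \<Rightarrow> ('a \<Rightarrow> real) \<Rightarrow> real" where
  "a_ex P \<epsilon> M p u v =
     (1 / \<epsilon>) * ip (dom_of M)
       (\<lambda>x. sig_t P * (the_inv_into (Vh M p) (H_op P \<epsilon> M p) u x - c_ratio P \<epsilon> * u x)) v"


section \<open>Iterations and error propagators\<close>

definition transport_solve ::
    "'a::euclidean_space dsa_data \<Rightarrow> real \<Rightarrow> 'a mesh \<Rightarrow> nat \<Rightarrow> ('a \<Rightarrow> real) \<Rightarrow>
     ('a \<Rightarrow> real) \<Rightarrow> (nat \<Rightarrow> 'a \<Rightarrow> real) \<Rightarrow> bool" where
  "transport_solve P \<epsilon> M p q \<phi> \<psi> \<longleftrightarrow>
     (\<forall>m\<in>dirs P. \<psi> m \<in> Vh M p \<and>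
        (\<forall>v\<in>Vh M p. b_form P \<epsilon> M m (\<psi> m) v =
                     ip (dom_of M) (\<lambda>x. sigma_s P \<epsilon> * \<phi> x + q x) v))"

definition phi_star ::
    "'a::euclidean_space dsa_data \<Rightarrow> real \<Rightarrow> 'a mesh \<Rightarrow> nat \<Rightarrow>
     ('a \<Rightarrow> real) \<Rightarrow> ('a \<Rightarrow> real)" where
  "phi_star P \<epsilon> M p q =
     (THE \<phi>. \<phi> \<in> Vh M p \<and>
        (\<exists>\<psi>. transport_solve P \<epsilon> M p q \<phi> \<psi> \<and> \<phi> = (\<lambda>x. \<Sum>m\<in>dirs P. wt P m * \<psi> m x)))"

definition SI_step ::
    "'a::euclidean_space dsa_data \<Rightarrow> real \<Rightarrow> 'a mesh \<Rightarrow> nat \<Rightarrow>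
     ('a \<Rightarrow> real) \<Rightarrow> ('a \<Rightarrow> real) \<Rightarrow> ('a \<Rightarrow> real)" where
  "SI_step P \<epsilon> M p q \<phi> =
     (THE \<phi>'. \<exists>\<psi>. transport_solve P \<epsilon> M p q \<phi> \<psi> \<and> \<phi>' = (\<lambda>x. \<Sum>m\<in>dirs P. wt P m * \<psi> m x))"

definition MIP_correction ::
    "'a::euclidean_space dsa_data \<Rightarrow> real \<Rightarrow> 'a mesh \<Rightarrow> nat \<Rightarrow>
     ('a \<Rightarrow> real) \<Rightarrow> ('a \<Rightarrow> real) \<Rightarrow> ('a \<Rightarrow> real)" where
  "MIP_correction P \<epsilon> M p q \<phi> =
     (THE \<delta>. \<delta> \<in> Vh M p \<and>
        (\<forall>v\<in>Vh M p. a_MIP P \<epsilon> M p \<delta> v =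
           ip (dom_of M) (\<lambda>x. sigma_s P \<epsilon> * (SI_step P \<epsilon> M p q \<phi> x - \<phi> x)) v))"

definition DSA_step ::
    "'a::euclidean_space dsa_data \<Rightarrow> real \<Rightarrow> 'a mesh \<Rightarrow> nat \<Rightarrow>
     ('a \<Rightarrow> real) \<Rightarrow> ('a \<Rightarrow> real) \<Rightarrow> ('a \<Rightarrow> real)" where
  "DSA_step P \<epsilon> M p q \<phi> = (\<lambda>x. SI_step P \<epsilon> M p q \<phi> x + MIP_correction P \<epsilon> M p q \<phi> x)"

text \<open>
  The linear map on \<open>Vh\<close> sending the error before one step to the error after it, for every
  source \<open>q\<close> and every iterate \<open>\<phi>\<close>; extensionality (\<open>undefined\<close> off \<open>Vh\<close>) makes the
  description definite.
\<close>

definition error_propagator ::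
    "'a::euclidean_space dsa_data \<Rightarrow> real \<Rightarrow> 'a mesh \<Rightarrow> nat \<Rightarrow>
     (('a \<Rightarrow> real) \<Rightarrow> ('a \<Rightarrow> real) \<Rightarrow> ('a \<Rightarrow> real)) \<Rightarrow> ('a \<Rightarrow> real) \<Rightarrow> ('a \<Rightarrow> real)" where
  "error_propagator P \<epsilon> M p step =
     (THE A. A \<in> Vh M p \<rightarrow>\<^sub>E Vh M p \<and> linear_on_space (Vh M p) A \<and>
        (\<forall>q\<in>Vh M p. \<forall>\<phi>\<in>Vh M p.
           A (\<lambda>x. phi_star P \<epsilon> M p q x - \<phi> x) = (\<lambda>x. phi_star P \<epsilon> M p q x - step q \<phi> x)))"

definition G_op ::
    "'a::euclidean_space dsa_data \<Rightarrow> real \<Rightarrow> 'a mesh \<Rightarrow> nat \<Rightarrow>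
     ('a \<Rightarrow> real) \<Rightarrow> ('a \<Rightarrow> real)" where
  "G_op P \<epsilon> M p = error_propagator P \<epsilon> M p (SI_step P \<epsilon> M p)"

definition E_op ::
    "'a::euclidean_space dsa_data \<Rightarrow> real \<Rightarrow> 'a mesh \<Rightarrow> nat \<Rightarrow>
     ('a \<Rightarrow> real) \<Rightarrow> ('a \<Rightarrow> real)" where
  "E_op P \<epsilon> M p = error_propagator P \<epsilon> M p (DSA_step P \<epsilon> M p)"

definition norm_ex ::
    "'a::euclidean_space dsa_data \<Rightarrow> real \<Rightarrow> 'a mesh \<Rightarrow> nat \<Rightarrow>
     (('a \<Rightarrow> real) \<Rightarrow> ('a \<Rightarrow> real)) \<Rightarrow> real" where
  "norm_ex P \<epsilon> M p A = op_norm_on (Vh M p) (a_ex P \<epsilon> M p) A"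

definition rho ::
    "'a::euclidean_space mesh \<Rightarrow> nat \<Rightarrow> (('a \<Rightarrow> real) \<Rightarrow> ('a \<Rightarrow> real)) \<Rightarrow> real" where
  "rho M p A = spectral_radius_on (Vh M p) A"

definition lambda_max_H ::
    "'a::euclidean_space dsa_data \<Rightarrow> real \<Rightarrow> 'a mesh \<Rightarrow> nat \<Rightarrow> real" where
  "lambda_max_H P \<epsilon> M p = max_eigenvalue_on (Vh M p) (H_op P \<epsilon> M p)"

end

theory Submission
  imports Defs "HOL-Library.Function_Algebras"
begin

text \<open>
  Write \<open>\<eta> = \<epsilon> / sig_t\<close>, let \<open>I\<close> be the \<open>L\<^sup>2\<close> product and \<open>t m\<close> the streaming part of the transport
  form. The response then solves \<open>I \<psi>\<^sub>m v + \<eta> t m \<psi>\<^sub>m v = I g v\<close>. By the divergence theorem, \<open>t m\<close> is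
  nonnegative on the diagonal and its adjoint is the form of the opposite direction; central pairing
  therefore makes \<open>H\<close> symmetric, and \<open>I (g - H g) g\<close> is a sum of nonnegative terms vanishing only if all
  \<open>t m g\<close> vanish, which forces \<open>g = 0\<close>. Hence \<open>0 < H < 1\<close>, and since \<open>G = c H\<close> commutes with
  \<open>H\<close>, its norm in \<open>a_ex\<close> and its spectral radius are both \<open>c \<lambda>\<^sub>m\<^sub>a\<^sub>x\<close>. The divergence theorem itself is
  obtained by applying the fundamental theorem of calculus along almost every line in a fixed
  direction and averaging over translations.

  For small Knudsen number, represent \<open>t m\<close> by \<open>T\<^sub>m = D\<^sub>m - R\<^sub>m + S\<^sub>m\<close>: broken directional derivative,
  lifted jump and upwind dissipation. Expanding the response to second order in \<open>\<eta> T\<^sub>m\<close>, odd terms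
  cancel by central pairing, the quadrature moments turn the even ones into \<open>a_MIP\<close> with
  \<open>\<tau> = \<beta>\<close>, and the remainder is of the order of the Knudsen number in the MIP norm because the inverse
  estimates bound \<open>\<eta> T\<^sub>m\<close>, and each lifting gains a factor \<open>\<surd>Kn\<close>. The error operator is then
  \<open>(1 - A\<^sub>M\<^sub>I\<^sub>P\<^sup>-\<^sup>1 A\<^sub>e\<^sub>x) G\<close>, whose first factor is small in the \<open>a_ex\<close> norm.
\<close>

section \<open>Bilinear forms on finite-dimensional spaces\<close>

text \<open>Two obstacles shape the estimates. The first is to reach the full power of the Knudsen
  number \<open>k\<close> instead of its root. Second moments bound the weight \<open>beta\<close>
  of the jumps below by a constant, so a lifted jump, which costs \<open>sqrt (k / \<eta>)\<close>,
  has size \<open>sqrt k\<close> once scaled by \<open>sqrt \<eta>\<close>; the broken derivative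
  has no such gain. The deviation \<open>z\<close> is of relative size \<open>sqrt k\<close>, and
  tested against the whole adjoint transport operator it would leave only that root. The part
  without gain is odd under reversal of the direction, however, and averages out; what remains is
  the mean upwind dissipation, and it brings the second root. The second obstacle is that operator
  norm and spectral radius are suprema, without meaning for empty or unbounded sets. Nonzero
  vectors, a priori bounds and eigenvalues must therefore be exhibited. The accelerated error
  operator is in general not symmetric for \<open>a_ex\<close>, so its eigenvalue has to come from a
  different inner product. All forms are bilinear only on the discrete space, where the integrals
  and traces exist; this is why the algebra is relative to a subspace \<open>V\<close>.\<close>

instantiation "fun" :: (type, real_vector) real_vector
begin

text \<open>Members of the broken space are plain functions; the pointwise structure makes span,
  independence and subspaces available for them.\<close>

definition scaleR_fun :: "real \<Rightarrow> ('a \<Rightarrow> 'b) \<Rightarrow> 'a \<Rightarrow> 'b" where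
  "scaleR_fun c f = (\<lambda>x. c *\<^sub>R f x)"

instance
  by standard (auto simp: scaleR_fun_def fun_eq_iff algebra_simps)

end

lemma scaleR_fun_apply [simp]: "(c *\<^sub>R f) x = c *\<^sub>R f x"
  by (simp add: scaleR_fun_def)

text \<open>Relative to a carrier set, because the discrete space depends on mesh and degree and the
  integrals below are additive only on it. Combinations rather than sums and multiples are
  axiomatised so that one computation per side proves an instance.\<close>

locale bilinear_form =
  fixes V :: "'v::real_vector set" and a :: "'v \<Rightarrow> 'v \<Rightarrow> real"
  assumes subspace_V: "subspace V"
    and comb_left: "u \<in> V \<Longrightarrow> v \<in> V \<Longrightarrow> w \<in> V \<Longrightarrow> a (s *\<^sub>R u + t *\<^sub>R v) w = s * a u w + t * a v w"
    and comb_right: "u \<in> V \<Longrightarrow> v \<in> V \<Longrightarrow> w \<in> V \<Longrightarrow> a w (s *\<^sub>R u + t *\<^sub>R v) = s * a w u + t * a w v"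
begin

lemmas closed [simp] = subspace_0[OF subspace_V] subspace_add[OF subspace_V] subspace_diff[OF subspace_V]
  subspace_scale[OF subspace_V] subspace_neg[OF subspace_V] subspace_sum[OF subspace_V]

lemma add_left: "u \<in> V \<Longrightarrow> v \<in> V \<Longrightarrow> w \<in> V \<Longrightarrow> a (u + v) w = a u w + a v w"
  using comb_left[of u v w 1 1] by simp
lemma add_right: "u \<in> V \<Longrightarrow> v \<in> V \<Longrightarrow> w \<in> V \<Longrightarrow> a w (u + v) = a w u + a w v"
  using comb_right[of u v w 1 1] by simp
lemma scale_left: "u \<in> V \<Longrightarrow> w \<in> V \<Longrightarrow> a (s *\<^sub>R u) w = s * a u w"
  using comb_left[of u u w s 0] by simp
lemma scale_right: "u \<in> V \<Longrightarrow> w \<in> V \<Longrightarrow> a w (s *\<^sub>R u) = s * a w u"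
  using comb_right[of u u w s 0] by simp
lemma diff_left: "u \<in> V \<Longrightarrow> v \<in> V \<Longrightarrow> w \<in> V \<Longrightarrow> a (u - v) w = a u w - a v w"
  using comb_left[of u v w 1 "-1"] by simp
lemma diff_right: "u \<in> V \<Longrightarrow> v \<in> V \<Longrightarrow> w \<in> V \<Longrightarrow> a w (u - v) = a w u - a w v"
  using comb_right[of u v w 1 "-1"] by simp
lemma minus_left: "u \<in> V \<Longrightarrow> w \<in> V \<Longrightarrow> a (- u) w = - a u w"
  using scale_left[of u w "-1"] by simp
lemma minus_right: "u \<in> V \<Longrightarrow> w \<in> V \<Longrightarrow> a w (- u) = - a w u"
  using scale_right[of u w "-1"] by simp
lemma zero_left: "w \<in> V \<Longrightarrow> a 0 w = 0"
  using scale_left[of 0 w 0] by simp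
lemma zero_right: "w \<in> V \<Longrightarrow> a w 0 = 0"
  using scale_right[of 0 w 0] by simp
lemma sum_left: "w \<in> V \<Longrightarrow> (\<And>i. i \<in> S \<Longrightarrow> f i \<in> V) \<Longrightarrow> a (\<Sum>i\<in>S. f i) w = (\<Sum>i\<in>S. a (f i) w)"
  by (induction S rule: infinite_finite_induct) (auto simp: zero_left add_left)
lemma sum_right: "w \<in> V \<Longrightarrow> (\<And>i. i \<in> S \<Longrightarrow> f i \<in> V) \<Longrightarrow> a w (\<Sum>i\<in>S. f i) = (\<Sum>i\<in>S. a w (f i))"
  by (induction S rule: infinite_finite_induct) (auto simp: zero_right add_right)

lemmas bilin = add_left add_right scale_left scale_right diff_left diff_right minus_left minus_right
  zero_left zero_right

end

text \<open>Semidefiniteness already gives Cauchy-Schwarz, and forms with a kernel do occur: the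
  defect of a maximal Rayleigh quotient and the product on a single face.\<close>

locale psd_form = bilinear_form +
  assumes sym: "u \<in> V \<Longrightarrow> v \<in> V \<Longrightarrow> a u v = a v u"
    and psd: "v \<in> V \<Longrightarrow> 0 \<le> a v v"
begin

definition nrm :: "'a \<Rightarrow> real" where
  "nrm v = sqrt (a v v)"

lemma nrm_sq: "v \<in> V \<Longrightarrow> (nrm v)\<^sup>2 = a v v"
  by (simp add: nrm_def psd)

lemma nrm_nonneg [simp]: "v \<in> V \<Longrightarrow> 0 \<le> nrm v"
  by (simp add: nrm_def psd)

lemma Cauchy_Schwarz:
  assumes u: "u \<in> V" and v: "v \<in> V"
  shows "(a u v)\<^sup>2 \<le> a u u * a v v"
proof -
  have q: "0 \<le> a u u + 2 * t * a u v + t\<^sup>2 * a v v" for t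
    using psd[of "u + t *\<^sub>R v"] u v sym[OF v u] by (simp add: bilin algebra_simps power2_eq_square)
  show ?thesis
  proof (cases "a v v = 0")
    case True
    have "a u v = 0"
    proof (rule ccontr)
      assume "a u v \<noteq> 0"
      \<comment> \<open>If \<open>a v v = 0\<close> the quadratic is affine in \<open>t\<close>;
        this \<open>t\<close> gives it the value -1.\<close>
      then show False using q[of "- (a u u + 1) / (2 * a u v)"] True by (simp add: field_simps)
    qed
    then show ?thesis by (simp add: True)
  next
    case False
    then have pos: "a v v > 0" using psd[OF v] by simp
    then have "0 \<le> a v v * (a u u + 2 * (- a u v / a v v) * a u v + (- a u v / a v v)\<^sup>2 * a v v)"
      using q[of "- a u v / a v v"] by simp
    also have "\<dots> = a u u * a v v - (a u v)\<^sup>2"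
      using pos by (simp add: field_simps power2_eq_square)
    finally show ?thesis by simp
  qed
qed

lemma abs_le_nrm:
  assumes u: "u \<in> V" and v: "v \<in> V"
  shows "\<bar>a u v\<bar> \<le> nrm u * nrm v"
  using real_sqrt_le_mono[OF Cauchy_Schwarz[OF u v]] by (simp add: nrm_def real_sqrt_mult)

lemma nrm_scale: "v \<in> V \<Longrightarrow> nrm (c *\<^sub>R v) = \<bar>c\<bar> * nrm v"
  by (simp add: nrm_def bilin real_sqrt_mult flip: mult.assoc)

lemma nrm_triangle:
  assumes u: "u \<in> V" and v: "v \<in> V"
  shows "nrm (u + v) \<le> nrm u + nrm v"
proof (rule power2_le_imp_le)
  have "(nrm (u + v))\<^sup>2 = a u u + 2 * a u v + a v v"
    using u v sym[OF v u] by (simp add: nrm_sq bilin)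
  also have "\<dots> \<le> a u u + 2 * (nrm u * nrm v) + a v v" using abs_le_nrm[OF u v] by simp
  also have "\<dots> = (nrm u + nrm v)\<^sup>2" using u v by (simp add: nrm_sq power2_sum)
  finally show "(nrm (u + v))\<^sup>2 \<le> (nrm u + nrm v)\<^sup>2" .
qed (use u v in simp)

lemma nrm_triangle_diff:
  assumes u: "u \<in> V" and v: "v \<in> V"
  shows "nrm (u - v) \<le> nrm u + nrm v"
  using nrm_triangle[OF u, of "- v"] v nrm_scale[OF v, of "-1"] by simp

lemma nrm_sum_le:
  assumes "\<And>i. i \<in> S \<Longrightarrow> f i \<in> V"
  shows "nrm (\<Sum>i\<in>S. f i) \<le> (\<Sum>i\<in>S. nrm (f i))"
  using assms
proof (induction S rule: infinite_finite_induct)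
  case (insert i S)
  then have "nrm (f i + (\<Sum>i\<in>S. f i)) \<le> nrm (f i) + nrm (\<Sum>i\<in>S. f i)" by (intro nrm_triangle) auto
  then show ?case using insert by fastforce
qed (auto simp: nrm_def zero_left)

text \<open>Test with \<open>v\<close> itself. Liftings and deviations are known only through the
  functionals they represent, so their norms are always estimated this way.\<close>

lemma nrm_le_of_dual:
  assumes v: "v \<in> V" and K: "0 \<le> K" and bd: "\<And>w. w \<in> V \<Longrightarrow> \<bar>a v w\<bar> \<le> K * nrm w"
  shows "nrm v \<le> K"
proof (cases "nrm v = 0")
  case False
  then have "nrm v > 0" using nrm_nonneg[OF v] by linarith
  moreover have "nrm v * nrm v \<le> K * nrm v" using bd[OF v] nrm_sq[OF v] psd[OF v] by (simp add: power2_eq_square)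
  ultimately show ?thesis by simp
qed (use K in simp)

lemma nrm_weighted_mean_le:
  assumes w: "\<And>i. i \<in> S \<Longrightarrow> 0 \<le> w i" "(\<Sum>i\<in>S. w i) = 1" and f: "\<And>i. i \<in> S \<Longrightarrow> f i \<in> V \<and> nrm (f i) \<le> K"
  shows "nrm (\<Sum>i\<in>S. w i *\<^sub>R f i) \<le> K"
proof -
  have "nrm (\<Sum>i\<in>S. w i *\<^sub>R f i) \<le> (\<Sum>i\<in>S. nrm (w i *\<^sub>R f i))" by (rule nrm_sum_le) (use f in auto)
  also have "\<dots> \<le> (\<Sum>i\<in>S. w i * K)" by (rule sum_mono) (use w f in \<open>auto simp: nrm_scale intro: mult_left_mono\<close>)
  also have "\<dots> = K" using w by (simp flip: sum_distrib_right)
  finally show ?thesis .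
qed

end

locale pd_form = psd_form +
  assumes pos: "v \<in> V \<Longrightarrow> v \<noteq> 0 \<Longrightarrow> 0 < a v v"
begin

lemma eq_0_iff: "v \<in> V \<Longrightarrow> a v v = 0 \<longleftrightarrow> v = 0"
  using pos[of v] zero_left[of 0] by force

lemma nondegenerate: "v \<in> V \<Longrightarrow> (\<And>w. w \<in> V \<Longrightarrow> a v w = 0) \<Longrightarrow> v = 0"
  using eq_0_iff by blast

lemma eqI: "u \<in> V \<Longrightarrow> v \<in> V \<Longrightarrow> (\<And>w. w \<in> V \<Longrightarrow> a u w = a v w) \<Longrightarrow> u = v"
  using nondegenerate[of "u - v"] by (simp add: bilin)

end

lemma pd_form_cong:
  assumes a: "pd_form V a" and eq: "\<And>u v. u \<in> V \<Longrightarrow> v \<in> V \<Longrightarrow> a' u v = a u v"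
  shows "pd_form V a'"
proof -
  interpret pd_form V a by (rule a)
  show ?thesis
    by unfold_locales (simp_all add: eq subspace_V comb_left comb_right sym psd pos)
qed

section \<open>Solvability and extremal eigenvalues in finite dimension\<close>

definition fin_dim :: "'v::real_vector set \<Rightarrow> bool" where
  "fin_dim V \<longleftrightarrow> (\<exists>C. finite C \<and> V \<subseteq> span C)"

lemma fin_dim_basis:
  assumes "fin_dim V" "subspace V"
  obtains B where "finite B" "independent B" "span B = V"
proof -
  obtain C where C: "finite C" "V \<subseteq> span C" using assms by (auto simp: fin_dim_def)
  obtain B where B: "B \<subseteq> V" "independent B" "V \<subseteq> span B" by (rule maximal_independent_subset)
  have "finite B" using independent_span_bound[OF C(1) B(2)] B(1) C(2) by blast
  moreover have "span B = V" using B assms(2) span_minimal by blast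
  ultimately show ?thesis using B(2) that by blast
qed

lemma sum_indicator_fun:
  fixes c :: "'i \<Rightarrow> real"
  assumes "finite B" "\<And>i. i \<notin> B \<Longrightarrow> c i = 0"
  shows "c = (\<Sum>i\<in>B. c i *\<^sub>R (\<lambda>j. if j = i then 1 else 0))"
proof
  fix j
  have "(\<Sum>i\<in>B. c i *\<^sub>R (\<lambda>j. if j = i then 1 else 0)) j = (\<Sum>i\<in>B. if i = j then c i else 0)"
    by (induction B rule: infinite_finite_induct) auto
  then show "c j = (\<Sum>i\<in>B. c i *\<^sub>R (\<lambda>j. if j = i then 1 else 0)) j" using assms by (auto simp: sum.delta)
qed

text \<open>
  The Gram map \<open>v \<mapsto> (b v i)\<close>, \<open>i\<close> running through a basis, is injective by positivity, hence
  onto by a dimension count.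
\<close>

lemma Lax_Milgram:
  fixes V :: "'v::real_vector set"
  assumes V: "fin_dim V" and b: "bilinear_form V b"
    and pos: "\<And>v. v \<in> V \<Longrightarrow> v \<noteq> 0 \<Longrightarrow> 0 < b v v"
    and l: "\<And>u v s t. u \<in> V \<Longrightarrow> v \<in> V \<Longrightarrow> l (s *\<^sub>R u + t *\<^sub>R v) = s * l u + t * (l v :: real)"
  shows "\<exists>!u. u \<in> V \<and> (\<forall>v\<in>V. b u v = l v)"
proof -
  interpret b: bilinear_form V b by (rule b)
  obtain B where B: "finite B" "independent B" "span B = V"
    using fin_dim_basis[OF V b.subspace_V] .
  have BV: "i \<in> V" if "i \<in> B" for i using that B span_base by blast
  define f where "f = (\<lambda>u i. if i \<in> B then b u i else 0)"
  have f_comb: "f (s *\<^sub>R u + t *\<^sub>R v) = s *\<^sub>R f u + t *\<^sub>R f v" if "u \<in> V" "v \<in> V" for s t u v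
    by (rule ext) (simp add: f_def b.comb_left[OF that BV])
  have from_basis: "h v = 0" if h: "\<And>u v s t. u \<in> V \<Longrightarrow> v \<in> V \<Longrightarrow> h (s *\<^sub>R u + t *\<^sub>R v) = s * h u + t * (h v :: real)"
    and z: "\<And>i. i \<in> B \<Longrightarrow> h i = 0" and v: "v \<in> V" for h v
  proof -
    have "subspace {v \<in> V. h v = 0}"
    proof (rule subspaceI)
      show "0 \<in> {v \<in> V. h v = 0}" using h[of 0 0 0 0] by simp
      show "x + y \<in> {v \<in> V. h v = 0}" if "x \<in> {v \<in> V. h v = 0}" "y \<in> {v \<in> V. h v = 0}" for x y
        using h[of x y 1 1] that by simp
      show "c *\<^sub>R x \<in> {v \<in> V. h v = 0}" if "x \<in> {v \<in> V. h v = 0}" for c x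
        using h[of x x c 0] that by simp
    qed
    then have "span B \<subseteq> {v \<in> V. h v = 0}" using BV z by (intro span_minimal) auto
    then show ?thesis using v B by blast
  qed
  \<comment> \<open>\<open>f\<close> is linear on \<open>V\<close> only, whereas preservation of
    independence concerns maps that are linear everywhere; \<open>g\<close> extends \<open>f\<close>
    from the basis and agrees with it on \<open>V\<close>.\<close>
  obtain g where g: "linear g" "\<And>i. i \<in> B \<Longrightarrow> g i = f i"
    proof -
    have "\<exists>g. linear g \<and> (\<forall>x\<in>B. g x = f x)" by (rule linear_independent_extend[OF B(2)])
    then show ?thesis using that by blast
  qed
  have gf: "g v = f v" if v: "v \<in> V" for v
  proof
    fix j
    have comb: "g (s *\<^sub>R x + t *\<^sub>R z) j - f (s *\<^sub>R x + t *\<^sub>R z) j = s * (g x j - f x j) + t * (g z j - f z j)"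
      if "x \<in> V" "z \<in> V" for x z s t
      by (simp add: f_comb[OF that] linear_add[OF g(1)] linear_scale[OF g(1)] algebra_simps)
    have "g i j - f i j = 0" if "i \<in> B" for i by (simp add: g(2)[OF that])
    from from_basis[of "\<lambda>v. g v j - f v j", OF comb this v] have "g v j - f v j = 0" .
    then show "g v j = f v j" by simp
  qed
  have inj: "inj_on g (span B)"
  proof (subst linear_inj_on_iff_eq_0[OF g(1)], simp, intro ballI impI)
    fix v assume v: "v \<in> span B" "g v = 0"
    then have vV: "v \<in> V" using B by simp
    have "f v = 0" using gf[OF vV] v(2) by simp
    then have "b v i = 0" if "i \<in> B" for i using that by (metis f_def zero_fun_apply)
    then have "b v v = 0"
      by (intro from_basis[of "b v" v] b.comb_right vV)
    then show "v = 0" using pos[OF vV] by force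
  qed
  have ind: "independent (g ` B)"
    using linear_independent_injective_image[OF g(1) B(2) inj] .
  have card: "card (g ` B) = card B"
    by (intro card_image inj_on_subset[OF inj] span_superset)
  define C where "C = (\<lambda>i j. if j = i then (1::real) else 0) ` B"
  have fC: "c \<in> span C" if "\<And>i. i \<notin> B \<Longrightarrow> c i = 0" for c :: "'v \<Rightarrow> real"
  proof -
    have "(\<Sum>i\<in>B. c i *\<^sub>R (\<lambda>j. if j = i then 1 else 0)) \<in> span C"
      by (intro span_sum span_scale span_base) (auto simp: C_def)
    then show ?thesis using sum_indicator_fun[OF B(1) that] by simp
  qed
  define y where "y = (\<lambda>i. if i \<in> B then l i else 0)"
  \<comment> \<open>All values lie in the span of the \<open>card B\<close> unit functions in
    \<open>C\<close>. A vector outside the span of the image would give \<open>card B + 1\<close>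
    independent vectors there.\<close>
  have "y \<in> span (g ` B)"
  proof (rule ccontr)
    assume y: "y \<notin> span (g ` B)"
    then have "y \<notin> g ` B" using span_base[of y "g ` B"] by auto
    have "independent (insert y (g ` B))" using y ind by (simp add: independent_insertI)
    moreover have "insert y (g ` B) \<subseteq> span C"
    proof -
      have "y \<in> span C" by (rule fC) (simp add: y_def)
      moreover have "g i \<in> span C" if "i \<in> B" for i by (subst g(2)[OF that], rule fC) (simp add: f_def)
      ultimately show ?thesis by blast
    qed
    moreover have "finite C" using B by (simp add: C_def)
    ultimately have "card (insert y (g ` B)) \<le> card C" using independent_span_bound[of C "insert y (g ` B)"] by simp
    moreover have "card C \<le> card B" unfolding C_def by (rule card_image_le[OF B(1)])
    ultimately show False using \<open>y \<notin> g ` B\<close> B(1) card by simp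
  qed
  then have "y \<in> g ` V" using linear_span_image[OF g(1), of B] B(3) by simp
  then obtain u where "u \<in> V" "y = g u" by blast
  then have u: "u \<in> V" "f u = y" by (simp_all add: gf)
  have sol: "b u v = l v" if v: "v \<in> V" for v
  proof -
    have comb: "b u (s *\<^sub>R x + t *\<^sub>R y) - l (s *\<^sub>R x + t *\<^sub>R y) = s * (b u x - l x) + t * (b u y - l y)"
      if "x \<in> V" "y \<in> V" for x y s t
      by (simp add: l[OF that] b.comb_right[OF that u(1)] algebra_simps)
    have "b u i - l i = 0" if "i \<in> B" for i using fun_cong[OF u(2), of i] that by (simp add: f_def y_def)
    from from_basis[of "\<lambda>v. b u v - l v", OF comb this v] show ?thesis by simp
  qed
  have "u' = u" if u': "u' \<in> V" "\<forall>v\<in>V. b u' v = l v" for u'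
  proof -
    have d: "u' - u \<in> V" using u' u(1) by simp
    have "b (u' - u) (u' - u) = b u' (u' - u) - b u (u' - u)" by (rule b.diff_left[OF u'(1) u(1) d])
    also have "\<dots> = 0" using u'(2) sol[OF d] d by simp
    finally show ?thesis using pos[OF d] by force
  qed
  then show ?thesis using u(1) sol by blast
qed

text \<open>Maximise the Rayleigh quotient over a sup-norm sphere of coordinate vectors.\<close>

lemma max_eigenpair:
  fixes V :: "'v::real_vector set"
  assumes V: "fin_dim V" and a: "pd_form V a" and m: "bilinear_form V m"
    and sym: "\<And>u v. u \<in> V \<Longrightarrow> v \<in> V \<Longrightarrow> m u v = m v u" and ne: "z \<in> V" "z \<noteq> 0"
  obtains v0 M where "v0 \<in> V" "v0 \<noteq> 0" "\<And>v. v \<in> V \<Longrightarrow> m v v \<le> M * a v v"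
    "\<And>w. w \<in> V \<Longrightarrow> m v0 w = M * a v0 w"
proof -
  interpret a: pd_form V a by (rule a)
  interpret m: bilinear_form V m by (rule m)
  obtain B where B: "finite B" "independent B" "span B = V"
    using fin_dim_basis[OF V a.subspace_V] .
  have BV: "i \<in> V" if "i \<in> B" for i using that B span_base by blast
  define u where "u = (\<lambda>c. \<Sum>i\<in>B. c i *\<^sub>R i)"
  have uV: "u c \<in> V" for c unfolding u_def by (rule a.closed) (simp add: BV)
  have quad: "f (u c) (u c) = (\<Sum>i\<in>B. \<Sum>j\<in>B. c i * c j * f i j)" if "bilinear_form V f" for f c
  proof -
    interpret f: bilinear_form V f by (rule that)
    have "f (u c) (u c) = (\<Sum>i\<in>B. f (c i *\<^sub>R i) (u c))"
      by (subst (1) u_def, rule f.sum_left) (auto simp: uV BV)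
    also have "\<dots> = (\<Sum>i\<in>B. \<Sum>j\<in>B. f (c i *\<^sub>R i) (c j *\<^sub>R j))"
      by (intro sum.cong refl, subst u_def, rule f.sum_right) (auto simp: BV)
    finally show ?thesis by (simp add: BV f.scale_left f.scale_right mult_ac)
  qed
  have coord: "\<exists>c. (\<forall>i. i \<notin> B \<longrightarrow> c i = 0) \<and> u c = v" if v: "v \<in> V" for v
  proof -
    have "v \<in> span B" using v B by simp
    then obtain c where c: "v = (\<Sum>i\<in>B. c i *\<^sub>R i)" using span_finite[OF B(1)] by auto
    have "u (\<lambda>i. if i \<in> B then c i else 0) = v" unfolding u_def c by (intro sum.cong) auto
    then show ?thesis by (intro exI[of _ "\<lambda>i. if i \<in> B then c i else 0"]) auto
  qed
  have u0: "u c \<noteq> 0" if "i \<in> B" "c i \<noteq> 0" for c i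
    using independentD[OF B(2) B(1) subset_refl] that unfolding u_def by blast
  \<comment> \<open>Coordinates are functions on the whole vector type. Pinning those outside the
    basis to 0 leaves a product of compact sets, and the sphere is closed in it as a finite union
    over the coordinate of modulus 1.\<close>
  define P where "P = Pi\<^sub>E UNIV (\<lambda>i. if i \<in> B then {-1..1::real} else {0})"
  define S where "S = P \<inter> (\<Union>i\<in>B. {c. \<bar>c i\<bar> = 1})"
  have "compactin (product_topology (\<lambda>i::'v. euclidean) UNIV) P"
    unfolding P_def by (subst compactin_PiE) auto
  then have "compact P" by (simp add: euclidean_product_topology)
  moreover have "closed (\<Union>i\<in>B. {c::'v \<Rightarrow> real. \<bar>c i\<bar> = 1})"
    by (intro closed_UN B(1) ballI closed_Collect_eq continuous_on_rabs continuous_on_const continuous_on_product_coordinates)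
  ultimately have S: "compact S" unfolding S_def by (rule compact_Int_closed)
  have nz: "a (u c) (u c) > 0" if c: "c \<in> S" for c
  proof -
    obtain i where "i \<in> B" "\<bar>c i\<bar> = 1" using c by (auto simp: S_def)
    then have "u c \<noteq> 0" using u0[of i c] by auto
    then show ?thesis using a.pos[OF uV] by blast
  qed
  have coordc: "continuous_on S (\<lambda>c. c i)" for i :: 'v
    by (rule continuous_on_subset[OF continuous_on_product_coordinates subset_UNIV])
  have cont: "continuous_on S (\<lambda>c. m (u c) (u c) / a (u c) (u c))"
  proof (rule continuous_on_divide)
    show "continuous_on S (\<lambda>c. m (u c) (u c))" "continuous_on S (\<lambda>c. a (u c) (u c))"
      unfolding quad[OF m] quad[OF a.bilinear_form_axioms] by (intro continuous_intros coordc)+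
    show "\<forall>c\<in>S. a (u c) (u c) \<noteq> 0" using nz by force
  qed
  have scaled: "\<exists>c\<in>S. \<exists>r. r > 0 \<and> u c = r *\<^sub>R v" if v: "v \<in> V" "v \<noteq> 0" for v
  proof -
    obtain c where c: "\<And>i. i \<notin> B \<Longrightarrow> c i = 0" "u c = v" using coord[OF v(1)] by blast
    have "B \<noteq> {}" using v c by (auto simp: u_def)
    define t where "t = Max ((\<lambda>i. \<bar>c i\<bar>) ` B)"
    have le: "\<bar>c i\<bar> \<le> t" if "i \<in> B" for i using that B by (auto simp: t_def)
    have "t \<in> (\<lambda>i. \<bar>c i\<bar>) ` B" unfolding t_def using B \<open>B \<noteq> {}\<close> by (intro Max_in) auto
    then obtain k where k: "k \<in> B" "t = \<bar>c k\<bar>" by blast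
    have "t \<noteq> 0"
    proof
      assume "t = 0"
      then have "\<And>i. i \<in> B \<Longrightarrow> c i = 0" using le by force
      then have "u c = 0" by (simp add: u_def)
      then show False using v c by simp
    qed
    then have t: "t > 0" using k by auto
    have "\<bar>c i / t\<bar> \<le> 1" if "i \<in> B" for i using le[OF that] t by simp
    then have "-1 \<le> c i / t \<and> c i / t \<le> 1" if "i \<in> B" for i using that by (metis abs_le_D1 abs_le_D2 minus_le_iff)
    moreover have "\<bar>c k / t\<bar> = 1" using k t by simp
    ultimately have "(\<lambda>i. c i / t) \<in> S"
      unfolding S_def P_def using c(1) k(1) by (auto simp del: abs_divide)
    moreover have "u (\<lambda>i. c i / t) = (1 / t) *\<^sub>R v"
      by (simp add: c(2)[symmetric] u_def scaleR_sum_right)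
    ultimately show ?thesis using t by (intro bexI[of _ "\<lambda>i. c i / t"] exI[of _ "1/t"]) auto
  qed
  have "S \<noteq> {}" using scaled[OF ne] by auto
  then obtain c0 where c0: "c0 \<in> S" and
    mx: "\<And>c. c \<in> S \<Longrightarrow> m (u c) (u c) / a (u c) (u c) \<le> m (u c0) (u c0) / a (u c0) (u c0)"
    using continuous_attains_sup[OF S _ cont] by auto
  define v0 where "v0 = u c0"
  define M where "M = m v0 v0 / a v0 v0"
  have v0: "v0 \<in> V" "a v0 v0 > 0" using uV nz[OF c0] by (auto simp: v0_def)
  then have "v0 \<noteq> 0" using a.zero_left[of 0] by auto
  have le: "m v v \<le> M * a v v" if v: "v \<in> V" for v
  proof (cases "v = 0")
    case True then show ?thesis by (simp add: a.zero_left m.zero_left)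
  next
    case False
    obtain c r where cr: "c \<in> S" "r > 0" "u c = r *\<^sub>R v" using scaled[OF v False] by blast
    have "m (u c) (u c) / a (u c) (u c) = m v v / a v v"
      using v cr by (simp add: m.bilin a.bilin)
    then have "m v v / a v v \<le> M" using mx[OF cr(1)] by (simp add: M_def v0_def)
    then show ?thesis using a.pos[OF v False] by (simp add: field_simps)
  qed
  \<comment> \<open>By maximality \<open>d\<close> is semidefinite, and it vanishes at the
    maximiser. Cauchy-Schwarz then makes \<open>d v0\<close> vanish on all of \<open>V\<close>,
    which is the eigenvalue equation.\<close>
  define d where "d = (\<lambda>v w. M * a v w - m v w)"
  interpret d: psd_form V d
    by unfold_locales
      (auto simp: d_def a.comb_left a.comb_right m.comb_left m.comb_right algebra_simps a.sym sym le a.subspace_V)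
  have "d v0 v0 = 0" using v0 by (simp add: d_def M_def)
  then have "d v0 w = 0" if "w \<in> V" for w
    using d.Cauchy_Schwarz[OF v0(1) that] by simp
  then show ?thesis using that[OF v0(1) \<open>v0 \<noteq> 0\<close> le] by (simp add: d_def)
qed

text \<open>Eigenvectors to different eigenvalues are orthogonal, hence independent, so their number
  is bounded. This gives a meaning to the \<open>Max\<close> in the definition of the largest
  eigenvalue.\<close>

lemma finite_eigenvalues:
  fixes V :: "'v::real_vector set"
  assumes V: "fin_dim V" and a: "pd_form V a"
    and A: "\<And>v. v \<in> V \<Longrightarrow> A v \<in> V" "\<And>u v. u \<in> V \<Longrightarrow> v \<in> V \<Longrightarrow> a (A u) v = a u (A v)"
  shows "finite {l. \<exists>v\<in>V. v \<noteq> 0 \<and> A v = l *\<^sub>R v}"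
proof (rule ccontr)
  interpret a: pd_form V a by (rule a)
  obtain C where C: "finite C" "V \<subseteq> span C" using V by (auto simp: fin_dim_def)
  let ?E = "{l. \<exists>v\<in>V. v \<noteq> 0 \<and> A v = l *\<^sub>R v}"
  assume "infinite ?E"
  then obtain L where L: "finite L" "card L = Suc (card C)" "L \<subseteq> ?E"
    using infinite_arbitrarily_large by blast
  then have "\<forall>l\<in>L. \<exists>v. v \<in> V \<and> v \<noteq> 0 \<and> A v = l *\<^sub>R v" by blast
  then obtain v where v: "\<And>l. l \<in> L \<Longrightarrow> v l \<in> V \<and> v l \<noteq> 0 \<and> A (v l) = l *\<^sub>R v l" by metis
  have orth: "a (v l) (v k) = 0" if "l \<in> L" "k \<in> L" "l \<noteq> k" for l k
    using A(2)[of "v l" "v k"] v[OF that(1)] v[OF that(2)] that(3) by (simp add: a.bilin)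
  have inj: "inj_on v L"
  proof (rule inj_onI)
    fix l k assume "l \<in> L" "k \<in> L" "v l = v k"
    then show "l = k" using orth[of l k] v[of k] a.pos[of "v k"] by auto
  qed
  have "independent (v ` L)"
  proof (rule independent_if_scalars_zero)
    show "finite (v ` L)" using L by simp
    fix f x assume s: "(\<Sum>x\<in>v ` L. f x *\<^sub>R x) = 0" and x: "x \<in> v ` L"
    then obtain k where k: "k \<in> L" "x = v k" by blast
    have "0 = a (\<Sum>l\<in>L. f (v l) *\<^sub>R v l) (v k)"
      using s v[OF k(1)] by (simp add: sum.reindex[OF inj] a.zero_left)
    also have "\<dots> = (\<Sum>l\<in>L. f (v l) * a (v l) (v k))"
      using v k by (subst a.sum_left) (auto simp: a.bilin)
    also have "\<dots> = (\<Sum>l\<in>L. if l = k then f (v k) * a (v k) (v k) else 0)"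
      using orth k by (intro sum.cong) auto
    also have "\<dots> = f x * a x x" using L k by (simp add: sum.delta')
    finally show "f x = 0" using a.pos[of x] v[OF k(1)] k by auto
  qed
  moreover have "v ` L \<subseteq> span C" using v C by blast
  ultimately have "card (v ` L) \<le> card C" using independent_span_bound[OF C(1)] by blast
  then show False using L card_image[OF inj] by simp
qed

text \<open>For the eigenvector \<open>u + i v\<close> the cross terms cancel in
  \<open>a (A u) (A u) + a (A v) (A v)\<close>, leaving the squared modulus of \<open>l\<close>
  times \<open>a u u + a v v\<close>.\<close>

lemma cmod_eigenvalue_le:
  assumes a: "pd_form V a" and A: "\<And>v. v \<in> V \<Longrightarrow> A v \<in> V"
    and bd: "\<And>v. v \<in> V \<Longrightarrow> form_norm a (A v) \<le> k * form_norm a v" and k: "0 \<le> k"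
    and l: "l \<in> complex_eigenvalues_on V A"
  shows "cmod l \<le> k"
proof -
  interpret a: pd_form V a by (rule a)
  obtain u v where uv: "u \<in> V" "v \<in> V" "u \<noteq> 0 \<or> v \<noteq> 0"
    and Au: "A u = Re l *\<^sub>R u - Im l *\<^sub>R v" and Av: "A v = Im l *\<^sub>R u + Re l *\<^sub>R v"
    using l by (auto simp: complex_eigenvalues_on_def zero_fun_def fun_eq_iff plus_fun_def)
  have sq: "a (A w) (A w) \<le> k\<^sup>2 * a w w" if w: "w \<in> V" for w
  proof -
    have "(form_norm a (A w))\<^sup>2 \<le> (k * form_norm a w)\<^sup>2"
      using bd[OF w] a.psd[OF A[OF w]] by (intro power_mono) (auto simp: form_norm_def)
    then show ?thesis using a.psd[OF A[OF w]] a.psd[OF w] by (simp add: form_norm_def power_mult_distrib)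
  qed
  have "(cmod l)\<^sup>2 * (a u u + a v v) = a (A u) (A u) + a (A v) (A v)"
    using uv a.sym[of u v] by (simp add: Au Av a.bilin cmod_power2) (simp add: algebra_simps power2_eq_square)
  also have "\<dots> \<le> k\<^sup>2 * (a u u + a v v)" using sq uv by (simp add: algebra_simps add_mono)
  finally have "(cmod l)\<^sup>2 * (a u u + a v v) \<le> k\<^sup>2 * (a u u + a v v)" .
  moreover have "a u u + a v v > 0"
    using uv a.pos[of u] a.pos[of v] a.psd[of u] a.psd[of v] by (auto intro: add_pos_nonneg add_nonneg_pos)
  ultimately have "(cmod l)\<^sup>2 \<le> k\<^sup>2" by simp
  then show ?thesis using k by (rule power2_le_imp_le)
qed

section \<open>Spectral radius and operator norm\<close>

lemma real_eigenvalue_in_complex_eigenvalues: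
  "v \<in> V \<Longrightarrow> v \<noteq> 0 \<Longrightarrow> A v = l *\<^sub>R v \<Longrightarrow> 0 \<in> V \<Longrightarrow> A 0 = 0 \<Longrightarrow> complex_of_real l \<in> complex_eigenvalues_on V A"
  unfolding complex_eigenvalues_on_def
  by (intro CollectI bexI[of _ v] bexI[of _ "0"]) (auto simp: zero_fun_def fun_eq_iff scaleR_fun_def)

text \<open>An empty supremum is an unspecified real number, so an upper bound needs some eigenvalue
  to exist.\<close>

lemma spectral_radius_le:
  assumes "pd_form V a" "\<And>v. v \<in> V \<Longrightarrow> A v \<in> V"
    "\<And>v. v \<in> V \<Longrightarrow> form_norm a (A v) \<le> k * form_norm a v" "0 \<le> k"
    and "complex_eigenvalues_on V A \<noteq> {}"
  shows "spectral_radius_on V A \<le> k"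
  unfolding spectral_radius_on_def
  by (rule cSUP_least[OF assms(5)]) (rule cmod_eigenvalue_le[OF assms(1-4)])

lemma le_spectral_radius:
  assumes "pd_form V a" "\<And>v. v \<in> V \<Longrightarrow> A v \<in> V"
    "\<And>v. v \<in> V \<Longrightarrow> form_norm a (A v) \<le> k * form_norm a v" "0 \<le> k"
    and "l \<in> complex_eigenvalues_on V A"
  shows "cmod l \<le> spectral_radius_on V A"
  unfolding spectral_radius_on_def
  by (rule cSUP_upper[OF assms(5)], rule bdd_aboveI2, rule cmod_eigenvalue_le[OF assms(1-4)])

lemma op_norm_on_le:
  assumes a: "pd_form V a" and bd: "\<And>v. v \<in> V \<Longrightarrow> form_norm a (A v) \<le> k * form_norm a v"
    and ne: "z \<in> V" "z \<noteq> 0"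
  shows "op_norm_on V a A \<le> k"
  unfolding op_norm_on_def
proof (rule cSUP_least)
  show "V - {\<lambda>_. 0} \<noteq> {}" using ne by (auto simp: zero_fun_def)
  fix v assume v: "v \<in> V - {\<lambda>_. 0}"
  then have "form_norm a v > 0"
    using pd_form.pos[OF a, of v] by (simp add: form_norm_def zero_fun_def)
  then show "form_norm a (A v) / form_norm a v \<le> k"
    using bd[of v] v by (simp add: field_simps)
qed

text \<open>The constant \<open>k\<close> serves only to bound the quotients above, so that their
  supremum dominates each of them.\<close>

lemma le_op_norm_on:
  assumes a: "pd_form V a" and bd: "\<And>v. v \<in> V \<Longrightarrow> form_norm a (A v) \<le> k * form_norm a v"
    and v: "v \<in> V" "v \<noteq> 0"
  shows "form_norm a (A v) \<le> op_norm_on V a A * form_norm a v"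
proof -
  have pos: "form_norm a v > 0" if "v \<in> V - {\<lambda>_. 0}" for v
    using pd_form.pos[OF a, of v] that by (simp add: form_norm_def zero_fun_def)
  have vm: "v \<in> V - {\<lambda>_. 0}" using v by (simp add: zero_fun_def)
  have "bdd_above ((\<lambda>v. form_norm a (A v) / form_norm a v) ` (V - {\<lambda>_. 0}))"
    by (rule bdd_aboveI2[where M = k]) (use bd pos in \<open>auto simp: divide_le_eq\<close>)
  then have "form_norm a (A v) / form_norm a v \<le> op_norm_on V a A"
    unfolding op_norm_on_def by (rule cSUP_upper[OF vm])
  then show ?thesis using pos[OF vm] by (simp add: field_simps)
qed

lemma form_norm_eq_nrm: "psd_form V a \<Longrightarrow> form_norm a = psd_form.nrm a"
  by (simp add: form_norm_def psd_form.nrm_def fun_eq_iff)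

lemma bilinear_form_compose:
  assumes "bilinear_form V a" and "\<And>v. v \<in> V \<Longrightarrow> A v \<in> V"
    and "\<And>u v s t. u \<in> V \<Longrightarrow> v \<in> V \<Longrightarrow> A (s *\<^sub>R u + t *\<^sub>R v) = s *\<^sub>R A u + t *\<^sub>R A v"
  shows "bilinear_form V (\<lambda>u v. a (A u) v)"
proof -
  interpret a: bilinear_form V a by (rule assms)
  show ?thesis by unfold_locales (simp_all add: assms a.subspace_V a.comb_left a.comb_right)
qed

text \<open>The maximum \<open>M\<close> of the Rayleigh quotient of the semidefinite form
  \<open>a (A u) v\<close> is an eigenvalue. Cauchy-Schwarz for that form bounds
  \<open>a (A v) w\<close> by \<open>M\<close> times the two norms, so no other part of the spectrum
  can exceed \<open>M\<close> in modulus.\<close>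

lemma positive_selfadjoint_norm:
  assumes V: "fin_dim V" and a: "pd_form V a" and A: "\<And>v. v \<in> V \<Longrightarrow> A v \<in> V"
    and lin: "\<And>u v s t. u \<in> V \<Longrightarrow> v \<in> V \<Longrightarrow> A (s *\<^sub>R u + t *\<^sub>R v) = s *\<^sub>R A u + t *\<^sub>R A v"
    and sa: "\<And>u v. u \<in> V \<Longrightarrow> v \<in> V \<Longrightarrow> a (A u) v = a u (A v)"
    and nonneg: "\<And>v. v \<in> V \<Longrightarrow> 0 \<le> a (A v) v"
    and ne: "z \<in> V" "z \<noteq> 0"
  shows "\<exists>v0 M. v0 \<in> V \<and> v0 \<noteq> 0 \<and> A v0 = M *\<^sub>R v0 \<and> 0 \<le> M \<and>
    (\<forall>v\<in>V. form_norm a (A v) \<le> M * form_norm a v)"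
proof -
  interpret a: pd_form V a by (rule a)
  define m where "m = (\<lambda>u v. a (A u) v)"
  have mb: "bilinear_form V m"
    unfolding m_def by (rule bilinear_form_compose[OF a.bilinear_form_axioms A lin])
  interpret m: psd_form V m
  proof (intro psd_form.intro mb psd_form_axioms.intro)
    show "m u v = m v u" if "u \<in> V" "v \<in> V" for u v
      using sa[OF that] a.sym[OF that(1) A[OF that(2)]] by (simp add: m_def)
    show "0 \<le> m v v" if "v \<in> V" for v using nonneg[OF that] by (simp add: m_def)
  qed
  obtain v0 M where v0: "v0 \<in> V" "v0 \<noteq> 0" and le: "\<And>v. v \<in> V \<Longrightarrow> m v v \<le> M * a v v"
    and eq: "\<And>w. w \<in> V \<Longrightarrow> m v0 w = M * a v0 w"
    using max_eigenpair[OF V a mb m.sym ne] by metis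
  have "A v0 = M *\<^sub>R v0"
    by (rule a.eqI) (use v0 A eq in \<open>auto simp: m_def a.bilin\<close>)
  moreover have M: "0 \<le> M"
    using eq[OF v0(1)] m.psd[OF v0(1)] a.pos[OF v0] by (simp add: zero_le_mult_iff)
  moreover have "form_norm a (A v) \<le> M * form_norm a v" if v: "v \<in> V" for v
  proof -
    have "a.nrm (A v) \<le> M * a.nrm v"
    proof (rule a.nrm_le_of_dual)
      fix w assume w: "w \<in> V"
      have "(m v w)\<^sup>2 \<le> m v v * m w w" by (rule m.Cauchy_Schwarz[OF v w])
      also have "\<dots> \<le> (M * a v v) * (M * a w w)"
        using le v w m.psd M a.psd by (intro mult_mono) auto
      also have "\<dots> = (M * a.nrm v * a.nrm w)\<^sup>2"
        by (simp only: a.nrm_sq[OF v, symmetric] a.nrm_sq[OF w, symmetric] power2_eq_square mult_ac)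
      finally have "\<bar>m v w\<bar> \<le> \<bar>M * a.nrm v * a.nrm w\<bar>" by (simp only: abs_le_square_iff)
      then show "\<bar>a (A v) w\<bar> \<le> M * a.nrm v * a.nrm w" using M v w by (simp add: m_def)
    qed (use v A M in auto)
    then show ?thesis by (simp add: form_norm_eq_nrm[OF a.psd_form_axioms])
  qed
  ultimately show ?thesis using v0 by blast
qed

text \<open>The bound \<open>M\<close> limits both quantities from above, and the eigenvector
  \<open>v0\<close> attains it in both.\<close>

lemma op_norm_eq_spectral_radius:
  assumes a: "pd_form V a" and A: "\<And>v. v \<in> V \<Longrightarrow> A v \<in> V" and A0: "A 0 = 0"
    and v0: "v0 \<in> V" "v0 \<noteq> 0" "A v0 = M *\<^sub>R v0" and M: "0 \<le> M"
    and bd: "\<And>v. v \<in> V \<Longrightarrow> form_norm a (A v) \<le> M * form_norm a v"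
  shows "op_norm_on V a A = M" "spectral_radius_on V A = M"
proof -
  interpret a: pd_form V a by (rule a)
  have l: "complex_of_real M \<in> complex_eigenvalues_on V A"
    using v0 A0 by (intro real_eigenvalue_in_complex_eigenvalues[where v = v0]) auto
  have "spectral_radius_on V A \<le> M" by (rule spectral_radius_le[OF a A bd M]) (use l in auto)
  moreover have "M \<le> spectral_radius_on V A" using le_spectral_radius[OF a A bd M l] M by simp
  ultimately show "spectral_radius_on V A = M" by simp
  have "form_norm a (A v0) = M * form_norm a v0"
    using v0 M by (simp add: form_norm_eq_nrm[OF a.psd_form_axioms] a.nrm_scale)
  moreover have "form_norm a v0 > 0" using a.pos[OF v0(1,2)] by (simp add: form_norm_def)
  ultimately have "M \<le> op_norm_on V a A"
    using le_op_norm_on[OF a bd v0(1,2)] by simp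
  moreover have "op_norm_on V a A \<le> M" by (rule op_norm_on_le[OF a bd v0(1,2)])
  ultimately show "op_norm_on V a A = M" by simp
qed

text \<open>
  \<open>E = G - \<delta>\<close> with \<open>\<delta> = A\<^sub>m\<^sup>-\<^sup>1 A\<^sub>x G\<close>; it is self-adjoint for the inner product \<open>ax (G u) v\<close>,
  which provides a real eigenvalue.
\<close>

locale preconditioned_correction =
  ax: pd_form V ax + am: pd_form V am for V :: "'v::real_vector set" and ax am +
  fixes G \<delta> :: "'v \<Rightarrow> 'v" and \<kappa> M :: real and z :: 'v
  assumes fin: "fin_dim V"
    and ne: "z \<in> V" "z \<noteq> 0"
    and G: "v \<in> V \<Longrightarrow> G v \<in> V"
    and G_lin: "u \<in> V \<Longrightarrow> v \<in> V \<Longrightarrow> G (s *\<^sub>R u + t *\<^sub>R v) = s *\<^sub>R G u + t *\<^sub>R G v"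
    and G_sa: "u \<in> V \<Longrightarrow> v \<in> V \<Longrightarrow> ax (G u) v = ax u (G v)"
    and G_pos: "v \<in> V \<Longrightarrow> v \<noteq> 0 \<Longrightarrow> 0 < ax (G v) v"
    and G_bd: "v \<in> V \<Longrightarrow> ax.nrm (G v) \<le> M * ax.nrm v"
    and \<delta>: "v \<in> V \<Longrightarrow> \<delta> v \<in> V" "v \<in> V \<Longrightarrow> w \<in> V \<Longrightarrow> am (\<delta> v) w = ax (G v) w"
    and close: "u \<in> V \<Longrightarrow> v \<in> V \<Longrightarrow> \<bar>ax u v - am u v\<bar> \<le> \<kappa> * am.nrm u * am.nrm v"
    and \<kappa>: "0 \<le> \<kappa>" "\<kappa> \<le> 1/4"
begin

text \<open>With \<open>\<kappa> \<le> 1/4\<close> the squared norms differ at most by the factors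
  4/3 and 5/4. The constants 4/3 and 3/2 are rational upper bounds of the roots whose product is
  2.\<close>

lemma nrm_equiv:
  assumes v: "v \<in> V"
  shows "am.nrm v \<le> 4/3 * ax.nrm v" "ax.nrm v \<le> 3/2 * am.nrm v"
proof -
  have c: "\<bar>(ax.nrm v)\<^sup>2 - (am.nrm v)\<^sup>2\<bar> \<le> \<kappa> * (am.nrm v)\<^sup>2"
    using close[OF v v] v by (simp add: ax.nrm_sq am.nrm_sq flip: power2_eq_square) (simp add: power2_eq_square am.nrm_sq[OF v, unfolded power2_eq_square] mult.assoc)
  have "\<kappa> * (am.nrm v)\<^sup>2 \<le> 1/4 * (am.nrm v)\<^sup>2" using \<kappa> by (intro mult_right_mono) auto
  then have "(am.nrm v)\<^sup>2 \<le> 4/3 * (ax.nrm v)\<^sup>2" "(ax.nrm v)\<^sup>2 \<le> 5/4 * (am.nrm v)\<^sup>2" using c by auto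
  then have "(am.nrm v)\<^sup>2 \<le> (4/3 * ax.nrm v)\<^sup>2" "(ax.nrm v)\<^sup>2 \<le> (3/2 * am.nrm v)\<^sup>2"
    using zero_le_power2[of "ax.nrm v"] zero_le_power2[of "am.nrm v"] by (simp_all add: power_mult_distrib power2_eq_square)
  then show "am.nrm v \<le> 4/3 * ax.nrm v" "ax.nrm v \<le> 3/2 * am.nrm v"
    using v by (auto intro: power2_le_imp_le)
qed

text \<open>In the form \<open>am\<close> the remaining error \<open>G v - \<delta> v\<close>
  represents \<open>am (G v) - ax (G v)\<close>, a pure consistency error at \<open>G v\<close>.
  Passing to the \<open>ax\<close> norm and back costs the product 2 of the equivalence
  constants.\<close>

lemma correction_bound:
  assumes v: "v \<in> V"
  shows "ax.nrm (G v - \<delta> v) \<le> 2 * \<kappa> * M * ax.nrm v"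
proof -
  have Gv: "G v \<in> V" "\<delta> v \<in> V" "G v - \<delta> v \<in> V" using v G \<delta> by auto
  have "am.nrm (G v - \<delta> v) \<le> \<kappa> * am.nrm (G v)"
  proof (rule am.nrm_le_of_dual)
    fix w assume w: "w \<in> V"
    have "am (G v - \<delta> v) w = - (ax (G v) w - am (G v) w)" using Gv w v by (simp add: am.bilin \<delta>)
    then show "\<bar>am (G v - \<delta> v) w\<bar> \<le> \<kappa> * am.nrm (G v) * am.nrm w"
      using close[OF Gv(1) w] by simp
  qed (use Gv \<kappa> in auto)
  then have "ax.nrm (G v - \<delta> v) \<le> 3/2 * (\<kappa> * am.nrm (G v))"
    using nrm_equiv(2)[OF Gv(3)] by simp
  also have "\<dots> \<le> 3/2 * (\<kappa> * (4/3 * ax.nrm (G v)))"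
    using nrm_equiv(1)[OF Gv(1)] \<kappa> by (intro mult_left_mono) auto
  also have "\<dots> \<le> 2 * \<kappa> * (M * ax.nrm v)"
    using G_bd[OF v] \<kappa> by (simp add: mult_left_mono)
  finally show ?thesis by (simp add: mult.assoc)
qed

lemma \<delta>_lin:
  assumes "u \<in> V" "v \<in> V"
  shows "\<delta> (s *\<^sub>R u + t *\<^sub>R v) = s *\<^sub>R \<delta> u + t *\<^sub>R \<delta> v"
  by (rule am.eqI) (use assms in \<open>auto simp: \<delta> G G_lin am.bilin ax.bilin\<close>)

lemma correction_eigenvalue:
  obtains v0 l where "v0 \<in> V" "v0 \<noteq> 0" "G v0 - \<delta> v0 = l *\<^sub>R v0"
proof -
  define n where "n = (\<lambda>u v. ax (G u) v)"
  \<comment> \<open>This is \<open>n (G u - \<delta> u) v\<close> in visibly symmetric form: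
    \<open>ax (\<delta> u) (G v)\<close> equals \<open>am (\<delta> u) (\<delta> v)\<close> by the
    equation defining \<open>\<delta> v\<close>.\<close>
  define m where "m = (\<lambda>u v. ax (G u) (G v) - am (\<delta> u) (\<delta> v))"
  have nb: "bilinear_form V n"
    unfolding n_def by (rule bilinear_form_compose[OF ax.bilinear_form_axioms G G_lin])
  interpret n: bilinear_form V n by (rule nb)
  have n: "pd_form V n"
  proof (intro pd_form.intro psd_form.intro nb psd_form_axioms.intro pd_form_axioms.intro)
    show "n u v = n v u" if "u \<in> V" "v \<in> V" for u v
      using G_sa[OF that] ax.sym[OF that(1) G[OF that(2)]] by (simp add: n_def)
    show "0 < n v v" if "v \<in> V" "v \<noteq> 0" for v using G_pos that by (simp add: n_def)
    then show "0 \<le> n v v" if "v \<in> V" for v using that n.zero_left[of 0] by (cases "v = 0") (auto simp: less_imp_le)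
  qed
  have mb: "bilinear_form V m"
    by unfold_locales
       (simp_all add: m_def G \<delta>(1) G_lin \<delta>_lin ax.subspace_V ax.comb_left ax.comb_right am.comb_left am.comb_right algebra_simps)
  have ms: "m u v = m v u" if "u \<in> V" "v \<in> V" for u v
    using that by (simp add: m_def ax.sym[of "G u"] am.sym[of "\<delta> u"] G \<delta>(1))
  obtain v0 l where v0: "v0 \<in> V" "v0 \<noteq> 0" and eq: "\<And>w. w \<in> V \<Longrightarrow> m v0 w = l * n v0 w"
    using max_eigenpair[OF fin n mb ms ne] by metis
  define d where "d = G v0 - \<delta> v0 - l *\<^sub>R v0"
  have d: "d \<in> V" using v0 by (simp add: d_def G \<delta>)
  have "ax (G d) w = 0" if w: "w \<in> V" for w
  proof -
    have "ax (G d) w = ax (G v0) (G w) - ax (\<delta> v0) (G w) - l * ax v0 (G w)"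
      using v0 w d by (simp add: G_sa d_def ax.bilin G \<delta>(1))
    also have "ax (\<delta> v0) (G w) = am (\<delta> v0) (\<delta> w)"
      using ax.sym[OF \<delta>(1)[OF v0(1)] G[OF w]] am.sym[OF \<delta>(1)[OF v0(1)] \<delta>(1)[OF w]]
        \<delta>(2)[OF w \<delta>(1)[OF v0(1)]] by simp
    also have "ax v0 (G w) = ax (G v0) w" using v0 w by (simp add: G_sa)
    finally show ?thesis using eq[OF w] by (simp add: m_def n_def)
  qed
  then have "ax (G d) d = 0" using d by blast
  then have "d = 0" using G_pos[OF d] by force
  then show ?thesis using that[OF v0, of l] by (simp add: d_def)
qed

end

section \<open>Transport response\<close>

text \<open>The part of the theory valid for every Knudsen number. The geometry enters only through
  sign, reversal and nondegeneracy of the streaming forms \<open>t m\<close>; \<open>\<eta>\<close>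
  is the mean free path scale and \<open>c\<close> the scattering ratio.\<close>

locale transport_response =
  I: pd_form V I for V :: "'v::real_vector set" and I +
  fixes D :: "'i set" and w :: "'i \<Rightarrow> real" and \<eta> c :: real
    and t :: "'i \<Rightarrow> 'v \<Rightarrow> 'v \<Rightarrow> real" and opp :: "'i \<Rightarrow> 'i"
  assumes fin: "fin_dim V" and fin_D: "finite D"
    and w_pos: "m \<in> D \<Longrightarrow> 0 < w m" and w_sum: "(\<Sum>m\<in>D. w m) = 1"
    and \<eta>: "0 < \<eta>" and c: "0 < c" "c < 1"
    and t_bilin: "m \<in> D \<Longrightarrow> bilinear_form V (t m)"
    and t_nonneg: "m \<in> D \<Longrightarrow> v \<in> V \<Longrightarrow> 0 \<le> t m v v"
    and opp: "bij_betw opp D D" "m \<in> D \<Longrightarrow> w (opp m) = w m"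
      "m \<in> D \<Longrightarrow> u \<in> V \<Longrightarrow> v \<in> V \<Longrightarrow> t (opp m) u v = t m v u"
    and nondeg: "g \<in> V \<Longrightarrow> (\<And>m v. m \<in> D \<Longrightarrow> v \<in> V \<Longrightarrow> t m g v = 0) \<Longrightarrow> g = 0"
begin

definition \<psi> :: "'i \<Rightarrow> 'v \<Rightarrow> 'v" where
  "\<psi> m g = (THE u. u \<in> V \<and> (\<forall>v\<in>V. I u v + \<eta> * t m u v = I g v))"

definition H :: "'v \<Rightarrow> 'v" where
  "H g = (\<Sum>m\<in>D. w m *\<^sub>R \<psi> m g)"

lemma opp_in: "m \<in> D \<Longrightarrow> opp m \<in> D"
  using opp(1) by (auto simp: bij_betw_def)

lemma sum_opp: "(\<Sum>m\<in>D. f (opp m)) = (\<Sum>m\<in>D. f m)"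
  by (rule sum.reindex_bij_betw[OF opp(1)])

lemma form_bilin:
  assumes m: "m \<in> D" shows "bilinear_form V (\<lambda>u v. I u v + \<eta> * t m u v)"
proof -
  interpret t: bilinear_form V "t m" by (rule t_bilin[OF m])
  show ?thesis
    by unfold_locales (simp_all add: I.subspace_V I.comb_left t.comb_left I.comb_right t.comb_right algebra_simps)
qed

lemma \<psi>_ex1:
  assumes m: "m \<in> D" and g: "g \<in> V"
  shows "\<exists>!u. u \<in> V \<and> (\<forall>v\<in>V. I u v + \<eta> * t m u v = I g v)"
proof (rule Lax_Milgram[OF fin form_bilin[OF m]])
  show "0 < I v v + \<eta> * t m v v" if "v \<in> V" "v \<noteq> 0" for v
    using I.pos[OF that] t_nonneg[OF m that(1)] \<eta> by (simp add: add_pos_nonneg)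
qed (simp add: g I.comb_right)

lemma \<psi>:
  assumes m: "m \<in> D" and g: "g \<in> V"
  shows \<psi>_in: "\<psi> m g \<in> V" and \<psi>_eq: "v \<in> V \<Longrightarrow> I (\<psi> m g) v + \<eta> * t m (\<psi> m g) v = I g v"
  using theI'[OF \<psi>_ex1[OF m g]] by (auto simp: \<psi>_def)

lemma \<psi>_unique:
  assumes "m \<in> D" "g \<in> V" "u \<in> V" "\<And>v. v \<in> V \<Longrightarrow> I u v + \<eta> * t m u v = I g v"
  shows "\<psi> m g = u"
  using \<psi>_ex1[OF assms(1,2)] \<psi>_in[OF assms(1,2)] \<psi>_eq[OF assms(1,2)] assms(3,4) by blast

lemma \<psi>_lin:
  assumes m: "m \<in> D" and uv: "u \<in> V" "v \<in> V"
  shows "\<psi> m (a *\<^sub>R u + b *\<^sub>R v) = a *\<^sub>R \<psi> m u + b *\<^sub>R \<psi> m v"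
proof (rule \<psi>_unique[OF m])
  interpret f: bilinear_form V "\<lambda>u v. I u v + \<eta> * t m u v" by (rule form_bilin[OF m])
  fix x assume x: "x \<in> V"
  show "I (a *\<^sub>R \<psi> m u + b *\<^sub>R \<psi> m v) x + \<eta> * t m (a *\<^sub>R \<psi> m u + b *\<^sub>R \<psi> m v) x = I (a *\<^sub>R u + b *\<^sub>R v) x"
    using f.comb_left[OF \<psi>_in[OF m uv(1)] \<psi>_in[OF m uv(2)] x] \<psi>_eq[OF m uv(1) x] \<psi>_eq[OF m uv(2) x]
    by (simp add: I.comb_left uv x)
qed (use uv m in \<open>auto simp: \<psi>_in\<close>)

lemma H_in: "g \<in> V \<Longrightarrow> H g \<in> V"
  unfolding H_def by (intro I.closed) (simp add: \<psi>_in)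

lemma H_lin: "u \<in> V \<Longrightarrow> v \<in> V \<Longrightarrow> H (a *\<^sub>R u + b *\<^sub>R v) = a *\<^sub>R H u + b *\<^sub>R H v"
  by (simp add: H_def \<psi>_lin scaleR_sum_right sum.distrib algebra_simps cong: sum.cong)

lemma I_H: "g \<in> V \<Longrightarrow> v \<in> V \<Longrightarrow> I (H g) v = (\<Sum>m\<in>D. w m * I (\<psi> m g) v)"
  unfolding H_def by (subst I.sum_left) (auto simp: \<psi>_in I.scale_left)

text \<open>Solution operators of opposite directions are adjoint: test the equation of each with
  the solution of the other. The average over directions is invariant under reversal.\<close>

lemma H_sa:
  assumes g: "g \<in> V" and v: "v \<in> V"
  shows "I (H g) v = I g (H v)"
proof -
  have "I (\<psi> m g) v = I g (\<psi> (opp m) v)" if m: "m \<in> D" for m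
  proof -
    note p = \<psi>_in[OF m g] and q = \<psi>_in[OF opp_in[OF m] v]
    have "I (\<psi> m g) v = I v (\<psi> m g)" by (rule I.sym[OF p v])
    also have "\<dots> = I (\<psi> (opp m) v) (\<psi> m g) + \<eta> * t (opp m) (\<psi> (opp m) v) (\<psi> m g)"
      using \<psi>_eq[OF opp_in[OF m] v p] by simp
    also have "\<dots> = I (\<psi> m g) (\<psi> (opp m) v) + \<eta> * t m (\<psi> m g) (\<psi> (opp m) v)"
      using opp(3)[OF m q p] I.sym[OF q p] by simp
    also have "\<dots> = I g (\<psi> (opp m) v)" by (rule \<psi>_eq[OF m g q])
    finally show ?thesis .
  qed
  then have "I (H g) v = (\<Sum>m\<in>D. w (opp m) * I g (\<psi> (opp m) v))"
    using g v by (simp add: I_H opp(2))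
  also have "\<dots> = (\<Sum>m\<in>D. w m * I g (\<psi> m v))" by (rule sum_opp)
  also have "\<dots> = I g (H v)"
    using I_H[OF v g] I.sym[OF H_in[OF v] g] I.sym[OF \<psi>_in[OF _ v] g] by simp
  finally show ?thesis .
qed

lemma \<psi>_energy:
  assumes m: "m \<in> D" and g: "g \<in> V"
  shows "I (\<psi> m g) (\<psi> m g) \<le> I (\<psi> m g) g"
  using \<psi>_eq[OF m g \<psi>_in[OF m g]] mult_nonneg_nonneg[OF less_imp_le[OF \<eta>] t_nonneg[OF m \<psi>_in[OF m g]]]
    I.sym[OF g \<psi>_in[OF m g]] by linarith

text \<open>The variance of the angular fluxes about their mean is nonnegative, and each flux
  satisfies \<open>\<psi>_energy\<close>. Read at \<open>Hi v\<close> it says that the inverse of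
  \<open>H\<close> is at least the identity, whence the positivity of \<open>ax\<close>.\<close>

lemma H_energy:
  assumes g: "g \<in> V"
  shows "I (H g) (H g) \<le> I (H g) g"
proof -
  have "0 \<le> (\<Sum>m\<in>D. w m * I (\<psi> m g - H g) (\<psi> m g - H g))"
    by (intro sum_nonneg mult_nonneg_nonneg I.psd) (use w_pos less_imp_le in \<open>auto simp: \<psi>_in H_in g\<close>)
  also have "\<dots> = (\<Sum>m\<in>D. w m * I (\<psi> m g) (\<psi> m g) - 2 * (w m * I (\<psi> m g) (H g)) + w m * I (H g) (H g))"
  proof (rule sum.cong[OF refl])
    fix m assume m: "m \<in> D"
    have "I (\<psi> m g - H g) (\<psi> m g - H g) = I (\<psi> m g) (\<psi> m g) - 2 * I (\<psi> m g) (H g) + I (H g) (H g)"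
      using \<psi>_in[OF m g] H_in[OF g] I.sym[OF H_in[OF g] \<psi>_in[OF m g]] by (simp add: I.bilin)
    then show "w m * I (\<psi> m g - H g) (\<psi> m g - H g) =
        w m * I (\<psi> m g) (\<psi> m g) - 2 * (w m * I (\<psi> m g) (H g)) + w m * I (H g) (H g)"
      by (simp only: distrib_left right_diff_distrib mult.left_commute)
  qed
  also have "\<dots> = (\<Sum>m\<in>D. w m * I (\<psi> m g) (\<psi> m g)) - 2 * (\<Sum>m\<in>D. w m * I (\<psi> m g) (H g)) + (\<Sum>m\<in>D. w m) * I (H g) (H g)"
    by (simp add: sum.distrib sum_subtractf sum_distrib_left sum_distrib_right)
  also have "\<dots> = (\<Sum>m\<in>D. w m * I (\<psi> m g) (\<psi> m g)) - I (H g) (H g)"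
    using I_H[OF g H_in[OF g]] by (simp add: w_sum)
  also have "(\<Sum>m\<in>D. w m * I (\<psi> m g) (\<psi> m g)) \<le> (\<Sum>m\<in>D. w m * I (\<psi> m g) g)"
    by (intro sum_mono mult_left_mono \<psi>_energy g) (use w_pos less_imp_le in auto)
  also have "\<dots> = I (H g) g" by (simp add: I_H g)
  finally show ?thesis by simp
qed

text \<open>Expand the squares and use \<open>\<psi>_energy\<close>. Bounding the defect of
  \<open>H\<close> from below by squares allows the case of equality to be read off direction by
  direction.\<close>

lemma H_defect:
  assumes g: "g \<in> V"
  shows "(\<Sum>m\<in>D. w m * I (g - \<psi> m g) (g - \<psi> m g)) \<le> I g g - I (H g) g"
proof -
  have "(\<Sum>m\<in>D. w m * I (g - \<psi> m g) (g - \<psi> m g)) \<le> (\<Sum>m\<in>D. w m * (I g g - I (\<psi> m g) g))"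
  proof (intro sum_mono mult_left_mono)
    fix m assume m: "m \<in> D"
    show "I (g - \<psi> m g) (g - \<psi> m g) \<le> I g g - I (\<psi> m g) g"
      using \<psi>_energy[OF m g] \<psi>_in[OF m g] g I.sym[OF g \<psi>_in[OF m g]] by (simp add: I.bilin)
    show "0 \<le> w m" using w_pos[OF m] by simp
  qed
  also have "\<dots> = (\<Sum>m\<in>D. w m) * I g g - I (H g) g"
    by (simp add: I_H g sum_distrib_right sum_subtractf right_diff_distrib)
  finally show ?thesis by (simp add: w_sum)
qed

lemma H_le: "g \<in> V \<Longrightarrow> I (H g) g \<le> I g g"
  using H_defect[of g] sum_nonneg[of D "\<lambda>m. w m * I (g - \<psi> m g) (g - \<psi> m g)"]
  by (simp add: I.psd \<psi>_in w_pos less_imp_le)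

lemma H_pos:
  assumes g: "g \<in> V" "g \<noteq> 0"
  shows "0 < I (H g) g"
proof -
  obtain m where m: "m \<in> D" using w_sum by (metis sum.empty zero_neq_one ex_in_conv)
  have "\<psi> m g \<noteq> 0"
  proof
    assume "\<psi> m g = 0"
    then have "I g v = 0" if "v \<in> V" for v
      using \<psi>_eq[OF m g(1) that] bilinear_form.zero_left[OF form_bilin[OF m] that] by simp
    then show False using g I.nondegenerate by blast
  qed
  then have "0 < I (\<psi> m g) (\<psi> m g)" by (intro I.pos \<psi>_in m g(1))
  then have "0 < w m * I (\<psi> m g) g" using \<psi>_energy[OF m g(1)] w_pos[OF m] by simp
  moreover have "0 \<le> w k * I (\<psi> k g) g" if k: "k \<in> D" for k
    using \<psi>_energy[OF k g(1)] I.psd[OF \<psi>_in[OF k g(1)]] w_pos[OF k] by simp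
  ultimately show ?thesis
    unfolding I_H[OF g(1) g(1)] using m fin_D by (intro sum_pos2[of D m]) auto
qed

text \<open>An eigenvalue of at least 1 leaves no defect, so every flux equals \<open>g\<close>; the
  transport equations then reduce to \<open>t m g v = 0\<close>, against nondegeneracy.\<close>

lemma H_eigenvalue_less_1:
  assumes g: "g \<in> V" "g \<noteq> 0" and l: "H g = l *\<^sub>R g"
  shows "l < 1"
proof (rule ccontr)
  assume "\<not> l < 1"
  then have "I g g - I (H g) g \<le> 0" using g I.psd[OF g(1)] by (simp add: l I.bilin mult_le_cancel_right1)
  then have "(\<Sum>m\<in>D. w m * I (g - \<psi> m g) (g - \<psi> m g)) \<le> 0" using H_defect[OF g(1)] by simp
  moreover have nn: "0 \<le> w m * I (g - \<psi> m g) (g - \<psi> m g)" if "m \<in> D" for m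
    using that w_pos[OF that] g by (intro mult_nonneg_nonneg I.psd) (auto simp: \<psi>_in)
  ultimately have "(\<Sum>m\<in>D. w m * I (g - \<psi> m g) (g - \<psi> m g)) = 0"
    by (simp add: antisym sum_nonneg)
  then have "w m * I (g - \<psi> m g) (g - \<psi> m g) = 0" if "m \<in> D" for m
    using sum_nonneg_eq_0_iff[OF fin_D, of "\<lambda>m. w m * I (g - \<psi> m g) (g - \<psi> m g)"] nn that by simp
  then have eq: "\<psi> m g = g" if "m \<in> D" for m
    using w_pos[OF that] I.eq_0_iff[of "g - \<psi> m g"] that g(1) by (force simp: \<psi>_in)
  have "t m g v = 0" if m: "m \<in> D" and v: "v \<in> V" for m v
    using \<psi>_eq[OF m g(1) v] eq[OF m] \<eta> by simp
  then show False using nondeg g by blast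
qed

text \<open>Positivity gives injectivity, and it makes \<open>I (H u) v\<close> a form to which
  \<open>Lax_Milgram\<close> applies, whence surjectivity.\<close>

lemma H_bij: "bij_betw H V V"
proof -
  have "u = v" if uv: "u \<in> V" "v \<in> V" and "H u = H v" for u v
  proof -
    have "H (u - v) = 0" using H_lin[OF uv, of 1 "-1"] that by simp
    then have "I (H (u - v)) (u - v) = 0" using uv by (simp add: I.zero_left)
    then show ?thesis using H_pos[of "u - v"] uv by force
  qed
  moreover have "y \<in> H ` V" if y: "y \<in> V" for y
  proof -
    have "\<exists>!u. u \<in> V \<and> (\<forall>v\<in>V. I (H u) v = I y v)"
      by (rule Lax_Milgram[OF fin bilinear_form_compose[OF I.bilinear_form_axioms H_in H_lin]])
         (auto simp: H_pos I.comb_right y)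
    then obtain u where "u \<in> V" "\<And>v. v \<in> V \<Longrightarrow> I (H u) v = I y v" by blast
    then show ?thesis using I.eqI[OF H_in y] by blast
  qed
  ultimately show ?thesis unfolding bij_betw_def by (auto intro!: inj_onI simp: H_in)
qed

definition Hi :: "'v \<Rightarrow> 'v" where
  "Hi = the_inv_into V H"

lemma Hi_in: "u \<in> V \<Longrightarrow> Hi u \<in> V"
  unfolding Hi_def using H_bij by (intro the_inv_into_into) (auto simp: bij_betw_def)
lemma H_Hi: "u \<in> V \<Longrightarrow> H (Hi u) = u"
  unfolding Hi_def using H_bij by (intro f_the_inv_into_f) (auto simp: bij_betw_def)
lemma Hi_H: "u \<in> V \<Longrightarrow> Hi (H u) = u"
  unfolding Hi_def using H_bij by (intro the_inv_into_f_f) (auto simp: bij_betw_def)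
lemma Hi_lin:
  assumes "u \<in> V" "v \<in> V"
  shows "Hi (a *\<^sub>R u + b *\<^sub>R v) = a *\<^sub>R Hi u + b *\<^sub>R Hi v"
  using Hi_H[of "a *\<^sub>R Hi u + b *\<^sub>R Hi v"] assms by (simp add: H_lin Hi_in H_Hi)

text \<open>The exact preconditioner: if it replaced the MIP form in the correction equation, the
  correction would be \<open>G v\<close> and the error would vanish after one step.\<close>

definition ax :: "'v \<Rightarrow> 'v \<Rightarrow> real" where
  "ax u v = (1 / \<eta>) * I (Hi u - c *\<^sub>R u) v"

lemma ax_pd: "pd_form V ax"
proof -
  have b: "bilinear_form V ax"
    unfolding ax_def
    by unfold_locales
       (simp_all add: I.subspace_V Hi_lin Hi_in I.bilin algebra_simps)
  have sym: "ax u v = ax v u" if uv: "u \<in> V" "v \<in> V" for u v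
  proof -
    have "I (Hi u) v = I (Hi v) u"
      using H_sa[OF Hi_in[OF uv(1)] Hi_in[OF uv(2)]] I.sym[OF uv(1) Hi_in[OF uv(2)]] uv by (simp add: H_Hi)
    then show ?thesis using uv by (simp add: ax_def I.bilin Hi_in I.sym[of u v])
  qed
  have pos: "0 < ax v v" if v: "v \<in> V" "v \<noteq> 0" for v
  proof -
    have "I v v \<le> I (Hi v) v" using H_energy[OF Hi_in[OF v(1)]] I.sym[OF v(1) Hi_in[OF v(1)]] v by (simp add: H_Hi)
    moreover have "c * I v v < I v v" using c I.pos[OF v] by simp
    ultimately show ?thesis using v \<eta> by (simp add: ax_def I.bilin Hi_in)
  qed
  interpret b: bilinear_form V ax by (rule b)
  show ?thesis
  proof (intro pd_form.intro psd_form.intro b psd_form_axioms.intro pd_form_axioms.intro sym pos)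
    show "0 \<le> ax v v" if "v \<in> V" for v
      using pos[OF that] b.zero_left[of 0] by (cases "v = 0") (auto simp: less_imp_le)
  qed
qed

definition G :: "'v \<Rightarrow> 'v" where
  "G u = c *\<^sub>R H u"

lemma G_in: "u \<in> V \<Longrightarrow> G u \<in> V"
  by (simp add: G_def H_in)
lemma G_lin: "u \<in> V \<Longrightarrow> v \<in> V \<Longrightarrow> G (a *\<^sub>R u + b *\<^sub>R v) = a *\<^sub>R G u + b *\<^sub>R G v"
  by (simp add: G_def H_lin algebra_simps)
text \<open>The factor \<open>H\<close> in \<open>G\<close> cancels the inverse in
  \<open>ax\<close>. The result is the right-hand side of the correction equation,
  \<open>c / \<eta>\<close> being the scattering coefficient and \<open>u - G u\<close> the change
  made by the predictor.\<close>

lemma ax_G: "u \<in> V \<Longrightarrow> v \<in> V \<Longrightarrow> ax (G u) v = (c / \<eta>) * I (u - G u) v"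
  using Hi_lin[of "H u" "H u" c 0] by (simp add: ax_def G_def H_in Hi_H I.bilin algebra_simps)
lemma G_sa:
  assumes "u \<in> V" "v \<in> V"
  shows "ax (G u) v = ax u (G v)"
proof -
  have "ax u (G v) = ax (G v) u"
    by (rule psd_form.sym[OF pd_form.axioms(1)[OF ax_pd] assms(1) G_in[OF assms(2)]])
  also have "\<dots> = (c / \<eta>) * (I v u - c * I (H v) u)" using assms by (simp add: ax_G) (simp add: G_def I.bilin H_in)
  also have "\<dots> = (c / \<eta>) * (I u v - c * I (H u) v)"
    using H_sa[OF assms(2,1)] I.sym[OF assms] I.sym[OF assms(2) H_in[OF assms(1)]] by simp
  also have "\<dots> = ax (G u) v" using assms by (simp add: ax_G) (simp add: G_def I.bilin H_in)
  finally show ?thesis ..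
qed
lemma G_pos:
  assumes v: "v \<in> V" "v \<noteq> 0" shows "0 < ax (G v) v"
proof -
  have "c * I (H v) v \<le> c * I v v" using H_le[OF v(1)] c by simp
  also have "\<dots> < I v v" using c I.pos[OF v] by simp
  finally have "0 < I (v - G v) v" using v by (simp add: G_def I.bilin H_in)
  then show ?thesis unfolding ax_G[OF v(1) v(1)] using c \<eta> by simp
qed

lemma fixed_point_ex1:
  assumes y: "y \<in> V"
  shows "\<exists>!u. u \<in> V \<and> u = G u + y"
proof -
  have b: "bilinear_form V (\<lambda>u v. I (u - G u) v)"
    by (rule bilinear_form_compose[OF I.bilinear_form_axioms]) (simp_all add: G_in G_lin algebra_simps)
  have pos: "0 < I (v - G v) v" if "v \<in> V" "v \<noteq> 0" for v
    using G_pos[OF that] c \<eta> that by (simp add: ax_G zero_less_mult_iff zero_less_divide_iff)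
  have "\<exists>!u. u \<in> V \<and> (\<forall>v\<in>V. I (u - G u) v = I y v)"
    by (rule Lax_Milgram[OF fin b pos]) (auto simp: I.comb_right y)
  moreover have "(u \<in> V \<and> (\<forall>v\<in>V. I (u - G u) v = I y v)) = (u \<in> V \<and> u = G u + y)" for u
  proof -
    have "u = G u + y \<longleftrightarrow> u - G u = y" by (metis add_diff_cancel_left' diff_add_cancel add.commute)
    moreover have "u - G u = y" if "u \<in> V" "\<forall>v\<in>V. I (u - G u) v = I y v"
      by (rule I.eqI) (use that y G_in[OF that(1)] in auto)
    ultimately show ?thesis by auto
  qed
  ultimately show ?thesis by (simp only:)
qed

text \<open>The fluxes with source \<open>Hi u\<close> have mean \<open>u\<close>, so averaging
  their equations expresses the inverse of \<open>H\<close> through the streaming forms. The later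
  expansion starts here.\<close>

lemma I_Hi:
  assumes u: "u \<in> V" and v: "v \<in> V"
  shows "I (Hi u) v = I u v + \<eta> * (\<Sum>m\<in>D. w m * t m (\<psi> m (Hi u)) v)"
proof -
  have "I (Hi u) v = (\<Sum>m\<in>D. w m * I (Hi u) v)" by (simp add: w_sum flip: sum_distrib_right)
  also have "\<dots> = (\<Sum>m\<in>D. w m * I (\<psi> m (Hi u)) v + \<eta> * (w m * t m (\<psi> m (Hi u)) v))"
  proof (rule sum.cong[OF refl])
    fix m assume m: "m \<in> D"
    show "w m * I (Hi u) v = w m * I (\<psi> m (Hi u)) v + \<eta> * (w m * t m (\<psi> m (Hi u)) v)"
      unfolding \<psi>_eq[OF m Hi_in[OF u] v, symmetric] by (simp only: distrib_left mult.left_commute)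
  qed
  also have "\<dots> = I u v + \<eta> * (\<Sum>m\<in>D. w m * t m (\<psi> m (Hi u)) v)"
    using I_H[OF Hi_in[OF u] v] unfolding H_Hi[OF u] by (simp only: sum.distrib sum_distrib_left)
  finally show ?thesis .
qed

lemma ax_expansion:
  assumes u: "u \<in> V" and v: "v \<in> V"
  shows "ax u v = ((1 - c) / \<eta>) * I u v + (\<Sum>m\<in>D. w m * t m (\<psi> m (Hi u)) v)"
proof -
  define S where "S = (\<Sum>m\<in>D. w m * t m (\<psi> m (Hi u)) v)"
  have "ax u v = (1 / \<eta>) * (I (Hi u) v - c * I u v)"
    using u v by (simp add: ax_def I.bilin Hi_in)
  moreover have "I (Hi u) v = I u v + \<eta> * S" unfolding S_def by (rule I_Hi[OF u v])
  ultimately have "ax u v = ((1 - c) / \<eta>) * I u v + S"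
    using \<eta> by (simp add: field_simps)
  then show ?thesis by (simp only: S_def)
qed

end

section \<open>Expansion of the response in the diffusive regime\<close>

text \<open>
  With \<open>z = H\<^sup>-\<^sup>1 u - u\<close>, \<open>\<zeta>\<close> the deviation of the angular flux from \<open>u\<close>, and \<open>t m u v = I (T m u) v\<close>,
  the summands bound in turn the averages of \<open>\<eta> I (R u) (R v)\<close> and \<open>\<eta> I (S u) (S v)\<close>, then \<open>I z (S v)\<close>,
  and finally the remainder \<open>\<eta> I (T \<zeta>) (T\<^sup>* v)\<close>.
\<close>

definition consistency_const :: "real \<Rightarrow> real \<Rightarrow> real \<Rightarrow> real" where
  "consistency_const A B C1 = 2 * B\<^sup>2 + 2 * (B + C1 * A) * B + C1 * (2 * (B + C1 * A) + A) * A"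

text \<open>
  \<open>\<D>\<close>, \<open>R\<close> and \<open>S\<close> represent the broken directional derivative, the lifted jump and the
  upwind stabilisation, so that \<open>t m u v = I (\<D> m u - R m u + S m u) v\<close>; \<open>\<E>\<close> is an energy norm
  and \<open>k\<close> the cell Knudsen number.
\<close>

locale diffusive_response = transport_response V I D w \<eta> c t opp
  for V :: "'v::real_vector set" and I and D :: "'i set" and w \<eta> c t opp +
  fixes \<D> R S :: "'i \<Rightarrow> 'v \<Rightarrow> 'v" and \<E> :: "'v \<Rightarrow> real" and k A B C1 :: real
  assumes ops_in: "m \<in> D \<Longrightarrow> u \<in> V \<Longrightarrow> \<D> m u \<in> V" "m \<in> D \<Longrightarrow> u \<in> V \<Longrightarrow> R m u \<in> V" "m \<in> D \<Longrightarrow> u \<in> V \<Longrightarrow> S m u \<in> V"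
    and t_ops: "m \<in> D \<Longrightarrow> u \<in> V \<Longrightarrow> v \<in> V \<Longrightarrow> t m u v = I (\<D> m u - R m u + S m u) v"
    and opp_ops: "m \<in> D \<Longrightarrow> u \<in> V \<Longrightarrow> \<D> (opp m) u - R (opp m) u = - (\<D> m u - R m u)"
      "m \<in> D \<Longrightarrow> u \<in> V \<Longrightarrow> S (opp m) u = S m u"
    and \<E>_nonneg: "u \<in> V \<Longrightarrow> 0 \<le> \<E> u"
    and coeffs: "0 \<le> A" "0 \<le> B" "0 \<le> C1" "0 \<le> k" "k \<le> 1" "C1 * k \<le> 1/2"
    and T_small: "m \<in> D \<Longrightarrow> u \<in> V \<Longrightarrow> \<eta> * I.nrm (\<D> m u - R m u + S m u) \<le> C1 * k * I.nrm u"
    and T_energy: "m \<in> D \<Longrightarrow> u \<in> V \<Longrightarrow> sqrt \<eta> * I.nrm (\<D> m u - R m u + S m u) \<le> A * \<E> u"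
    and R_energy: "m \<in> D \<Longrightarrow> u \<in> V \<Longrightarrow> sqrt \<eta> * I.nrm (R m u) \<le> B * sqrt k * \<E> u"
    and S_energy: "m \<in> D \<Longrightarrow> u \<in> V \<Longrightarrow> sqrt \<eta> * I.nrm (S m u) \<le> B * sqrt k * \<E> u"
begin

definition N :: "'i \<Rightarrow> 'v \<Rightarrow> 'v" where "N m u = \<D> m u - R m u"
definition T :: "'i \<Rightarrow> 'v \<Rightarrow> 'v" where "T m u = \<D> m u - R m u + S m u"
definition Sbar :: "'v \<Rightarrow> 'v" where "Sbar u = (\<Sum>m\<in>D. w m *\<^sub>R S m u)"

lemma ops [simp]: "m \<in> D \<Longrightarrow> u \<in> V \<Longrightarrow> N m u \<in> V" "m \<in> D \<Longrightarrow> u \<in> V \<Longrightarrow> T m u \<in> V" "u \<in> V \<Longrightarrow> Sbar u \<in> V"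
  by (auto simp: N_def T_def Sbar_def ops_in)

lemma T_eq: "T m u = N m u + S m u"
  by (simp add: T_def N_def)

lemma t_T: "m \<in> D \<Longrightarrow> u \<in> V \<Longrightarrow> v \<in> V \<Longrightarrow> t m u v = I (T m u) v"
  by (simp add: T_def t_ops)

lemma T_adjoint:
  assumes "m \<in> D" "u \<in> V" "v \<in> V"
  shows "I (T m u) v = I u (T (opp m) v)"
  using opp(3)[OF assms(1,3,2)] assms I.sym[of u "T (opp m) v"] by (simp add: t_T opp_in)

lemma T_opp:
  assumes "m \<in> D" "v \<in> V" shows "T (opp m) v = S m v - N m v"
  using opp_ops[OF assms] by (simp add: T_eq N_def)

lemma sum_odd_0:
  assumes "\<And>m. m \<in> D \<Longrightarrow> f (opp m) = - f m"
  shows "(\<Sum>m\<in>D. w m * f m) = (0::real)"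
proof -
  have "(\<Sum>m\<in>D. w m * f m) = (\<Sum>m\<in>D. w (opp m) * f (opp m))" by (rule sum_opp[symmetric])
  also have "\<dots> = (\<Sum>m\<in>D. - (w m * f m))" by (rule sum.cong) (auto simp: opp(2) assms)
  finally show ?thesis by (simp add: sum_negf)
qed

lemma N_opp: "m \<in> D \<Longrightarrow> u \<in> V \<Longrightarrow> N (opp m) u = - N m u"
  by (simp add: N_def opp_ops)

text \<open>The leading part of \<open>ax\<close>, later identified with the MIP form. The product
  of two lifted jumps is left out of the last sum: interior penalty forms have no such term, and it
  is as small as the remainder.\<close>

definition a0 :: "'v \<Rightarrow> 'v \<Rightarrow> real" where
  "a0 u v = ((1 - c) / \<eta>) * I u v + I (Sbar u) v +
     \<eta> * (\<Sum>m\<in>D. w m * (I (\<D> m u) (\<D> m v) - I (R m u) (\<D> m v) - I (\<D> m u) (R m v)))"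

lemma response_expansion:
  assumes u: "u \<in> V" and v: "v \<in> V"
  shows "\<bar>ax u v - a0 u v\<bar> \<le> consistency_const A B C1 * k * \<E> u * \<E> v"
proof -
  define g where "g = Hi u"
  define z where "z = g - u"
  define \<zeta> where "\<zeta> = (\<lambda>m. \<psi> m g - u)"
  define e where "e = sqrt \<eta>"
  have e: "e > 0" "e * e = \<eta>" using \<eta> by (auto simp: e_def)
  have g: "g \<in> V" using u by (simp add: g_def Hi_in)
  have z: "z \<in> V" using g u by (simp add: z_def)
  have \<zeta>: "\<zeta> m \<in> V" if "m \<in> D" for m using that g u by (simp add: \<zeta>_def \<psi>_in)
  have \<psi>: "\<psi> m g = u + \<zeta> m" for m by (simp add: \<zeta>_def)
  have \<zeta>_eq: "I (\<zeta> m) y = I z y - \<eta> * I (T m u) y - \<eta> * I (T m (\<zeta> m)) y" if m: "m \<in> D" and y: "y \<in> V" for m y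
  proof -
    interpret tm: bilinear_form V "t m" by (rule t_bilin[OF m])
    have "I (u + \<zeta> m) y + \<eta> * t m (u + \<zeta> m) y = I g y" using \<psi>_eq[OF m g y] by (simp only: \<psi>)
    then show ?thesis using u y m g by (simp add: I.bilin tm.bilin \<zeta> t_T[symmetric] z_def algebra_simps)
  qed
  have w_nn: "0 \<le> w m" if "m \<in> D" for m using w_pos[OF that] by simp
  have sum_w: "\<bar>\<Sum>m\<in>D. w m * f m\<bar> \<le> K" if "\<And>m. m \<in> D \<Longrightarrow> \<bar>f m\<bar> \<le> K" for f K
  proof -
    have "\<bar>\<Sum>m\<in>D. w m * f m\<bar> \<le> (\<Sum>m\<in>D. w m * K)"
      by (rule order_trans[OF sum_abs sum_mono]) (use that w_nn in \<open>auto simp: abs_mult intro!: mult_left_mono\<close>)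
    then show ?thesis by (simp add: w_sum flip: sum_distrib_right)
  qed
  \<comment> \<open>\<open>k \<le> 1\<close> allows a full power to be weakened to a root where
    terms of both kinds are collected.\<close>
  have sq: "sqrt k * sqrt k = k" "k \<le> sqrt k" "0 \<le> sqrt k"
  proof -
    show "sqrt k * sqrt k = k" using coeffs by simp
    have "k * k \<le> k * 1" using coeffs by (intro mult_left_mono) auto
    then show "k \<le> sqrt k" by (intro real_le_rsqrt) (simp add: power2_eq_square)
  qed (use coeffs in simp)
  have Eu: "0 \<le> \<E> u" "0 \<le> \<E> v" using u v by (auto simp: \<E>_nonneg)
  note nn = coeffs(1-4) sq(3) Eu e(1)

  have Sbar_bd: "e * I.nrm (Sbar x) \<le> B * sqrt k * \<E> x" if x: "x \<in> V" for x
  proof -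
    have "I.nrm (Sbar x) \<le> B * sqrt k * \<E> x / e"
      unfolding Sbar_def
    proof (rule I.nrm_weighted_mean_le[OF w_nn w_sum])
      show "S m x \<in> V \<and> I.nrm (S m x) \<le> B * sqrt k * \<E> x / e" if "m \<in> D" for m
        using S_energy[OF that x] that x e by (simp add: ops_in e_def[symmetric] field_simps)
    qed
    then show ?thesis using e by (simp add: field_simps)
  qed
  have Tu: "\<eta> * I.nrm (T m u) \<le> e * (A * \<E> u)" if "m \<in> D" for m
  proof -
    have "\<eta> * I.nrm (T m u) = e * (e * I.nrm (T m u))" by (simp flip: e(2))
    also have "\<dots> \<le> e * (A * \<E> u)"
      by (rule mult_left_mono) (use T_energy[OF that u] e in \<open>auto simp: T_def e_def\<close>)
    finally show ?thesis .
  qed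
  \<comment> \<open>Testing the equation of \<open>\<zeta> m\<close> with \<open>\<zeta> m\<close>
    itself drops the streaming term by its sign, so no smallness is spent here.\<close>
  have \<zeta>_bd: "I.nrm (\<zeta> m) \<le> I.nrm z + e * (A * \<E> u)" if m: "m \<in> D" for m
  proof -
    have x: "z - \<eta> *\<^sub>R T m u \<in> V" using z m u by simp
    have "I (\<zeta> m) (\<zeta> m) \<le> I (\<zeta> m) (\<zeta> m) + \<eta> * I (T m (\<zeta> m)) (\<zeta> m)"
      using t_nonneg[OF m \<zeta>[OF m]] \<eta> by (simp add: t_T m \<zeta>)
    also have "\<dots> = I (z - \<eta> *\<^sub>R T m u) (\<zeta> m)"
      using \<zeta>_eq[OF m \<zeta>[OF m]] z m u \<zeta>[OF m] by (simp add: I.bilin)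
    also have "\<dots> \<le> I.nrm (z - \<eta> *\<^sub>R T m u) * I.nrm (\<zeta> m)"
      using I.abs_le_nrm[OF x \<zeta>[OF m]] by simp
    finally have "I.nrm (\<zeta> m) * I.nrm (\<zeta> m) \<le> I.nrm (z - \<eta> *\<^sub>R T m u) * I.nrm (\<zeta> m)"
      using I.nrm_sq[OF \<zeta>[OF m]] by (simp add: power2_eq_square)
    then have "I.nrm (\<zeta> m) \<le> I.nrm (z - \<eta> *\<^sub>R T m u)"
      using I.nrm_nonneg[OF \<zeta>[OF m]] I.nrm_nonneg[OF x] by (cases "I.nrm (\<zeta> m) = 0") auto
    also have "\<dots> \<le> I.nrm z + I.nrm (\<eta> *\<^sub>R T m u)" using z m u by (intro I.nrm_triangle_diff) auto
    also have "I.nrm (\<eta> *\<^sub>R T m u) = \<eta> * I.nrm (T m u)" using m u \<eta> by (simp add: I.nrm_scale)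
    finally show ?thesis using Tu[OF m] by simp
  qed
  have T\<zeta>: "\<eta> * I.nrm (T m (\<zeta> m)) \<le> C1 * k * (I.nrm z + e * (A * \<E> u))" if m: "m \<in> D" for m
  proof -
    have "\<eta> * I.nrm (T m (\<zeta> m)) \<le> C1 * k * I.nrm (\<zeta> m)" using T_small[OF m \<zeta>[OF m]] by (simp add: T_def)
    also have "\<dots> \<le> C1 * k * (I.nrm z + e * (A * \<E> u))" using \<zeta>_bd[OF m] coeffs by (intro mult_left_mono) auto
    finally show ?thesis .
  qed
  have N0: "(\<Sum>m\<in>D. w m * I (N m u) y) = 0" "(\<Sum>m\<in>D. w m * I y (N m v)) = 0" if "y \<in> V" for y
    by (rule sum_odd_0; use that u v in \<open>simp add: N_opp I.bilin\<close>)+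
  have ISbar: "(\<Sum>m\<in>D. w m * I (S m x) y) = I (Sbar x) y" "(\<Sum>m\<in>D. w m * I y (S m x)) = I y (Sbar x)" if "x \<in> V" "y \<in> V" for x y
    using that unfolding Sbar_def by (simp_all add: I.sum_left I.sum_right ops_in I.bilin)
  have T_mean: "(\<Sum>m\<in>D. w m * I (T m u) y) = I (Sbar u) y" if y: "y \<in> V" for y
  proof -
    have "(\<Sum>m\<in>D. w m * I (T m u) y) = (\<Sum>m\<in>D. w m * I (N m u) y) + (\<Sum>m\<in>D. w m * I (S m u) y)"
      unfolding sum.distrib[symmetric]
      by (rule sum.cong) (use u y in \<open>auto simp: T_eq I.bilin ops_in distrib_left\<close>)
    then show ?thesis using N0(1)[OF y] ISbar(1)[OF u y] by simp
  qed
  have t\<zeta>: "w m * t m (\<psi> m g) y = w m * I (T m u) y + w m * I (T m (\<zeta> m)) y" if m: "m \<in> D" and y: "y \<in> V" for m y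
  proof -
    interpret tm: bilinear_form V "t m" by (rule t_bilin[OF m])
    show ?thesis unfolding \<psi> using u m y by (simp add: tm.add_left \<zeta> t_T[symmetric] distrib_left)
  qed

  have z_eq: "I z y = \<eta> * (I (Sbar u) y + (\<Sum>m\<in>D. w m * I (T m (\<zeta> m)) y))" if y: "y \<in> V" for y
  proof -
    have "I z y = \<eta> * (\<Sum>m\<in>D. w m * t m (\<psi> m g) y)"
      using I_Hi[OF u y] u y g by (simp add: z_def I.bilin g_def)
    also have "(\<Sum>m\<in>D. w m * t m (\<psi> m g) y) = (\<Sum>m\<in>D. w m * I (T m u) y) + (\<Sum>m\<in>D. w m * I (T m (\<zeta> m)) y)"
      unfolding sum.distrib[symmetric] by (rule sum.cong) (auto simp: t\<zeta> y)
    finally show ?thesis using T_mean[OF y] by simp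
  qed
  have "I.nrm z \<le> e * (B * sqrt k * \<E> u) + C1 * k * (I.nrm z + e * (A * \<E> u))"
  proof (rule I.nrm_le_of_dual[OF z])
    show "0 \<le> e * (B * sqrt k * \<E> u) + C1 * k * (I.nrm z + e * (A * \<E> u))"
      using nn z by (intro add_nonneg_nonneg mult_nonneg_nonneg) auto
    fix y assume y: "y \<in> V"
    have "\<eta> * \<bar>I (Sbar u) y\<bar> \<le> \<eta> * (I.nrm (Sbar u) * I.nrm y)"
      using I.abs_le_nrm[of "Sbar u" y] u y \<eta> by (intro mult_left_mono) auto
    also have "\<dots> = e * (e * I.nrm (Sbar u)) * I.nrm y" using e by (simp flip: e(2))
    also have "\<dots> \<le> e * (B * sqrt k * \<E> u) * I.nrm y"
      using Sbar_bd[OF u] e y by (intro mult_right_mono mult_left_mono) auto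
    finally have 1: "\<eta> * \<bar>I (Sbar u) y\<bar> \<le> e * (B * sqrt k * \<E> u) * I.nrm y" .
    have 2: "\<bar>\<Sum>m\<in>D. w m * (\<eta> * I (T m (\<zeta> m)) y)\<bar> \<le> C1 * k * (I.nrm z + e * (A * \<E> u)) * I.nrm y"
    proof (rule sum_w)
      fix m assume m: "m \<in> D"
      have "\<bar>\<eta> * I (T m (\<zeta> m)) y\<bar> \<le> \<eta> * I.nrm (T m (\<zeta> m)) * I.nrm y"
        using I.abs_le_nrm[of "T m (\<zeta> m)" y] m y \<zeta>[OF m] \<eta> by (simp add: abs_mult mult.assoc)
      also have "\<dots> \<le> C1 * k * (I.nrm z + e * (A * \<E> u)) * I.nrm y"
        using T\<zeta>[OF m] y by (intro mult_right_mono) auto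
      finally show "\<bar>\<eta> * I (T m (\<zeta> m)) y\<bar> \<le> C1 * k * (I.nrm z + e * (A * \<E> u)) * I.nrm y" .
    qed
    have "\<bar>I z y\<bar> \<le> \<eta> * \<bar>I (Sbar u) y\<bar> + \<bar>\<Sum>m\<in>D. w m * (\<eta> * I (T m (\<zeta> m)) y)\<bar>"
    proof -
      have "I z y = \<eta> * I (Sbar u) y + (\<Sum>m\<in>D. w m * (\<eta> * I (T m (\<zeta> m)) y))"
        by (simp add: z_eq[OF y] distrib_left sum_distrib_left mult_ac)
      then show ?thesis using \<eta> by (simp add: abs_triangle_ineq[THEN order_trans] abs_mult)
    qed
    then show "\<bar>I z y\<bar> \<le> (e * (B * sqrt k * \<E> u) + C1 * k * (I.nrm z + e * (A * \<E> u))) * I.nrm y"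
      using 1 2 by (simp add: distrib_right)
  qed
  \<comment> \<open>\<open>C1 * k \<le> 1/2\<close> absorbs the norm of \<open>z\<close> into the
    left side; this is the origin of the factor 2 in \<open>z_bd\<close>.\<close>
  moreover have "C1 * k * I.nrm z \<le> 1/2 * I.nrm z" using coeffs z by (intro mult_right_mono) auto
  moreover have "C1 * k * (e * (A * \<E> u)) \<le> C1 * sqrt k * (e * (A * \<E> u))"
    using nn sq by (intro mult_right_mono mult_left_mono mult_nonneg_nonneg) auto
  ultimately have z_bd: "I.nrm z \<le> 2 * e * (B + C1 * A) * sqrt k * \<E> u"
    by (simp add: algebra_simps)
  \<comment> \<open>The root can be given up in this version of the bound: in the last remainder the
    whole factor \<open>k\<close> comes from \<open>T_small\<close>.\<close>
  have "2 * e * (B + C1 * A) * sqrt k * \<E> u \<le> 2 * e * (B + C1 * A) * 1 * \<E> u"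
    using nn coeffs by (intro mult_right_mono mult_left_mono mult_nonneg_nonneg add_nonneg_nonneg) auto
  then have z_bd': "I.nrm z + e * (A * \<E> u) \<le> e * (2 * (B + C1 * A) + A) * \<E> u"
    using z_bd by (simp add: algebra_simps)

  have "ax u v = ((1 - c) / \<eta>) * I u v + (\<Sum>m\<in>D. w m * t m (\<psi> m g) v)"
    unfolding g_def by (rule ax_expansion[OF u v])
  also have "(\<Sum>m\<in>D. w m * t m (\<psi> m g) v) = I (Sbar u) v + (\<Sum>m\<in>D. w m * I (T m (\<zeta> m)) v)"
    unfolding T_mean[OF v, symmetric] sum.distrib[symmetric] by (rule sum.cong) (auto simp: t\<zeta> v)
  \<comment> \<open>Move the operator to the test function and use the equation of
    \<open>\<zeta> m\<close> once more. This isolates the second order term and leaves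
    \<open>\<zeta>\<close> only between two factors of transport.\<close>
  also have "(\<Sum>m\<in>D. w m * I (T m (\<zeta> m)) v) =
      (\<Sum>m\<in>D. w m * I z (T (opp m) v) - \<eta> * (w m * I (T m u) (T (opp m) v)) - \<eta> * (w m * I (T m (\<zeta> m)) (T (opp m) v)))"
  proof (rule sum.cong[OF refl])
    fix m assume m: "m \<in> D"
    have "I (T m (\<zeta> m)) v = I z (T (opp m) v) - \<eta> * I (T m u) (T (opp m) v) - \<eta> * I (T m (\<zeta> m)) (T (opp m) v)"
      using T_adjoint[OF m \<zeta>[OF m] v] \<zeta>_eq[OF m, of "T (opp m) v"] m v by (simp add: opp_in)
    then show "w m * I (T m (\<zeta> m)) v =
        w m * I z (T (opp m) v) - \<eta> * (w m * I (T m u) (T (opp m) v)) - \<eta> * (w m * I (T m (\<zeta> m)) (T (opp m) v))"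
      by (simp add: right_diff_distrib mult.left_commute)
  qed
  also have "\<dots> = (\<Sum>m\<in>D. w m * I z (T (opp m) v)) - \<eta> * (\<Sum>m\<in>D. w m * I (T m u) (T (opp m) v)) -
      \<eta> * (\<Sum>m\<in>D. w m * I (T m (\<zeta> m)) (T (opp m) v))"
    by (simp only: sum_subtractf sum_distrib_left)
  \<comment> \<open>\<open>z\<close> does not depend on the direction, so the odd part of the
    operator averages out and only the mean dissipation tests \<open>z\<close>.\<close>
  also have "(\<Sum>m\<in>D. w m * I z (T (opp m) v)) = I z (Sbar v)"
  proof -
    have "(\<Sum>m\<in>D. w m * I z (T (opp m) v)) = (\<Sum>m\<in>D. w m * I z (S m v)) - (\<Sum>m\<in>D. w m * I z (N m v))"
      unfolding sum_subtractf[symmetric]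
      by (rule sum.cong) (use v z in \<open>auto simp: T_opp I.bilin ops_in right_diff_distrib\<close>)
    then show ?thesis using ISbar(2)[OF v z] N0(2)[OF z] by simp
  qed
  \<comment> \<open>The factors are \<open>N + S\<close> and \<open>S - N\<close>, and the mixed
    products are odd in the direction.\<close>
  also have "(\<Sum>m\<in>D. w m * I (T m u) (T (opp m) v)) =
      (\<Sum>m\<in>D. w m * I (S m u) (S m v)) - (\<Sum>m\<in>D. w m * I (N m u) (N m v))"
  proof -
    have "(\<Sum>m\<in>D. w m * I (T m u) (T (opp m) v)) =
       (\<Sum>m\<in>D. w m * I (S m u) (S m v)) - (\<Sum>m\<in>D. w m * I (N m u) (N m v))
       + (\<Sum>m\<in>D. w m * (I (N m u) (S m v) - I (S m u) (N m v)))"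
      unfolding sum_subtractf[symmetric] sum.distrib[symmetric]
    proof (rule sum.cong[OF refl])
      fix m assume m: "m \<in> D"
      show "w m * I (T m u) (T (opp m) v) = w m * I (S m u) (S m v) - w m * I (N m u) (N m v)
          + w m * (I (N m u) (S m v) - I (S m u) (N m v))"
        unfolding T_opp[OF m v] T_eq[of m u] using u v m by (simp add: I.bilin ops_in algebra_simps)
    qed
    moreover have "(\<Sum>m\<in>D. w m * (I (N m u) (S m v) - I (S m u) (N m v))) = 0"
      by (rule sum_odd_0) (use u v in \<open>simp add: N_opp opp_ops I.bilin ops_in\<close>)
    ultimately show ?thesis by simp
  qed
  also have "(\<Sum>m\<in>D. w m * I (N m u) (N m v)) =
      (\<Sum>m\<in>D. w m * (I (\<D> m u) (\<D> m v) - I (R m u) (\<D> m v) - I (\<D> m u) (R m v))) + (\<Sum>m\<in>D. w m * I (R m u) (R m v))"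
    unfolding sum.distrib[symmetric]
    by (rule sum.cong) (use u v in \<open>auto simp: N_def I.bilin ops_in algebra_simps\<close>)
  finally have "ax u v - a0 u v = I z (Sbar v) + \<eta> * (\<Sum>m\<in>D. w m * I (R m u) (R m v)) - \<eta> * (\<Sum>m\<in>D. w m * I (S m u) (S m v))
      - \<eta> * (\<Sum>m\<in>D. w m * I (T m (\<zeta> m)) (T (opp m) v))"
    by (simp add: a0_def algebra_simps)
  moreover have "\<bar>I z (Sbar v)\<bar> \<le> 2 * (B + C1 * A) * B * k * \<E> u * \<E> v"
  proof -
    have "\<bar>I z (Sbar v)\<bar> \<le> I.nrm z * I.nrm (Sbar v)" using z v by (intro I.abs_le_nrm) auto
    also have "\<dots> \<le> (2 * e * (B + C1 * A) * sqrt k * \<E> u) * I.nrm (Sbar v)"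
      using z_bd v by (intro mult_right_mono) auto
    also have "\<dots> = (2 * (B + C1 * A) * sqrt k * \<E> u) * (e * I.nrm (Sbar v))" by simp
    also have "\<dots> \<le> (2 * (B + C1 * A) * sqrt k * \<E> u) * (B * sqrt k * \<E> v)"
      using Sbar_bd[OF v] nn by (intro mult_left_mono mult_nonneg_nonneg add_nonneg_nonneg) auto
    also have "\<dots> = 2 * (B + C1 * A) * B * (sqrt k * sqrt k) * \<E> u * \<E> v" by (simp only: mult_ac)
    finally show ?thesis by (simp only: sq)
  qed
  moreover have RS: "\<bar>\<eta> * (\<Sum>m\<in>D. w m * I (X m u) (X m v))\<bar> \<le> B\<^sup>2 * k * \<E> u * \<E> v"
    if X: "\<And>m x. m \<in> D \<Longrightarrow> x \<in> V \<Longrightarrow> X m x \<in> V \<and> e * I.nrm (X m x) \<le> B * sqrt k * \<E> x" for X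
  proof -
    have "\<bar>\<Sum>m\<in>D. w m * (\<eta> * I (X m u) (X m v))\<bar> \<le> B\<^sup>2 * k * \<E> u * \<E> v"
    proof (rule sum_w)
      fix m assume m: "m \<in> D"
      have "\<bar>\<eta> * I (X m u) (X m v)\<bar> \<le> \<eta> * (I.nrm (X m u) * I.nrm (X m v))"
        using I.abs_le_nrm[of "X m u" "X m v"] X m u v \<eta> by (simp add: abs_mult)
      also have "\<dots> = (e * I.nrm (X m u)) * (e * I.nrm (X m v))" by (simp flip: e(2))
      also have "\<dots> \<le> (B * sqrt k * \<E> u) * (B * sqrt k * \<E> v)"
      proof (rule mult_mono)
        show "0 \<le> B * sqrt k * \<E> u" using nn by (intro mult_nonneg_nonneg) auto
      qed (use X[OF m u] X[OF m v] nn in auto)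
      also have "\<dots> = B\<^sup>2 * (sqrt k * sqrt k) * \<E> u * \<E> v" by (simp only: power2_eq_square mult_ac)
      finally show "\<bar>\<eta> * I (X m u) (X m v)\<bar> \<le> B\<^sup>2 * k * \<E> u * \<E> v" by (simp only: sq)
    qed
    then show ?thesis by (simp add: sum_distrib_left mult.left_commute)
  qed
  moreover have "\<bar>\<eta> * (\<Sum>m\<in>D. w m * I (R m u) (R m v))\<bar> \<le> B\<^sup>2 * k * \<E> u * \<E> v"
    by (rule RS) (use R_energy in \<open>simp add: ops_in e_def\<close>)
  moreover have "\<bar>\<eta> * (\<Sum>m\<in>D. w m * I (S m u) (S m v))\<bar> \<le> B\<^sup>2 * k * \<E> u * \<E> v"
    by (rule RS) (use S_energy in \<open>simp add: ops_in e_def\<close>)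
  moreover have "\<bar>\<eta> * (\<Sum>m\<in>D. w m * I (T m (\<zeta> m)) (T (opp m) v))\<bar> \<le> C1 * (2 * (B + C1 * A) + A) * A * k * \<E> u * \<E> v"
  proof -
    have "\<bar>\<Sum>m\<in>D. w m * (\<eta> * I (T m (\<zeta> m)) (T (opp m) v))\<bar> \<le> C1 * (2 * (B + C1 * A) + A) * A * k * \<E> u * \<E> v"
    proof (rule sum_w)
      fix m assume m: "m \<in> D"
      have "\<bar>\<eta> * I (T m (\<zeta> m)) (T (opp m) v)\<bar> \<le> (\<eta> * I.nrm (T m (\<zeta> m))) * I.nrm (T (opp m) v)"
        using I.abs_le_nrm[of "T m (\<zeta> m)" "T (opp m) v"] m v \<zeta>[OF m] \<eta> by (simp add: abs_mult mult.assoc opp_in)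
      also have "\<dots> \<le> (C1 * k * (e * (2 * (B + C1 * A) + A) * \<E> u)) * I.nrm (T (opp m) v)"
      proof (rule mult_right_mono)
        show "\<eta> * I.nrm (T m (\<zeta> m)) \<le> C1 * k * (e * (2 * (B + C1 * A) + A) * \<E> u)"
          using T\<zeta>[OF m] mult_left_mono[OF z_bd', of "C1 * k"] coeffs by simp
      qed (use m v opp_in in simp)
      also have "\<dots> = (C1 * k * (2 * (B + C1 * A) + A) * \<E> u) * (e * I.nrm (T (opp m) v))" by (simp only: mult_ac)
      also have "\<dots> \<le> (C1 * k * (2 * (B + C1 * A) + A) * \<E> u) * (A * \<E> v)"
        using T_energy[OF opp_in[OF m] v] nn
        by (intro mult_left_mono mult_nonneg_nonneg add_nonneg_nonneg) (auto simp: T_def e_def)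
      also have "\<dots> = C1 * (2 * (B + C1 * A) + A) * A * k * \<E> u * \<E> v" by (simp only: mult_ac)
      finally show "\<bar>\<eta> * I (T m (\<zeta> m)) (T (opp m) v)\<bar> \<le> C1 * (2 * (B + C1 * A) + A) * A * k * \<E> u * \<E> v" .
    qed
    then show ?thesis by (simp add: sum_distrib_left mult.left_commute)
  qed
  moreover have "consistency_const A B C1 * k * \<E> u * \<E> v = 2 * (B + C1 * A) * B * k * \<E> u * \<E> v + B\<^sup>2 * k * \<E> u * \<E> v + B\<^sup>2 * k * \<E> u * \<E> v
      + C1 * (2 * (B + C1 * A) + A) * A * k * \<E> u * \<E> v"
    by (simp add: consistency_const_def algebra_simps)
  ultimately show ?thesis by linarith
qed

end

section \<open>Divergence theorem on polytopal cells\<close>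

lemma nn_integral_lborel_translate:
  fixes f :: "'a::euclidean_space \<Rightarrow> ennreal"
  assumes [measurable]: "f \<in> borel_measurable borel"
  shows "(\<integral>\<^sup>+y. f (c + y) \<partial>lborel) = (\<integral>\<^sup>+y. f y \<partial>lborel)"
proof -
  have "(\<integral>\<^sup>+y. f y \<partial>lborel) = (\<integral>\<^sup>+y. f y \<partial>(distr lborel borel ((+) c)))"
    by (simp add: lborel_distr_plus)
  also have "\<dots> = (\<integral>\<^sup>+y. f (c + y) \<partial>lborel)"
    by (subst nn_integral_distr) auto
  finally show ?thesis by simp
qed

lemma closest_point_hyperplane:
  fixes n :: "'a::euclidean_space"
  assumes n: "norm n = 1"
  shows "closest_point {x. n \<bullet> x = \<alpha>} y = y - (n \<bullet> y - \<alpha>) *\<^sub>R n"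
proof (rule closest_point_unique[symmetric])
  show "convex {x. n \<bullet> x = \<alpha>}" by (rule convex_hyperplane)
  show "closed {x. n \<bullet> x = \<alpha>}" by (rule closed_hyperplane)
  have nn: "n \<bullet> n = 1" using n by (simp add: norm_eq_1)
  show "y - (n \<bullet> y - \<alpha>) *\<^sub>R n \<in> {x. n \<bullet> x = \<alpha>}"
    by (simp add: inner_diff_right nn)
  show "\<forall>z\<in>{x. n \<bullet> x = \<alpha>}. dist y (y - (n \<bullet> y - \<alpha>) *\<^sub>R n) \<le> dist y z"
  proof
    fix z assume z: "z \<in> {x. n \<bullet> x = \<alpha>}"
    have "dist y (y - (n \<bullet> y - \<alpha>) *\<^sub>R n) = \<bar>n \<bullet> (y - z)\<bar>"
      using z n by (simp add: dist_norm inner_diff_right)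
    also have "\<dots> \<le> norm n * norm (y - z)" by (rule Cauchy_Schwarz_ineq2)
    finally show "dist y (y - (n \<bullet> y - \<alpha>) *\<^sub>R n) \<le> dist y z" by (simp add: n dist_norm)
  qed
qed

text \<open>
  Fubini for the splitting of \<open>y\<close> into its signed distance \<open>n \<bullet> y - \<alpha>\<close> from a hyperplane and
  its projection. Only translation invariance is used: the weight \<open>indicator {-1/2..1/2}\<close> has
  integral 1 along every normal line, so it can be inserted and then moved by a translation.
\<close>

lemma nn_integral_hyperplane_disintegration:
  fixes n :: "'a::euclidean_space" and \<Phi> :: "real \<times> 'a \<Rightarrow> ennreal"
  assumes n: "norm n = 1" and [measurable]: "\<Phi> \<in> borel_measurable borel"
  shows "(\<integral>\<^sup>+y. \<Phi> (n \<bullet> y - \<alpha>, y - (n \<bullet> y - \<alpha>) *\<^sub>R n) \<partial>lborel) =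
    (\<integral>\<^sup>+t. (\<integral>\<^sup>+y. indicator {-1/2..1/2} (n \<bullet> y - \<alpha>) * \<Phi> (t, y - (n \<bullet> y - \<alpha>) *\<^sub>R n) \<partial>lborel) \<partial>lborel)"
proof -
  interpret lborel_pair: pair_sigma_finite "lborel :: real measure" "lborel :: 'a measure" ..
  have nn: "n \<bullet> n = 1" using n by (simp add: norm_eq_1)
  define s where "s = (\<lambda>y::'a. n \<bullet> y - \<alpha>)"
  define q where "q = (\<lambda>y::'a. y - (n \<bullet> y - \<alpha>) *\<^sub>R n)"
  define I where "I = (indicator {-1/2..1/2} :: real \<Rightarrow> ennreal)"
  have m[measurable]: "s \<in> borel_measurable borel" "q \<in> borel_measurable borel" "I \<in> borel_measurable borel"
    unfolding s_def q_def I_def by measurable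
  have \<Phi>'[measurable]: "\<Phi> \<in> borel_measurable (borel \<Otimes>\<^sub>M borel)"
    by (simp add: borel_prod)
  have one: "(\<integral>\<^sup>+t. I (c + t) \<partial>lborel) = 1" for c
    by (subst nn_integral_lborel_translate) (auto simp: I_def)
  have "(\<integral>\<^sup>+y. \<Phi> (s y, q y) \<partial>lborel) = (\<integral>\<^sup>+y. (\<integral>\<^sup>+t. I (s y + t) * \<Phi> (s y, q y) \<partial>lborel) \<partial>lborel)"
    by (subst nn_integral_multc) (auto simp: one)
  also have "\<dots> = (\<integral>\<^sup>+t. (\<integral>\<^sup>+y. I (s y + t) * \<Phi> (s y, q y) \<partial>lborel) \<partial>lborel)"
    by (rule lborel_pair.Fubini') measurable
  also have "\<dots> = (\<integral>\<^sup>+t. (\<integral>\<^sup>+y. I (s y) * \<Phi> (s y - t, q y) \<partial>lborel) \<partial>lborel)"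
  proof (rule nn_integral_cong)
    fix t :: real
    have sq: "s (- t *\<^sub>R n + y) = s y - t" "q (- t *\<^sub>R n + y) = q y" for y
      by (simp_all add: s_def q_def inner_diff_right nn algebra_simps)
    show "(\<integral>\<^sup>+y. I (s y + t) * \<Phi> (s y, q y) \<partial>lborel) = (\<integral>\<^sup>+y. I (s y) * \<Phi> (s y - t, q y) \<partial>lborel)"
      by (subst nn_integral_lborel_translate[symmetric, where c = "- t *\<^sub>R n"]) (measurable, simp only: sq, simp)
  qed
  also have "\<dots> = (\<integral>\<^sup>+y. (\<integral>\<^sup>+t. I (s y) * \<Phi> (s y - t, q y) \<partial>lborel) \<partial>lborel)"
    by (rule lborel_pair.Fubini'[symmetric]) measurable
  also have "\<dots> = (\<integral>\<^sup>+y. (\<integral>\<^sup>+t. I (s y) * \<Phi> (t, q y) \<partial>lborel) \<partial>lborel)"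
  proof (rule nn_integral_cong)
    fix y :: 'a
    have "(\<integral>\<^sup>+t. I (s y) * \<Phi> (s y - t, q y) \<partial>lborel) = (\<integral>\<^sup>+t. I (s y) * \<Phi> (s y - t, q y) \<partial>(distr lborel borel uminus))"
      by (simp add: lborel_distr_uminus)
    also have "\<dots> = (\<integral>\<^sup>+t. I (s y) * \<Phi> (s y + t, q y) \<partial>lborel)"
      by (subst nn_integral_distr) auto
    also have "\<dots> = (\<integral>\<^sup>+t. I (s y) * \<Phi> (t, q y) \<partial>lborel)"
      by (rule nn_integral_lborel_translate[where f = "\<lambda>t. I (s y) * \<Phi> (t, q y)"]) measurable
    finally show "(\<integral>\<^sup>+t. I (s y) * \<Phi> (s y - t, q y) \<partial>lborel) = (\<integral>\<^sup>+t. I (s y) * \<Phi> (t, q y) \<partial>lborel)" .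
  qed
  also have "\<dots> = (\<integral>\<^sup>+t. (\<integral>\<^sup>+y. I (s y) * \<Phi> (t, q y) \<partial>lborel) \<partial>lborel)"
    by (rule lborel_pair.Fubini') measurable
  finally show ?thesis unfolding s_def q_def I_def .
qed

text \<open>At fixed height \<open>t\<close> over the plane the oblique and the orthogonal
  projection differ by the tangential shift \<open>\<tau>\<close>, which Lebesgue measure does not
  see. The admissible heights fill an interval of length
  \<open>\<bar>n \<bullet> \<omega>\<bar>\<close>: this is where the cosine of the flux
  arises.\<close>

lemma nn_integral_oblique_slab:
  fixes n \<omega> :: "'a::euclidean_space" and f :: "'a \<Rightarrow> ennreal"
  assumes n: "norm n = 1" and a: "n \<bullet> \<omega> \<noteq> 0" and [measurable]: "f \<in> borel_measurable borel"
  shows "(\<integral>\<^sup>+y. indicator {-1/2..1/2} ((n \<bullet> y - \<alpha>) / (n \<bullet> \<omega>)) * f (y - ((n \<bullet> y - \<alpha>) / (n \<bullet> \<omega>)) *\<^sub>R \<omega>) \<partial>lborel) =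
    ennreal \<bar>n \<bullet> \<omega>\<bar> * (\<integral>\<^sup>+y. indicator {-1/2..1/2} (n \<bullet> y - \<alpha>) * f (y - (n \<bullet> y - \<alpha>) *\<^sub>R n) \<partial>lborel)"
    (is "?L = _ * ?R")
proof -
  have nn: "n \<bullet> n = 1" using n by (simp add: norm_eq_1)
  define a where "a = n \<bullet> \<omega>"
  have a0: "a \<noteq> 0" using a by (simp add: a_def)
  define \<Phi> where "\<Phi> = (\<lambda>(t, x). (indicator {-1/2..1/2} (t / a) :: ennreal) * f (x + t *\<^sub>R n - (t / a) *\<^sub>R \<omega>))"
  have m[measurable]: "\<Phi> \<in> borel_measurable borel"
    unfolding \<Phi>_def borel_prod[symmetric] by measurable
  have "?L = (\<integral>\<^sup>+y. \<Phi> (n \<bullet> y - \<alpha>, y - (n \<bullet> y - \<alpha>) *\<^sub>R n) \<partial>lborel)"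
    by (simp add: \<Phi>_def a_def)
  also have "\<dots> = (\<integral>\<^sup>+t. (\<integral>\<^sup>+y. indicator {-1/2..1/2} (n \<bullet> y - \<alpha>) * \<Phi> (t, y - (n \<bullet> y - \<alpha>) *\<^sub>R n) \<partial>lborel) \<partial>lborel)"
    by (rule nn_integral_hyperplane_disintegration[OF n m])
  also have "\<dots> = (\<integral>\<^sup>+t. indicator {-1/2..1/2} (t / a) * ?R \<partial>lborel)"
  proof (rule nn_integral_cong)
    fix t :: real
    define \<tau> where "\<tau> = t *\<^sub>R n - (t / a) *\<^sub>R \<omega>"
    have \<tau>0: "n \<bullet> \<tau> = 0" using a0 by (simp add: \<tau>_def inner_diff_right nn a_def)
    define F where "F = (\<lambda>y. (indicator {-1/2..1/2} (n \<bullet> y - \<alpha>) :: ennreal) * f (y - (n \<bullet> y - \<alpha>) *\<^sub>R n))"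
    have mF: "F \<in> borel_measurable borel" unfolding F_def by measurable
    have Ft: "F (\<tau> + y) = indicator {-1/2..1/2} (n \<bullet> y - \<alpha>) * f (y - (n \<bullet> y - \<alpha>) *\<^sub>R n + \<tau>)" for y
      by (simp add: F_def inner_add_right \<tau>0 algebra_simps)
    have "(\<integral>\<^sup>+y. indicator {-1/2..1/2} (n \<bullet> y - \<alpha>) * \<Phi> (t, y - (n \<bullet> y - \<alpha>) *\<^sub>R n) \<partial>lborel)
      = (\<integral>\<^sup>+y. indicator {-1/2..1/2} (t / a) * F (\<tau> + y) \<partial>lborel)"
      by (rule nn_integral_cong) (simp only: \<Phi>_def Ft, simp add: \<tau>_def add_diff_eq mult.left_commute)
    also have "\<dots> = indicator {-1/2..1/2} (t / a) * (\<integral>\<^sup>+y. F (\<tau> + y) \<partial>lborel)"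
      by (rule nn_integral_cmult) (simp add: Ft)
    also have "(\<integral>\<^sup>+y. F (\<tau> + y) \<partial>lborel) = (\<integral>\<^sup>+y. F y \<partial>lborel)"
      by (rule nn_integral_lborel_translate[OF mF])
    finally show "(\<integral>\<^sup>+y. indicator {-1/2..1/2} (n \<bullet> y - \<alpha>) * \<Phi> (t, y - (n \<bullet> y - \<alpha>) *\<^sub>R n) \<partial>lborel)
      = indicator {-1/2..1/2} (t / a) * ?R" by (simp add: F_def)
  qed
  also have "\<dots> = (\<integral>\<^sup>+t. indicator {-1/2..1/2} (t / a) \<partial>lborel) * ?R"
    by (rule nn_integral_multc) measurable
  also have "(\<integral>\<^sup>+t. indicator {-1/2..1/2} (t / a) \<partial>lborel) = (\<integral>\<^sup>+t. indicator {-\<bar>a\<bar>/2..\<bar>a\<bar>/2} t \<partial>lborel)"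
  proof (rule nn_integral_cong)
    fix t :: real
    have "(- 1 / 2 \<le> t / a \<and> t / a \<le> 1 / 2) \<longleftrightarrow> (- \<bar>a\<bar> / 2 \<le> t \<and> t \<le> \<bar>a\<bar> / 2)"
      using a0 by (cases "a > 0") (auto simp: field_simps)
    then show "(indicator {-1/2..1/2} (t / a) :: ennreal) = indicator {-\<bar>a\<bar>/2..\<bar>a\<bar>/2} t"
      by (simp add: indicator_def)
  qed
  also have "\<dots> = ennreal \<bar>a\<bar>" by simp
  finally show ?thesis by (simp add: a_def)
qed

text \<open>Both sides are integrals against push-forwards of slab measures. Comparing these
  measures on Borel sets carries the identity over to signed functions without a discussion of
  integrability.\<close>

lemma integral_oblique_slab:
  fixes n \<omega> :: "'a::euclidean_space" and h :: "'a \<Rightarrow> real"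
  assumes n: "norm n = 1" and a: "n \<bullet> \<omega> \<noteq> 0" and [measurable]: "h \<in> borel_measurable borel"
  shows "(\<integral>y. indicator {-1/2..1/2} ((n \<bullet> y - \<alpha>) / (n \<bullet> \<omega>)) * h (y - ((n \<bullet> y - \<alpha>) / (n \<bullet> \<omega>)) *\<^sub>R \<omega>) \<partial>lborel) =
    \<bar>n \<bullet> \<omega>\<bar> * (\<integral>y. indicator {-1/2..1/2} (n \<bullet> y - \<alpha>) * h (y - (n \<bullet> y - \<alpha>) *\<^sub>R n) \<partial>lborel)"
proof -
  define D :: "real \<Rightarrow> 'a measure"
    where "D = (\<lambda>a. density lborel (\<lambda>y. indicator {-1/2..1/2} ((n \<bullet> y - \<alpha>) / a)))"
  define N where "N = (\<lambda>a w. distr (D a) borel (\<lambda>y. y - ((n \<bullet> y - \<alpha>) / a) *\<^sub>R w))"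
  have eD[simp]: "sets (D a) = sets borel" "space (D a) = UNIV" for a by (simp_all add: D_def)
  have qm[measurable]: "(\<lambda>y. y - ((n \<bullet> y - \<alpha>) / a) *\<^sub>R w) \<in> borel_measurable borel" for a and w :: 'a by measurable
  have qD: "(\<lambda>y. y - ((n \<bullet> y - \<alpha>) / a) *\<^sub>R w) \<in> measurable (D b) borel" for a b and w :: 'a
    using qm by (simp add: D_def)
  have em: "emeasure (N a w) A =
      (\<integral>\<^sup>+y. indicator {-1/2..1/2} ((n \<bullet> y - \<alpha>) / a) * indicator A (y - ((n \<bullet> y - \<alpha>) / a) *\<^sub>R w) \<partial>lborel)"
    if A[measurable]: "A \<in> sets borel" for a w A
  proof -
    have "emeasure (N a w) A = emeasure (D a) ((\<lambda>y. y - ((n \<bullet> y - \<alpha>) / a) *\<^sub>R w) -` A)"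
      unfolding N_def by (subst emeasure_distr[OF qD A]) simp
    also have "\<dots> = (\<integral>\<^sup>+y. indicator {-1/2..1/2} ((n \<bullet> y - \<alpha>) / a) *
        indicator ((\<lambda>y. y - ((n \<bullet> y - \<alpha>) / a) *\<^sub>R w) -` A) y \<partial>lborel)"
      unfolding D_def by (rule emeasure_density) (use measurable_sets[OF qm A] in auto)
    finally show ?thesis by (simp add: indicator_def)
  qed
  have int: "(\<integral>x. h x \<partial>N a w) =
      (\<integral>y. indicator {-1/2..1/2} ((n \<bullet> y - \<alpha>) / a) * h (y - ((n \<bullet> y - \<alpha>) / a) *\<^sub>R w) \<partial>lborel)" for a w
  proof -
    have "(\<integral>x. h x \<partial>N a w) = (\<integral>y. h (y - ((n \<bullet> y - \<alpha>) / a) *\<^sub>R w) \<partial>D a)"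
      unfolding N_def by (rule integral_distr[OF qD]) simp
    also have "\<dots> = (\<integral>y. h (y - ((n \<bullet> y - \<alpha>) / a) *\<^sub>R w) \<partial>density lborel (\<lambda>y. ennreal (indicator {-1/2..1/2} ((n \<bullet> y - \<alpha>) / a))))"
      unfolding D_def by (simp add: ennreal_indicator)
    also have "\<dots> = (\<integral>y. indicator {-1/2..1/2} ((n \<bullet> y - \<alpha>) / a) *\<^sub>R h (y - ((n \<bullet> y - \<alpha>) / a) *\<^sub>R w) \<partial>lborel)"
      by (rule integral_density) auto
    finally show ?thesis by simp
  qed
  have "N (n \<bullet> \<omega>) \<omega> = density (N 1 n) (\<lambda>_. ennreal \<bar>n \<bullet> \<omega>\<bar>)"
  proof (rule measure_eqI)
    show "sets (N (n \<bullet> \<omega>) \<omega>) = sets (density (N 1 n) (\<lambda>_. ennreal \<bar>n \<bullet> \<omega>\<bar>))" by (simp add: N_def)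
    fix A assume "A \<in> sets (N (n \<bullet> \<omega>) \<omega>)"
    then have [measurable]: "A \<in> sets borel" by (simp add: N_def)
    have "emeasure (density (N 1 n) (\<lambda>_. ennreal \<bar>n \<bullet> \<omega>\<bar>)) A = ennreal \<bar>n \<bullet> \<omega>\<bar> * emeasure (N 1 n) A"
      by (simp add: emeasure_density_const N_def)
    then show "emeasure (N (n \<bullet> \<omega>) \<omega>) A = emeasure (density (N 1 n) (\<lambda>_. ennreal \<bar>n \<bullet> \<omega>\<bar>)) A"
      using nn_integral_oblique_slab[OF n a, of "indicator A" \<alpha>] by (simp add: em)
  qed
  then have "(\<integral>x. h x \<partial>N (n \<bullet> \<omega>) \<omega>) = (\<integral>x. h x \<partial>density (N 1 n) (\<lambda>_. ennreal \<bar>n \<bullet> \<omega>\<bar>))" by simp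
  also have "\<dots> = (\<integral>x. \<bar>n \<bullet> \<omega>\<bar> *\<^sub>R h x \<partial>N 1 n)"
    by (rule integral_density) (simp_all add: N_def)
  finally show ?thesis unfolding int by (simp add: int)
qed

lemma set_integral_surface_measure:
  fixes e :: "'a::euclidean_space set" and F :: "'a \<Rightarrow> real"
  assumes n: "norm n = 1" and hull: "affine hull e = {x. n \<bullet> x = \<alpha>}" and e: "closed e"
    and F: "continuous_on e F"
  shows "(LINT x:e|surface_measure e. F x) =
    (\<integral>y. indicator {-1/2..1/2} (n \<bullet> y - \<alpha>) *
      (indicator e (y - (n \<bullet> y - \<alpha>) *\<^sub>R n) * F (y - (n \<bullet> y - \<alpha>) *\<^sub>R n)) \<partial>lborel)"
proof -
  define q where "q = (\<lambda>y::'a. y - (n \<bullet> y - \<alpha>) *\<^sub>R n)"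
  have [measurable]: "q \<in> borel_measurable borel" unfolding q_def by measurable
  have qcp: "closest_point (affine hull e) = q"
    by (rule ext) (simp add: hull q_def closest_point_hyperplane[OF n])
  define S where "S = {y. q y \<in> e \<and> dist y (q y) \<le> 1/2}"
  have [measurable]: "e \<in> sets borel" using e by (simp add: borel_closed)
  have S[measurable]: "S \<in> sets borel" unfolding S_def by measurable
  have "dist y (q y) = \<bar>n \<bullet> y - \<alpha>\<bar>" for y using n by (simp add: q_def dist_norm)
  then have d: "dist y (q y) \<le> 1/2 \<longleftrightarrow> n \<bullet> y - \<alpha> \<in> {-1/2..1/2}" for y
    unfolding atLeastAtMost_iff by (simp only: abs_le_iff) linarith
  have Fm[measurable]: "(\<lambda>x. indicator e x * F x) \<in> borel_measurable borel"
    using borel_measurable_continuous_on_indicator[OF _ F] e by simp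
  have "(LINT x:e|surface_measure e. F x) =
      (\<integral>x. indicator e x * F x \<partial>distr (restrict_space lborel S) borel q)"
    by (simp add: surface_measure_def Let_def qcp S_def set_lebesgue_integral_def)
  also have "\<dots> = (\<integral>y. indicator e (q y) * F (q y) \<partial>restrict_space lborel S)"
    by (subst integral_distr) (auto intro: measurable_restrict_space1)
  also have "\<dots> = (\<integral>y. indicator S y *\<^sub>R (indicator e (q y) * F (q y)) \<partial>lborel)"
    by (subst integral_restrict_space) auto
  also have "\<dots> = (\<integral>y. indicator {-1/2..1/2} (n \<bullet> y - \<alpha>) * (indicator e (q y) * F (q y)) \<partial>lborel)"
    by (rule Bochner_Integration.integral_cong) (unfold S_def indicator_def mem_Collect_eq d, auto)
  finally show ?thesis by (simp add: q_def)
qed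

lemma surface_measure_facts:
  fixes e :: "'a::euclidean_space set"
  assumes n: "norm n = 1" and hull: "affine hull e = {x. n \<bullet> x = \<alpha>}" and e: "compact e"
  shows finite_surface_measure: "finite_measure (surface_measure e)"
    and sets_surface_measure: "sets (surface_measure e) = sets borel"
proof -
  define q where "q = (\<lambda>y::'a. y - (n \<bullet> y - \<alpha>) *\<^sub>R n)"
  have [measurable]: "q \<in> borel_measurable borel" unfolding q_def by measurable
  have qcp: "closest_point (affine hull e) = q"
    by (rule ext) (simp add: hull q_def closest_point_hyperplane[OF n])
  define S where "S = {y. q y \<in> e \<and> dist y (q y) \<le> 1/2}"
  have [measurable]: "e \<in> sets borel" using e by (simp add: compact_imp_closed borel_closed)
  have S[measurable]: "S \<in> sets borel" unfolding S_def by measurable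
  have sm: "surface_measure e = distr (restrict_space lborel S) borel q"
    by (simp add: surface_measure_def Let_def qcp S_def)
  then show "sets (surface_measure e) = sets borel" by simp
  obtain B where B: "\<And>x. x \<in> e \<Longrightarrow> norm x \<le> B"
    using compact_imp_bounded[OF e] by (auto simp: bounded_iff)
  have "bounded S"
    unfolding bounded_iff
  proof (intro exI ballI)
    fix y assume "y \<in> S"
    then have "norm (q y) \<le> B" "norm (y - q y) \<le> 1/2" using B by (auto simp: S_def dist_norm)
    then show "norm y \<le> B + 1/2" using norm_triangle_ineq[of "q y" "y - q y"] by simp
  qed
  then have "emeasure lborel S < \<infinity>" by (rule emeasure_bounded_finite)
  then show "finite_measure (surface_measure e)"
    unfolding sm
    by (intro finite_measure.finite_measure_distr finite_measureI)
       (auto simp: emeasure_restrict_space intro: measurable_restrict_space1)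
qed

lemma set_integrable_surface_measure:
  fixes e :: "'a::euclidean_space set" and F :: "'a \<Rightarrow> real"
  assumes n: "norm n = 1" and hull: "affine hull e = {x. n \<bullet> x = \<alpha>}" and e: "compact e"
    and F: "continuous_on e F"
  shows "set_integrable (surface_measure e) e F"
proof -
  interpret finite_measure "surface_measure e" by (rule finite_surface_measure[OF n hull e])
  have eb: "e \<in> sets borel" using e by (simp add: compact_imp_closed borel_closed)
  have m: "(\<lambda>x. indicator e x *\<^sub>R F x) \<in> borel_measurable (surface_measure e)"
    using borel_measurable_continuous_on_indicator[OF eb F] sets_surface_measure[OF n hull e]
    by (simp cong: measurable_cong_sets)
  obtain B where B: "\<And>x. x \<in> e \<Longrightarrow> norm (F x) \<le> B"
    using compact_imp_bounded[OF compact_continuous_image[OF F e]] by (auto simp: bounded_iff)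
  show ?thesis
    unfolding set_integrable_def
    by (rule integrable_const_bound[where B = "max B 0", OF _ m]) (auto simp: indicator_def dest!: B)
qed

lemma integrable_oblique_slab:
  fixes n \<omega> :: "'a::euclidean_space" and F :: "'a \<Rightarrow> real"
  assumes e: "compact e" and F: "continuous_on e F"
  shows "integrable lborel (\<lambda>y. indicator {-1/2..1/2} ((n \<bullet> y - \<alpha>) / a) *
      (indicator e (y - ((n \<bullet> y - \<alpha>) / a) *\<^sub>R \<omega>) * F (y - ((n \<bullet> y - \<alpha>) / a) *\<^sub>R \<omega>)))"
proof -
  define q where "q = (\<lambda>y::'a. y - ((n \<bullet> y - \<alpha>) / a) *\<^sub>R \<omega>)"
  have [measurable]: "q \<in> borel_measurable borel" unfolding q_def by measurable
  define S where "S = {y. q y \<in> e \<and> (n \<bullet> y - \<alpha>) / a \<in> {-1/2..1/2}}"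
  have eb[measurable]: "e \<in> sets borel" using e by (simp add: compact_imp_closed borel_closed)
  have S[measurable]: "S \<in> sets borel" unfolding S_def by measurable
  have Fm[measurable]: "(\<lambda>x. indicator e x * F x) \<in> borel_measurable borel"
    using borel_measurable_continuous_on_indicator[OF eb F] by simp
  obtain B where B: "\<And>x. x \<in> e \<Longrightarrow> norm x \<le> B"
    using compact_imp_bounded[OF e] by (auto simp: bounded_iff)
  have "bounded S"
    unfolding bounded_iff
  proof (intro exI ballI)
    fix y assume y: "y \<in> S"
    have "norm (q y) \<le> B" using B y by (auto simp: S_def)
    moreover have "norm (y - q y) \<le> 1/2 * norm \<omega>"
    proof -
      have "\<bar>(n \<bullet> y - \<alpha>) / a\<bar> \<le> 1/2" using y unfolding S_def mem_Collect_eq atLeastAtMost_iff abs_le_iff by linarith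
      then have "\<bar>(n \<bullet> y - \<alpha>) / a\<bar> * norm \<omega> \<le> 1/2 * norm \<omega>" by (rule mult_right_mono) simp
      then show ?thesis by (simp only: q_def) simp
    qed
    ultimately show "norm y \<le> B + 1/2 * norm \<omega>" using norm_triangle_ineq[of "q y" "y - q y"] by simp
  qed
  then have fin: "emeasure lborel S < \<infinity>" by (rule emeasure_bounded_finite)
  obtain C where C: "\<And>x. x \<in> e \<Longrightarrow> norm (F x) \<le> C"
    using compact_imp_bounded[OF compact_continuous_image[OF F e]] by (auto simp: bounded_iff)
  have m: "(\<lambda>y. indicator {-1/2..1/2} ((n \<bullet> y - \<alpha>) / a) * (indicator e (q y) * F (q y))) \<in> borel_measurable borel"
    using measurable_compose[OF \<open>q \<in> borel_measurable borel\<close> Fm] by measurable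
  have "integrable lborel (\<lambda>y. indicator {-1/2..1/2} ((n \<bullet> y - \<alpha>) / a) * (indicator e (q y) * F (q y)))"
    using S m fin C
    by (intro integrableI_bounded_set[where A = S and B = C] AE_I2) (auto simp: S_def simp del: divide_le_eq_numeral1 le_divide_eq_numeral1 split: split_indicator)
  then show ?thesis by (simp add: q_def)
qed

section \<open>Exceptional lines and the local geometry of a cell\<close>

lemma negligible_UN:
  "finite I \<Longrightarrow> (\<And>i. i \<in> I \<Longrightarrow> negligible (A i)) \<Longrightarrow> negligible (\<Union>i\<in>I. A i)"
  by (rule negligible_Union) auto

text \<open>Sweeping along one direction raises the dimension by at most one, so a set of
  codimension two stays inside a proper affine subspace.\<close>

lemma negligible_sweep:
  fixes F :: "'a::euclidean_space set"
  assumes "aff_dim F \<le> int DIM('a) - 2"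
  shows "negligible {y. \<exists>s. y + s *\<^sub>R \<omega> \<in> F}"
proof (cases "F = {}")
  case False
  then obtain z where z: "z \<in> F" by blast
  define W where "W = (\<lambda>x. x - z) ` F"
  have "int (dim W) = aff_dim F"
    using aff_dim_eq_dim_subtract[of z F] z by (simp add: W_def hull_inc)
  then have "dim (insert \<omega> W) < DIM('a)"
    using assms by (simp add: dim_insert)
  then have "negligible (span (insert \<omega> W))" by (intro negligible_lowdim) simp
  then have N: "negligible ((+) z ` span (insert \<omega> W))" by (rule negligible_translation)
  show ?thesis
  proof (rule negligible_subset[OF N], rule subsetI)
    fix y assume "y \<in> {y. \<exists>s. y + s *\<^sub>R \<omega> \<in> F}"
    then obtain s where s: "y + s *\<^sub>R \<omega> \<in> F" by blast
    then have "y + s *\<^sub>R \<omega> - z \<in> W" by (auto simp: W_def)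
    then have "(y + s *\<^sub>R \<omega> - z) - s *\<^sub>R \<omega> \<in> span (insert \<omega> W)"
      by (intro span_diff span_scale span_base) auto
    then have "y - z \<in> span (insert \<omega> W)" by simp
    then show "y \<in> (+) z ` span (insert \<omega> W)" by (intro image_eqI[of _ _ "y - z"]) auto
  qed
qed simp

text \<open>A point of \<open>e\<close> outside its relative interior lies outside that of any piece
  containing it, because a piece has the same affine hull. Hence it lies on a facet of the piece, of
  codimension two.\<close>

lemma negligible_sweep_flat_face_boundary:
  fixes e :: "'a::euclidean_space set"
  assumes "flat_face e"
  shows "negligible {y. \<exists>s. y + s *\<^sub>R \<omega> \<in> e - rel_interior e}"
proof -
  obtain \<Q> where fin: "finite \<Q>" and Q: "\<And>Q. Q \<in> \<Q> \<Longrightarrow> polytope Q \<and> aff_dim Q = int DIM('a) - 1"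
    and e: "e = \<Union>\<Q>" and dim: "aff_dim e = int DIM('a) - 1"
    using assms unfolding flat_face_def by blast
  have "{y. \<exists>s. y + s *\<^sub>R \<omega> \<in> e - rel_interior e} \<subseteq>
      (\<Union>Q\<in>\<Q>. \<Union>F\<in>{F. F facet_of Q}. {y. \<exists>s. y + s *\<^sub>R \<omega> \<in> F})"
  proof
    fix y assume "y \<in> {y. \<exists>s. y + s *\<^sub>R \<omega> \<in> e - rel_interior e}"
    then obtain s where s: "y + s *\<^sub>R \<omega> \<in> e" "y + s *\<^sub>R \<omega> \<notin> rel_interior e" by blast
    then obtain q where q: "q \<in> \<Q>" "y + s *\<^sub>R \<omega> \<in> q" using e by blast
    have "q \<subseteq> e" using q e by blast
    then have "affine hull q = affine hull e"
      using Q[OF q(1)] dim aff_dim_eq_full_gen[of q e] by simp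
    then have "y + s *\<^sub>R \<omega> \<notin> rel_interior q"
      using subset_rel_interior[OF \<open>q \<subseteq> e\<close>] s by blast
    then have "y + s *\<^sub>R \<omega> \<in> rel_frontier q"
      using q(2) by (auto simp: rel_frontier_def intro: closure_subset[THEN subsetD])
    then have "\<exists>F. F facet_of q \<and> y + s *\<^sub>R \<omega> \<in> F"
      using rel_frontier_of_polyhedron[of q] Q[OF q(1)] polytope_imp_polyhedron by blast
    then show "y \<in> (\<Union>Q\<in>\<Q>. \<Union>F\<in>{F. F facet_of Q}. {y. \<exists>s. y + s *\<^sub>R \<omega> \<in> F})"
      using q by blast
  qed
  moreover have "negligible (\<Union>Q\<in>\<Q>. \<Union>F\<in>{F. F facet_of Q}. {y. \<exists>s. y + s *\<^sub>R \<omega> \<in> F})"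
  proof (intro negligible_UN fin)
    fix q F assume q: "q \<in> \<Q>"
    show "finite {F. F facet_of q}" using Q[OF q] finite_polytope_facets by blast
    assume "F \<in> {F. F facet_of q}"
    then have "aff_dim F = aff_dim q - 1" by (simp add: facet_of_def)
    then show "negligible {y. \<exists>s. y + s *\<^sub>R \<omega> \<in> F}"
      using Q[OF q] by (intro negligible_sweep) simp
  qed
  ultimately show ?thesis by (rule negligible_subset[rotated])
qed

lemma flat_face_hull:
  fixes e :: "'a::euclidean_space set"
  assumes e: "flat_face e" and n: "norm n = 1" and orth: "\<And>x y. x \<in> e \<Longrightarrow> y \<in> e \<Longrightarrow> n \<bullet> (x - y) = 0"
  obtains \<alpha> where "affine hull e = {x. n \<bullet> x = \<alpha>}"
proof -
  have "n \<noteq> 0" using n by auto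
  have dim: "aff_dim e = int DIM('a) - 1" using e by (simp add: flat_face_def)
  have "e \<noteq> {}" using dim by auto
  then obtain z where z: "z \<in> e" by blast
  have sub: "e \<subseteq> {x. n \<bullet> x = n \<bullet> z}" using orth[OF _ z] by (auto simp: inner_diff_right)
  have "affine hull e = {x. n \<bullet> x = n \<bullet> z}"
  proof (rule affine_dim_equal)
    show "affine hull e \<subseteq> {x. n \<bullet> x = n \<bullet> z}" using sub by (rule hull_minimal) (rule affine_hyperplane)
    show "aff_dim (affine hull e) = aff_dim {x. n \<bullet> x = n \<bullet> z}"
      using \<open>n \<noteq> 0\<close> by (simp add: dim aff_dim_hyperplane)
  qed (use \<open>e \<noteq> {}\<close> in \<open>auto simp: affine_hyperplane\<close>)
  then show ?thesis by (rule that)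
qed

lemma flat_face_compact: "flat_face e \<Longrightarrow> compact e"
  unfolding flat_face_def using polytope_imp_compact by (metis compact_Union)

lemma AE_lborel_not_negligible:
  assumes "negligible N" shows "AE y in lborel. y \<notin> N"
proof -
  have "AE y in lebesgue. y \<notin> N"
    using assms by (intro AE_not_in) (simp add: negligible_iff_null_sets)
  then show ?thesis by (simp add: AE_completion_iff)
qed

text \<open>The sides of a face are prescribed only at relative interior points: almost every line
  of a given direction meets the frontier nowhere else.\<close>

locale polytopal_cell =
  fixes K :: "'a::euclidean_space set" and E :: "'a set set" and \<nu> :: "'a set \<Rightarrow> 'a" and \<alpha> :: "'a set \<Rightarrow> real"
  assumes open_K: "open K" and bounded_K: "bounded K" and finite_E: "finite E"
    and frontier_K: "frontier K = \<Union>E"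
    and flat: "e \<in> E \<Longrightarrow> flat_face e"
    and norm_\<nu>: "e \<in> E \<Longrightarrow> norm (\<nu> e) = 1"
    and hull: "e \<in> E \<Longrightarrow> affine hull e = {x. \<nu> e \<bullet> x = \<alpha> e}"
    and disj: "e \<in> E \<Longrightarrow> f \<in> E \<Longrightarrow> e \<noteq> f \<Longrightarrow> rel_interior e \<inter> rel_interior f = {}"
    and outward: "e \<in> E \<Longrightarrow> x \<in> rel_interior e \<Longrightarrow>
      \<exists>r>0. \<forall>t. 0 < t \<and> t < r \<longrightarrow> x - t *\<^sub>R \<nu> e \<in> K \<and> x + t *\<^sub>R \<nu> e \<notin> K"
begin

lemma in_plane: "e \<in> E \<Longrightarrow> x \<in> e \<Longrightarrow> \<nu> e \<bullet> x = \<alpha> e"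
  using hull[of e] hull_inc[of x e affine] by auto

lemma compact_face: "e \<in> E \<Longrightarrow> compact e"
  by (simp add: flat flat_face_compact)

lemma negligible_plane: "e \<in> E \<Longrightarrow> negligible {y. \<nu> e \<bullet> y = c}"
  using norm_\<nu>[of e] by (intro negligible_hyperplane) auto

lemma negligible_frontier: "negligible (frontier K)"
  unfolding frontier_K
  by (intro negligible_Union finite_E) (use in_plane negligible_plane in \<open>blast intro: negligible_subset\<close>)

text \<open>Besides clean crossings, the ends of the segment of parameters from -1/2 to 1/2 must
  avoid the frontier, so that no crossing sits at an end point.\<close>

definition transversal :: "'a \<Rightarrow> 'a \<Rightarrow> bool" where
  "transversal \<omega> y \<longleftrightarrow>
     (\<forall>e\<in>E. \<forall>s. y + s *\<^sub>R \<omega> \<in> e \<longrightarrow> y + s *\<^sub>R \<omega> \<in> rel_interior e \<and> \<nu> e \<bullet> \<omega> \<noteq> 0) \<and>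
     y + (1/2) *\<^sub>R \<omega> \<notin> frontier K \<and> y + (-1/2) *\<^sub>R \<omega> \<notin> frontier K"

lemma AE_transversal: "AE y in lborel. transversal \<omega> y"
proof -
  define N where "N = (\<Union>e\<in>E. {y. \<exists>s. y + s *\<^sub>R \<omega> \<in> e - rel_interior e} \<union>
      (if \<nu> e \<bullet> \<omega> = 0 then {y. \<nu> e \<bullet> y = \<alpha> e} else {})) \<union>
      ((+) (- (1/2) *\<^sub>R \<omega>) ` frontier K) \<union> ((+) ((1/2) *\<^sub>R \<omega>) ` frontier K)"
  have "negligible N"
    unfolding N_def
    by (intro negligible_Un negligible_UN finite_E negligible_translation negligible_frontier
        negligible_sweep_flat_face_boundary flat) (auto intro: negligible_plane)
  moreover have "transversal \<omega> y" if "y \<notin> N" for y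
    unfolding transversal_def
  proof (intro conjI ballI allI impI)
    fix e s assume e: "e \<in> E" and s: "y + s *\<^sub>R \<omega> \<in> e"
    show "y + s *\<^sub>R \<omega> \<in> rel_interior e" using that e s by (auto simp: N_def)
    show "\<nu> e \<bullet> \<omega> \<noteq> 0"
    proof
      assume "\<nu> e \<bullet> \<omega> = 0"
      moreover from this have "\<nu> e \<bullet> y = \<alpha> e" using in_plane[OF e s] by (simp add: inner_add_right)
      ultimately show False using that e by (auto simp: N_def)
    qed
  next
    show "y + (1/2) *\<^sub>R \<omega> \<notin> frontier K"
    proof
      assume "y + (1/2) *\<^sub>R \<omega> \<in> frontier K"
      then have "y \<in> (+) (- (1/2) *\<^sub>R \<omega>) ` frontier K"
        by (intro image_eqI[of _ _ "y + (1/2) *\<^sub>R \<omega>"]) auto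
      then show False using that by (simp add: N_def)
    qed
    show "y + (-1/2) *\<^sub>R \<omega> \<notin> frontier K"
    proof
      assume "y + (-1/2) *\<^sub>R \<omega> \<in> frontier K"
      then have "y \<in> (+) ((1/2) *\<^sub>R \<omega>) ` frontier K"
        by (intro image_eqI[of _ _ "y + (-1/2) *\<^sub>R \<omega>"]) auto
      then show False using that by (simp add: N_def)
    qed
  qed
  ultimately show ?thesis using AE_lborel_not_negligible[of N] by (auto elim: AE_mp)
qed

text \<open>Near \<open>x\<close> the frontier is contained in the plane of \<open>e\<close>, so the
  two open half balls are connected sets missing it. Each lies on one side of \<open>K\<close>, and
  one point on the normal decides which.\<close>

lemma local_half_space:
  assumes e: "e \<in> E" and x: "x \<in> rel_interior e" and only: "\<And>f. f \<in> E \<Longrightarrow> x \<in> f \<Longrightarrow> f = e"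
  obtains r where "r > 0"
    and "\<And>z. z \<in> ball x r \<Longrightarrow> \<nu> e \<bullet> z < \<alpha> e \<Longrightarrow> z \<in> K"
    and "\<And>z. z \<in> ball x r \<Longrightarrow> \<nu> e \<bullet> z > \<alpha> e \<Longrightarrow> z \<notin> closure K"
proof -
  have nn: "\<nu> e \<bullet> \<nu> e = 1" using norm_\<nu>[OF e] by (simp add: norm_eq_1)
  have xe: "x \<in> e" using x rel_interior_subset by blast
  have xa: "\<nu> e \<bullet> x = \<alpha> e" using in_plane[OF e xe] .
  have "open (- \<Union>(E - {e}))"
    using finite_E compact_face by (auto intro!: closed_Union compact_imp_closed)
  moreover have "x \<in> - \<Union>(E - {e})" using only by blast
  ultimately obtain r1 where r1: "r1 > 0" "ball x r1 \<subseteq> - \<Union>(E - {e})"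
    by (meson open_contains_ball)
  obtain r2 where r2: "r2 > 0" "\<And>t. 0 < t \<Longrightarrow> t < r2 \<Longrightarrow> x - t *\<^sub>R \<nu> e \<in> K \<and> x + t *\<^sub>R \<nu> e \<notin> K"
    using outward[OF e x] by blast
  define r where "r = min r1 r2"
  have r: "r > 0" "r \<le> r1" "r \<le> r2" using r1 r2 by (auto simp: r_def)
  have fr: "z \<in> e" if z: "z \<in> ball x r" "z \<in> frontier K" for z
  proof -
    obtain X where X: "X \<in> E" "z \<in> X" using z(2) frontier_K by blast
    have "z \<in> ball x r1" using z(1) r by auto
    then have "z \<notin> \<Union>(E - {e})" using r1(2) by blast
    then show ?thesis using X by blast
  qed
  let ?t = "r / 2"
  have t: "0 < ?t" "?t < r2" using r by auto
  define L where "L = ball x r \<inter> {z. \<nu> e \<bullet> z < \<alpha> e}"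
  define U where "U = ball x r \<inter> {z. \<nu> e \<bullet> z > \<alpha> e}"
  have con: "connected L" "connected U"
    unfolding L_def U_def
    by (intro convex_connected convex_Int convex_ball convex_halfspace_lt convex_halfspace_gt)+
  have off: "L \<inter> frontier K = {}" "U \<inter> frontier K = {}"
    using fr in_plane[OF e] unfolding L_def U_def by fastforce+
  have pts: "x - ?t *\<^sub>R \<nu> e \<in> L" "x + ?t *\<^sub>R \<nu> e \<in> U"
    using r norm_\<nu>[OF e] by (auto simp: L_def U_def dist_norm inner_diff_right inner_add_right nn xa)
  have L: "L \<subseteq> K" using connected_Int_frontier[OF con(1), of K] off pts r2(2)[OF t] by blast
  have "U \<inter> K = {}" using connected_Int_frontier[OF con(2), of K] off pts r2(2)[OF t] by blast
  then have U: "U \<inter> closure K = {}" using off(2) open_K by (auto simp: frontier_def interior_open)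
  show ?thesis
    by (rule that[OF r(1)]) (use L U in \<open>auto simp: L_def U_def\<close>)
qed

text \<open>Parameter at which the line \<open>y + s *\<^sub>R \<omega>\<close> crosses the plane of \<open>e\<close>.\<close>

definition crossing :: "'a \<Rightarrow> 'a set \<Rightarrow> 'a \<Rightarrow> real" where
  "crossing \<omega> e y = - ((\<nu> e \<bullet> y - \<alpha> e) / (\<nu> e \<bullet> \<omega>))"

lemma crossing_unique:
  assumes e: "e \<in> E" and s: "y + s *\<^sub>R \<omega> \<in> e" and a: "\<nu> e \<bullet> \<omega> \<noteq> 0"
  shows "s = crossing \<omega> e y"
proof -
  have "\<nu> e \<bullet> y + s * (\<nu> e \<bullet> \<omega>) = \<alpha> e" using in_plane[OF e s] by (simp add: inner_add_right)
  then show ?thesis using a by (simp add: crossing_def field_simps)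
qed

text \<open>
  The fundamental theorem of calculus along a transversal line: adding to \<open>f\<close> restricted to
  \<open>closure K\<close> a step at each crossing gives a continuous function of the parameter.
\<close>

lemma line_integral:
  fixes f f' :: "'a \<Rightarrow> real"
  assumes y: "transversal \<omega> y"
    and f': "\<And>x s. ((\<lambda>s. f (x + s *\<^sub>R \<omega>)) has_real_derivative f' (x + s *\<^sub>R \<omega>)) (at s)"
  shows "((\<lambda>s. indicator (closure K) (y + s *\<^sub>R \<omega>) * f' (y + s *\<^sub>R \<omega>)) has_integral
      indicator (closure K) (y + (1/2) *\<^sub>R \<omega>) * f (y + (1/2) *\<^sub>R \<omega>)
      - indicator (closure K) (y + (-1/2) *\<^sub>R \<omega>) * f (y + (-1/2) *\<^sub>R \<omega>)
      + (\<Sum>e\<in>E. sgn (\<nu> e \<bullet> \<omega>) * (indicator {-1/2..1/2} (crossing \<omega> e y) *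
           (indicator e (y + crossing \<omega> e y *\<^sub>R \<omega>) * f (y + crossing \<omega> e y *\<^sub>R \<omega>)))))
      {-1/2..1/2}"
proof -
  define l where "l = (\<lambda>s. y + s *\<^sub>R \<omega>)"
  define c where "c = (\<lambda>e. crossing \<omega> e y)"
  define k where "k = (\<lambda>s. indicator (closure K) (l s) :: real)"
  define g where "g = (\<lambda>s. f (l s))"
  define a where "a = (\<lambda>e. \<nu> e \<bullet> \<omega>)"
  define H where "H = {e\<in>E. a e \<noteq> 0 \<and> l (c e) \<in> e}"
  \<comment> \<open>At a crossing the line is in the closure of \<open>K\<close>. On leaving, the
    product \<open>k s * g s\<close> still has its full value there, so the compensating step starts
    strictly after; on entering it has its full value already there, so the step includes the
    crossing.\<close>
  define h where "h = (\<lambda>e s. if a e > 0 then (if c e < s then g (c e) else 0) else (if c e \<le> s then - g (c e) else 0))"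
  define F where "F = (\<lambda>s. k s * g s + (\<Sum>e\<in>H. h e s))"
  have finH: "finite H" using finite_E by (simp add: H_def)
  have hit: "s = c e \<and> e \<in> H \<and> l s \<in> rel_interior e" if "e \<in> E" "l s \<in> e" for e s
  proof -
    have "l s \<in> rel_interior e" "a e \<noteq> 0" using y that by (auto simp: transversal_def l_def a_def)
    moreover from this have "s = c e" using crossing_unique that by (auto simp: l_def c_def a_def)
    ultimately show ?thesis using that by (auto simp: H_def)
  qed
  have lc: "continuous_on UNIV l" "isCont l s" for s
    unfolding l_def by (intro continuous_intros)+
  have g: "(g has_real_derivative f' (l s)) (at s)" for s
    using f'[of y s] by (simp add: g_def l_def)
  have gc: "isCont g s" for s using g DERIV_isCont by blast
  have frontier_hit: "l s \<in> frontier K \<longleftrightarrow> (\<exists>e\<in>H. s = c e)" for s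
    using hit frontier_K by (auto simp: H_def)
  have h_const: "\<forall>\<^sub>F s' in nhds s. h e s' = h e s" if "s \<noteq> c e" for e s
  proof (cases "s < c e")
    case True
    then have "\<forall>\<^sub>F s' in nhds s. s' < c e" by (auto intro: eventually_nhds_in_open[of "{..<c e}", simplified])
    then show ?thesis by eventually_elim (use True in \<open>auto simp: h_def\<close>)
  next
    case False
    then have "\<forall>\<^sub>F s' in nhds s. s' > c e" using that by (auto intro: eventually_nhds_in_open[of "{c e<..}", simplified])
    then show ?thesis by eventually_elim (use False that in \<open>auto simp: h_def\<close>)
  qed
  have deriv: "(F has_real_derivative k s * f' (l s)) (at s)" if "l s \<notin> frontier K" for s
  proof -
    have "\<forall>\<^sub>F s' in nhds s. k s' = k s"
    proof (cases "l s \<in> K")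
      case True
      then have "\<forall>\<^sub>F s' in nhds s. l s' \<in> K"
        using lc(1) open_K by (intro eventually_nhds_in_open[of "l -` K", simplified]) (auto intro: open_vimage)
      then show ?thesis
        by eventually_elim (use True closure_subset[of K] in \<open>auto simp: k_def indicator_def\<close>)
    next
      case False
      then have "l s \<in> - closure K" using that open_K by (auto simp: frontier_def interior_open)
      then have "\<forall>\<^sub>F s' in nhds s. l s' \<in> - closure K"
        using lc(1) eventually_nhds_in_open[of "l -` (- closure K)" s] by (simp add: open_vimage open_Compl del: vimage_Compl)
      then show ?thesis
        by eventually_elim (use \<open>l s \<in> - closure K\<close> in \<open>auto simp: k_def indicator_def\<close>)
    qed
    moreover have "\<forall>\<^sub>F s' in nhds s. \<forall>e\<in>H. h e s' = h e s"
      using finH h_const that frontier_hit by (intro eventually_ball_finite) auto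
    ultimately have ev: "\<forall>\<^sub>F s' in nhds s. F s' = k s * g s' + (\<Sum>e\<in>H. h e s)"
      by eventually_elim (simp add: F_def)
    have "((\<lambda>s'. k s * g s' + (\<Sum>e\<in>H. h e s)) has_real_derivative k s * f' (l s)) (at s)"
      using g[of s] by (auto intro!: derivative_eq_intros)
    then show ?thesis using DERIV_cong_ev[OF refl ev refl] by blast
  qed
  have cont: "isCont F s" for s
  proof (cases "l s \<in> frontier K")
    case False
    then show ?thesis using deriv DERIV_isCont by blast
  next
    case True
    then obtain e where e: "e \<in> E" "l s \<in> e" using frontier_K by blast
    have se: "s = c e" "e \<in> H" and ri: "l s \<in> rel_interior e" using hit[OF e] by auto
    have only: "f = e" if "f \<in> E" "l s \<in> f" for f
      using disj[OF that(1) e(1)] hit[OF that] ri by blast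
    obtain r where r: "r > 0" and lower: "\<And>z. z \<in> ball (l s) r \<Longrightarrow> \<nu> e \<bullet> z < \<alpha> e \<Longrightarrow> z \<in> K"
      and upper: "\<And>z. z \<in> ball (l s) r \<Longrightarrow> \<nu> e \<bullet> z > \<alpha> e \<Longrightarrow> z \<notin> closure K"
      using local_half_space[OF e(1) ri only] by blast
    have a0: "a e \<noteq> 0" using se by (simp add: H_def)
    have height: "\<nu> e \<bullet> l s' = \<alpha> e + (s' - s) * a e" for s'
      using in_plane[OF e] by (simp add: l_def a_def inner_add_right algebra_simps)
    \<comment> \<open>Near the crossing \<open>F\<close> follows \<open>g\<close> on the inner side
      and stays constant on the outer side, up to a constant.\<close>
    define G where "G = (\<lambda>s'. if a e > 0 then g (min s' s) else g (max s' s) - g s)"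
    have near: "\<forall>\<^sub>F s' in nhds s. l s' \<in> ball (l s) r"
      using lc(1) r eventually_nhds_in_open[of "l -` ball (l s) r" s] by (simp add: open_vimage)
    have others: "\<forall>\<^sub>F s' in nhds s. \<forall>f\<in>H - {e}. h f s' = h f s"
    proof (intro eventually_ball_finite ballI h_const)
      fix f assume "f \<in> H - {e}"
      then show "s \<noteq> c f" using only[of f] by (auto simp: H_def)
    qed (use finH in auto)
    have "\<forall>\<^sub>F s' in nhds s. F s' = G s' + (\<Sum>f\<in>H - {e}. h f s)"
      using near others
    proof eventually_elim
      case (elim s')
      have kin: "k s' = 1" if "(s' - s) * a e < 0"
        using lower[OF elim(1)] that height[of s'] closure_subset[of K] by (auto simp: k_def indicator_def)
      have kout: "k s' = 0" if "(s' - s) * a e > 0"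
        using upper[OF elim(1)] that height[of s'] by (auto simp: k_def indicator_def)
      have ks: "k s = 1" using True by (auto simp: k_def indicator_def frontier_def)
      have "k s' * g s' + h e s' = G s'"
      proof (cases "s' = s")
        case True then show ?thesis using ks se by (simp add: G_def h_def)
      next
        case False
        then consider "a e > 0" "s' < s" | "a e > 0" "s' > s" | "a e < 0" "s' < s" | "a e < 0" "s' > s"
          using a0 by linarith
        then show ?thesis
          by cases (use kin kout se in \<open>auto simp: G_def h_def min_def max_def mult_less_0_iff zero_less_mult_iff\<close>)
      qed
      then show ?case using elim(2) finH se by (simp add: F_def sum.remove)
    qed
    moreover have "isCont (\<lambda>s'. G s' + (\<Sum>f\<in>H - {e}. h f s)) s"
    proof -
      have "isCont (\<lambda>s'. g (min s' s)) s" "isCont (\<lambda>s'. g (max s' s)) s"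
        by (rule isCont_o2[where g = g], intro continuous_intros, rule gc)+
      then show ?thesis unfolding G_def by (cases "a e > 0") (auto intro!: continuous_intros)
    qed
    ultimately show ?thesis using isCont_cong by fastforce
  qed
  have "((\<lambda>s. k s * f' (l s)) has_integral (F (1/2) - F (-1/2))) {-1/2..1/2}"
  proof (rule fundamental_theorem_of_calculus_interior_strong)
    show "finite (c ` H)" using finH by simp
    show "continuous_on {-1/2..1/2} F" using cont by (simp add: continuous_at_imp_continuous_on)
    show "(F has_vector_derivative k s * f' (l s)) (at s)" if "s \<in> {-1/2<..<1/2} - c ` H" for s
      using deriv[of s] that frontier_hit[of s]
      by (auto simp: has_real_derivative_iff_has_vector_derivative)
  qed simp
  moreover have "F (1/2) - F (-1/2) = k (1/2) * g (1/2) - k (-1/2) * g (-1/2) +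
      (\<Sum>e\<in>E. sgn (a e) * (indicator {-1/2..1/2} (c e) * (indicator e (l (c e)) * g (c e))))"
  proof -
    \<comment> \<open>Since no crossing is at an end point, strict and weak inequality in
      \<open>h\<close> agree there.\<close>
    have ends: "c e \<noteq> 1/2" "c e \<noteq> -1/2" if "e \<in> H" for e
      using y frontier_hit[of "1/2"] frontier_hit[of "-1/2"] that by (auto simp: transversal_def l_def)
    have "(\<Sum>e\<in>H. h e (1/2)) - (\<Sum>e\<in>H. h e (-1/2)) = (\<Sum>e\<in>H. h e (1/2) - h e (-1/2))"
      by (simp add: sum_subtractf)
    also have "\<dots> = (\<Sum>e\<in>H. sgn (a e) * (indicator {-1/2..1/2} (c e) * (indicator e (l (c e)) * g (c e))))"
    proof (rule sum.cong[OF refl])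
      fix e assume e: "e \<in> H"
      have "a e \<noteq> 0" "l (c e) \<in> e" using e by (auto simp: H_def)
      then show "h e (1/2) - h e (-1/2) = sgn (a e) * (indicator {-1/2..1/2} (c e) * (indicator e (l (c e)) * g (c e)))"
        using ends[OF e] by (cases "a e > 0") (auto simp: h_def indicator_def)
    qed
    also have "\<dots> = (\<Sum>e\<in>E. sgn (a e) * (indicator {-1/2..1/2} (c e) * (indicator e (l (c e)) * g (c e))))"
      by (rule sum.mono_neutral_left[OF finite_E]) (auto simp: H_def indicator_def)
    finally show ?thesis by (simp add: F_def)
  qed
  ultimately show ?thesis by (simp add: k_def g_def l_def c_def a_def)
qed

end

section \<open>Averaging the line identity over translations\<close>

lemma lborel_translate:
  fixes f :: "'a::euclidean_space \<Rightarrow> real"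
  assumes f: "f \<in> borel_measurable borel"
  shows integral_lborel_translate: "(\<integral>y. f (c + y) \<partial>lborel) = (\<integral>y. f y \<partial>lborel)"
    and integrable_lborel_translate: "integrable lborel (\<lambda>y. f (c + y)) \<longleftrightarrow> integrable lborel f"
proof -
  have "(\<integral>y. f y \<partial>distr lborel borel ((+) c)) = (\<integral>y. f (c + y) \<partial>lborel)"
    by (rule integral_distr) (use f in auto)
  then show "(\<integral>y. f (c + y) \<partial>lborel) = (\<integral>y. f y \<partial>lborel)" by (simp add: lborel_distr_plus)
  have "integrable (distr lborel borel ((+) c)) f \<longleftrightarrow> integrable lborel (\<lambda>y. f (c + y))"
    by (rule integrable_distr_eq) (use f in auto)
  then show "integrable lborel (\<lambda>y. f (c + y)) \<longleftrightarrow> integrable lborel f" by (simp add: lborel_distr_plus)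
qed

context polytopal_cell
begin

lemma compact_closure_K: "compact (closure K)"
  using bounded_K by (simp add: compact_closure)

lemma integrable_closure_K:
  "continuous_on UNIV f \<Longrightarrow> integrable lborel (\<lambda>x. indicator (closure K) x * (f x :: real))"
  using borel_integrable_compact[OF compact_closure_K, of f] continuous_on_subset by fastforce

text \<open>The segment of parameters has length 1, so averaging \<open>f'\<close> over it and over
  all base points returns its integral. The end terms of the line identity are translates of one
  function and cancel; each crossing term is an oblique slab integral, with weight
  \<open>\<bar>\<nu> e \<bullet> \<omega>\<bar>\<close>, and the sign of the step completes the
  flux.\<close>

lemma divergence:
  fixes f f' :: "'a \<Rightarrow> real"
  assumes f': "\<And>x s. ((\<lambda>s. f (x + s *\<^sub>R \<omega>)) has_real_derivative f' (x + s *\<^sub>R \<omega>)) (at s)"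
    and cf: "continuous_on UNIV f" and cf': "continuous_on UNIV f'"
  shows "(LINT x:K|lborel. f' x) = (\<Sum>e\<in>E. (\<nu> e \<bullet> \<omega>) * (LINT x:e|surface_measure e. f x))"
proof -
  interpret lborel_pair: pair_sigma_finite "lborel :: real measure" "lborel :: 'a measure" ..
  define F where "F = (\<lambda>x. indicator (closure K) x * f' x)"
  define P where "P = (\<lambda>x. indicator (closure K) x * f x)"
  define T where "T = (\<lambda>e y. indicator {-1/2..1/2} (crossing \<omega> e y) *
           (indicator e (y + crossing \<omega> e y *\<^sub>R \<omega>) * f (y + crossing \<omega> e y *\<^sub>R \<omega>)))"
  have F: "integrable lborel F" unfolding F_def by (rule integrable_closure_K[OF cf'])
  have P: "integrable lborel P" unfolding P_def by (rule integrable_closure_K[OF cf])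
  have Fm[measurable]: "F \<in> borel_measurable borel" using borel_measurable_integrable[OF F] by simp
  have Pm[measurable]: "P \<in> borel_measurable borel" using borel_measurable_integrable[OF P] by simp
  have T_eq: "T e = (\<lambda>y. indicator {-1/2..1/2} ((\<nu> e \<bullet> y - \<alpha> e) / (\<nu> e \<bullet> \<omega>)) *
      (indicator e (y - ((\<nu> e \<bullet> y - \<alpha> e) / (\<nu> e \<bullet> \<omega>)) *\<^sub>R \<omega>) *
       f (y - ((\<nu> e \<bullet> y - \<alpha> e) / (\<nu> e \<bullet> \<omega>)) *\<^sub>R \<omega>)))" for e
  proof -
    have "indicator {-1/2..1/2} (- t) = (indicator {-1/2..1/2} t :: real)" for t :: real
      by (auto simp: indicator_def)
    then show ?thesis unfolding T_def crossing_def by (simp only: scaleR_minus_left) simp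
  qed
  have cfe: "continuous_on e f" for e using cf continuous_on_subset by blast
  have Ti: "integrable lborel (T e)" if "e \<in> E" for e
    unfolding T_eq by (rule integrable_oblique_slab[OF compact_face[OF that] cfe])
  have T: "sgn (\<nu> e \<bullet> \<omega>) * (\<integral>y. T e y \<partial>lborel) = (\<nu> e \<bullet> \<omega>) * (LINT x:e|surface_measure e. f x)" if e: "e \<in> E" for e
  proof (cases "\<nu> e \<bullet> \<omega> = 0")
    case False
    have ce: "closed e" using compact_face[OF e] by (rule compact_imp_closed)
    have "(\<lambda>x. indicator e x * f x) \<in> borel_measurable borel"
      using borel_measurable_continuous_on_indicator[OF borel_closed[OF ce] cfe] by simp
    from integral_oblique_slab[OF norm_\<nu>[OF e] False this, of "\<alpha> e"]
    have "(\<integral>y. T e y \<partial>lborel) = \<bar>\<nu> e \<bullet> \<omega>\<bar> * (LINT x:e|surface_measure e. f x)"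
      unfolding T_eq set_integral_surface_measure[OF norm_\<nu>[OF e] hull[OF e] ce cfe] .
    then show ?thesis by (simp add: sgn_mult_abs mult.assoc[symmetric])
  qed simp
  define \<phi> where "\<phi> = (\<lambda>s y. indicator {-1/2..1/2::real} s * F (s *\<^sub>R \<omega> + y))"
  have \<phi>m[measurable]: "case_prod \<phi> \<in> borel_measurable (lborel \<Otimes>\<^sub>M lborel)"
    unfolding \<phi>_def by measurable
  have \<phi>y: "(\<integral>y. \<phi> s y \<partial>lborel) = indicator {-1/2..1/2} s * (\<integral>x. F x \<partial>lborel)" for s
    by (simp add: \<phi>_def integral_lborel_translate)
  have ind: "integrable lborel (\<lambda>s. indicator {-1/2..1/2::real} s * c)"
      "(\<integral>s. indicator {-1/2..1/2::real} s * c \<partial>lborel) = c" for c :: real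
    by simp_all
  have "integrable (lborel \<Otimes>\<^sub>M lborel) (case_prod \<phi>)"
  proof (rule lborel_pair.Fubini_integrable[OF \<phi>m])
    have "(\<integral>y. norm (case_prod \<phi> (s, y)) \<partial>lborel) = indicator {-1/2..1/2} s * (\<integral>x. \<bar>F x\<bar> \<partial>lborel)" for s
      using integral_lborel_translate[of "\<lambda>x. \<bar>F x\<bar>" "s *\<^sub>R \<omega>"] by (simp add: \<phi>_def abs_mult)
    then show "integrable lborel (\<lambda>s. \<integral>y. norm (case_prod \<phi> (s, y)) \<partial>lborel)" using ind(1) by simp
    show "AE s in lborel. integrable lborel (\<lambda>y. case_prod \<phi> (s, y))"
      using F by (simp add: \<phi>_def integrable_lborel_translate)
  qed
  then have "(\<integral>y. (\<integral>s. \<phi> s y \<partial>lborel) \<partial>lborel) = (\<integral>s. (\<integral>y. \<phi> s y \<partial>lborel) \<partial>lborel)"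
    by (rule lborel_pair.Fubini_integral)
  also have "\<dots> = (\<integral>x. F x \<partial>lborel)" by (simp add: \<phi>y ind(2))
  finally have int_F: "(\<integral>x. F x \<partial>lborel) = (\<integral>y. (\<integral>s. \<phi> s y \<partial>lborel) \<partial>lborel)" by simp
  have line: "(\<integral>s. \<phi> s y \<partial>lborel) = P ((1/2) *\<^sub>R \<omega> + y) - P ((-1/2) *\<^sub>R \<omega> + y) + (\<Sum>e\<in>E. sgn (\<nu> e \<bullet> \<omega>) * T e y)"
    if y: "transversal \<omega> y" for y
  proof -
    obtain B where B: "\<And>x. x \<in> closure K \<Longrightarrow> norm (f' x) \<le> B"
      using compact_imp_bounded[OF compact_continuous_image[OF continuous_on_subset[OF cf'] compact_closure_K]]
      by (auto simp: bounded_iff)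
    have "(\<lambda>s. \<phi> s y) \<in> borel_measurable lborel" unfolding \<phi>_def by measurable
    moreover have "\<bar>F x\<bar> \<le> max B 0" for x
      using B[of x] by (auto simp: F_def indicator_def)
    ultimately have "integrable lborel (\<lambda>s. \<phi> s y)"
      by (intro integrableI_bounded_set[where A = "{-1/2..1/2}" and B = "max B 0"])
         (auto simp: \<phi>_def indicator_def)
    then have si: "set_integrable lborel {-1/2..1/2} (\<lambda>s. F (s *\<^sub>R \<omega> + y))"
      by (simp add: set_integrable_def \<phi>_def)
    have "(\<integral>s. \<phi> s y \<partial>lborel) = (LINT s:{-1/2..1/2}|lborel. F (s *\<^sub>R \<omega> + y))"
      by (simp add: set_lebesgue_integral_def \<phi>_def)
    also have "\<dots> = integral {-1/2..1/2} (\<lambda>s. F (s *\<^sub>R \<omega> + y))"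
      by (rule set_borel_integral_eq_integral(2)[OF si])
    also have "\<dots> = P ((1/2) *\<^sub>R \<omega> + y) - P ((-1/2) *\<^sub>R \<omega> + y) + (\<Sum>e\<in>E. sgn (\<nu> e \<bullet> \<omega>) * T e y)"
      using line_integral[OF y f'] by (intro integral_unique) (simp add: F_def P_def T_def add.commute)
    finally show ?thesis .
  qed
  have P_tr: "integrable lborel (\<lambda>y. P (c + y))" "(\<integral>y. P (c + y) \<partial>lborel) = (\<integral>x. P x \<partial>lborel)" for c
    using P by (simp_all add: integrable_lborel_translate integral_lborel_translate)
  have mT[measurable]: "T e \<in> borel_measurable borel" if "e \<in> E" for e
    using borel_measurable_integrable[OF Ti[OF that]] by simp
  have "(\<integral>y. (\<integral>s. \<phi> s y \<partial>lborel) \<partial>lborel) =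
      (\<integral>y. P ((1/2) *\<^sub>R \<omega> + y) - P ((-1/2) *\<^sub>R \<omega> + y) + (\<Sum>e\<in>E. sgn (\<nu> e \<bullet> \<omega>) * T e y) \<partial>lborel)"
  proof (rule integral_cong_AE)
    show "(\<lambda>y. \<integral>s. \<phi> s y \<partial>lborel) \<in> borel_measurable lborel"
      unfolding \<phi>_def by measurable
    show "AE y in lborel. (\<integral>s. \<phi> s y \<partial>lborel) =
        P ((1/2) *\<^sub>R \<omega> + y) - P ((-1/2) *\<^sub>R \<omega> + y) + (\<Sum>e\<in>E. sgn (\<nu> e \<bullet> \<omega>) * T e y)"
      using AE_transversal[of \<omega>] by eventually_elim (rule line)
  qed (auto intro!: borel_measurable_add borel_measurable_diff borel_measurable_sum borel_measurable_times mT)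
  also have "\<dots> = (\<Sum>e\<in>E. sgn (\<nu> e \<bullet> \<omega>) * (\<integral>y. T e y \<partial>lborel))"
  proof -
    have "(\<integral>y. P (c + y) - P (c' + y) + (\<Sum>e\<in>E. sgn (\<nu> e \<bullet> \<omega>) * T e y) \<partial>lborel) =
        (\<Sum>e\<in>E. sgn (\<nu> e \<bullet> \<omega>) * (\<integral>y. T e y \<partial>lborel))" for c c'
      using P_tr Ti by simp
    then show ?thesis .
  qed
  also have "\<dots> = (\<Sum>e\<in>E. (\<nu> e \<bullet> \<omega>) * (LINT x:e|surface_measure e. f x))"
    by (intro sum.cong refl T)
  finally have "(\<integral>x. F x \<partial>lborel) = (\<Sum>e\<in>E. (\<nu> e \<bullet> \<omega>) * (LINT x:e|surface_measure e. f x))"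
    using int_F by simp
  moreover have "(\<integral>x. F x \<partial>lborel) = (LINT x:K|lborel. f' x)"
    unfolding set_lebesgue_integral_def
  proof (rule integral_cong_AE)
    have "continuous_on K f'" using cf' continuous_on_subset by blast
    then show "(\<lambda>x. indicator K x *\<^sub>R f' x) \<in> borel_measurable lborel"
      using borel_measurable_continuous_on_indicator[of K f'] open_K by simp
    have "AE x in lborel. x \<notin> frontier K" by (rule AE_lborel_not_negligible[OF negligible_frontier])
    then show "AE x in lborel. F x = indicator K x *\<^sub>R f' x"
      by eventually_elim (use open_K closure_subset[of K] in \<open>auto simp: F_def frontier_def interior_open indicator_def\<close>)
  qed simp
  ultimately show ?thesis by simp
qed

end

section \<open>Polynomials and broken spaces\<close>

lemma sum_fun_apply: "(\<Sum>i\<in>S. f i) x = (\<Sum>i\<in>S. f i x)"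
  by (induction S rule: infinite_finite_induct) auto

lemma fun_comb: "(\<lambda>x. s * u x + t * v x) = s *\<^sub>R u + t *\<^sub>R (v :: 'a \<Rightarrow> real)"
  by (simp add: fun_eq_iff)

definition exponents :: "nat \<Rightarrow> ('a::euclidean_space \<Rightarrow> nat) set" where
  "exponents p = {\<alpha> \<in> Basis \<rightarrow>\<^sub>E {..p}. (\<Sum>i\<in>Basis. \<alpha> i) \<le> p}"

definition monomial :: "('a::euclidean_space \<Rightarrow> nat) \<Rightarrow> 'a \<Rightarrow> real" where
  "monomial \<alpha> x = (\<Prod>i\<in>Basis. (x \<bullet> i) ^ \<alpha> i)"

lemma finite_exponents: "finite (exponents p :: ('a::euclidean_space \<Rightarrow> nat) set)"
proof -
  have "finite (Basis \<rightarrow>\<^sub>E {..p} :: ('a \<Rightarrow> nat) set)" by (rule finite_PiE) auto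
  then show ?thesis unfolding exponents_def by (rule finite_subset[rotated]) auto
qed

lemma polys_altdef:
  "(q :: 'a::euclidean_space \<Rightarrow> real) \<in> polys p \<longleftrightarrow> (\<exists>c. q = (\<Sum>\<alpha>\<in>exponents p. c \<alpha> *\<^sub>R monomial \<alpha>))"
  unfolding polys_def exponents_def[symmetric]
  by (simp add: fun_eq_iff sum_fun_apply monomial_def)

lemma monomial_in_polys:
  assumes "\<alpha> \<in> exponents p" shows "monomial \<alpha> \<in> polys p"
proof -
  have "(\<Sum>\<beta>\<in>exponents p. (if \<beta> = \<alpha> then 1 else 0) *\<^sub>R monomial \<beta>) = (\<Sum>\<beta>\<in>exponents p. if \<alpha> = \<beta> then monomial \<beta> else 0)"
    by (rule sum.cong) auto
  also have "\<dots> = monomial \<alpha>"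
    using assms by (simp add: sum.delta finite_exponents)
  finally show ?thesis unfolding polys_altdef by (intro exI[of _ "\<lambda>\<beta>. if \<beta> = \<alpha> then 1 else 0"]) simp
qed

lemma subspace_polys: "subspace (polys p :: ('a::euclidean_space \<Rightarrow> real) set)"
proof (rule subspaceI)
  show "0 \<in> (polys p :: ('a \<Rightarrow> real) set)" unfolding polys_altdef by (intro exI[of _ "\<lambda>_. 0"]) simp
  fix x y :: "'a \<Rightarrow> real" and c :: real
  assume x: "x \<in> polys p"
  then obtain a where a: "x = (\<Sum>\<alpha>\<in>exponents p. a \<alpha> *\<^sub>R monomial \<alpha>)" unfolding polys_altdef by blast
  show "c *\<^sub>R x \<in> polys p"
    unfolding polys_altdef a by (intro exI[of _ "\<lambda>\<alpha>. c * a \<alpha>"]) (simp add: scaleR_sum_right)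
  assume "y \<in> polys p"
  then obtain b where b: "y = (\<Sum>\<alpha>\<in>exponents p. b \<alpha> *\<^sub>R monomial \<alpha>)" unfolding polys_altdef by blast
  show "x + y \<in> polys p"
    unfolding polys_altdef a b by (intro exI[of _ "\<lambda>\<alpha>. a \<alpha> + b \<alpha>"]) (simp add: sum.distrib scaleR_left_distrib)
qed

lemma polys_const: "(\<lambda>x::'a::euclidean_space. c) \<in> polys p"
proof -
  have "restrict (\<lambda>_. 0) Basis \<in> exponents p" by (simp add: exponents_def)
  from monomial_in_polys[OF this] have "c *\<^sub>R monomial (restrict (\<lambda>_. 0) (Basis :: 'a set)) \<in> polys p"
    by (rule subspace_scale[OF subspace_polys])
  moreover have "c *\<^sub>R monomial (restrict (\<lambda>_. 0) (Basis :: 'a set)) = (\<lambda>x. c)"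
    by (simp add: fun_eq_iff monomial_def)
  ultimately show ?thesis by simp
qed

text \<open>Where \<open>\<alpha> i = 0\<close> the truncated subtraction leaves the monomial
  unchanged, but its coefficient is 0.\<close>

lemma monomial_derivative:
  fixes \<alpha> :: "'a::euclidean_space \<Rightarrow> nat"
  shows "(monomial \<alpha> has_derivative
    (\<lambda>y. \<Sum>i\<in>Basis. (y \<bullet> i) * (real (\<alpha> i) * monomial (\<alpha>(i := \<alpha> i - 1)) x))) (at x)"
proof -
  have prod: "monomial (\<alpha>(i := k)) x = (x \<bullet> i) ^ k * (\<Prod>j\<in>Basis - {i}. (x \<bullet> j) ^ \<alpha> j)" if i: "i \<in> Basis" for i k
  proof -
    have "(\<Prod>j\<in>Basis - {i}. (x \<bullet> j) ^ (\<alpha>(i := k)) j) = (\<Prod>j\<in>Basis - {i}. (x \<bullet> j) ^ \<alpha> j)"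
      by (rule prod.cong) auto
    then show ?thesis using i by (simp add: monomial_def prod.remove[OF finite_Basis i])
  qed
  have "((\<lambda>x. \<Prod>i\<in>Basis. (x \<bullet> i) ^ \<alpha> i) has_derivative
     (\<lambda>y. \<Sum>i\<in>Basis. (real (\<alpha> i) * (y \<bullet> i) * (x \<bullet> i) ^ (\<alpha> i - 1)) * (\<Prod>j\<in>Basis - {i}. (x \<bullet> j) ^ \<alpha> j))) (at x)"
    by (rule has_derivative_prod) (auto intro!: derivative_eq_intros)
  moreover have "(\<lambda>x. \<Prod>i\<in>Basis. (x \<bullet> i) ^ \<alpha> i) = monomial \<alpha>" by (simp add: fun_eq_iff monomial_def)
  ultimately have "(monomial \<alpha> has_derivative
     (\<lambda>y. \<Sum>i\<in>Basis. (real (\<alpha> i) * (y \<bullet> i) * (x \<bullet> i) ^ (\<alpha> i - 1)) * (\<Prod>j\<in>Basis - {i}. (x \<bullet> j) ^ \<alpha> j))) (at x)"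
    by (simp only:)
  then show ?thesis
    by (rule has_derivative_eq_rhs) (auto simp: fun_eq_iff prod mult_ac intro!: sum.cong)
qed

text \<open>The drop of the degree is not recorded: what is used is that differentiation maps the
  discrete space into itself.\<close>

lemma polys_derivative:
  fixes q :: "'a::euclidean_space \<Rightarrow> real"
  assumes q: "q \<in> polys p"
  shows "\<exists>g. (\<forall>i\<in>Basis. g i \<in> polys p) \<and>
    (\<forall>x. (q has_derivative (\<lambda>y. \<Sum>i\<in>Basis. (y \<bullet> i) * g i x)) (at x))"
proof -
  obtain c where c: "q = (\<Sum>\<alpha>\<in>exponents p. c \<alpha> *\<^sub>R monomial \<alpha>)" using q unfolding polys_altdef by blast
  define g where "g = (\<lambda>i. \<Sum>\<alpha>\<in>exponents p. (c \<alpha> * real (\<alpha> i)) *\<^sub>R monomial (\<alpha>(i := \<alpha> i - 1)))"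
  have upd: "\<alpha>(i := \<alpha> i - 1) \<in> exponents p" if a: "\<alpha> \<in> exponents p" and i: "i \<in> Basis" for \<alpha> and i :: 'a
  proof -
    have "(\<Sum>j\<in>Basis. (\<alpha>(i := \<alpha> i - 1)) j) \<le> (\<Sum>j\<in>Basis. \<alpha> j)" by (rule sum_mono) auto
    moreover have "\<alpha>(i := \<alpha> i - 1) \<in> Basis \<rightarrow>\<^sub>E {..p}"
    proof (rule PiE_I)
      fix j :: 'a
      have "\<alpha> i \<le> p" "j \<in> Basis \<Longrightarrow> \<alpha> j \<le> p" using a i by (auto simp: exponents_def)
      then show "j \<in> Basis \<Longrightarrow> (\<alpha>(i := \<alpha> i - 1)) j \<in> {..p}" by auto
    next
      fix j :: 'a assume "j \<notin> Basis"
      then show "(\<alpha>(i := \<alpha> i - 1)) j = undefined" using a i by (auto simp: exponents_def)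
    qed
    ultimately show ?thesis using a by (simp add: exponents_def)
  qed
  have "g i \<in> polys p" if "i \<in> Basis" for i
    unfolding g_def
    by (intro subspace_sum[OF subspace_polys] subspace_scale[OF subspace_polys] monomial_in_polys upd that)
  moreover have "(q has_derivative (\<lambda>y. \<Sum>i\<in>Basis. (y \<bullet> i) * g i x)) (at x)" for x
  proof -
    have qe: "q = (\<lambda>x. \<Sum>\<alpha>\<in>exponents p. c \<alpha> * monomial \<alpha> x)" unfolding c by (simp add: fun_eq_iff sum_fun_apply)
    have "((\<lambda>x. \<Sum>\<alpha>\<in>exponents p. c \<alpha> * monomial \<alpha> x) has_derivative
        (\<lambda>y. \<Sum>\<alpha>\<in>exponents p. c \<alpha> * (\<Sum>i\<in>Basis. (y \<bullet> i) * (real (\<alpha> i) * monomial (\<alpha>(i := \<alpha> i - 1)) x)))) (at x)"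
      by (intro has_derivative_sum has_derivative_mult_right monomial_derivative)
    moreover have "(\<Sum>\<alpha>\<in>exponents p. c \<alpha> * (\<Sum>i\<in>Basis. (y \<bullet> i) * (real (\<alpha> i) * monomial (\<alpha>(i := \<alpha> i - 1)) x))) =
        (\<Sum>i\<in>Basis. (y \<bullet> i) * g i x)" for y
      unfolding g_def sum_fun_apply sum_distrib_left
      by (subst sum.swap) (intro sum.cong refl, simp)
    ultimately show ?thesis unfolding qe by simp
  qed
  ultimately show ?thesis by (intro exI[of _ g]) simp
qed

lemma continuous_on_polys:
  assumes "q \<in> polys p" shows "continuous_on S (q :: 'a::euclidean_space \<Rightarrow> real)"
proof -
  obtain g where d: "\<And>x. (q has_derivative (\<lambda>y. \<Sum>i\<in>Basis. (y \<bullet> i) * g i x)) (at x)"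
    using polys_derivative[OF assms] by auto
  have "isCont q x" for x by (rule has_derivative_continuous[OF d])
  then show ?thesis by (rule continuous_at_imp_continuous_on[rule_format])
qed

lemma grad_eqI:
  assumes "GDERIV f x :> (D :: 'a::euclidean_space)" shows "grad f x = D"
  unfolding grad_def
proof (rule the_equality[where P = "\<lambda>D. GDERIV f x :> D", OF assms])
  fix D' assume D': "GDERIV f x :> D'"
  then have "(\<lambda>h. h \<bullet> D') = (\<lambda>h. h \<bullet> D)"
    using assms has_derivative_unique unfolding gderiv_def by blast
  then show "D' = D" by (metis inner_commute vector_eq_ldot)
qed

lemma grad_polys:
  fixes q :: "'a::euclidean_space \<Rightarrow> real"
  assumes q: "q \<in> polys p"
  shows GDERIV_polys: "GDERIV q x :> grad q x"
    and polys_dir_deriv: "(\<lambda>x. \<omega> \<bullet> grad q x) \<in> polys p"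
proof -
  obtain g where g: "\<And>i. i \<in> Basis \<Longrightarrow> g i \<in> polys p"
    and d: "\<And>x. (q has_derivative (\<lambda>y. \<Sum>i\<in>Basis. (y \<bullet> i) * g i x)) (at x)"
    using polys_derivative[OF q] by auto
  have G: "GDERIV q x :> (\<Sum>i\<in>Basis. g i x *\<^sub>R i)" for x
    using d[of x] by (simp add: gderiv_def inner_sum_right mult.commute)
  have e: "grad q x = (\<Sum>i\<in>Basis. g i x *\<^sub>R i)" for x by (rule grad_eqI[OF G])
  show "GDERIV q x :> grad q x" using G e by simp
  have "(\<lambda>x. \<omega> \<bullet> grad q x) = (\<Sum>i\<in>Basis. (\<omega> \<bullet> i) *\<^sub>R g i)"
    by (simp add: fun_eq_iff e inner_sum_right sum_fun_apply mult.commute)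
  then show "(\<lambda>x. \<omega> \<bullet> grad q x) \<in> polys p"
    using subspace_sum[OF subspace_polys, of Basis "\<lambda>i. (\<omega> \<bullet> i) *\<^sub>R g i"] g subspace_scale[OF subspace_polys] by metis
qed

lemma polys_line_derivative:
  fixes q :: "'a::euclidean_space \<Rightarrow> real"
  assumes q: "q \<in> polys p"
  shows "((\<lambda>s. q (x + s *\<^sub>R \<omega>)) has_real_derivative \<omega> \<bullet> grad q (x + s *\<^sub>R \<omega>)) (at s)"
proof -
  have 1: "(q has_derivative (\<lambda>h. h \<bullet> grad q (x + s *\<^sub>R \<omega>))) (at (x + s *\<^sub>R \<omega>))"
    using GDERIV_polys[OF q] by (simp add: gderiv_def)
  have 2: "((\<lambda>s. x + s *\<^sub>R \<omega>) has_derivative (\<lambda>h. h *\<^sub>R \<omega>)) (at s)" by (auto intro!: derivative_eq_intros)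
  show ?thesis
    using has_derivative_compose[OF 2 1] unfolding has_field_derivative_def
    by (rule has_derivative_eq_rhs) (auto simp: fun_eq_iff)
qed

lemma grad_cong_open:
  assumes "open K" "x \<in> K" "\<And>y. y \<in> K \<Longrightarrow> u y = q y" and q: "GDERIV q x :> grad q x"
  shows "grad u x = grad (q :: 'a::euclidean_space \<Rightarrow> real) x" "GDERIV u x :> grad q x"
proof -
  show G: "GDERIV u x :> grad q x"
    using has_derivative_transform_within_open[OF q[unfolded gderiv_def] assms(1,2)] assms(3)
    by (simp add: gderiv_def)
  show "grad u x = grad q x" by (rule grad_eqI[OF G])
qed

locale broken_space =
  fixes M :: "'a::euclidean_space mesh" and p :: nat
  assumes mesh: "polytopic_mesh M"
begin

abbreviation "V \<equiv> Vh M p"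

lemma fin_cells: "finite (cells M)" and fin_faces: "finite (faces M)"
  using mesh by (auto simp: polytopic_mesh_def)

lemma cell: assumes "K \<in> cells M" shows "open K" "bounded K" "K \<noteq> {}" "K \<subseteq> dom_of M"
  using mesh assms by (auto simp: polytopic_mesh_def lipschitz_polytope_def)

lemma cells_disjoint: "K \<in> cells M \<Longrightarrow> K' \<in> cells M \<Longrightarrow> x \<in> K \<Longrightarrow> x \<in> K' \<Longrightarrow> K = K'"
proof -
  assume K: "K \<in> cells M" "K' \<in> cells M" "x \<in> K" "x \<in> K'"
  have "disjoint (cells M)" using mesh unfolding polytopic_mesh_def by (elim conjE)
  from disjointD[OF this K(1,2)] show "K = K'" using K by auto
qed

text \<open>The polynomial continues \<open>u\<close> from the open cell to the whole space, which
  supplies traces on the closed cell and smooth integrands for the divergence theorem.\<close>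

definition rep :: "'a set \<Rightarrow> ('a \<Rightarrow> real) \<Rightarrow> 'a \<Rightarrow> real" where
  "rep K u = (SOME q. q \<in> polys p \<and> (\<forall>x\<in>K. u x = q x))"

lemma rep:
  assumes "u \<in> V" "K \<in> cells M"
  shows rep_polys: "rep K u \<in> polys p" and rep_eq: "x \<in> K \<Longrightarrow> u x = rep K u x"
proof -
  have "\<exists>q. q \<in> polys p \<and> (\<forall>x\<in>K. u x = q x)" using assms by (auto simp: Vh_def)
  from someI_ex[OF this] show "rep K u \<in> polys p" "x \<in> K \<Longrightarrow> u x = rep K u x" by (auto simp: rep_def)
qed

lemma Vh_0: "u \<in> V \<Longrightarrow> x \<notin> \<Union>(cells M) \<Longrightarrow> u x = 0"
  by (simp add: Vh_def)

lemma VhI: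
  assumes "\<And>K. K \<in> cells M \<Longrightarrow> \<exists>q\<in>polys p. \<forall>x\<in>K. u x = q x" "\<And>x. x \<notin> \<Union>(cells M) \<Longrightarrow> u x = 0"
  shows "u \<in> V"
  using assms by (auto simp: Vh_def)

lemma subspace_V: "subspace V"
proof (rule subspaceI)
  show "0 \<in> V" by (rule VhI) (auto intro!: bexI[of _ 0] subspace_0 subspace_polys)
  fix x y :: "'a \<Rightarrow> real" and c :: real
  assume x: "x \<in> V"
  show "c *\<^sub>R x \<in> V"
  proof (rule VhI)
    fix K assume K: "K \<in> cells M"
    show "\<exists>q\<in>polys p. \<forall>z\<in>K. (c *\<^sub>R x) z = q z"
      using subspace_scale[OF subspace_polys rep_polys[OF x K], of c] rep_eq[OF x K]
      by (intro bexI[of _ "c *\<^sub>R rep K x"]) auto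
  qed (use Vh_0[OF x] in auto)
  assume y: "y \<in> V"
  show "x + y \<in> V"
  proof (rule VhI)
    fix K assume K: "K \<in> cells M"
    show "\<exists>q\<in>polys p. \<forall>z\<in>K. (x + y) z = q z"
      using subspace_add[OF subspace_polys rep_polys[OF x K] rep_polys[OF y K]] rep_eq[OF x K] rep_eq[OF y K]
      by (intro bexI[of _ "rep K x + rep K y"]) auto
  qed (use Vh_0[OF x] Vh_0[OF y] in auto)
qed

lemma fin_dim_V: "fin_dim V"
  unfolding fin_dim_def
proof (intro exI conjI subsetI)
  define B where "B = (\<lambda>(K, \<alpha>) x. if x \<in> K then monomial \<alpha> x else 0) ` (cells M \<times> exponents p)"
  show "finite B" by (simp add: B_def fin_cells finite_exponents)
  fix u assume u: "u \<in> V"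
  have "\<forall>K\<in>cells M. \<exists>c. rep K u = (\<Sum>\<alpha>\<in>exponents p. c \<alpha> *\<^sub>R monomial \<alpha>)"
    using rep_polys[OF u] polys_altdef by blast
  then obtain c where c: "\<And>K. K \<in> cells M \<Longrightarrow> rep K u = (\<Sum>\<alpha>\<in>exponents p. c K \<alpha> *\<^sub>R monomial \<alpha>)" by metis
  have "(\<Sum>K\<in>cells M. \<Sum>\<alpha>\<in>exponents p. c K \<alpha> *\<^sub>R (\<lambda>x. if x \<in> K then monomial \<alpha> x else 0)) \<in> span B"
    by (intro span_sum span_scale span_base) (auto simp: B_def)
  also have "(\<Sum>K\<in>cells M. \<Sum>\<alpha>\<in>exponents p. c K \<alpha> *\<^sub>R (\<lambda>x. if x \<in> K then monomial \<alpha> x else 0)) = u"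
  proof
    fix x
    have "(\<Sum>K\<in>cells M. \<Sum>\<alpha>\<in>exponents p. c K \<alpha> *\<^sub>R (\<lambda>x. if x \<in> K then monomial \<alpha> x else 0)) x =
        (\<Sum>K\<in>cells M. if x \<in> K then u x else 0)"
    proof (unfold sum_fun_apply, rule sum.cong[OF refl])
      fix K assume K: "K \<in> cells M"
      show "(\<Sum>\<alpha>\<in>exponents p. (c K \<alpha> *\<^sub>R (\<lambda>x. if x \<in> K then monomial \<alpha> x else 0)) x) = (if x \<in> K then u x else 0)"
        using rep_eq[OF u K, of x] by (simp add: c[OF K] sum_fun_apply)
    qed
    also have "\<dots> = u x"
    proof (cases "x \<in> \<Union>(cells M)")
      case True
      then obtain K where K: "K \<in> cells M" "x \<in> K" by blast
      have "(\<Sum>K\<in>cells M. if x \<in> K then u x else 0) = (\<Sum>K'\<in>cells M. if K' = K then u x else 0)"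
        by (rule sum.cong) (use K cells_disjoint in auto)
      then show ?thesis using K fin_cells by simp
    qed (auto simp: Vh_0[OF u] intro!: sum.neutral)
    finally show "(\<Sum>K\<in>cells M. \<Sum>\<alpha>\<in>exponents p. c K \<alpha> *\<^sub>R (\<lambda>x. if x \<in> K then monomial \<alpha> x else 0)) x = u x" .
  qed
  finally show "u \<in> span B" .
qed

text \<open>The value 0 off the cells is the normalisation of the broken space, so derivatives can
  again be used as trial and test functions.\<close>

definition dd :: "'a \<Rightarrow> ('a \<Rightarrow> real) \<Rightarrow> 'a \<Rightarrow> real" where
  "dd \<omega> u x = (if x \<in> \<Union>(cells M) then \<omega> \<bullet> grad u x else 0)"

lemma grad_rep:
  assumes "u \<in> V" "K \<in> cells M" "x \<in> K"
  shows "grad u x = grad (rep K u) x" "GDERIV u x :> grad u x"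
  using grad_cong_open[OF cell(1)[OF assms(2)] assms(3) rep_eq[OF assms(1,2)] GDERIV_polys[OF rep_polys[OF assms(1,2)]]]
  by auto

lemma dd_eq: "u \<in> V \<Longrightarrow> K \<in> cells M \<Longrightarrow> x \<in> K \<Longrightarrow> dd \<omega> u x = \<omega> \<bullet> grad (rep K u) x"
  by (auto simp: dd_def grad_rep)

lemma dd_in: assumes u: "u \<in> V" shows "dd \<omega> u \<in> V"
proof (rule VhI)
  fix K assume K: "K \<in> cells M"
  show "\<exists>q\<in>polys p. \<forall>x\<in>K. dd \<omega> u x = q x"
    by (intro bexI[of _ "\<lambda>x. \<omega> \<bullet> grad (rep K u) x"] ballI polys_dir_deriv[OF rep_polys[OF u K]]) (rule dd_eq[OF u K])
qed (auto simp: dd_def)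

lemma dd_lin:
  assumes u: "u \<in> V" and v: "v \<in> V"
  shows "dd \<omega> (s *\<^sub>R u + t *\<^sub>R v) = s *\<^sub>R dd \<omega> u + t *\<^sub>R dd \<omega> v"
proof
  fix x
  show "dd \<omega> (s *\<^sub>R u + t *\<^sub>R v) x = (s *\<^sub>R dd \<omega> u + t *\<^sub>R dd \<omega> v) x"
  proof (cases "x \<in> \<Union>(cells M)")
    case True
    then obtain K where K: "K \<in> cells M" "x \<in> K" by blast
    have "GDERIV (s *\<^sub>R u + t *\<^sub>R v) x :> s *\<^sub>R grad u x + t *\<^sub>R grad v x"
      using grad_rep(2)[OF u K] grad_rep(2)[OF v K]
      unfolding gderiv_def fun_comb[symmetric]
      by (auto intro!: derivative_eq_intros simp: inner_add_right)
    then have "grad (s *\<^sub>R u + t *\<^sub>R v) x = s *\<^sub>R grad u x + t *\<^sub>R grad v x" by (rule grad_eqI)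
    then show ?thesis using True by (simp add: dd_def inner_add_right)
  qed (simp add: dd_def)
qed

lemma dd_lin_dir: "dd (s *\<^sub>R \<omega> + t *\<^sub>R \<omega>') u = s *\<^sub>R dd \<omega> u + t *\<^sub>R dd \<omega>' u"
  by (auto simp: fun_eq_iff dd_def inner_add_left)

lemma dd_minus: "dd (- \<omega>) u = - dd \<omega> u"
  by (auto simp: fun_eq_iff dd_def)

lemma set_integrable_cell:
  assumes K: "K \<in> cells M" and f: "continuous_on UNIV f" and eq: "\<And>x. x \<in> K \<Longrightarrow> g x = (f x :: real)"
  shows "set_integrable lborel K g"
proof -
  have "set_integrable lborel (closure K) f"
    unfolding set_integrable_def
    by (rule borel_integrable_compact) (use cell[OF K] f in \<open>auto simp: compact_closure intro: continuous_on_subset\<close>)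
  then have "set_integrable lborel K f"
    by (rule set_integrable_subset) (use cell[OF K] closure_subset in \<open>auto simp: open_Int\<close>)
  then show ?thesis
    unfolding set_integrable_def
    by (rule Bochner_Integration.integrable_cong[THEN iffD1, rotated -1]) (auto simp: indicator_def eq)
qed

lemma ip_integrable:
  assumes u: "u \<in> V" and v: "v \<in> V" and K: "K \<in> cells M"
  shows "set_integrable lborel K (\<lambda>x. u x * v x)"
  by (rule set_integrable_cell[OF K, where f = "\<lambda>x. rep K u x * rep K v x"])
     (simp_all add: rep_eq[OF u K] rep_eq[OF v K]
       continuous_on_mult[OF continuous_on_polys[OF rep_polys[OF u K]] continuous_on_polys[OF rep_polys[OF v K]]])

lemma ip_real: "ip S f g = (LINT x:S|lborel. f x * (g x :: real))"
  by (simp add: ip_def)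

lemma ip_cell_psd: assumes K: "K \<in> cells M" shows "psd_form V (ip K)"
proof
  fix u v w :: "'a \<Rightarrow> real" and s t :: real
  assume uvw: "u \<in> V" "v \<in> V" "w \<in> V"
  have "ip K (s *\<^sub>R u + t *\<^sub>R v) w = (LINT x:K|lborel. s * (u x * w x) + t * (v x * w x))"
    by (simp add: ip_real algebra_simps)
  also have "\<dots> = s * ip K u w + t * ip K v w"
    unfolding ip_real
    by (subst set_integral_add(2)) (simp_all add: ip_integrable uvw K)
  finally show l: "ip K (s *\<^sub>R u + t *\<^sub>R v) w = s * ip K u w + t * ip K v w" .
  have c: "ip K f g = ip K g f" for f g :: "'a \<Rightarrow> real" by (simp add: ip_real mult.commute)
  show "ip K w (s *\<^sub>R u + t *\<^sub>R v) = s * ip K w u + t * ip K w v"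
    using l by (simp only: c[of w])
next
  fix v :: "'a \<Rightarrow> real"
  show "0 \<le> ip K v v" unfolding ip_real set_lebesgue_integral_def
    by (intro Bochner_Integration.integral_nonneg) auto
next
  fix u v :: "'a \<Rightarrow> real"
  show "ip K u v = ip K v u" by (simp add: ip_real mult.commute)
qed (rule subspace_V)

lemma ip_dom:
  assumes u: "u \<in> V" and v: "v \<in> V"
  shows "ip (dom_of M) u v = (\<Sum>K\<in>cells M. ip K u v)"
proof -
  have "indicator (dom_of M) x *\<^sub>R (u x * v x) = (\<Sum>K\<in>cells M. indicator K x *\<^sub>R (u x * v x))" for x
  proof (cases "x \<in> \<Union>(cells M)")
    case True
    then obtain K where K: "K \<in> cells M" "x \<in> K" by blast
    have "(\<Sum>K\<in>cells M. indicator K x *\<^sub>R (u x * v x)) = (\<Sum>K'\<in>cells M. if K' = K then u x * v x else 0)"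
      by (rule sum.cong) (use K cells_disjoint in \<open>auto simp: indicator_def\<close>)
    then show ?thesis using K fin_cells cell(4)[OF K(1)] by (auto simp: indicator_def)
  qed (simp add: Vh_0[OF u])
  then have "ip (dom_of M) u v = (\<integral>x. (\<Sum>K\<in>cells M. indicator K x *\<^sub>R (u x * v x)) \<partial>lborel)"
    unfolding ip_real set_lebesgue_integral_def by simp
  also have "\<dots> = (\<Sum>K\<in>cells M. ip K u v)"
    unfolding ip_real set_lebesgue_integral_def
    by (rule Bochner_Integration.integral_sum) (use ip_integrable[OF u v] in \<open>simp add: set_integrable_def\<close>)
  finally show ?thesis .
qed

abbreviation I :: "('a \<Rightarrow> real) \<Rightarrow> ('a \<Rightarrow> real) \<Rightarrow> real" where "I \<equiv> ip (dom_of M)"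

text \<open>The points of the cell where \<open>v\<close> is nonzero form an open set, and it is
  null; an open null set is empty.\<close>

lemma ip_cell_0_imp:
  assumes K: "K \<in> cells M" and v: "v \<in> V" and 0: "ip K v v = 0" and x: "x \<in> K"
  shows "v x = 0"
proof (rule ccontr)
  assume nz: "v x \<noteq> 0"
  have "AE x in lborel. indicator K x *\<^sub>R (v x * v x) = 0"
    using 0 ip_integrable[OF v v K] unfolding ip_real set_lebesgue_integral_def set_integrable_def
    by (subst (asm) integral_nonneg_eq_0_iff_AE) auto
  then have "AE x in lebesgue. indicator K x *\<^sub>R (v x * v x) = 0" by (rule AE_completion)
  then have "AE x in lebesgue. x \<notin> {x \<in> K. v x \<noteq> 0}" by eventually_elim (auto simp: indicator_def)
  moreover have "open {x \<in> K. v x \<noteq> 0}"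
  proof -
    have "{x \<in> K. v x \<noteq> 0} = K \<inter> rep K v -` (- {0})" using rep_eq[OF v K] by auto
    then show ?thesis
      using continuous_on_polys[OF rep_polys[OF v K], of UNIV] cell(1)[OF K] by (auto intro!: open_Int open_vimage)
  qed
  ultimately have "negligible {x \<in> K. v x \<noteq> 0}"
    unfolding negligible_iff_null_sets by (intro AE_iff_null_sets[THEN iffD2]) auto
  then show False using open_not_negligible[OF \<open>open {x \<in> K. v x \<noteq> 0}\<close>] x nz by blast
qed

lemma I_pd: "pd_form V I"
proof -
  note psd = psd_form.psd[OF ip_cell_psd]
  note comb = bilinear_form.comb_left[OF psd_form.axioms(1)[OF ip_cell_psd]]
    bilinear_form.comb_right[OF psd_form.axioms(1)[OF ip_cell_psd]]
  note [simp] = subspace_add[OF subspace_V] subspace_scale[OF subspace_V]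
  show ?thesis
  proof
    fix u v w :: "'a \<Rightarrow> real" and s t :: real
    assume uvw: "u \<in> V" "v \<in> V" "w \<in> V"
    show "I (s *\<^sub>R u + t *\<^sub>R v) w = s * I u w + t * I v w" "I w (s *\<^sub>R u + t *\<^sub>R v) = s * I w u + t * I w v"
      using uvw by (simp_all add: ip_dom comb sum.distrib sum_distrib_left)
  next
    fix u v :: "'a \<Rightarrow> real"
    show "I u v = I v u" by (simp add: ip_real mult.commute)
  next
    fix v assume v: "v \<in> V"
    show "0 \<le> I v v" using v by (simp add: ip_dom sum_nonneg psd)
    assume nz: "v \<noteq> 0"
    then obtain x where x: "v x \<noteq> 0" by (auto simp: fun_eq_iff)
    then obtain K where K: "K \<in> cells M" "x \<in> K" using Vh_0[OF v] by blast
    have "ip K v v \<noteq> 0" using ip_cell_0_imp[OF K(1) v _ K(2)] x by blast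
    then have "0 < ip K v v" using psd[OF K(1) v] by simp
    then show "0 < I v v" unfolding ip_dom[OF v v] using K fin_cells psd v by (intro sum_pos2) auto
  qed (rule subspace_V)
qed

section \<open>Faces, their two sides, and traces\<close>

lemma face_flat: "e \<in> faces M \<Longrightarrow> flat_face e"
proof -
  have "\<forall>e\<in>faces M. flat_face e" using mesh unfolding polytopic_mesh_def by (elim conjE)
  then show "e \<in> faces M \<Longrightarrow> flat_face e" by blast
qed

lemma face_normal:
  assumes "e \<in> faces M"
  shows "norm (nrm M e) = 1" "x \<in> e \<Longrightarrow> y \<in> e \<Longrightarrow> nrm M e \<bullet> (x - y) = 0"
proof -
  have "\<forall>e\<in>faces M. norm (nrm M e) = 1 \<and> (\<forall>x\<in>e. \<forall>y\<in>e. nrm M e \<bullet> (x - y) = 0)"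
    using mesh unfolding polytopic_mesh_def by (elim conjE)
  then show "norm (nrm M e) = 1" "x \<in> e \<Longrightarrow> y \<in> e \<Longrightarrow> nrm M e \<bullet> (x - y) = 0" using assms by blast+
qed

lemma int_bd: "int_faces M \<inter> bd_faces M = {}"
  using mesh unfolding polytopic_mesh_def by (elim conjE)

lemma int_face_cells:
  assumes "e \<in> int_faces M"
  shows "K_plus M e \<noteq> K_minus M e" "cells_at M e = {K_plus M e, K_minus M e}"
proof -
  have "\<forall>e\<in>int_faces M. K_plus M e \<noteq> K_minus M e \<and> cells_at M e = {K_plus M e, K_minus M e}"
    using mesh unfolding polytopic_mesh_def by (elim conjE)
  then show "K_plus M e \<noteq> K_minus M e" "cells_at M e = {K_plus M e, K_minus M e}" using assms by blast+
qed

lemma bd_face_cells: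
  assumes "e \<in> bd_faces M" shows "cells_at M e = {K_plus M e}"
proof -
  have "\<forall>e\<in>bd_faces M. cells_at M e = {K_plus M e} \<and> e \<subseteq> frontier (dom_of M)"
    using mesh unfolding polytopic_mesh_def by (elim conjE)
  then show ?thesis using assms by blast
qed

lemma K_plus:
  assumes "e \<in> faces M" shows "K_plus M e \<in> cells M" "e \<subseteq> frontier (K_plus M e)"
proof -
  have "K_plus M e \<in> cells_at M e"
    using assms int_face_cells bd_face_cells by (auto simp: faces_def)
  then show "K_plus M e \<in> cells M" "e \<subseteq> frontier (K_plus M e)" by (auto simp: cells_at_def)
qed

lemma K_minus:
  assumes "e \<in> int_faces M" shows "K_minus M e \<in> cells M" "e \<subseteq> frontier (K_minus M e)"
proof -
  have "K_minus M e \<in> cells_at M e" using assms int_face_cells by auto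
  then show "K_minus M e \<in> cells M" "e \<subseteq> frontier (K_minus M e)" by (auto simp: cells_at_def)
qed

lemma face_sides_int:
  assumes "e \<in> int_faces M" "x \<in> rel_interior e"
  shows "\<exists>r>0. \<forall>t. 0 < t \<and> t < r \<longrightarrow> x - t *\<^sub>R nrm M e \<in> K_plus M e \<and> x + t *\<^sub>R nrm M e \<in> K_minus M e"
proof -
  have "\<forall>e\<in>int_faces M. \<forall>x\<in>rel_interior e. \<exists>r>0. \<forall>t. 0 < t \<and> t < r \<longrightarrow>
        x - t *\<^sub>R nrm M e \<in> K_plus M e \<and> x + t *\<^sub>R nrm M e \<in> K_minus M e"
    using mesh unfolding polytopic_mesh_def by (elim conjE)
  then show ?thesis using assms by blast
qed

lemma face_sides_bd:
  assumes "e \<in> bd_faces M" "x \<in> rel_interior e"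
  shows "\<exists>r>0. \<forall>t. 0 < t \<and> t < r \<longrightarrow> x - t *\<^sub>R nrm M e \<in> K_plus M e \<and> x + t *\<^sub>R nrm M e \<notin> dom_of M"
proof -
  have "\<forall>e\<in>bd_faces M. \<forall>x\<in>rel_interior e. \<exists>r>0. \<forall>t. 0 < t \<and> t < r \<longrightarrow>
        x - t *\<^sub>R nrm M e \<in> K_plus M e \<and> x + t *\<^sub>R nrm M e \<notin> dom_of M"
    using mesh unfolding polytopic_mesh_def by (elim conjE)
  then show ?thesis using assms by blast
qed

definition height :: "'a set \<Rightarrow> real" where
  "height e = (SOME \<alpha>. affine hull e = {x. nrm M e \<bullet> x = \<alpha>})"

lemma face_hull: assumes e: "e \<in> faces M" shows "affine hull e = {x. nrm M e \<bullet> x = height e}"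
proof -
  obtain \<alpha> where "affine hull e = {x. nrm M e \<bullet> x = \<alpha>}"
    by (rule flat_face_hull[OF face_flat[OF e] face_normal[OF e]])
  then show ?thesis unfolding height_def by (rule someI)
qed

lemma face_compact: "e \<in> faces M \<Longrightarrow> compact e"
  by (rule flat_face_compact[OF face_flat])

lemmas face_integrable = set_integrable_surface_measure[OF face_normal(1) face_hull face_compact]

lemma face_ip_cong:
  assumes "\<And>x. x \<in> e \<Longrightarrow> f x = f' x" "\<And>x. x \<in> e \<Longrightarrow> g x = g' x"
  shows "face_ip e f g = face_ip e f' g'"
  unfolding face_ip_def set_lebesgue_integral_def
  by (rule Bochner_Integration.integral_cong) (auto simp: indicator_def assms)

lemma face_ip_sym: "face_ip e f g = face_ip e g f"
  by (simp add: face_ip_def mult.commute)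

lemma face_ip_nonneg: "0 \<le> face_ip e f f"
  unfolding face_ip_def set_lebesgue_integral_def by (intro Bochner_Integration.integral_nonneg) auto

lemma face_ip_scale: "face_ip e (\<lambda>x. s * f x) g = s * face_ip e f g"
  by (simp add: face_ip_def mult.assoc)

lemma face_ip_comb:
  assumes e: "e \<in> faces M" and c: "continuous_on e f" "continuous_on e g" "continuous_on e h"
  shows "face_ip e (\<lambda>x. s * f x + t * g x) h = s * face_ip e f h + t * face_ip e g h"
proof -
  have "face_ip e (\<lambda>x. s * f x + t * g x) h = (LINT x:e|surface_measure e. s * (f x * h x) + t * (g x * h x))"
    by (simp add: face_ip_def algebra_simps)
  also have "\<dots> = s * face_ip e f h + t * face_ip e g h"
    unfolding face_ip_def
    by (subst set_integral_add(2)) (auto intro!: face_integrable[OF e e e] continuous_on_mult c simp: continuous_on_mult_left)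
  finally show ?thesis .
qed

text \<open>For a cell adjacent to the face, the sign that turns the fixed face normal into the
  outer one.\<close>

definition out :: "'a set \<Rightarrow> 'a set \<Rightarrow> real" where
  "out K e = (if K = K_plus M e then 1 else -1)"

lemma cell_polytopal:
  assumes K: "K \<in> cells M"
  shows "polytopal_cell K {e \<in> faces M. e \<subseteq> frontier K} (\<lambda>e. out K e *\<^sub>R nrm M e) (\<lambda>e. out K e * height e)"
proof
  show "open K" "bounded K" using cell[OF K] by auto
  show "finite {e \<in> faces M. e \<subseteq> frontier K}" using fin_faces by simp
  have "\<forall>K\<in>cells M. frontier K = \<Union>{e \<in> faces M. e \<subseteq> frontier K}"
    using mesh unfolding polytopic_mesh_def by (elim conjE)
  then show "frontier K = \<Union>{e \<in> faces M. e \<subseteq> frontier K}" using K by blast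
  fix e assume e: "e \<in> {e \<in> faces M. e \<subseteq> frontier K}"
  then have ef: "e \<in> faces M" by simp
  show "flat_face e" by (rule face_flat[OF ef])
  show "norm (out K e *\<^sub>R nrm M e) = 1" using face_normal(1)[OF ef] by (simp add: out_def)
  show "affine hull e = {x. (out K e *\<^sub>R nrm M e) \<bullet> x = out K e * height e}"
    unfolding face_hull[OF ef] by (simp add: out_def)
  show "rel_interior e \<inter> rel_interior f = {}" if "f \<in> {e \<in> faces M. e \<subseteq> frontier K}" "e \<noteq> f" for f
  proof -
    have "\<forall>e\<in>faces M. \<forall>f\<in>faces M. e \<noteq> f \<longrightarrow> rel_interior e \<inter> rel_interior f = {}"
      using mesh unfolding polytopic_mesh_def by (elim conjE)
    then show ?thesis using that ef by blast
  qed
  fix x assume x: "x \<in> rel_interior e"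
  have Kc: "K \<in> cells_at M e" using K e by (simp add: cells_at_def)
  show "\<exists>r>0. \<forall>t. 0 < t \<and> t < r \<longrightarrow> x - t *\<^sub>R out K e *\<^sub>R nrm M e \<in> K \<and> x + t *\<^sub>R out K e *\<^sub>R nrm M e \<notin> K"
  proof (cases "e \<in> int_faces M")
    case True
    obtain r where r: "r > 0" "\<And>t. 0 < t \<Longrightarrow> t < r \<Longrightarrow> x - t *\<^sub>R nrm M e \<in> K_plus M e \<and> x + t *\<^sub>R nrm M e \<in> K_minus M e"
      using face_sides_int[OF True x] by blast
    have ne: "K_plus M e \<noteq> K_minus M e" and Kpm: "K = K_plus M e \<or> K = K_minus M e"
      using int_face_cells[OF True] Kc by auto
    have disj: "z \<notin> K_minus M e" if "z \<in> K_plus M e" for z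
      using cells_disjoint[OF K_plus(1)[OF ef] K_minus(1)[OF True] that] ne by blast
    show ?thesis
      using Kpm
    proof
      assume "K = K_plus M e"
      then show ?thesis using r disj by (intro exI[of _ r]) (auto simp: out_def)
    next
      assume "K = K_minus M e"
      then show ?thesis using r disj ne by (intro exI[of _ r]) (auto simp: out_def)
    qed
  next
    case False
    then have bd: "e \<in> bd_faces M" using ef by (simp add: faces_def)
    then have KK: "K = K_plus M e" using bd_face_cells Kc by simp
    obtain r where r: "r > 0" "\<And>t. 0 < t \<Longrightarrow> t < r \<Longrightarrow> x - t *\<^sub>R nrm M e \<in> K_plus M e \<and> x + t *\<^sub>R nrm M e \<notin> dom_of M"
      using face_sides_bd[OF bd x] by blast
    then show ?thesis using KK cell(4)[OF K] by (intro exI[of _ r]) (auto simp: out_def)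
  qed
qed

lemma sum_cells_faces:
  fixes g :: "'a set \<Rightarrow> 'a set \<Rightarrow> real"
  shows "(\<Sum>K\<in>cells M. \<Sum>e | e \<in> faces M \<and> e \<subseteq> frontier K. g K e) =
    (\<Sum>e\<in>faces M. g (K_plus M e) e + (if e \<in> int_faces M then g (K_minus M e) e else 0))"
proof -
  have "(\<Sum>K\<in>cells M. \<Sum>e | e \<in> faces M \<and> e \<subseteq> frontier K. g K e) =
      (\<Sum>e\<in>faces M. \<Sum>K | K \<in> cells M \<and> e \<subseteq> frontier K. g K e)"
    by (rule sum.swap_restrict[OF fin_cells fin_faces])
  also have "\<dots> = (\<Sum>e\<in>faces M. g (K_plus M e) e + (if e \<in> int_faces M then g (K_minus M e) e else 0))"
  proof (rule sum.cong[OF refl])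
    fix e assume e: "e \<in> faces M"
    have "{K. K \<in> cells M \<and> e \<subseteq> frontier K} = cells_at M e" by (simp add: cells_at_def)
    then show "(\<Sum>K | K \<in> cells M \<and> e \<subseteq> frontier K. g K e) =
        g (K_plus M e) e + (if e \<in> int_faces M then g (K_minus M e) e else 0)"
      using int_face_cells[of e] bd_face_cells[of e] e by (auto simp: faces_def)
  qed
  finally show ?thesis .
qed

text \<open>The two cells at an interior face see opposite outer normals, which leaves the
  difference of the two one-sided integrals. A boundary face contributes one side only, in agreement
  with a zero exterior trace.\<close>

lemma broken_divergence:
  fixes f f' :: "'a set \<Rightarrow> 'a \<Rightarrow> real"
  assumes "\<And>K x s. K \<in> cells M \<Longrightarrow> ((\<lambda>s. f K (x + s *\<^sub>R \<omega>)) has_real_derivative f' K (x + s *\<^sub>R \<omega>)) (at s)"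
    and "\<And>K. K \<in> cells M \<Longrightarrow> continuous_on UNIV (f K)" "\<And>K. K \<in> cells M \<Longrightarrow> continuous_on UNIV (f' K)"
  shows "(\<Sum>K\<in>cells M. LINT x:K|lborel. f' K x) =
    (\<Sum>e\<in>faces M. (nrm M e \<bullet> \<omega>) * ((LINT x:e|surface_measure e. f (K_plus M e) x) -
       (if e \<in> int_faces M then LINT x:e|surface_measure e. f (K_minus M e) x else 0)))"
proof -
  have "(\<Sum>K\<in>cells M. LINT x:K|lborel. f' K x) =
      (\<Sum>K\<in>cells M. \<Sum>e | e \<in> faces M \<and> e \<subseteq> frontier K. ((out K e *\<^sub>R nrm M e) \<bullet> \<omega>) * (LINT x:e|surface_measure e. f K x))"
    by (rule sum.cong[OF refl], rule polytopal_cell.divergence[OF cell_polytopal]) (use assms in auto)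
  also have "\<dots> = (\<Sum>e\<in>faces M. (nrm M e \<bullet> \<omega>) * ((LINT x:e|surface_measure e. f (K_plus M e) x) -
       (if e \<in> int_faces M then LINT x:e|surface_measure e. f (K_minus M e) x else 0)))"
    unfolding sum_cells_faces
  proof (rule sum.cong[OF refl])
    fix e
    show "((out (K_plus M e) e *\<^sub>R nrm M e) \<bullet> \<omega>) * (LINT x:e|surface_measure e. f (K_plus M e) x) +
      (if e \<in> int_faces M then ((out (K_minus M e) e *\<^sub>R nrm M e) \<bullet> \<omega>) * (LINT x:e|surface_measure e. f (K_minus M e) x) else 0) =
      (nrm M e \<bullet> \<omega>) * ((LINT x:e|surface_measure e. f (K_plus M e) x) -
       (if e \<in> int_faces M then LINT x:e|surface_measure e. f (K_minus M e) x else 0))"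
      using int_face_cells(1)[of e] by (auto simp: out_def right_diff_distrib)
  qed
  finally show ?thesis .
qed

text \<open>\<open>Lim\<close> is a description, so besides convergence one needs that the frontier
  point can be approached from the cell.\<close>

lemma trace_cell:
  assumes K: "K \<in> cells M" and x: "x \<in> frontier K" and u: "u \<in> V"
  shows "(u \<longlongrightarrow> rep K u x) (at x within K)" "at x within K \<noteq> bot"
proof -
  have "x \<notin> K" "x \<in> closure K" using x cell(1)[OF K] by (auto simp: frontier_def interior_open)
  then show nb: "at x within K \<noteq> bot"
    by (auto simp: trivial_limit_within closure_def)
  have "(rep K u \<longlongrightarrow> rep K u x) (at x within K)"
    using continuous_on_polys[OF rep_polys[OF u K], of UNIV]
    by (auto simp: continuous_on_eq_continuous_at isCont_def intro: tendsto_within_subset)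
  then show "(u \<longlongrightarrow> rep K u x) (at x within K)"
    by (rule Lim_transform_eventually) (auto simp: eventually_at_filter rep_eq[OF u K])
qed

lemma trace_plus_rep:
  assumes e: "e \<in> faces M" and u: "u \<in> V" and x: "x \<in> e"
  shows "trace_plus M e u x = rep (K_plus M e) u x"
proof -
  have "x \<in> frontier (K_plus M e)" using K_plus(2)[OF e] x by blast
  from trace_cell[OF K_plus(1)[OF e] this u] show ?thesis unfolding trace_plus_def by (intro tendsto_Lim) auto
qed

lemma trace_minus_rep:
  assumes e: "e \<in> int_faces M" and u: "u \<in> V" and x: "x \<in> e"
  shows "trace_minus M e u x = rep (K_minus M e) u x"
proof -
  have "x \<in> frontier (K_minus M e)" using K_minus(2)[OF e] x by blast
  from trace_cell[OF K_minus(1)[OF e] this u] show ?thesis unfolding trace_minus_def using e by (auto intro!: tendsto_Lim)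
qed

lemma trace_cont:
  assumes e: "e \<in> faces M" and u: "u \<in> V"
  shows "continuous_on e (trace_plus M e u)" "continuous_on e (trace_minus M e u)"
proof -
  show "continuous_on e (trace_plus M e u)"
    by (rule continuous_on_eq[OF continuous_on_polys[OF rep_polys[OF u K_plus(1)[OF e]]]])
       (simp add: trace_plus_rep[OF e u])
  show "continuous_on e (trace_minus M e u)"
  proof (cases "e \<in> int_faces M")
    case True
    show ?thesis
      by (rule continuous_on_eq[OF continuous_on_polys[OF rep_polys[OF u K_minus(1)[OF True]]]])
         (simp add: trace_minus_rep[OF True u])
  next
    case False
    then have "trace_minus M e u = (\<lambda>_. 0)" by (auto simp: trace_minus_def)
    then show ?thesis by simp
  qed
qed

lemma trace_lin:
  assumes e: "e \<in> faces M" and u: "u \<in> V" and v: "v \<in> V" and x: "x \<in> e"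
  shows "trace_plus M e (s *\<^sub>R u + t *\<^sub>R v) x = s * trace_plus M e u x + t * trace_plus M e v x"
    "trace_minus M e (s *\<^sub>R u + t *\<^sub>R v) x = s * trace_minus M e u x + t * trace_minus M e v x"
proof -
  have lim: "((s *\<^sub>R u + t *\<^sub>R v) \<longlongrightarrow> s * rep K u x + t * rep K v x) (at x within K)"
    if "K \<in> cells M" "x \<in> frontier K" for K
    unfolding fun_comb[symmetric] by (intro tendsto_intros trace_cell that u v)
  have xp: "x \<in> frontier (K_plus M e)" using K_plus(2)[OF e] x by blast
  have "trace_plus M e (s *\<^sub>R u + t *\<^sub>R v) x = s * rep (K_plus M e) u x + t * rep (K_plus M e) v x"
    unfolding trace_plus_def
    by (rule tendsto_Lim[OF trace_cell(2)[OF K_plus(1)[OF e] xp u] lim[OF K_plus(1)[OF e] xp]])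
  then show "trace_plus M e (s *\<^sub>R u + t *\<^sub>R v) x = s * trace_plus M e u x + t * trace_plus M e v x"
    by (simp add: trace_plus_rep[OF e _ x] u v)
  show "trace_minus M e (s *\<^sub>R u + t *\<^sub>R v) x = s * trace_minus M e u x + t * trace_minus M e v x"
  proof (cases "e \<in> int_faces M")
    case True
    have xm: "x \<in> frontier (K_minus M e)" using K_minus(2)[OF True] x by blast
    have "trace_minus M e (s *\<^sub>R u + t *\<^sub>R v) x = s * rep (K_minus M e) u x + t * rep (K_minus M e) v x"
      unfolding trace_minus_def using True
      by (auto intro!: tendsto_Lim[OF trace_cell(2)[OF K_minus(1)[OF True] xm u] lim[OF K_minus(1)[OF True] xm]])
    then show ?thesis by (simp add: trace_minus_rep[OF True _ x] u v)
  qed (simp add: trace_minus_def)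
qed

text \<open>The flux is not a member of the discrete space, as it is not normalised off the cells.
  Its traces are limits within a cell, where it agrees with the member \<open>dd n u\<close> up to
  the factor \<open>D\<close>.\<close>

lemma trace_normal_derivative:
  assumes e: "e \<in> faces M" and u: "u \<in> V" and x: "x \<in> e"
  shows "trace_plus M e (\<lambda>y. D * (grad u y \<bullet> n)) x = D * trace_plus M e (dd n u) x"
    "trace_minus M e (\<lambda>y. D * (grad u y \<bullet> n)) x = D * trace_minus M e (dd n u) x"
proof -
  have lim: "((\<lambda>y. D * (grad u y \<bullet> n)) \<longlongrightarrow> D * rep K (dd n u) x) (at x within K)"
    if K: "K \<in> cells M" "x \<in> frontier K" for K
  proof -
    have "((\<lambda>y. D * dd n u y) \<longlongrightarrow> D * rep K (dd n u) x) (at x within K)"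
      by (intro tendsto_intros trace_cell K dd_in u)
    then show ?thesis
      by (rule Lim_transform_eventually) (use K in \<open>auto simp: eventually_at_filter dd_def inner_commute\<close>)
  qed
  have xp: "x \<in> frontier (K_plus M e)" using K_plus(2)[OF e] x by blast
  have "trace_plus M e (\<lambda>y. D * (grad u y \<bullet> n)) x = D * rep (K_plus M e) (dd n u) x"
    unfolding trace_plus_def
    by (rule tendsto_Lim[OF trace_cell(2)[OF K_plus(1)[OF e] xp u] lim[OF K_plus(1)[OF e] xp]])
  then show "trace_plus M e (\<lambda>y. D * (grad u y \<bullet> n)) x = D * trace_plus M e (dd n u) x"
    by (simp add: trace_plus_rep[OF e _ x] dd_in u)
  show "trace_minus M e (\<lambda>y. D * (grad u y \<bullet> n)) x = D * trace_minus M e (dd n u) x"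
  proof (cases "e \<in> int_faces M")
    case True
    have xm: "x \<in> frontier (K_minus M e)" using K_minus(2)[OF True] x by blast
    have "trace_minus M e (\<lambda>y. D * (grad u y \<bullet> n)) x = D * rep (K_minus M e) (dd n u) x"
      unfolding trace_minus_def using True
      by (auto intro!: tendsto_Lim[OF trace_cell(2)[OF K_minus(1)[OF True] xm u] lim[OF K_minus(1)[OF True] xm]])
    then show ?thesis by (simp add: trace_minus_rep[OF True _ x] dd_in u)
  qed (simp add: trace_minus_def)
qed

section \<open>Face forms and lifted jumps\<close>

text \<open>Common pattern of one-sided traces, jumps, averages and traces of derivatives;
  bilinearity and Cauchy-Schwarz for face sums are proved once from it. Linearity holds on the face
  only, since limits elsewhere are uncontrolled.\<close>

definition trace_op :: "('a set \<Rightarrow> ('a \<Rightarrow> real) \<Rightarrow> 'a \<Rightarrow> real) \<Rightarrow> bool" where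
  "trace_op X \<longleftrightarrow> (\<forall>e\<in>faces M. \<forall>u\<in>V. continuous_on e (X e u) \<and>
     (\<forall>v\<in>V. \<forall>s t. \<forall>x\<in>e. X e (s *\<^sub>R u + t *\<^sub>R v) x = s * X e u x + t * X e v x))"

lemma trace_opD:
  assumes "trace_op X" "e \<in> faces M" "u \<in> V"
  shows "continuous_on e (X e u)"
    "v \<in> V \<Longrightarrow> x \<in> e \<Longrightarrow> X e (s *\<^sub>R u + t *\<^sub>R v) x = s * X e u x + t * X e v x"
  using assms unfolding trace_op_def by blast+

lemma trace_op_plus: "trace_op (trace_plus M)" and trace_op_minus: "trace_op (trace_minus M)"
  unfolding trace_op_def by (simp_all add: trace_cont trace_lin)

lemma trace_op_comb:
  assumes "trace_op X" "trace_op Y" shows "trace_op (\<lambda>e u x. a * X e u x + b * Y e u x)"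
  unfolding trace_op_def
  using trace_opD[OF assms(1)] trace_opD[OF assms(2)]
  by (auto intro!: continuous_intros simp: algebra_simps)

lemma trace_op_jump: "trace_op (jump M)" and trace_op_avg: "trace_op (avg M)"
proof -
  have "jump M = (\<lambda>e u x. 1 * trace_plus M e u x + (-1) * trace_minus M e u x)"
    by (auto simp: fun_eq_iff jump_def)
  then show "trace_op (jump M)" using trace_op_comb[OF trace_op_plus trace_op_minus, of 1 "-1"] by (simp only:)
  have "avg M = (\<lambda>e u x. (1/2) * trace_plus M e u x + (1/2) * trace_minus M e u x)"
    by (auto simp: fun_eq_iff avg_def)
  then show "trace_op (avg M)" using trace_op_comb[OF trace_op_plus trace_op_minus, of "1/2" "1/2"] by (simp only:)
qed

text \<open>The direction may vary with the face, as it does for normal derivatives.\<close>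

lemma trace_op_dd: "trace_op X \<Longrightarrow> trace_op (\<lambda>e u. X e (dd (d e) u))"
  unfolding trace_op_def by (auto simp: dd_in dd_lin)

text \<open>The weight covers the centred flux, the upwind dissipation and the penalty, so every
  face term of both schemes is an instance.\<close>

definition fform :: "('a set \<Rightarrow> real) \<Rightarrow> ('a set \<Rightarrow> ('a \<Rightarrow> real) \<Rightarrow> 'a \<Rightarrow> real) \<Rightarrow>
    ('a set \<Rightarrow> ('a \<Rightarrow> real) \<Rightarrow> 'a \<Rightarrow> real) \<Rightarrow> ('a \<Rightarrow> real) \<Rightarrow> ('a \<Rightarrow> real) \<Rightarrow> real" where
  "fform \<kappa> X Y u v = (\<Sum>e\<in>faces M. \<kappa> e * face_ip e (X e u) (Y e v))"

lemma face_ip_bilinear: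
  assumes X: "trace_op X" and Y: "trace_op Y" and e: "e \<in> faces M"
  shows "bilinear_form V (\<lambda>u v. face_ip e (X e u) (Y e v))"
proof
  have l: "face_ip e (X e (s *\<^sub>R u + t *\<^sub>R v)) (Y e w) = s * face_ip e (X e u) (Y e w) + t * face_ip e (X e v) (Y e w)"
    if "u \<in> V" "v \<in> V" "w \<in> V" "trace_op X" "trace_op Y" for u v w s t X Y
  proof -
    have "face_ip e (X e (s *\<^sub>R u + t *\<^sub>R v)) (Y e w) = face_ip e (\<lambda>x. s * X e u x + t * X e v x) (Y e w)"
      by (rule face_ip_cong) (use trace_opD[OF that(4) e] that in auto)
    also have "\<dots> = s * face_ip e (X e u) (Y e w) + t * face_ip e (X e v) (Y e w)"
      by (rule face_ip_comb[OF e]) (use trace_opD[OF that(4) e] trace_opD[OF that(5) e] that in auto)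
    finally show ?thesis .
  qed
  fix u v w :: "'a \<Rightarrow> real" and s t :: real
  assume uvw: "u \<in> V" "v \<in> V" "w \<in> V"
  show "face_ip e (X e (s *\<^sub>R u + t *\<^sub>R v)) (Y e w) = s * face_ip e (X e u) (Y e w) + t * face_ip e (X e v) (Y e w)"
    by (rule l[OF uvw X Y])
  show "face_ip e (X e w) (Y e (s *\<^sub>R u + t *\<^sub>R v)) = s * face_ip e (X e w) (Y e u) + t * face_ip e (X e w) (Y e v)"
    using l[OF uvw Y X] by (simp only: face_ip_sym[of e "X e w"])
qed (rule subspace_V)

lemma fform_bilinear:
  assumes X: "trace_op X" and Y: "trace_op Y"
  shows "bilinear_form V (fform \<kappa> X Y)"
proof
  note f = bilinear_form.comb_left[OF face_ip_bilinear[OF X Y]] bilinear_form.comb_right[OF face_ip_bilinear[OF X Y]]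
  fix u v w :: "'a \<Rightarrow> real" and s t :: real
  assume uvw: "u \<in> V" "v \<in> V" "w \<in> V"
  show "fform \<kappa> X Y (s *\<^sub>R u + t *\<^sub>R v) w = s * fform \<kappa> X Y u w + t * fform \<kappa> X Y v w"
    "fform \<kappa> X Y w (s *\<^sub>R u + t *\<^sub>R v) = s * fform \<kappa> X Y w u + t * fform \<kappa> X Y w v"
    unfolding fform_def sum_distrib_left sum.distrib[symmetric]
    by (auto intro!: sum.cong simp: f uvw algebra_simps)
qed (rule subspace_V)

lemma fform_sym: "fform \<kappa> X Y u v = fform \<kappa> Y X v u"
  by (simp add: fform_def face_ip_sym)

lemma face_ip_CS:
  assumes e: "e \<in> faces M" and f: "continuous_on e f" and g: "continuous_on e g"
  shows "\<bar>face_ip e f g\<bar> \<le> sqrt (face_ip e f f) * sqrt (face_ip e g g)"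
proof -
  interpret psd_form "{f. continuous_on e f}" "face_ip e"
  proof
    show "subspace {f :: 'a \<Rightarrow> real. continuous_on e f}"
      by (rule subspaceI) (auto simp: plus_fun_def zero_fun_def scaleR_fun_def intro!: continuous_intros)
    fix u v w :: "'a \<Rightarrow> real" and s t :: real
    assume "u \<in> {f. continuous_on e f}" "v \<in> {f. continuous_on e f}" "w \<in> {f. continuous_on e f}"
    then show "face_ip e (s *\<^sub>R u + t *\<^sub>R v) w = s * face_ip e u w + t * face_ip e v w"
      "face_ip e w (s *\<^sub>R u + t *\<^sub>R v) = s * face_ip e w u + t * face_ip e w v"
      unfolding face_ip_sym[of e w] fun_comb[symmetric] using face_ip_comb[OF e] by auto
  next
    show "0 \<le> face_ip e v v" for v by (rule face_ip_nonneg)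
    show "face_ip e u v = face_ip e v u" for u v by (rule face_ip_sym)
  qed
  show ?thesis using abs_le_nrm[of f g] f g by (simp add: nrm_def)
qed

lemma face_ip_mono:
  assumes e: "e \<in> faces M" and f: "continuous_on e f"
    and le: "\<And>x. x \<in> e \<Longrightarrow> (f x)\<^sup>2 \<le> (\<Sum>i\<in>S. (h i x)\<^sup>2)" and h: "\<And>i. i \<in> S \<Longrightarrow> continuous_on e (h i)"
  shows "face_ip e f f \<le> (\<Sum>i\<in>S. face_ip e (h i) (h i))"
proof -
  have i: "set_integrable (surface_measure e) e (\<lambda>x. h i x * h i x)" if "i \<in> S" for i
    by (intro face_integrable[OF e e e] continuous_on_mult h that)
  have "face_ip e f f \<le> (LINT x:e|surface_measure e. (\<Sum>i\<in>S. h i x * h i x))"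
    unfolding face_ip_def
  proof (rule set_integral_mono)
    show "set_integrable (surface_measure e) e (\<lambda>x. f x * f x)"
      by (intro face_integrable[OF e e e] continuous_on_mult f)
    show "set_integrable (surface_measure e) e (\<lambda>x. \<Sum>i\<in>S. h i x * h i x)"
      by (intro face_integrable[OF e e e] continuous_on_sum continuous_on_mult h)
    show "f x * f x \<le> (\<Sum>i\<in>S. h i x * h i x)" if "x \<in> e" for x
      using le[OF that] by (simp add: power2_eq_square)
  qed
  also have "\<dots> = (\<Sum>i\<in>S. face_ip e (h i) (h i))"
    unfolding face_ip_def set_lebesgue_integral_def scaleR_sum_right
    by (rule Bochner_Integration.integral_sum) (use i in \<open>simp add: set_integrable_def\<close>)
  finally show ?thesis .
qed

lemma fform_CS:
  assumes X: "trace_op X" and Y: "trace_op Y" and \<kappa>: "\<And>e. e \<in> faces M \<Longrightarrow> \<bar>\<kappa> e\<bar> \<le> 1"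
    and u: "u \<in> V" and v: "v \<in> V"
  shows "\<bar>fform \<kappa> X Y u v\<bar> \<le> sqrt (fform (\<lambda>_. 1) X X u u) * sqrt (fform (\<lambda>_. 1) Y Y v v)"
proof -
  have "\<bar>fform \<kappa> X Y u v\<bar> \<le> (\<Sum>e\<in>faces M. \<bar>sqrt (face_ip e (X e u) (X e u))\<bar> * \<bar>sqrt (face_ip e (Y e v) (Y e v))\<bar>)"
    unfolding fform_def
  proof (rule order_trans[OF sum_abs sum_mono])
    fix e assume e: "e \<in> faces M"
    have "\<bar>\<kappa> e * face_ip e (X e u) (Y e v)\<bar> \<le> 1 * \<bar>face_ip e (X e u) (Y e v)\<bar>"
      unfolding abs_mult by (rule mult_right_mono[OF \<kappa>[OF e]]) simp
    then show "\<bar>\<kappa> e * face_ip e (X e u) (Y e v)\<bar> \<le> \<bar>sqrt (face_ip e (X e u) (X e u))\<bar> * \<bar>sqrt (face_ip e (Y e v) (Y e v))\<bar>"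
      using face_ip_CS[OF e trace_opD(1)[OF X e u] trace_opD(1)[OF Y e v]] by (simp add: face_ip_nonneg)
  qed
  also have "\<dots> \<le> L2_set (\<lambda>e. sqrt (face_ip e (X e u) (X e u))) (faces M) * L2_set (\<lambda>e. sqrt (face_ip e (Y e v) (Y e v))) (faces M)"
    by (rule L2_set_mult_ineq)
  finally show ?thesis by (simp add: L2_set_def fform_def face_ip_nonneg)
qed

text \<open>Integrated form of the product rule for jumps: the jump of a product is jump times
  average plus average times jump. The factor 1/2 in the boundary average makes it valid there as
  well.\<close>

lemma face_green:
  assumes e: "e \<in> faces M" and u: "u \<in> V" and v: "v \<in> V"
  shows "face_ip e (jump M e u) (avg M e v) + face_ip e (avg M e u) (jump M e v) =
    face_ip e (trace_plus M e u) (trace_plus M e v) - face_ip e (trace_minus M e u) (trace_minus M e v)"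
proof -
  note c = trace_cont[OF e u] trace_cont[OF e v]
  have j: "jump M e w = (\<lambda>x. 1 * trace_plus M e w x + (-1) * trace_minus M e w x)"
    "avg M e w = (\<lambda>x. (1/2) * trace_plus M e w x + (1/2) * trace_minus M e w x)" for w
    by (auto simp: fun_eq_iff jump_def avg_def)
  have l: "face_ip e (\<lambda>x. s * trace_plus M e u x + t * trace_minus M e u x) (\<lambda>x. s' * trace_plus M e v x + t' * trace_minus M e v x) =
     s * (s' * face_ip e (trace_plus M e u) (trace_plus M e v) + t' * face_ip e (trace_plus M e u) (trace_minus M e v)) +
     t * (s' * face_ip e (trace_minus M e u) (trace_plus M e v) + t' * face_ip e (trace_minus M e u) (trace_minus M e v))" for s t s' t'
  proof -
    have r: "face_ip e f (\<lambda>x. s' * trace_plus M e v x + t' * trace_minus M e v x) =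
      s' * face_ip e f (trace_plus M e v) + t' * face_ip e f (trace_minus M e v)" if "continuous_on e f" for f
      unfolding face_ip_sym[of e f] by (rule face_ip_comb[OF e c(3,4) that])
    show ?thesis
      by (subst face_ip_comb[OF e c(1,2)]) (auto intro!: continuous_intros c simp: r c)
  qed
  show ?thesis unfolding j l by (simp add: field_simps)
qed

text \<open>Discrete integration by parts, obtained from the divergence theorem for the product of
  the two polynomials on each cell. Sign and reversal of the streaming form both rest on it.\<close>

lemma green:
  assumes u: "u \<in> V" and v: "v \<in> V"
  shows "I (dd \<omega> u) v + I u (dd \<omega> v) =
    fform (\<lambda>e. nrm M e \<bullet> \<omega>) (jump M) (avg M) u v + fform (\<lambda>e. nrm M e \<bullet> \<omega>) (avg M) (jump M) u v"
proof -
  define f where "f = (\<lambda>K x. rep K u x * rep K v x)"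
  define f' where "f' = (\<lambda>K x. (\<omega> \<bullet> grad (rep K u) x) * rep K v x + rep K u x * (\<omega> \<bullet> grad (rep K v) x))"
  have c: "continuous_on UNIV (rep K w)" "continuous_on UNIV (\<lambda>x. \<omega> \<bullet> grad (rep K w) x)" if "K \<in> cells M" "w \<in> V" for K w
    using continuous_on_polys[OF rep_polys[OF that(2,1)]] continuous_on_polys[OF polys_dir_deriv[OF rep_polys[OF that(2,1)]]] by auto
  have "I (dd \<omega> u) v + I u (dd \<omega> v) = (\<Sum>K\<in>cells M. ip K (dd \<omega> u) v + ip K u (dd \<omega> v))"
    using u v by (simp add: ip_dom dd_in sum.distrib)
  also have "\<dots> = (\<Sum>K\<in>cells M. LINT x:K|lborel. f' K x)"
  proof (rule sum.cong[OF refl])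
    fix K assume K: "K \<in> cells M"
    have "ip K (dd \<omega> u) v + ip K u (dd \<omega> v) = (LINT x:K|lborel. dd \<omega> u x * v x + u x * dd \<omega> v x)"
      unfolding ip_real by (rule set_integral_add(2)[symmetric]) (intro ip_integrable dd_in u v K)+
    also have "\<dots> = (LINT x:K|lborel. f' K x)"
      unfolding set_lebesgue_integral_def
      by (rule Bochner_Integration.integral_cong)
         (auto simp: indicator_def f'_def dd_eq[OF u K] dd_eq[OF v K] rep_eq[OF u K] rep_eq[OF v K])
    finally show "ip K (dd \<omega> u) v + ip K u (dd \<omega> v) = (LINT x:K|lborel. f' K x)" .
  qed
  also have "\<dots> = (\<Sum>e\<in>faces M. (nrm M e \<bullet> \<omega>) * ((LINT x:e|surface_measure e. f (K_plus M e) x) -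
       (if e \<in> int_faces M then LINT x:e|surface_measure e. f (K_minus M e) x else 0)))"
  proof (rule broken_divergence)
    fix K assume K: "K \<in> cells M"
    show "((\<lambda>s. f K (x + s *\<^sub>R \<omega>)) has_real_derivative f' K (x + s *\<^sub>R \<omega>)) (at s)" for x s
      unfolding f_def f'_def
      by (rule DERIV_cong[OF DERIV_mult[OF polys_line_derivative[OF rep_polys[OF u K]] polys_line_derivative[OF rep_polys[OF v K]]]]) simp
    show "continuous_on UNIV (f K)" "continuous_on UNIV (f' K)"
      unfolding f_def f'_def by (intro continuous_intros c K u v)+
  qed
  also have "\<dots> = (\<Sum>e\<in>faces M. (nrm M e \<bullet> \<omega>) * (face_ip e (jump M e u) (avg M e v) + face_ip e (avg M e u) (jump M e v)))"
  proof (intro sum.cong refl arg_cong2[where f = "(*)"])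
    fix e assume e: "e \<in> faces M"
    have "(LINT x:e|surface_measure e. f (K_plus M e) x) = face_ip e (trace_plus M e u) (trace_plus M e v)"
      unfolding f_def face_ip_def[symmetric]
      by (rule face_ip_cong) (simp_all add: trace_plus_rep[OF e] u v)
    moreover have "(if e \<in> int_faces M then LINT x:e|surface_measure e. f (K_minus M e) x else 0) =
        face_ip e (trace_minus M e u) (trace_minus M e v)"
    proof (cases "e \<in> int_faces M")
      case True
      then show ?thesis
        unfolding f_def face_ip_def[symmetric]
        by (auto intro!: face_ip_cong simp: trace_minus_rep[OF True] u v)
    next
      case False
      then show ?thesis by (simp add: trace_minus_def[abs_def] face_ip_def)
    qed
    ultimately show "(LINT x:e|surface_measure e. f (K_plus M e) x) -
       (if e \<in> int_faces M then LINT x:e|surface_measure e. f (K_minus M e) x else 0) =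
      face_ip e (jump M e u) (avg M e v) + face_ip e (avg M e u) (jump M e v)"
      by (simp add: face_green[OF e u v])
  qed
  finally show ?thesis by (simp add: fform_def distrib_left sum.distrib)
qed

section \<open>Jump, trace and gradient energies, and their inverse estimates\<close>

definition J :: "('a \<Rightarrow> real) \<Rightarrow> real" where "J u = fform (\<lambda>_. 1) (jump M) (jump M) u u"
text \<open>An interior face is counted from both sides, so this is the sum over the cells of the
  squared norm on the whole cell boundary.\<close>

definition Tr :: "('a \<Rightarrow> real) \<Rightarrow> real" where
  "Tr u = fform (\<lambda>_. 1) (trace_plus M) (trace_plus M) u u + fform (\<lambda>_. 1) (trace_minus M) (trace_minus M) u u"

lemma J_nonneg: "0 \<le> J u"
  unfolding J_def fform_def by (auto intro!: sum_nonneg face_ip_nonneg)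

lemma face_square_sum:
  assumes e: "e \<in> faces M" and f: "continuous_on e f" and g: "continuous_on e g"
  shows "face_ip e (\<lambda>x. a * f x + b * g x) (\<lambda>x. a * f x + b * g x) \<le> 2 * (a\<^sup>2 * face_ip e f f + b\<^sup>2 * face_ip e g g)"
proof -
  \<comment> \<open>The factors \<open>sqrt 2\<close> turn the right side of
    \<open>face_ip_mono\<close> into the bound of a squared sum by twice the sum of squares.\<close>
  define h where "h = (\<lambda>i. if i then (\<lambda>x. (sqrt 2 * a) * f x) else (\<lambda>x. (sqrt 2 * b) * g x))"
  have sc: "face_ip e (\<lambda>x. c * k x) (\<lambda>x. c * k x) = c\<^sup>2 * face_ip e k k" for c k
    by (simp only: face_ip_scale face_ip_sym[of e k "\<lambda>x. c * k x"] power2_eq_square mult.assoc)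
  have "face_ip e (\<lambda>x. a * f x + b * g x) (\<lambda>x. a * f x + b * g x) \<le> (\<Sum>i\<in>{True, False}. face_ip e (h i) (h i))"
  proof (rule face_ip_mono[OF e])
    show "(a * f x + b * g x)\<^sup>2 \<le> (\<Sum>i\<in>{True, False}. (h i x)\<^sup>2)" for x
      using sum_squares_bound[of "a * f x" "b * g x"] by (simp add: h_def power2_sum power_mult_distrib)
    have "continuous_on e (h True)" "continuous_on e (h False)"
      unfolding h_def by (auto intro!: continuous_intros f g)
    then show "continuous_on e (h i)" if "i \<in> {True, False}" for i by (cases i) simp_all
    show "continuous_on e (\<lambda>x. a * f x + b * g x)" by (intro continuous_intros f g)
  qed
  also have "\<dots> = 2 * (a\<^sup>2 * face_ip e f f + b\<^sup>2 * face_ip e g g)"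
    unfolding h_def by (simp add: sc power_mult_distrib)
  finally show ?thesis .
qed

lemma J_le_Tr: assumes u: "u \<in> V" shows "J u \<le> 2 * Tr u"
  unfolding J_def Tr_def fform_def distrib_left sum_distrib_left sum.distrib[symmetric]
proof (rule sum_mono)
  fix e assume e: "e \<in> faces M"
  have "jump M e u = (\<lambda>x. 1 * trace_plus M e u x + (-1) * trace_minus M e u x)" by (auto simp: fun_eq_iff jump_def)
  then show "1 * face_ip e (jump M e u) (jump M e u) \<le>
      2 * (1 * face_ip e (trace_plus M e u) (trace_plus M e u)) + 2 * (1 * face_ip e (trace_minus M e u) (trace_minus M e u))"
    using face_square_sum[OF e trace_cont[OF e u], of 1 "-1"] by simp
qed

lemma avg_le_Tr: assumes u: "u \<in> V" and e: "e \<in> faces M"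
  shows "face_ip e (avg M e u) (avg M e u) \<le>
    (1/2) * (face_ip e (trace_plus M e u) (trace_plus M e u) + face_ip e (trace_minus M e u) (trace_minus M e u))"
proof -
  have "avg M e u = (\<lambda>x. (1/2) * trace_plus M e u x + (1/2) * trace_minus M e u x)" by (auto simp: fun_eq_iff avg_def)
  then show ?thesis using face_square_sum[OF e trace_cont[OF e u], of "1/2" "1/2"] by (simp add: power2_eq_square)
qed

lemma avg_form_le_Tr: assumes u: "u \<in> V" shows "fform (\<lambda>_. 1) (avg M) (avg M) u u \<le> (1/2) * Tr u"
  unfolding Tr_def fform_def sum.distrib[symmetric] sum_distrib_left
  by (rule sum_mono) (use avg_le_Tr[OF u] in simp)

definition Gr :: "('a \<Rightarrow> real) \<Rightarrow> ('a \<Rightarrow> real) \<Rightarrow> real" where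
  "Gr u v = (\<Sum>K\<in>cells M. ip K (grad u) (grad v))"

lemma inner_grad: "K \<in> cells M \<Longrightarrow> x \<in> K \<Longrightarrow> grad u x \<bullet> grad v x = (\<Sum>i\<in>Basis. dd i u x * dd i v x)"

  by (subst euclidean_inner, rule sum.cong) (auto simp: dd_def inner_commute)

lemma ip_grad:
  assumes u: "u \<in> V" and v: "v \<in> V" and K: "K \<in> cells M"
  shows "ip K (grad u) (grad v) = (\<Sum>i\<in>Basis. ip K (dd i u) (dd i v))"
proof -
  have "ip K (grad u) (grad v) = (LINT x:K|lborel. (\<Sum>i\<in>Basis. dd i u x * dd i v x))"
    unfolding ip_def set_lebesgue_integral_def
    by (rule Bochner_Integration.integral_cong) (auto simp: inner_grad[OF K] split: split_indicator)
  also have "\<dots> = (\<Sum>i\<in>Basis. ip K (dd i u) (dd i v))"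
    unfolding ip_real set_lebesgue_integral_def scaleR_sum_right
    by (rule Bochner_Integration.integral_sum) (use ip_integrable[OF dd_in[OF u] dd_in[OF v] K] in \<open>simp add: set_integrable_def\<close>)
  finally show ?thesis .
qed

lemma Gr_eq:
  assumes u: "u \<in> V" and v: "v \<in> V"
  shows "Gr u v = (\<Sum>i\<in>Basis. I (dd i u) (dd i v))"
proof -
  have "Gr u v = (\<Sum>K\<in>cells M. \<Sum>i\<in>Basis. ip K (dd i u) (dd i v))"
    unfolding Gr_def by (rule sum.cong) (simp_all add: ip_grad u v)
  also have "\<dots> = (\<Sum>i\<in>Basis. \<Sum>K\<in>cells M. ip K (dd i u) (dd i v))" by (rule sum.swap)
  also have "\<dots> = (\<Sum>i\<in>Basis. I (dd i u) (dd i v))" by (simp add: ip_dom dd_in u v)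
  finally show ?thesis .
qed

lemma Gr_nonneg: "u \<in> V \<Longrightarrow> 0 \<le> Gr u u"
  using psd_form.psd[OF pd_form.axioms(1)[OF I_pd]] by (auto simp: Gr_eq dd_in intro!: sum_nonneg)

lemma dd_le_Gr:
  assumes u: "u \<in> V" and \<omega>: "norm \<omega> = 1"
  shows "I (dd \<omega> u) (dd \<omega> u) \<le> Gr u u"
  unfolding Gr_def ip_dom[OF dd_in[OF u] dd_in[OF u]]
proof (rule sum_mono)
  fix K assume K: "K \<in> cells M"
  have "ip K (dd \<omega> u) (dd \<omega> u) \<le> (LINT x:K|lborel. (\<Sum>i\<in>Basis. dd i u x * dd i u x))"
    unfolding ip_real
  proof (rule set_integral_mono)
    show "set_integrable lborel K (\<lambda>x. dd \<omega> u x * dd \<omega> u x)" by (intro ip_integrable dd_in u K)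
    show "set_integrable lborel K (\<lambda>x. \<Sum>i\<in>Basis. dd i u x * dd i u x)"
      using ip_integrable[OF dd_in[OF u] dd_in[OF u] K] unfolding set_integrable_def scaleR_sum_right
      by (intro Bochner_Integration.integrable_sum) simp
    fix x assume x: "x \<in> K"
    have "(\<omega> \<bullet> grad u x)\<^sup>2 \<le> (\<omega> \<bullet> \<omega>) * (grad u x \<bullet> grad u x)" by (rule Cauchy_Schwarz_ineq)
    then show "dd \<omega> u x * dd \<omega> u x \<le> (\<Sum>i\<in>Basis. dd i u x * dd i u x)"
      using K \<omega> unfolding inner_grad[OF K x, symmetric] by (auto simp: dd_def x power2_eq_square norm_eq_1)
  qed
  also have "\<dots> = ip K (grad u) (grad u)"
    unfolding ip_def set_lebesgue_integral_def
    by (rule Bochner_Integration.integral_cong) (auto simp: inner_grad[OF K] split: split_indicator)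
  finally show "ip K (dd \<omega> u) (dd \<omega> u) \<le> ip K (grad u) (grad u)" .
qed

lemma trace_op_dd_sum:
  assumes X: "trace_op X" and e: "e \<in> faces M" and u: "u \<in> V" and x: "x \<in> e" and "finite B"
  shows "X e (dd (\<Sum>i\<in>B. c i *\<^sub>R i) u) x = (\<Sum>i\<in>B. c i * X e (dd i u) x)"
  using \<open>finite B\<close>
proof (induction B)
  case empty
  have z: "dd 0 u = 0 *\<^sub>R dd 0 u + 0 *\<^sub>R dd 0 u" by (auto simp: fun_eq_iff dd_def)
  have "X e (0 *\<^sub>R dd 0 u + 0 *\<^sub>R dd 0 u) x = 0"
    by (simp only: trace_opD(2)[OF X e dd_in[OF u] dd_in[OF u] x] mult_zero_left add_0_left)
  then show ?case by (simp only: z[symmetric] sum.empty)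
next
  case (insert i B)
  have "dd (\<Sum>i\<in>insert i B. c i *\<^sub>R i) u = c i *\<^sub>R dd i u + 1 *\<^sub>R dd (\<Sum>i\<in>B. c i *\<^sub>R i) u"
    using dd_lin_dir[of "c i" i 1 "\<Sum>i\<in>B. c i *\<^sub>R i" u] insert by simp
  then have "X e (dd (\<Sum>i\<in>insert i B. c i *\<^sub>R i) u) x = c i * X e (dd i u) x + 1 * X e (dd (\<Sum>i\<in>B. c i *\<^sub>R i) u) x"
    by (simp only: trace_opD(2)[OF X e dd_in[OF u] dd_in[OF u] x])
  then show ?case using insert by simp
qed

text \<open>The normal changes from face to face, so the normal derivative is not the trace of one
  discrete function. Expanding the normal in coordinates reduces it to the derivatives
  \<open>dd i u\<close>, to which the trace inverse estimate applies.\<close>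

lemma normal_derivative_form_le:
  assumes u: "u \<in> V"
  shows "fform (\<lambda>_. 1) (\<lambda>e w. avg M e (dd (nrm M e) w)) (\<lambda>e w. avg M e (dd (nrm M e) w)) u u \<le> (1/2) * (\<Sum>i\<in>Basis. Tr (dd i u))"
proof -
  have one: "face_ip e (X e (dd (nrm M e) u)) (X e (dd (nrm M e) u)) \<le> (\<Sum>i\<in>Basis. face_ip e (X e (dd i u)) (X e (dd i u)))"
    if e: "e \<in> faces M" and X: "trace_op X" for e X
  proof (rule face_ip_mono[OF e])
    show "continuous_on e (X e (dd (nrm M e) u))" "\<And>i. continuous_on e (X e (dd i u))"
      by (rule trace_opD(1)[OF X e dd_in[OF u]])+
    fix x assume x: "x \<in> e"
    have "X e (dd (nrm M e) u) x = (\<Sum>i\<in>Basis. (nrm M e \<bullet> i) * X e (dd i u) x)"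
      using trace_op_dd_sum[OF X e u x finite_Basis, of "\<lambda>i. nrm M e \<bullet> i"] by (simp only: euclidean_representation)
    also have "\<bar>\<dots>\<bar> \<le> L2_set (\<lambda>i. nrm M e \<bullet> i) Basis * L2_set (\<lambda>i. X e (dd i u) x) Basis"
      by (rule order_trans[OF sum_abs]) (simp add: abs_mult L2_set_mult_ineq)
    also have "L2_set (\<lambda>i. nrm M e \<bullet> i) Basis = 1"
      using face_normal(1)[OF e] euclidean_inner[of "nrm M e" "nrm M e"]
      by (simp add: L2_set_def power2_eq_square norm_eq_1)
    finally have "\<bar>X e (dd (nrm M e) u) x\<bar> \<le> sqrt (\<Sum>i\<in>Basis. (X e (dd i u) x)\<^sup>2)" by (simp add: L2_set_def)
    then have "\<bar>X e (dd (nrm M e) u) x\<bar>\<^sup>2 \<le> (sqrt (\<Sum>i\<in>Basis. (X e (dd i u) x)\<^sup>2))\<^sup>2" by (rule power_mono) simp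
    then show "(X e (dd (nrm M e) u) x)\<^sup>2 \<le> (\<Sum>i\<in>Basis. (X e (dd i u) x)\<^sup>2)" by (simp add: sum_nonneg)
  qed
  have "fform (\<lambda>_. 1) (\<lambda>e w. avg M e (dd (nrm M e) w)) (\<lambda>e w. avg M e (dd (nrm M e) w)) u u \<le>
      (\<Sum>e\<in>faces M. (1/2) * (\<Sum>i\<in>Basis. face_ip e (trace_plus M e (dd i u)) (trace_plus M e (dd i u)) + face_ip e (trace_minus M e (dd i u)) (trace_minus M e (dd i u))))"
    unfolding fform_def
  proof (rule sum_mono)
    fix e assume e: "e \<in> faces M"
    show "1 * face_ip e (avg M e (dd (nrm M e) u)) (avg M e (dd (nrm M e) u)) \<le>
      (1/2) * (\<Sum>i\<in>Basis. face_ip e (trace_plus M e (dd i u)) (trace_plus M e (dd i u)) + face_ip e (trace_minus M e (dd i u)) (trace_minus M e (dd i u)))"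
      using avg_le_Tr[OF dd_in[OF u, of "nrm M e"] e] one[OF e trace_op_plus] one[OF e trace_op_minus] by (simp add: sum.distrib)
  qed
  also have "\<dots> = (1/2) * (\<Sum>i\<in>Basis. Tr (dd i u))"
    unfolding Tr_def fform_def sum.distrib[symmetric] sum_distrib_left by (subst sum.swap) simp
  finally show ?thesis .
qed

text \<open>Regrouping by cells reconstitutes whole-boundary norms, so the number of faces of a cell
  never enters the constant.\<close>

lemma trace_inverse:
  assumes C: "trace_inverse_estimate C M" "0 \<le> C" and p: "1 \<le> p"
    and L: "\<And>K. K \<in> cells M \<Longrightarrow> (real p)\<^sup>2 / diameter K \<le> L" and u: "u \<in> V"
  shows "Tr u \<le> C * L * I u u"
proof -
  have "Tr u = (\<Sum>e\<in>faces M. face_ip e (rep (K_plus M e) u) (rep (K_plus M e) u) +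
      (if e \<in> int_faces M then face_ip e (rep (K_minus M e) u) (rep (K_minus M e) u) else 0))"
    unfolding Tr_def fform_def sum.distrib[symmetric]
  proof (rule sum.cong[OF refl])
    fix e assume e: "e \<in> faces M"
    have "face_ip e (trace_plus M e u) (trace_plus M e u) = face_ip e (rep (K_plus M e) u) (rep (K_plus M e) u)"
      by (rule face_ip_cong) (simp_all add: trace_plus_rep[OF e u])
    moreover have "face_ip e (trace_minus M e u) (trace_minus M e u) =
       (if e \<in> int_faces M then face_ip e (rep (K_minus M e) u) (rep (K_minus M e) u) else 0)"
    proof (cases "e \<in> int_faces M")
      case True then show ?thesis by (auto intro!: face_ip_cong simp: trace_minus_rep[OF True u])
    next
      case False then show ?thesis by (simp add: trace_minus_def[abs_def] face_ip_def)
    qed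
    ultimately show "1 * face_ip e (trace_plus M e u) (trace_plus M e u) + 1 * face_ip e (trace_minus M e u) (trace_minus M e u) =
      face_ip e (rep (K_plus M e) u) (rep (K_plus M e) u) +
      (if e \<in> int_faces M then face_ip e (rep (K_minus M e) u) (rep (K_minus M e) u) else 0)" by simp
  qed
  also have "\<dots> = (\<Sum>K\<in>cells M. \<Sum>e | e \<in> faces M \<and> e \<subseteq> frontier K. face_ip e (rep K u) (rep K u))"
    by (rule sum_cells_faces[symmetric])
  also have "\<dots> \<le> (\<Sum>K\<in>cells M. C * L * ip K u u)"
  proof (rule sum_mono)
    fix K assume K: "K \<in> cells M"
    have ipr: "ip K (rep K u) (rep K u) = ip K u u"
      unfolding ip_def set_lebesgue_integral_def
      by (rule Bochner_Integration.integral_cong) (auto simp: indicator_def rep_eq[OF u K])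
    have "(\<Sum>e | e \<in> faces M \<and> e \<subseteq> frontier K. face_ip e (rep K u) (rep K u)) \<le> C * (real p)\<^sup>2 / diameter K * ip K (rep K u) (rep K u)"
      using C(1) K p rep_polys[OF u K] unfolding trace_inverse_estimate_def by blast
    also have "\<dots> = C * ((real p)\<^sup>2 / diameter K) * ip K u u" by (simp add: ipr)
    also have "\<dots> \<le> C * L * ip K u u"
      using L[OF K] C(2) psd_form.psd[OF ip_cell_psd[OF K] u] by (intro mult_right_mono mult_left_mono) auto
    finally show "(\<Sum>e | e \<in> faces M \<and> e \<subseteq> frontier K. face_ip e (rep K u) (rep K u)) \<le> C * L * ip K u u" .
  qed
  also have "\<dots> = C * L * I u u" by (simp add: ip_dom u sum_distrib_left)
  finally show ?thesis .
qed

lemma grad_inverse: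
  assumes C: "inverse_estimate C M" "0 \<le> C" and p: "1 \<le> p"
    and L: "\<And>K. K \<in> cells M \<Longrightarrow> (real p)\<^sup>2 / diameter K \<le> L" and u: "u \<in> V"
  shows "Gr u u \<le> (C * L)\<^sup>2 * I u u"
proof -
  have "ip K (grad u) (grad u) \<le> (C * L)\<^sup>2 * ip K u u" if K: "K \<in> cells M" for K
  proof -
    have ipr: "ip K (rep K u) (rep K u) = ip K u u" "ip K (grad (rep K u)) (grad (rep K u)) = ip K (grad u) (grad u)"
      unfolding ip_def set_lebesgue_integral_def
      by (rule Bochner_Integration.integral_cong; auto simp: indicator_def rep_eq[OF u K] grad_rep(1)[OF u K])+
    have nn: "0 \<le> ip K u u" "0 \<le> ip K (grad u) (grad u)"
      using psd_form.psd[OF ip_cell_psd[OF K]] u by (auto simp: ip_grad K dd_in intro!: sum_nonneg)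
    have "sqrt (ip K (grad (rep K u)) (grad (rep K u))) \<le> C * (real p)\<^sup>2 / diameter K * sqrt (ip K (rep K u) (rep K u))"
      using C(1) K p rep_polys[OF u K] unfolding inverse_estimate_def by blast
    also have "\<dots> = C * ((real p)\<^sup>2 / diameter K) * sqrt (ip K u u)" by (simp add: ipr)
    also have "\<dots> \<le> C * L * sqrt (ip K u u)"
      using L[OF K] C(2) nn by (intro mult_right_mono mult_left_mono) auto
    finally have "(sqrt (ip K (grad u) (grad u)))\<^sup>2 \<le> (C * L * sqrt (ip K u u))\<^sup>2"
      unfolding ipr using nn by (intro power_mono) auto
    then show ?thesis using nn by (simp add: power_mult_distrib)
  qed
  then have "Gr u u \<le> (\<Sum>K\<in>cells M. (C * L)\<^sup>2 * ip K u u)" unfolding Gr_def by (rule sum_mono)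
  then show ?thesis by (simp add: ip_dom u sum_distrib_left)
qed

end

section \<open>Discrete transport and source iteration\<close>

locale dsa_setting = broken_space M p for M :: "'a::euclidean_space mesh" and p :: nat +
  fixes P :: "'a dsa_data" and \<epsilon> :: real
  assumes data: "admissible_data P" and p: "1 \<le> p"
    and \<epsilon>: "0 < \<epsilon>" "\<epsilon> < sqrt (sig_t P / sig_a P)"
    and inv: "inverse_estimate (C_inv P) M" and tr: "trace_inverse_estimate (C_tr P) M"
    and bd_ne: "bd_faces M \<noteq> {}"
begin

abbreviation "D \<equiv> dirs P"
abbreviation "w \<equiv> wt P"
abbreviation "\<Omega> \<equiv> dir P"

definition \<eta> :: real where "\<eta> = \<epsilon> / sig_t P"
definition c :: real where "c = c_ratio P \<epsilon>"

lemma pos: "0 < sig_t P" "0 < sig_a P" "0 < theta P" "theta P < 1" "0 < C_inv P" "0 < C_tr P"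
  using data by (auto simp: admissible_data_def)

lemma quad: "admissible_quadrature P"
  using data by (simp add: admissible_data_def)

lemma \<eta>_pos: "0 < \<eta>"
  using \<epsilon> pos by (simp add: \<eta>_def)

lemma c_eq: "c = 1 - \<epsilon>\<^sup>2 * (sig_a P / sig_t P)"
  using \<epsilon> pos by (simp add: c_def c_ratio_def sigma_s_def sigma_t_def field_simps power2_eq_square)

lemma c_bounds: "0 < c" "c < 1"
proof -
  have "\<epsilon>\<^sup>2 < (sqrt (sig_t P / sig_a P))\<^sup>2" using \<epsilon> by (intro power_strict_mono) auto
  then have "\<epsilon>\<^sup>2 * (sig_a P / sig_t P) < 1" using pos by (simp add: field_simps)
  then show "0 < c" by (simp add: c_eq)
  show "c < 1" using \<epsilon> pos by (simp add: c_eq)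
qed

section \<open>Quadrature moments and reversal of directions\<close>

lemma fin_D: "finite D" by (simp add: dirs_def)

lemma dir: "m \<in> D \<Longrightarrow> norm (\<Omega> m) = 1" and w_pos: "m \<in> D \<Longrightarrow> 0 < w m"
  and w_sum: "(\<Sum>m\<in>D. w m) = 1"
  using quad by (auto simp: admissible_quadrature_def)

lemma second_moment: "i \<in> Basis \<Longrightarrow> j \<in> Basis \<Longrightarrow>
    (\<Sum>m\<in>D. w m * ((\<Omega> m \<bullet> i) * (\<Omega> m \<bullet> j))) = (if i = j then 1 / real DIM('a) else 0)"
proof -
  have "\<forall>i\<in>Basis. \<forall>j\<in>Basis. (\<Sum>m\<in>D. w m * ((\<Omega> m \<bullet> i) * (\<Omega> m \<bullet> j))) = (if i = j then 1 / real DIM('a) else 0)"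
    using quad unfolding admissible_quadrature_def by (elim conjE)
  then show "i \<in> Basis \<Longrightarrow> j \<in> Basis \<Longrightarrow>
    (\<Sum>m\<in>D. w m * ((\<Omega> m \<bullet> i) * (\<Omega> m \<bullet> j))) = (if i = j then 1 / real DIM('a) else 0)" by blast
qed

lemma second_moment_inner: "(\<Sum>m\<in>D. w m * ((\<Omega> m \<bullet> x) * (\<Omega> m \<bullet> y))) = (x \<bullet> y) / real DIM('a)"
proof -
  have "(\<Sum>m\<in>D. w m * ((\<Omega> m \<bullet> x) * (\<Omega> m \<bullet> y))) =
      (\<Sum>m\<in>D. \<Sum>i\<in>Basis. \<Sum>j\<in>Basis. (x \<bullet> i) * (y \<bullet> j) * (w m * ((\<Omega> m \<bullet> i) * (\<Omega> m \<bullet> j))))"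
  proof (rule sum.cong[OF refl])
    fix m
    have e: "\<Omega> m \<bullet> x = (\<Sum>i\<in>Basis. (x \<bullet> i) * (\<Omega> m \<bullet> i))" for x
      by (subst euclidean_inner) (simp add: mult.commute)
    show "w m * ((\<Omega> m \<bullet> x) * (\<Omega> m \<bullet> y)) = (\<Sum>i\<in>Basis. \<Sum>j\<in>Basis. (x \<bullet> i) * (y \<bullet> j) * (w m * ((\<Omega> m \<bullet> i) * (\<Omega> m \<bullet> j))))"
      unfolding e[of x] e[of y] sum_product by (simp only: sum_distrib_left) (simp only: mult_ac)
  qed
  also have "\<dots> = (\<Sum>i\<in>Basis. \<Sum>j\<in>Basis. \<Sum>m\<in>D. (x \<bullet> i) * (y \<bullet> j) * (w m * ((\<Omega> m \<bullet> i) * (\<Omega> m \<bullet> j))))"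
    by (subst sum.swap, rule sum.cong[OF refl], rule sum.swap)
  also have "\<dots> = (\<Sum>i\<in>Basis. \<Sum>j\<in>Basis. if i = j then (x \<bullet> i) * (y \<bullet> j) / real DIM('a) else 0)"
    unfolding sum_distrib_left[symmetric] by (intro sum.cong refl) (simp add: second_moment)
  also have "\<dots> = (\<Sum>i\<in>Basis. (x \<bullet> i) * (y \<bullet> i) / real DIM('a))" by (intro sum.cong refl) simp
  also have "\<dots> = (x \<bullet> y) / real DIM('a)" by (subst euclidean_inner[of x y]) (simp add: sum_divide_distrib)
  finally show ?thesis .
qed

definition opp :: "nat \<Rightarrow> nat" where
  "opp m = (SOME m'. m' \<in> D \<and> \<Omega> m' = - \<Omega> m \<and> w m' = w m)"

lemma opp: assumes "m \<in> D" shows "opp m \<in> D" "\<Omega> (opp m) = - \<Omega> m" "w (opp m) = w m"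
proof -
  have "\<forall>m\<in>D. \<exists>m'\<in>D. \<Omega> m' = - \<Omega> m \<and> w m' = w m"
    using quad unfolding admissible_quadrature_def by (elim conjE)
  then have "\<exists>m'. m' \<in> D \<and> \<Omega> m' = - \<Omega> m \<and> w m' = w m" using assms by blast
  from someI_ex[OF this] show "opp m \<in> D" "\<Omega> (opp m) = - \<Omega> m" "w (opp m) = w m" by (auto simp: opp_def)
qed

text \<open>The reversed node determines direction and weight of the original one, and these pairs
  are distinct.\<close>

lemma opp_bij: "bij_betw opp D D"
proof -
  have inj: "inj_on (\<lambda>m. (\<Omega> m, w m)) D"
    using quad unfolding admissible_quadrature_def by (elim conjE)
  have "inj_on opp D"
  proof (rule inj_onI)
    fix m k assume mk: "m \<in> D" "k \<in> D" "opp m = opp k"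
    then have "(\<Omega> m, w m) = (\<Omega> k, w k)" using opp[OF mk(1)] opp[OF mk(2)] by simp
    then show "m = k" using inj_onD[OF inj _ mk(1,2)] by simp
  qed
  moreover have "opp ` D \<subseteq> D" using opp by auto
  ultimately show ?thesis using fin_D by (simp add: bij_betw_def endo_inj_surj)
qed

text \<open>Streaming after integration by parts, with the derivative on the trial function. Its
  three terms are the broken derivative, the centred jump term and the upwind dissipation, which are
  treated separately in the expansion.\<close>

definition tform :: "nat \<Rightarrow> ('a \<Rightarrow> real) \<Rightarrow> ('a \<Rightarrow> real) \<Rightarrow> real" where
  "tform m u v = I (dd (\<Omega> m) u) v - fform (\<lambda>e. nrm M e \<bullet> \<Omega> m) (jump M) (avg M) u v
     + fform (\<lambda>e. \<bar>nrm M e \<bullet> \<Omega> m\<bar> / 2) (jump M) (jump M) u v"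

lemma fform_neg: "fform (\<lambda>e. - \<kappa> e) X Y u v = - fform \<kappa> X Y u v"
  by (simp add: fform_def sum_negf)

lemma I_sym: "I u v = I v u" by (simp add: ip_real mult.commute)

lemma dd_form_bilinear: "bilinear_form V (\<lambda>u v. I (dd \<omega> u) v)"
  by (rule bilinear_form_compose[OF psd_form.axioms(1)[OF pd_form.axioms(1)[OF I_pd]]]) (simp_all add: dd_in dd_lin)

lemma tform_bilinear: "bilinear_form V (tform m)"
proof -
  note f1 = dd_form_bilinear[of "\<Omega> m"]
  note f2 = fform_bilinear[OF trace_op_jump trace_op_avg, of "\<lambda>e. nrm M e \<bullet> \<Omega> m"]
  note f3 = fform_bilinear[OF trace_op_jump trace_op_jump, of "\<lambda>e. \<bar>nrm M e \<bullet> \<Omega> m\<bar> / 2"]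
  note l = bilinear_form.comb_left[OF f1] bilinear_form.comb_left[OF f2] bilinear_form.comb_left[OF f3]
  note r = bilinear_form.comb_right[OF f1] bilinear_form.comb_right[OF f2] bilinear_form.comb_right[OF f3]
  show ?thesis
    by unfold_locales (simp_all add: subspace_V tform_def l r algebra_simps)
qed

lemma tform_diag:
  assumes u: "u \<in> V"
  shows "tform m u u = fform (\<lambda>e. \<bar>nrm M e \<bullet> \<Omega> m\<bar> / 2) (jump M) (jump M) u u"
  using green[OF u u, of "\<Omega> m"] fform_sym[of "\<lambda>e. nrm M e \<bullet> \<Omega> m" "jump M" "avg M" u u] I_sym[of u "dd (\<Omega> m) u"]
  by (simp add: tform_def)

lemma tform_nonneg: "u \<in> V \<Longrightarrow> 0 \<le> tform m u u"
  unfolding tform_diag by (auto simp: fform_def intro!: sum_nonneg mult_nonneg_nonneg face_ip_nonneg)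

text \<open>\<open>green\<close> exchanges the roles of the arguments in the first two terms, which
  are odd in the direction; the dissipation is symmetric and even.\<close>

lemma tform_opp:
  assumes m: "m \<in> D" and u: "u \<in> V" and v: "v \<in> V"
  shows "tform (opp m) u v = tform m v u"
proof -
  have "dd (\<Omega> (opp m)) u = - dd (\<Omega> m) u" by (simp add: opp(2)[OF m] dd_minus)
  then have 1: "I (dd (\<Omega> (opp m)) u) v = - I (dd (\<Omega> m) u) v"
    using bilinear_form.minus_left[OF psd_form.axioms(1)[OF pd_form.axioms(1)[OF I_pd]] dd_in[OF u] v] by simp
  have 2: "fform (\<lambda>e. nrm M e \<bullet> \<Omega> (opp m)) (jump M) (avg M) u v = - fform (\<lambda>e. nrm M e \<bullet> \<Omega> m) (jump M) (avg M) u v"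
    using fform_neg[of "\<lambda>e. nrm M e \<bullet> \<Omega> m"] by (simp add: opp(2)[OF m])
  have 3: "fform (\<lambda>e. \<bar>nrm M e \<bullet> \<Omega> (opp m)\<bar> / 2) (jump M) (jump M) u v = fform (\<lambda>e. \<bar>nrm M e \<bullet> \<Omega> m\<bar> / 2) (jump M) (jump M) v u"
    using fform_sym[of "\<lambda>e. \<bar>nrm M e \<bullet> \<Omega> m\<bar> / 2" "jump M" "jump M" u v] by (simp add: opp(2)[OF m])
  show ?thesis
    unfolding tform_def 1 2 3
    using green[OF v u, of "\<Omega> m"] I_sym[of v "dd (\<Omega> m) u"]
      fform_sym[of "\<lambda>e. nrm M e \<bullet> \<Omega> m" "avg M" "jump M" v u] by simp
qed

lemma ip_scale: "ip S (\<lambda>x. s * f x) g = s * ip S f (g :: 'a \<Rightarrow> real)"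
  by (simp add: ip_real mult.assoc)

text \<open>The upwind value is the average plus or minus half the jump, so the upwind flux splits
  into a centred flux and a dissipation with weight half the modulus of the normal
  component.\<close>

lemma b_form_eq:
  assumes u: "u \<in> V" and v: "v \<in> V"
  shows "b_form P \<epsilon> M m u v = (1 / \<eta>) * I u v + tform m u v"
proof -
  have 1: "(\<Sum>K\<in>cells M. ip K u (\<lambda>x. \<Omega> m \<bullet> grad v x)) = I u (dd (\<Omega> m) v)"
    unfolding ip_dom[OF u dd_in[OF v]]
  proof (rule sum.cong[OF refl])
    fix K assume K: "K \<in> cells M"
    show "ip K u (\<lambda>x. \<Omega> m \<bullet> grad v x) = ip K u (dd (\<Omega> m) v)"
      unfolding ip_real set_lebesgue_integral_def
      by (rule Bochner_Integration.integral_cong) (use K in \<open>auto simp: indicator_def dd_def\<close>)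
  qed
  have 2: "(\<Sum>e\<in>faces M. face_ip e (\<lambda>x. (\<Omega> m \<bullet> nrm M e) * upwind M (\<Omega> m) e u x) (jump M e v)) =
      fform (\<lambda>e. nrm M e \<bullet> \<Omega> m) (avg M) (jump M) u v + fform (\<lambda>e. \<bar>nrm M e \<bullet> \<Omega> m\<bar> / 2) (jump M) (jump M) u v"
    unfolding fform_def sum.distrib[symmetric]
  proof (rule sum.cong[OF refl])
    fix e assume e: "e \<in> faces M"
    have "(\<lambda>x. (\<Omega> m \<bullet> nrm M e) * upwind M (\<Omega> m) e u x) = (\<lambda>x. (nrm M e \<bullet> \<Omega> m) * avg M e u x + \<bar>nrm M e \<bullet> \<Omega> m\<bar> / 2 * jump M e u x)"
      by (auto simp: fun_eq_iff upwind_def avg_def jump_def inner_commute abs_if field_simps)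
    then show "face_ip e (\<lambda>x. (\<Omega> m \<bullet> nrm M e) * upwind M (\<Omega> m) e u x) (jump M e v) =
       (nrm M e \<bullet> \<Omega> m) * face_ip e (avg M e u) (jump M e v) + \<bar>nrm M e \<bullet> \<Omega> m\<bar> / 2 * face_ip e (jump M e u) (jump M e v)"
      by (simp only: face_ip_comb[OF e trace_opD(1)[OF trace_op_avg e u] trace_opD(1)[OF trace_op_jump e u] trace_opD(1)[OF trace_op_jump e v]])
  qed
  have 3: "I (\<lambda>x. sigma_t P \<epsilon> * u x) v = (1 / \<eta>) * I u v"
    by (simp only: ip_scale) (simp add: sigma_t_def \<eta>_def)
  show ?thesis
    unfolding b_form_def 1 2 3 tform_def using green[OF u v, of "\<Omega> m"] by simp
qed

lemma dd_moment:
  assumes u: "u \<in> V" and v: "v \<in> V"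
  shows "(\<Sum>m\<in>D. w m * I (dd (\<Omega> m) u) (dd (\<Omega> m) v)) = Gr u v / real DIM('a)"
proof -
  have K: "(\<Sum>m\<in>D. w m * ip K (dd (\<Omega> m) u) (dd (\<Omega> m) v)) = ip K (grad u) (grad v) / real DIM('a)" if K: "K \<in> cells M" for K
  proof -
    have "(\<Sum>m\<in>D. w m * ip K (dd (\<Omega> m) u) (dd (\<Omega> m) v)) =
        (\<Sum>m\<in>D. \<integral>x. w m * (indicator K x *\<^sub>R (dd (\<Omega> m) u x * dd (\<Omega> m) v x)) \<partial>lborel)"
      by (simp add: ip_real set_lebesgue_integral_def)
    also have "\<dots> = (\<integral>x. (\<Sum>m\<in>D. w m * (indicator K x *\<^sub>R (dd (\<Omega> m) u x * dd (\<Omega> m) v x))) \<partial>lborel)"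
      by (rule Bochner_Integration.integral_sum[symmetric])
         (use ip_integrable[OF dd_in[OF u] dd_in[OF v] K] in \<open>simp add: set_integrable_def\<close>)
    also have "\<dots> = (\<integral>x. (indicator K x *\<^sub>R (grad u x \<bullet> grad v x)) / real DIM('a) \<partial>lborel)"
    proof (rule Bochner_Integration.integral_cong[OF refl])
      fix x
      show "(\<Sum>m\<in>D. w m * (indicator K x *\<^sub>R (dd (\<Omega> m) u x * dd (\<Omega> m) v x))) = (indicator K x *\<^sub>R (grad u x \<bullet> grad v x)) / real DIM('a)"
      proof (cases "x \<in> K")
        case True
        then have "x \<in> \<Union>(cells M)" using K by blast
        then show ?thesis using True by (simp add: dd_def second_moment_inner)
      qed simp
    qed
    finally show ?thesis by (simp add: ip_def set_lebesgue_integral_def)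
  qed
  have "(\<Sum>m\<in>D. w m * I (dd (\<Omega> m) u) (dd (\<Omega> m) v)) = (\<Sum>K\<in>cells M. \<Sum>m\<in>D. w m * ip K (dd (\<Omega> m) u) (dd (\<Omega> m) v))"
    by (subst sum.swap) (simp add: ip_dom dd_in u v sum_distrib_left)
  also have "\<dots> = Gr u v / real DIM('a)" by (simp add: K Gr_def sum_divide_distrib)
  finally show ?thesis .
qed

text \<open>For numbers of modulus at most 1 the modulus dominates the square, and the squares
  average to \<open>1 / d\<close> by the second moments, \<open>d\<close> being the dimension. This
  keeps the jumps under control without any mesh size.\<close>

lemma beta_ge: assumes e: "e \<in> faces M" shows "1 / (2 * real DIM('a)) \<le> beta P M e"
proof -
  have "1 / real DIM('a) = (\<Sum>m\<in>D. w m * ((\<Omega> m \<bullet> nrm M e) * (\<Omega> m \<bullet> nrm M e)))"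
    using face_normal(1)[OF e] by (simp add: second_moment_inner norm_eq_1)
  also have "\<dots> \<le> (\<Sum>m\<in>D. w m * \<bar>\<Omega> m \<bullet> nrm M e\<bar>)"
  proof (intro sum_mono mult_left_mono)
    fix m assume m: "m \<in> D"
    have "\<bar>\<Omega> m \<bullet> nrm M e\<bar> \<le> 1" using Cauchy_Schwarz_ineq2[of "\<Omega> m" "nrm M e"] dir[OF m] face_normal(1)[OF e] by simp
    then have "\<bar>\<Omega> m \<bullet> nrm M e\<bar> * \<bar>\<Omega> m \<bullet> nrm M e\<bar> \<le> \<bar>\<Omega> m \<bullet> nrm M e\<bar> * 1" by (intro mult_left_mono) auto
    then show "(\<Omega> m \<bullet> nrm M e) * (\<Omega> m \<bullet> nrm M e) \<le> \<bar>\<Omega> m \<bullet> nrm M e\<bar>" by (simp flip: abs_mult)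
    show "0 \<le> w m" using w_pos[OF m] by simp
  qed
  finally show ?thesis by (simp add: beta_def field_simps)
qed

lemma fform_beta: "fform (beta P M) X Y u v = (\<Sum>m\<in>D. w m * fform (\<lambda>e. \<bar>nrm M e \<bullet> \<Omega> m\<bar> / 2) X Y u v)"
proof -
  have "fform (beta P M) X Y u v = (\<Sum>e\<in>faces M. \<Sum>m\<in>D. w m * (\<bar>nrm M e \<bullet> \<Omega> m\<bar> / 2 * face_ip e (X e u) (Y e v)))"
    unfolding fform_def
  proof (rule sum.cong[OF refl])
    fix e
    show "beta P M e * face_ip e (X e u) (Y e v) = (\<Sum>m\<in>D. w m * (\<bar>nrm M e \<bullet> \<Omega> m\<bar> / 2 * face_ip e (X e u) (Y e v)))"
      unfolding beta_def sum_divide_distrib sum_distrib_right by (simp add: inner_commute mult.assoc)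
  qed
  also have "\<dots> = (\<Sum>m\<in>D. w m * fform (\<lambda>e. \<bar>nrm M e \<bullet> \<Omega> m\<bar> / 2) X Y u v)"
    unfolding fform_def sum_distrib_left by (rule sum.swap)
  finally show ?thesis .
qed

lemma J_le_beta: "J u \<le> 2 * real DIM('a) * fform (beta P M) (jump M) (jump M) u u"
  unfolding J_def fform_def sum_distrib_left
proof (rule sum_mono)
  fix e assume e: "e \<in> faces M"
  have "1 \<le> 2 * real DIM('a) * beta P M e" using beta_ge[OF e] by (simp add: field_simps)
  from mult_right_mono[OF this face_ip_nonneg[of e "jump M e u"]]
  show "1 * face_ip e (jump M e u) (jump M e u) \<le> 2 * real DIM('a) * (beta P M e * face_ip e (jump M e u) (jump M e u))"
    by (simp add: mult.assoc)
qed

text \<open>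
  If \<open>g\<close> has neither jumps nor a derivative in direction \<open>i\<close>, the divergence theorem for
  \<open>(x \<bullet> i) * g\<^sup>2\<close> in direction \<open>i\<close> gives \<open>\<integral> g\<^sup>2 = 0\<close>.
\<close>

lemma no_jump_no_derivative_0:
  assumes g: "g \<in> V" and J: "J g = 0" and i: "i \<in> Basis" and d: "dd i g = 0"
  shows "g = 0"
proof -
  define f where "f = (\<lambda>K x. (rep K g x * rep K g x) * (x \<bullet> i))"
  define f' where "f' = (\<lambda>K x. ((i \<bullet> grad (rep K g) x) * rep K g x + (i \<bullet> grad (rep K g) x) * rep K g x) * (x \<bullet> i) + (rep K g x * rep K g x))"
  have c: "continuous_on UNIV (rep K g)" "continuous_on UNIV (\<lambda>x. i \<bullet> grad (rep K g) x)" if "K \<in> cells M" for K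
    using continuous_on_polys[OF rep_polys[OF g that]] continuous_on_polys[OF polys_dir_deriv[OF rep_polys[OF g that]]] by auto
  have "I g g = (\<Sum>K\<in>cells M. LINT x:K|lborel. f' K x)"
    unfolding ip_dom[OF g g]
  proof (rule sum.cong[OF refl])
    fix K assume K: "K \<in> cells M"
    have "i \<bullet> grad (rep K g) x = 0" if "x \<in> K" for x
      using fun_cong[OF d, of x] dd_eq[OF g K that, of i] by simp
    then show "ip K g g = (LINT x:K|lborel. f' K x)"
      unfolding ip_real set_lebesgue_integral_def
      by (intro Bochner_Integration.integral_cong) (auto simp: indicator_def f'_def rep_eq[OF g K])
  qed
  also have "\<dots> = (\<Sum>e\<in>faces M. (nrm M e \<bullet> i) * ((LINT x:e|surface_measure e. f (K_plus M e) x) -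
       (if e \<in> int_faces M then LINT x:e|surface_measure e. f (K_minus M e) x else 0)))"
  proof (rule broken_divergence)
    fix K assume K: "K \<in> cells M"
    show "((\<lambda>s. f K (x + s *\<^sub>R i)) has_real_derivative f' K (x + s *\<^sub>R i)) (at s)" for x s
    proof -
      have l: "((\<lambda>s. (x + s *\<^sub>R i) \<bullet> i) has_real_derivative 1) (at s)"
        using i by (auto intro!: derivative_eq_intros simp: inner_add_left)
      note q = polys_line_derivative[OF rep_polys[OF g K], of x i s]
      show ?thesis
        unfolding f_def f'_def by (rule DERIV_cong[OF DERIV_mult[OF DERIV_mult[OF q q] l]]) (simp add: algebra_simps)
    qed
    show "continuous_on UNIV (f K)" "continuous_on UNIV (f' K)"
      unfolding f_def f'_def by (intro continuous_intros c K)+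
  qed
  also have "\<dots> = 0"
  proof (rule sum.neutral, rule ballI)
    fix e assume e: "e \<in> faces M"
    note tc = trace_cont[OF e g]
    \<comment> \<open>The difference of the squared traces is the jump times their sum, so a
      vanishing jump norm annihilates it by Cauchy-Schwarz.\<close>
    define h where "h = (\<lambda>x. (trace_plus M e g x + trace_minus M e g x) * (x \<bullet> i))"
    have ch: "continuous_on e h" unfolding h_def by (intro continuous_intros tc)
    have p: "(LINT x:e|surface_measure e. f (K_plus M e) x) = face_ip e (trace_plus M e g) (\<lambda>x. trace_plus M e g x * (x \<bullet> i))"
      unfolding f_def mult.assoc face_ip_def[symmetric]
      by (rule face_ip_cong) (simp_all add: trace_plus_rep[OF e g])
    have m: "(if e \<in> int_faces M then LINT x:e|surface_measure e. f (K_minus M e) x else 0) =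
       face_ip e (trace_minus M e g) (\<lambda>x. trace_minus M e g x * (x \<bullet> i))"
    proof (cases "e \<in> int_faces M")
      case True
      then show ?thesis
        unfolding f_def mult.assoc face_ip_def[symmetric] by (auto intro!: face_ip_cong simp: trace_minus_rep[OF True g])
    next
      case False
      then show ?thesis by (simp add: trace_minus_def[abs_def] face_ip_def)
    qed
    have "face_ip e (trace_plus M e g) (\<lambda>x. trace_plus M e g x * (x \<bullet> i)) - face_ip e (trace_minus M e g) (\<lambda>x. trace_minus M e g x * (x \<bullet> i)) =
        (LINT x:e|surface_measure e. trace_plus M e g x * (trace_plus M e g x * (x \<bullet> i)) - trace_minus M e g x * (trace_minus M e g x * (x \<bullet> i)))"
      unfolding face_ip_def
      by (rule set_integral_diff(2)[symmetric]) (intro face_integrable[OF e e e] continuous_intros tc)+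
    also have "\<dots> = face_ip e (jump M e g) h"
      unfolding face_ip_def h_def jump_def by (simp add: algebra_simps)
    also have "\<dots> = 0"
    proof -
      have "face_ip e (jump M e g) (jump M e g) = 0"
        using J e sum_nonneg_eq_0_iff[OF fin_faces, of "\<lambda>e. 1 * face_ip e (jump M e g) (jump M e g)"]
        unfolding J_def fform_def by (simp add: face_ip_nonneg)
      then show ?thesis using face_ip_CS[OF e trace_opD(1)[OF trace_op_jump e g] ch] by simp
    qed
    finally show "(nrm M e \<bullet> i) * ((LINT x:e|surface_measure e. f (K_plus M e) x) -
       (if e \<in> int_faces M then LINT x:e|surface_measure e. f (K_minus M e) x else 0)) = 0"
      unfolding p m by simp
  qed
  finally show ?thesis using pd_form.eq_0_iff[OF I_pd g] by simp
qed

text \<open>The averaged diagonal values control all jumps, including boundary traces. Without jumps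
  only the directional derivatives remain, and the second moments turn their vanishing into that of
  the full gradient.\<close>

lemma tform_nondegenerate:
  assumes g: "g \<in> V" and t: "\<And>m v. m \<in> D \<Longrightarrow> v \<in> V \<Longrightarrow> tform m g v = 0"
  shows "g = 0"
proof -
  have "fform (beta P M) (jump M) (jump M) g g = 0"
    unfolding fform_beta using t[OF _ g] by (simp add: tform_diag[OF g, symmetric])
  then have J: "J g = 0" using J_le_beta[of g] J_nonneg[of g] by simp
  have z: "fform \<kappa> (jump M) Y g v = 0" if "trace_op Y" "\<And>e. e \<in> faces M \<Longrightarrow> \<bar>\<kappa> e\<bar> \<le> 1" "v \<in> V" for \<kappa> Y v
    using fform_CS[OF trace_op_jump that(1,2) g that(3)] J by (simp add: J_def)
  have nd: "\<bar>nrm M e \<bullet> \<Omega> m\<bar> \<le> 1" if "e \<in> faces M" "m \<in> D" for e m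
    using Cauchy_Schwarz_ineq2[of "nrm M e" "\<Omega> m"] dir[OF that(2)] face_normal(1)[OF that(1)] by simp
  have "I (dd (\<Omega> m) g) v = 0" if m: "m \<in> D" and v: "v \<in> V" for m v
  proof -
    have "fform (\<lambda>e. nrm M e \<bullet> \<Omega> m) (jump M) (avg M) g v = 0"
      by (rule z[OF trace_op_avg _ v]) (simp add: nd m)
    moreover have "fform (\<lambda>e. \<bar>nrm M e \<bullet> \<Omega> m\<bar> / 2) (jump M) (jump M) g v = 0"
      by (rule z[OF trace_op_jump _ v]) (use nd[OF _ m] in fastforce)
    ultimately show ?thesis using t[OF m v] by (simp add: tform_def)
  qed
  then have "Gr g g = 0" using dd_moment[OF g g] by (simp add: dd_in g)
  then have "(\<Sum>i\<in>Basis. I (dd i g) (dd i g)) = 0" by (simp add: Gr_eq g)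
  then have "I (dd i g) (dd i g) = 0" if "i \<in> Basis" for i
    using that sum_nonneg_eq_0_iff[of Basis "\<lambda>i. I (dd i g) (dd i g)"] psd_form.psd[OF pd_form.axioms(1)[OF I_pd] dd_in[OF g]] by simp
  then have "dd i g = 0" if "i \<in> Basis" for i
    using that pd_form.eq_0_iff[OF I_pd dd_in[OF g]] by blast
  then show ?thesis using no_jump_no_derivative_0[OF g J] nonempty_Basis by blast
qed

sublocale TR: transport_response V I D w \<eta> c tform opp
proof (intro transport_response.intro I_pd transport_response_axioms.intro)
  show "fin_dim V" by (rule fin_dim_V)
qed (simp_all add: fin_D w_pos w_sum \<eta>_pos c_bounds tform_bilinear tform_nonneg opp opp_bij tform_opp tform_nondegenerate)

lemma Vc: "s *\<^sub>R u + t *\<^sub>R v \<in> V" if "u \<in> V" "v \<in> V"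
  using that subspace_V by (simp add: subspace_add subspace_scale)

section \<open>The defined operators as instances of the abstract response\<close>

lemma Psi_hat_eq:
  assumes m: "m \<in> D" and g: "g \<in> V"
  shows "Psi_hat P \<epsilon> M p m g = TR.\<psi> m g"
proof -
  have "(\<psi> \<in> V \<and> (\<forall>v\<in>V. \<epsilon> * b_form P \<epsilon> M m \<psi> v = I (\<lambda>x. sig_t P * g x) v)) =
      (\<psi> \<in> V \<and> (\<forall>v\<in>V. I \<psi> v + \<eta> * tform m \<psi> v = I g v))" for \<psi>
  proof (rule conj_cong[OF refl], rule ball_cong[OF refl])
    fix v assume \<psi>: "\<psi> \<in> V" and v: "v \<in> V"
    have "\<epsilon> * b_form P \<epsilon> M m \<psi> v = sig_t P * (I \<psi> v + \<eta> * tform m \<psi> v)"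
      using \<epsilon> pos by (simp add: b_form_eq[OF \<psi> v] \<eta>_def field_simps)
    moreover have "I (\<lambda>x. sig_t P * g x) v = sig_t P * I g v" by (rule ip_scale)
    ultimately show "(\<epsilon> * b_form P \<epsilon> M m \<psi> v = I (\<lambda>x. sig_t P * g x) v) = (I \<psi> v + \<eta> * tform m \<psi> v = I g v)"
      using pos by simp
  qed
  then show ?thesis unfolding Psi_hat_def TR.\<psi>_def by (simp only:)
qed

lemma H_op_eq: assumes g: "g \<in> V" shows "H_op P \<epsilon> M p g = TR.H g"
  unfolding H_op_def TR.H_def by (auto simp: fun_eq_iff sum_fun_apply Psi_hat_eq[OF _ g] intro!: sum.cong)

lemma Hi_eq: "the_inv_into V (H_op P \<epsilon> M p) u = TR.Hi u"
proof -
  have "(x \<in> V \<and> H_op P \<epsilon> M p x = u) = (x \<in> V \<and> TR.H x = u)" for x by (auto simp: H_op_eq)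
  then show ?thesis unfolding the_inv_into_def TR.Hi_def by simp
qed

lemma a_ex_eq: assumes u: "u \<in> V" and v: "v \<in> V" shows "a_ex P \<epsilon> M p u v = TR.ax u v"
proof -
  have "a_ex P \<epsilon> M p u v = (1 / \<epsilon>) * I (\<lambda>x. sig_t P * (TR.Hi u - c *\<^sub>R u) x) v"
    by (simp add: a_ex_def Hi_eq c_def)
  also have "\<dots> = (1 / \<epsilon>) * (sig_t P * I (TR.Hi u - c *\<^sub>R u) v)" by (simp only: ip_scale)
  finally show ?thesis by (simp add: TR.ax_def) (simp add: \<eta>_def)
qed

lemma a_ex_pd: "pd_form V (a_ex P \<epsilon> M p)"
  by (rule pd_form_cong[OF TR.ax_pd a_ex_eq])

lemma max_eigenvalue_H:
  assumes ev: "v0 \<in> V" "v0 \<noteq> 0" "TR.G v0 = N *\<^sub>R v0"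
    and max: "\<And>l v. v \<in> V \<Longrightarrow> v \<noteq> 0 \<Longrightarrow> TR.G v = l *\<^sub>R v \<Longrightarrow> l \<le> N"
  shows "c * lambda_max_H P \<epsilon> M p = N" "lambda_max_H P \<epsilon> M p < 1"
proof -
  let ?E = "{l. \<exists>v\<in>V. v \<noteq> (\<lambda>_. 0) \<and> H_op P \<epsilon> M p v = (\<lambda>x. l * v x)}"
  have E: "?E = {l. \<exists>v\<in>V. v \<noteq> 0 \<and> TR.H v = l *\<^sub>R v}"
    by (auto simp: H_op_eq zero_fun_def scaleR_fun_def)
  have fin: "finite ?E" unfolding E
    by (rule finite_eigenvalues[OF fin_dim_V I_pd]) (simp_all add: TR.H_in TR.H_sa)
  have GH: "TR.G v = (c * l) *\<^sub>R v \<longleftrightarrow> TR.H v = l *\<^sub>R v" for v l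
    using c_bounds by (simp add: TR.G_def flip: scaleR_scaleR)
  have "Max ?E = N / c"
  proof (rule Max_eqI[OF fin])
    show "N / c \<in> ?E" unfolding E using ev GH[of v0 "N / c"] c_bounds by auto
    fix l assume "l \<in> ?E"
    then obtain v where v: "v \<in> V" "v \<noteq> 0" "TR.H v = l *\<^sub>R v" unfolding E by blast
    then have "c * l \<le> N" using max GH[of v l] by blast
    then show "l \<le> N / c" using c_bounds by (simp add: field_simps)
  qed
  then have lm: "lambda_max_H P \<epsilon> M p = N / c" by (simp add: lambda_max_H_def max_eigenvalue_on_def)
  then show "c * lambda_max_H P \<epsilon> M p = N" using c_bounds by simp
  have "TR.H v0 = (N / c) *\<^sub>R v0" using ev GH[of v0 "N / c"] c_bounds by simp
  then show "lambda_max_H P \<epsilon> M p < 1" unfolding lm using TR.H_eigenvalue_less_1 ev by blast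
qed

lemma eta_sigma_s: "\<eta> * sigma_s P \<epsilon> = c"
  using \<epsilon> pos by (simp add: \<eta>_def c_def c_ratio_def sigma_t_def sigma_s_def field_simps)

text \<open>Multiplying the transport equation by \<open>\<eta>\<close> normalises its zeroth order
  term, and the source becomes \<open>c *\<^sub>R \<phi> + \<eta> *\<^sub>R q\<close> because
  \<open>\<eta>\<close> times the scattering coefficient is \<open>c\<close>.\<close>

lemma transport_solve_iff:
  assumes q: "q \<in> V" and \<phi>: "\<phi> \<in> V"
  shows "transport_solve P \<epsilon> M p q \<phi> \<psi> \<longleftrightarrow> (\<forall>m\<in>D. \<psi> m = TR.\<psi> m (c *\<^sub>R \<phi> + \<eta> *\<^sub>R q))"
proof -
  let ?g = "c *\<^sub>R \<phi> + \<eta> *\<^sub>R q"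
  have g: "?g \<in> V" by (rule Vc[OF \<phi> q])
  have src: "I ?g v = \<eta> * I (\<lambda>x. sigma_s P \<epsilon> * \<phi> x + q x) v" if "v \<in> V" for v
  proof -
    have "?g = (\<lambda>x. \<eta> * (sigma_s P \<epsilon> * \<phi> x + q x))"
      by (simp add: fun_eq_iff algebra_simps flip: eta_sigma_s)
    then show ?thesis by (simp only: ip_scale)
  qed
  have "(\<psi> m \<in> V \<and> (\<forall>v\<in>V. b_form P \<epsilon> M m (\<psi> m) v = I (\<lambda>x. sigma_s P \<epsilon> * \<phi> x + q x) v)) \<longleftrightarrow> \<psi> m = TR.\<psi> m ?g"
    if m: "m \<in> D" for m
  proof -
    have "(\<psi> m \<in> V \<and> (\<forall>v\<in>V. b_form P \<epsilon> M m (\<psi> m) v = I (\<lambda>x. sigma_s P \<epsilon> * \<phi> x + q x) v)) \<longleftrightarrow>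
      (\<psi> m \<in> V \<and> (\<forall>v\<in>V. I (\<psi> m) v + \<eta> * tform m (\<psi> m) v = I ?g v))"
    proof (rule conj_cong[OF refl], rule ball_cong[OF refl])
      fix v assume \<psi>: "\<psi> m \<in> V" and v: "v \<in> V"
      have "I (\<psi> m) v + \<eta> * tform m (\<psi> m) v = \<eta> * b_form P \<epsilon> M m (\<psi> m) v"
        using \<eta>_pos by (simp add: b_form_eq[OF \<psi> v] field_simps)
      then show "(b_form P \<epsilon> M m (\<psi> m) v = I (\<lambda>x. sigma_s P \<epsilon> * \<phi> x + q x) v) = (I (\<psi> m) v + \<eta> * tform m (\<psi> m) v = I ?g v)"
        using \<eta>_pos by (simp add: src[OF v])
    qed
    also have "\<dots> \<longleftrightarrow> \<psi> m = TR.\<psi> m ?g"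
      using TR.\<psi>_unique[OF m g] TR.\<psi>_in[OF m g] TR.\<psi>_eq[OF m g] by metis
    finally show ?thesis .
  qed
  then show ?thesis unfolding transport_solve_def by (intro ball_cong refl) blast
qed

lemma mean_solution: "(\<forall>m\<in>D. \<psi> m = TR.\<psi> m g) \<Longrightarrow> (\<lambda>x. \<Sum>m\<in>D. w m * \<psi> m x) = TR.H g"
  unfolding TR.H_def by (auto simp: fun_eq_iff sum_fun_apply intro!: sum.cong)

lemma solution_mean_iff:
  assumes "q \<in> V" "\<phi> \<in> V"
  shows "(\<exists>\<psi>. transport_solve P \<epsilon> M p q \<phi> \<psi> \<and> \<phi>' = (\<lambda>x. \<Sum>m\<in>D. w m * \<psi> m x)) \<longleftrightarrow> \<phi>' = TR.H (c *\<^sub>R \<phi> + \<eta> *\<^sub>R q)"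
  unfolding transport_solve_iff[OF assms]
proof
  assume "\<exists>\<psi>. (\<forall>m\<in>D. \<psi> m = TR.\<psi> m (c *\<^sub>R \<phi> + \<eta> *\<^sub>R q)) \<and> \<phi>' = (\<lambda>x. \<Sum>m\<in>D. w m * \<psi> m x)"
  then show "\<phi>' = TR.H (c *\<^sub>R \<phi> + \<eta> *\<^sub>R q)" using mean_solution by blast
next
  assume "\<phi>' = TR.H (c *\<^sub>R \<phi> + \<eta> *\<^sub>R q)"
  then show "\<exists>\<psi>. (\<forall>m\<in>D. \<psi> m = TR.\<psi> m (c *\<^sub>R \<phi> + \<eta> *\<^sub>R q)) \<and> \<phi>' = (\<lambda>x. \<Sum>m\<in>D. w m * \<psi> m x)"
    using mean_solution[of "\<lambda>m. TR.\<psi> m (c *\<^sub>R \<phi> + \<eta> *\<^sub>R q)"]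
    by (intro exI[of _ "\<lambda>m. TR.\<psi> m (c *\<^sub>R \<phi> + \<eta> *\<^sub>R q)"]) simp
qed

lemma SI_step_eq:
  assumes "q \<in> V" "\<phi> \<in> V" shows "SI_step P \<epsilon> M p q \<phi> = TR.G \<phi> + \<eta> *\<^sub>R TR.H q"
proof -
  have "SI_step P \<epsilon> M p q \<phi> = TR.H (c *\<^sub>R \<phi> + \<eta> *\<^sub>R q)"
    unfolding SI_step_def by (simp add: solution_mean_iff[OF assms])
  then show ?thesis by (simp add: TR.H_lin assms TR.G_def)
qed

lemma phi_star:
  assumes q: "q \<in> V"
  shows phi_star_in: "phi_star P \<epsilon> M p q \<in> V"
    and phi_star_eq: "phi_star P \<epsilon> M p q = TR.G (phi_star P \<epsilon> M p q) + \<eta> *\<^sub>R TR.H q"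
proof -
  have y: "\<eta> *\<^sub>R TR.H q \<in> V" using TR.H_in[OF q] by (simp add: subspace_scale[OF subspace_V])
  have "(\<phi> \<in> V \<and> (\<exists>\<psi>. transport_solve P \<epsilon> M p q \<phi> \<psi> \<and> \<phi> = (\<lambda>x. \<Sum>m\<in>D. w m * \<psi> m x))) \<longleftrightarrow>
      (\<phi> \<in> V \<and> \<phi> = TR.G \<phi> + \<eta> *\<^sub>R TR.H q)" for \<phi>
    by (rule conj_cong[OF refl]) (simp only: solution_mean_iff[OF q] TR.H_lin q TR.G_def)
  then have "phi_star P \<epsilon> M p q = (THE \<phi>. \<phi> \<in> V \<and> \<phi> = TR.G \<phi> + \<eta> *\<^sub>R TR.H q)"
    unfolding phi_star_def by (simp only:)
  with theI'[OF TR.fixed_point_ex1[OF y]]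
  show "phi_star P \<epsilon> M p q \<in> V" "phi_star P \<epsilon> M p q = TR.G (phi_star P \<epsilon> M p q) + \<eta> *\<^sub>R TR.H q" by simp_all
qed

text \<open>Every member of \<open>V\<close> is the error of some iterate, already for the source 0,
  so the step fixes the map on \<open>V\<close>; off \<open>V\<close> extensionality fixes
  it.\<close>

lemma error_propagator_eq:
  assumes A_in: "\<And>v. v \<in> V \<Longrightarrow> A v \<in> V"
    and A_lin: "\<And>u v s t. u \<in> V \<Longrightarrow> v \<in> V \<Longrightarrow> A (s *\<^sub>R u + t *\<^sub>R v) = s *\<^sub>R A u + t *\<^sub>R A v"
    and step: "\<And>q \<phi>. q \<in> V \<Longrightarrow> \<phi> \<in> V \<Longrightarrow> phi_star P \<epsilon> M p q - step q \<phi> = A (phi_star P \<epsilon> M p q - \<phi>)"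
    and v: "v \<in> V"
  shows "error_propagator P \<epsilon> M p step v = A v"
proof -
  let ?Q = "\<lambda>A. A \<in> V \<rightarrow>\<^sub>E V \<and> linear_on_space V A \<and> (\<forall>q\<in>V. \<forall>\<phi>\<in>V.
           A (\<lambda>x. phi_star P \<epsilon> M p q x - \<phi> x) = (\<lambda>x. phi_star P \<epsilon> M p q x - step q \<phi> x))"
  have fd: "(\<lambda>x. f x - g x) = f - g" for f g :: "'a \<Rightarrow> real" by (simp add: fun_eq_iff)
  have "(THE A. ?Q A) = restrict A V"
  proof (rule the_equality)
    show "?Q (restrict A V)"
    proof (intro conjI ballI)
      show "restrict A V \<in> V \<rightarrow>\<^sub>E V" using A_in by auto
      show "linear_on_space V (restrict A V)"
        unfolding linear_on_space_def fun_comb by (auto simp: Vc A_lin)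
      fix q \<phi> assume q: "q \<in> V" and \<phi>: "\<phi> \<in> V"
      have "phi_star P \<epsilon> M p q - \<phi> \<in> V" by (rule subspace_diff[OF subspace_V phi_star_in[OF q] \<phi>])
      then show "restrict A V (\<lambda>x. phi_star P \<epsilon> M p q x - \<phi> x) = (\<lambda>x. phi_star P \<epsilon> M p q x - step q \<phi> x)"
        using step[OF q \<phi>] by (simp add: fd)
    qed
    fix A' assume A': "?Q A'"
    have z: "0 \<in> V" by (rule subspace_0[OF subspace_V])
    show "A' = restrict A V"
    proof (rule extensionalityI[where A = V])
      show "A' \<in> extensional V" "restrict A V \<in> extensional V" using A' by (auto simp: PiE_def)
      fix e assume e: "e \<in> V"
      let ?\<phi> = "phi_star P \<epsilon> M p 0 - e"
      have \<phi>: "?\<phi> \<in> V" by (rule subspace_diff[OF subspace_V phi_star_in[OF z] e])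
      have "A' (\<lambda>x. phi_star P \<epsilon> M p 0 x - ?\<phi> x) = (\<lambda>x. phi_star P \<epsilon> M p 0 x - step 0 ?\<phi> x)"
        using A' z \<phi> by blast
      then have "A' (phi_star P \<epsilon> M p 0 - ?\<phi>) = phi_star P \<epsilon> M p 0 - step 0 ?\<phi>" by (simp only: fd)
      also have "\<dots> = A (phi_star P \<epsilon> M p 0 - ?\<phi>)" by (rule step[OF z \<phi>])
      finally show "A' e = restrict A V e" using e by simp
    qed
  qed
  then show ?thesis using v by (simp add: error_propagator_def)
qed

lemma G_op_eq: "v \<in> V \<Longrightarrow> G_op P \<epsilon> M p v = TR.G v"
  unfolding G_op_def
proof (rule error_propagator_eq[OF TR.G_in TR.G_lin])
  fix q \<phi> assume q: "q \<in> V" and \<phi>: "\<phi> \<in> V"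
  have "phi_star P \<epsilon> M p q - SI_step P \<epsilon> M p q \<phi> = TR.G (phi_star P \<epsilon> M p q) - TR.G \<phi>"
    by (subst phi_star_eq[OF q]) (simp add: SI_step_eq[OF q \<phi>])
  then show "phi_star P \<epsilon> M p q - SI_step P \<epsilon> M p q \<phi> = TR.G (phi_star P \<epsilon> M p q - \<phi>)"
    using TR.G_lin[OF phi_star_in[OF q] \<phi>, of 1 "-1"] by simp
qed

lemma cells_ne: "cells M \<noteq> {}"
  using bd_ne K_plus(1) by (auto simp: faces_def)

text \<open>The indicator of one cell. It makes the suprema over nonzero functions nonempty.\<close>

lemma V_nontrivial: obtains z where "z \<in> V" "z \<noteq> 0"
proof -
  obtain K where K: "K \<in> cells M" using cells_ne by blast
  obtain x where x: "x \<in> K" using cell(3)[OF K] by blast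
  define z where "z = (\<lambda>y. if y \<in> K then 1 else (0::real))"
  have "z \<in> V"
  proof (rule VhI)
    fix K' assume K': "K' \<in> cells M"
    show "\<exists>q\<in>polys p. \<forall>y\<in>K'. z y = q y"
    proof (cases "K' = K")
      case True then show ?thesis by (intro bexI[OF _ polys_const[of 1]]) (simp add: z_def)
    next
      case False
      then show ?thesis using cells_disjoint[OF K K'] by (intro bexI[OF _ polys_const[of 0]]) (auto simp: z_def)
    qed
  qed (use K in \<open>auto simp: z_def\<close>)
  moreover have "z \<noteq> 0" using x by (auto simp: z_def fun_eq_iff)
  ultimately show ?thesis by (rule that)
qed

text \<open>All facts share one number \<open>N\<close>, the top eigenvalue of \<open>G\<close>. Its
  strict positivity is what makes halving the spectral radius a strict gain in the accelerated
  case.\<close>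

lemma G_norm:
  shows "\<exists>N>0. norm_ex P \<epsilon> M p (G_op P \<epsilon> M p) = N \<and> rho M p (G_op P \<epsilon> M p) = N \<and>
    c * lambda_max_H P \<epsilon> M p = N \<and> lambda_max_H P \<epsilon> M p < 1 \<and>
    (\<forall>v\<in>V. form_norm (a_ex P \<epsilon> M p) (TR.G v) \<le> N * form_norm (a_ex P \<epsilon> M p) v)"
proof -
  interpret ex: pd_form V "a_ex P \<epsilon> M p" by (rule a_ex_pd)
  obtain z where z: "z \<in> V" "z \<noteq> 0" by (rule V_nontrivial)
  have sa: "a_ex P \<epsilon> M p (TR.G u) v = a_ex P \<epsilon> M p u (TR.G v)" if "u \<in> V" "v \<in> V" for u v
    using that by (simp add: a_ex_eq TR.G_in TR.G_sa)
  have gpos: "0 < a_ex P \<epsilon> M p (TR.G v) v" if "v \<in> V" "v \<noteq> 0" for v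
    using that by (simp add: a_ex_eq TR.G_in TR.G_pos)
  have gnn: "0 \<le> a_ex P \<epsilon> M p (TR.G v) v" if v: "v \<in> V" for v
  proof (cases "v = 0")
    case True then show ?thesis using ex.zero_right[OF TR.G_in[OF v]] by simp
  qed (use gpos[OF v] in simp)
  obtain v0 N where v0: "v0 \<in> V" "v0 \<noteq> 0" "TR.G v0 = N *\<^sub>R v0" "0 \<le> N"
    and bd: "\<And>v. v \<in> V \<Longrightarrow> form_norm (a_ex P \<epsilon> M p) (TR.G v) \<le> N * form_norm (a_ex P \<epsilon> M p) v"
    using positive_selfadjoint_norm[where V = V and a = "a_ex P \<epsilon> M p" and A = TR.G and z = z, OF fin_dim_V a_ex_pd TR.G_in TR.G_lin sa gnn z] by auto
  have "0 < N * a_ex P \<epsilon> M p v0 v0" using gpos[OF v0(1,2)] v0 by (simp add: ex.scale_left)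
  then have N: "0 < N" using v0(4) by (cases "N = 0") auto
  have z0: "0 \<in> V" by (rule subspace_0[OF subspace_V])
  have G0: "G_op P \<epsilon> M p 0 = 0" using TR.G_lin[OF z0 z0, of 0 0] by (simp add: G_op_eq z0)
  have Gin: "G_op P \<epsilon> M p v \<in> V" if "v \<in> V" for v using that by (simp add: G_op_eq TR.G_in)
  have Gbd: "form_norm (a_ex P \<epsilon> M p) (G_op P \<epsilon> M p v) \<le> N * form_norm (a_ex P \<epsilon> M p) v" if "v \<in> V" for v
    using bd[OF that] that by (simp add: G_op_eq)
  have Gv0: "G_op P \<epsilon> M p v0 = N *\<^sub>R v0" using v0 by (simp add: G_op_eq)
  note eqs = op_norm_eq_spectral_radius[where V = V and a = "a_ex P \<epsilon> M p" and A = "G_op P \<epsilon> M p" and ?v0.0 = v0 and M = N,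
      OF a_ex_pd Gin G0 v0(1,2) Gv0 v0(4) Gbd]
  have 1: "norm_ex P \<epsilon> M p (G_op P \<epsilon> M p) = N" "rho M p (G_op P \<epsilon> M p) = N"
    unfolding norm_ex_def rho_def using eqs by blast+
  have max: "l \<le> N" if "v \<in> V" "v \<noteq> 0" "TR.G v = l *\<^sub>R v" for l v
  proof -
    have "\<bar>l\<bar> * form_norm (a_ex P \<epsilon> M p) v \<le> N * form_norm (a_ex P \<epsilon> M p) v"
      using bd[OF that(1)] that by (simp add: form_norm_eq_nrm[OF ex.psd_form_axioms] ex.nrm_scale)
    moreover have "0 < form_norm (a_ex P \<epsilon> M p) v" using ex.pos[OF that(1,2)] by (simp add: form_norm_def)
    ultimately show ?thesis by simp
  qed
  show ?thesis
    by (intro exI[of _ N] conjI ballI N 1 max_eigenvalue_H[OF v0(1-3) max] bd)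
qed

lemma source_iteration:
  "self_adjoint_on V (a_ex P \<epsilon> M p) (G_op P \<epsilon> M p) \<and>
   norm_ex P \<epsilon> M p (G_op P \<epsilon> M p) = rho M p (G_op P \<epsilon> M p) \<and>
   rho M p (G_op P \<epsilon> M p) = c_ratio P \<epsilon> * lambda_max_H P \<epsilon> M p \<and>
   c_ratio P \<epsilon> * lambda_max_H P \<epsilon> M p \<le> 1 - \<epsilon>\<^sup>2 * (sig_a P / sig_t P) \<and>
   lambda_max_H P \<epsilon> M p < 1 \<and>
   c_ratio P \<epsilon> * lambda_max_H P \<epsilon> M p < c_ratio P \<epsilon>"
proof -
  obtain N where N: "norm_ex P \<epsilon> M p (G_op P \<epsilon> M p) = N" "rho M p (G_op P \<epsilon> M p) = N"
    "c * lambda_max_H P \<epsilon> M p = N" "lambda_max_H P \<epsilon> M p < 1"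
    using G_norm by auto
  have lt: "c * lambda_max_H P \<epsilon> M p < c" using N(4) c_bounds by simp
  have "self_adjoint_on V (a_ex P \<epsilon> M p) (G_op P \<epsilon> M p)"
    unfolding self_adjoint_on_def by (auto simp: G_op_eq TR.G_in a_ex_eq TR.G_sa)
  then show ?thesis using N lt c_eq by (simp flip: c_def)
qed

end

section \<open>Low Knudsen regime\<close>

text \<open>\<open>const_B\<close> is the product of \<open>sqrt (4 * d)\<close>, the bound of jumps
  by energy, and \<open>sqrt (2 * C_tr)\<close>, the cost of a lifting; \<open>d\<close> is the
  dimension. \<open>const_A\<close> adds the derivative's share \<open>sqrt (2 * d)\<close> to two
  liftings, and \<open>const_1\<close> adds to the inverse constant a share \<open>2 * C_tr\<close>
  for each of them.\<close>

definition const_B :: "'a::euclidean_space dsa_data \<Rightarrow> real" where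
  "const_B P = sqrt (8 * real DIM('a) * C_tr P)"
definition const_A :: "'a::euclidean_space dsa_data \<Rightarrow> real" where
  "const_A P = sqrt (2 * real DIM('a)) + 2 * const_B P"
definition const_1 :: "'a::euclidean_space dsa_data \<Rightarrow> real" where
  "const_1 P = C_inv P + 4 * C_tr P"

context dsa_setting
begin

definition Xn :: "'a set \<Rightarrow> ('a \<Rightarrow> real) \<Rightarrow> 'a \<Rightarrow> real" where
  "Xn e u = avg M e (dd (nrm M e) u)"

lemma trace_op_Xn: "trace_op Xn"
  unfolding Xn_def by (rule trace_op_dd[OF trace_op_avg])

abbreviation "\<kappa> \<equiv> Knudsen P \<epsilon> M p"
abbreviation "DD \<equiv> D_bar P"

text \<open>Diffusion thus carries the same small parameter, divided by the dimension, as the second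
  order term of the transport expansion.\<close>

lemma eps_D: "\<epsilon> * DD = \<eta> / real DIM('a)"
  by (simp add: D_bar_def \<eta>_def)

lemma a_MIP_eq:
  assumes u: "u \<in> V" and v: "v \<in> V"
  shows "a_MIP P \<epsilon> M p u v = \<eta> / real DIM('a) * Gr u v + \<epsilon> * sig_a P * I u v + fform (tau P \<epsilon> M p) (jump M) (jump M) u v
    - \<eta> / real DIM('a) * fform (\<lambda>_. 1) Xn (jump M) u v - \<eta> / real DIM('a) * fform (\<lambda>_. 1) Xn (jump M) v u"
proof -
  have f: "(\<Sum>e\<in>faces M. face_ip e (avg M e (\<lambda>y. DD * (grad x y \<bullet> nrm M e))) (jump M e z)) = DD * fform (\<lambda>_. 1) Xn (jump M) x z"
    if x: "x \<in> V" for x z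
    unfolding fform_def sum_distrib_left
  proof (rule sum.cong[OF refl])
    fix e assume e: "e \<in> faces M"
    have "face_ip e (avg M e (\<lambda>y. DD * (grad x y \<bullet> nrm M e))) (jump M e z) = face_ip e (\<lambda>y. DD * Xn e x y) (jump M e z)"
      by (rule face_ip_cong) (simp_all add: Xn_def avg_def trace_normal_derivative[OF e x] distrib_left)
    then show "face_ip e (avg M e (\<lambda>y. DD * (grad x y \<bullet> nrm M e))) (jump M e z) = DD * (1 * face_ip e (Xn e x) (jump M e z))"
      by (simp add: face_ip_scale)
  qed
  have g: "(\<Sum>K\<in>cells M. ip K (\<lambda>x. DD *\<^sub>R grad u x) (grad v) + ip K (\<lambda>x. sig_a P * u x) v) = DD * Gr u v + sig_a P * I u v"
  proof -
    have "ip K (\<lambda>x. DD *\<^sub>R grad u x) (grad v) = DD * ip K (grad u) (grad v)" for K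
      by (simp add: ip_def)
    then show ?thesis by (simp add: ip_scale Gr_def ip_dom u v sum.distrib sum_distrib_left)
  qed
  have "a_MIP P \<epsilon> M p u v = (\<epsilon> * DD) * Gr u v + \<epsilon> * sig_a P * I u v + fform (tau P \<epsilon> M p) (jump M) (jump M) u v
    - (\<epsilon> * DD) * fform (\<lambda>_. 1) Xn (jump M) u v - (\<epsilon> * DD) * fform (\<lambda>_. 1) Xn (jump M) v u"
    unfolding a_MIP_def mip_faces_def g f[OF u] f[OF v] by (simp add: fform_def algebra_simps)
  then show ?thesis by (simp only: eps_D)
qed

lemma a_MIP_bilinear: "bilinear_form V (a_MIP P \<epsilon> M p)"
proof -
  have Grb: "Gr (s *\<^sub>R u + t *\<^sub>R v) z = s * Gr u z + t * Gr v z" if "u \<in> V" "v \<in> V" "z \<in> V" for u v z s t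
  proof -
    have "Gr (s *\<^sub>R u + t *\<^sub>R v) z = (\<Sum>i\<in>Basis. s * I (dd i u) (dd i z) + t * I (dd i v) (dd i z))"
      using that by (simp add: Gr_eq Vc dd_lin TR.I.comb_left dd_in)
    then show ?thesis using that by (simp add: Gr_eq sum.distrib sum_distrib_left)
  qed
  have Grs: "Gr u v = Gr v u" if "u \<in> V" "v \<in> V" for u v using that by (simp add: Gr_eq I_sym)
  note f = fform_bilinear[OF trace_op_jump trace_op_jump, of "tau P \<epsilon> M p"] fform_bilinear[OF trace_op_Xn trace_op_jump, of "\<lambda>_. 1"]
  note l = bilinear_form.comb_left[OF f(1)] bilinear_form.comb_left[OF f(2)] bilinear_form.comb_right[OF f(1)] bilinear_form.comb_right[OF f(2)]
  show ?thesis
  proof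
    fix u v z :: "'a \<Rightarrow> real" and s t :: real
    assume uvz: "u \<in> V" "v \<in> V" "z \<in> V"
    show "a_MIP P \<epsilon> M p (s *\<^sub>R u + t *\<^sub>R v) z = s * a_MIP P \<epsilon> M p u z + t * a_MIP P \<epsilon> M p v z"
      using uvz by (simp add: a_MIP_eq Vc Grb TR.I.comb_left l) (simp add: algebra_simps add_divide_distrib)
    have "Gr z (s *\<^sub>R u + t *\<^sub>R v) = s * Gr z u + t * Gr z v"
      using uvz Grb[OF uvz, of s t] Grs[OF uvz(3)] by (simp add: Vc)
    then show "a_MIP P \<epsilon> M p z (s *\<^sub>R u + t *\<^sub>R v) = s * a_MIP P \<epsilon> M p z u + t * a_MIP P \<epsilon> M p z v"
      using uvz by (simp add: a_MIP_eq Vc TR.I.comb_right l) (simp add: algebra_simps add_divide_distrib)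
  qed (rule subspace_V)
qed

lemma a_MIP_sym: "u \<in> V \<Longrightarrow> v \<in> V \<Longrightarrow> a_MIP P \<epsilon> M p u v = a_MIP P \<epsilon> M p v u"
  using fform_sym[of "tau P \<epsilon> M p" "jump M" "jump M" u v] by (simp add: a_MIP_eq Gr_eq I_sym)

section \<open>Scaled inverse estimates and liftings\<close>

lemma kappa_ge: "K \<in> cells M \<Longrightarrow> (real p)\<^sup>2 / (sigma_t P \<epsilon> * diameter K) \<le> \<kappa>"
  unfolding Knudsen_def using fin_cells by (intro Max_ge) auto

lemma L_bound: assumes K: "K \<in> cells M" shows "(real p)\<^sup>2 / diameter K \<le> \<kappa> / \<eta>"
proof -
  have "(real p)\<^sup>2 / (sigma_t P \<epsilon> * diameter K) = \<eta> * ((real p)\<^sup>2 / diameter K)"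
    by (simp add: sigma_t_def \<eta>_def)
  then show ?thesis using kappa_ge[OF K] \<eta>_pos by (simp add: field_simps)
qed

lemma kappa_nonneg: "0 \<le> \<kappa>"
proof -
  obtain K where K: "K \<in> cells M" using cells_ne by blast
  have "0 \<le> (real p)\<^sup>2 / (sigma_t P \<epsilon> * diameter K)"
    using \<epsilon> pos diameter_ge_0[OF cell(2)[OF K]] by (simp add: sigma_t_def)
  then show ?thesis using kappa_ge[OF K] by simp
qed

lemma Tr_bound: "u \<in> V \<Longrightarrow> Tr u \<le> C_tr P * (\<kappa> / \<eta>) * I u u"
  using trace_inverse[OF tr _ p L_bound] pos by simp

lemma Gr_bound: "u \<in> V \<Longrightarrow> Gr u u \<le> (C_inv P * (\<kappa> / \<eta>))\<^sup>2 * I u u"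
  using grad_inverse[OF inv _ p L_bound] pos by simp

text \<open>The threshold is the value at which the scaled interior penalty weight is at most
  \<open>1 / (2 * d)\<close> in dimension \<open>d\<close>, the lower bound of \<open>beta\<close>
  from the second moments.\<close>

lemma tau_eq_beta:
  assumes \<kappa>: "\<kappa> \<le> (theta P)\<^sup>2 / C_tr P" and e: "e \<in> faces M"
  shows "tau P \<epsilon> M p e = beta P M e"
proof -
  have sub: "cells_at M e \<subseteq> cells M" by (auto simp: cells_at_def)
  then have fin: "finite (cells_at M e)" using fin_cells finite_subset by blast
  have ne: "cells_at M e \<noteq> {}" using K_plus[OF e] by (auto simp: cells_at_def)
  have "Max ((\<lambda>K. DD / diameter K) ` cells_at M e) \<in> (\<lambda>K. DD / diameter K) ` cells_at M e"
    using fin ne by (intro Max_in) auto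
  then obtain K where K: "K \<in> cells M" and mx: "Max ((\<lambda>K. DD / diameter K) ` cells_at M e) = DD / diameter K"
    using sub by blast
  have "\<epsilon> * tau_SIP P M p e = (C_tr P / (2 * (theta P)\<^sup>2)) * ((\<epsilon> * DD) * ((real p)\<^sup>2 / diameter K))"
    unfolding tau_SIP_def mx by simp
  also have "\<dots> = (C_tr P / (2 * (theta P)\<^sup>2 * real DIM('a))) * (\<eta> * ((real p)\<^sup>2 / diameter K))"
    unfolding eps_D by simp
  also have "\<dots> \<le> (C_tr P / (2 * (theta P)\<^sup>2 * real DIM('a))) * ((theta P)\<^sup>2 / C_tr P)"
  proof (rule mult_left_mono)
    show "\<eta> * ((real p)\<^sup>2 / diameter K) \<le> (theta P)\<^sup>2 / C_tr P"
      using mult_left_mono[OF L_bound[OF K], of \<eta>] \<eta>_pos \<kappa> by simp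
  qed (use pos in simp)
  also have "\<dots> = 1 / (2 * real DIM('a))" using pos by (simp add: field_simps)
  also have "\<dots> \<le> beta P M e" by (rule beta_ge[OF e])
  finally show ?thesis by (simp add: tau_def)
qed

definition riesz :: "(('a \<Rightarrow> real) \<Rightarrow> ('a \<Rightarrow> real) \<Rightarrow> real) \<Rightarrow> ('a \<Rightarrow> real) \<Rightarrow> 'a \<Rightarrow> real" where
  "riesz F u = (THE r. r \<in> V \<and> (\<forall>v\<in>V. I r v = F u v))"

lemma riesz:
  assumes F: "bilinear_form V F" and u: "u \<in> V"
  shows riesz_in: "riesz F u \<in> V" and riesz_eq: "v \<in> V \<Longrightarrow> I (riesz F u) v = F u v"
proof -
  have "\<exists>!r. r \<in> V \<and> (\<forall>v\<in>V. I r v = F u v)"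
    by (rule Lax_Milgram[OF fin_dim_V TR.I.bilinear_form_axioms])
       (simp_all add: TR.I.pos bilinear_form.comb_right[OF F] u)
  from theI'[OF this] show "riesz F u \<in> V" "v \<in> V \<Longrightarrow> I (riesz F u) v = F u v" by (auto simp: riesz_def)
qed

text \<open>The lifting operator of discontinuous Galerkin methods for the centred flux;
  \<open>Sop\<close> lifts the upwind dissipation in the same way.\<close>

definition Rop :: "nat \<Rightarrow> ('a \<Rightarrow> real) \<Rightarrow> 'a \<Rightarrow> real" where
  "Rop m = riesz (fform (\<lambda>e. nrm M e \<bullet> \<Omega> m) (jump M) (avg M))"
definition Sop :: "nat \<Rightarrow> ('a \<Rightarrow> real) \<Rightarrow> 'a \<Rightarrow> real" where
  "Sop m = riesz (fform (\<lambda>e. \<bar>nrm M e \<bullet> \<Omega> m\<bar> / 2) (jump M) (jump M))"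

lemma Rop: "u \<in> V \<Longrightarrow> Rop m u \<in> V" "u \<in> V \<Longrightarrow> v \<in> V \<Longrightarrow> I (Rop m u) v = fform (\<lambda>e. nrm M e \<bullet> \<Omega> m) (jump M) (avg M) u v"
  unfolding Rop_def
  using riesz_in[OF fform_bilinear[OF trace_op_jump trace_op_avg]] riesz_eq[OF fform_bilinear[OF trace_op_jump trace_op_avg]]
  by simp_all
lemma Sop: "u \<in> V \<Longrightarrow> Sop m u \<in> V" "u \<in> V \<Longrightarrow> v \<in> V \<Longrightarrow> I (Sop m u) v = fform (\<lambda>e. \<bar>nrm M e \<bullet> \<Omega> m\<bar> / 2) (jump M) (jump M) u v"
  unfolding Sop_def
  using riesz_in[OF fform_bilinear[OF trace_op_jump trace_op_jump]] riesz_eq[OF fform_bilinear[OF trace_op_jump trace_op_jump]]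
  by simp_all

lemma dir_normal_le: "e \<in> faces M \<Longrightarrow> m \<in> D \<Longrightarrow> \<bar>nrm M e \<bullet> \<Omega> m\<bar> \<le> 1"
  using Cauchy_Schwarz_ineq2[of "nrm M e" "\<Omega> m"] dir[of m] face_normal(1)[of e] by simp

text \<open>Duality, Cauchy-Schwarz on the faces, then the trace inverse estimate for the test
  function. The factor 2 in \<open>le\<close> is dictated by jumps; averages would need only
  1/2.\<close>

lemma lift_bound:
  assumes u: "u \<in> V" and r: "r \<in> V" and Y: "trace_op Y" and k: "\<And>e. e \<in> faces M \<Longrightarrow> \<bar>k e\<bar> \<le> 1"
    and eq: "\<And>v. v \<in> V \<Longrightarrow> I r v = fform k (jump M) Y u v"
    and le: "\<And>v. v \<in> V \<Longrightarrow> fform (\<lambda>_. 1) Y Y v v \<le> 2 * Tr v"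
  shows "TR.I.nrm r \<le> sqrt (J u) * sqrt (2 * C_tr P * (\<kappa> / \<eta>))"
proof (rule TR.I.nrm_le_of_dual[OF r])
  show "0 \<le> sqrt (J u) * sqrt (2 * C_tr P * (\<kappa> / \<eta>))"
    using J_nonneg pos kappa_nonneg \<eta>_pos by simp
  fix v assume v: "v \<in> V"
  have "\<bar>I r v\<bar> \<le> sqrt (J u) * sqrt (fform (\<lambda>_. 1) Y Y v v)"
    unfolding eq[OF v] J_def by (rule fform_CS[OF trace_op_jump Y k u v])
  also have "\<dots> \<le> sqrt (J u) * sqrt (2 * C_tr P * (\<kappa> / \<eta>) * I v v)"
    using le[OF v] Tr_bound[OF v] J_nonneg by (intro mult_left_mono real_sqrt_le_mono) auto
  also have "\<dots> = sqrt (J u) * sqrt (2 * C_tr P * (\<kappa> / \<eta>)) * TR.I.nrm v"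
    by (simp only: TR.I.nrm_def real_sqrt_mult[of "2 * C_tr P * (\<kappa> / \<eta>)" "I v v"] mult.assoc[of "sqrt (J u)"])
  finally show "\<bar>I r v\<bar> \<le> sqrt (J u) * sqrt (2 * C_tr P * (\<kappa> / \<eta>)) * TR.I.nrm v" .
qed

lemma Tr_nonneg: "0 \<le> Tr u"
  unfolding Tr_def fform_def by (auto intro!: add_nonneg_nonneg sum_nonneg face_ip_nonneg)

lemma Rop_bound:
  assumes m: "m \<in> D" and u: "u \<in> V"
  shows "TR.I.nrm (Rop m u) \<le> sqrt (J u) * sqrt (2 * C_tr P * (\<kappa> / \<eta>))"
proof (rule lift_bound[OF u Rop(1)[OF u] trace_op_avg dir_normal_le[OF _ m] Rop(2)[OF u]])
  show "fform (\<lambda>_. 1) (avg M) (avg M) v v \<le> 2 * Tr v" if "v \<in> V" for v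
    using avg_form_le_Tr[OF that] Tr_nonneg[of v] by linarith
qed

lemma Sop_bound:
  assumes m: "m \<in> D" and u: "u \<in> V"
  shows "TR.I.nrm (Sop m u) \<le> sqrt (J u) * sqrt (2 * C_tr P * (\<kappa> / \<eta>))"
proof (rule lift_bound[OF u Sop(1)[OF u] trace_op_jump _ Sop(2)[OF u]])
  show "fform (\<lambda>_. 1) (jump M) (jump M) v v \<le> 2 * Tr v" if "v \<in> V" for v
    using J_le_Tr[OF that] by (simp add: J_def)
  show "\<bar>\<bar>nrm M e \<bullet> \<Omega> m\<bar> / 2\<bar> \<le> 1" if "e \<in> faces M" for e
    using dir_normal_le[OF that m] by simp
qed

end

text \<open>The four thresholds serve, in this order, the choice of the penalty, the comparison of
  \<open>\<kappa>\<close> with its root, the absorption in the expansion, and the coercivity of the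
  MIP form.\<close>

locale low_knudsen = dsa_setting M p P \<epsilon>
  for M :: "'a::euclidean_space mesh" and p P \<epsilon> +
  assumes small: "\<kappa> \<le> (theta P)\<^sup>2 / C_tr P" "\<kappa> \<le> 1" "const_1 P * \<kappa> \<le> 1/2" "4 * C_tr P * \<kappa> \<le> 1"
begin

abbreviation "am \<equiv> a_MIP P \<epsilon> M p"
abbreviation "jb u \<equiv> fform (beta P M) (jump M) (jump M) u u"

lemma d_pos: "0 < real DIM('a)" by simp

lemma jb_nonneg: "0 \<le> jb u"
  unfolding fform_def
proof (intro sum_nonneg mult_nonneg_nonneg face_ip_nonneg)
  fix e assume "e \<in> faces M"
  then show "0 \<le> beta P M e" using beta_ge[of e] d_pos by (meson order_trans divide_nonneg_pos zero_le_one mult_pos_pos zero_less_numeral)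
qed

lemma tau_form: "fform (tau P \<epsilon> M p) X Y u v = fform (beta P M) X Y u v"
  unfolding fform_def by (rule sum.cong) (simp_all add: tau_eq_beta[OF small(1)])

text \<open>The normal derivatives cost \<open>C_tr * \<kappa>\<close> relative to the gradient
  energy, and the jumps are bounded through \<open>beta\<close>. The powers of \<open>\<eta>\<close>
  and of the dimension cancel, leaving the factor \<open>2 * sqrt (C_tr * \<kappa>)\<close>, at most
  1 by the fourth threshold.\<close>

lemma cross_bound:
  assumes u: "u \<in> V"
  shows "2 * (\<eta> / real DIM('a)) * \<bar>fform (\<lambda>_. 1) Xn (jump M) u u\<bar> \<le> 1/2 * (\<eta> / real DIM('a) * Gr u u + jb u)"
proof -
  define x where "x = sqrt (\<eta> / real DIM('a) * Gr u u)"
  define y where "y = sqrt (jb u)"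
  have nn: "0 \<le> Gr u u" "0 \<le> jb u" by (rule Gr_nonneg[OF u], rule jb_nonneg)
  have X: "fform (\<lambda>_. 1) Xn Xn u u \<le> 1/2 * (C_tr P * (\<kappa> / \<eta>) * Gr u u)"
  proof -
    have "fform (\<lambda>_. 1) Xn Xn u u \<le> 1/2 * (\<Sum>i\<in>Basis. Tr (dd i u))"
      using normal_derivative_form_le[OF u] by (simp add: Xn_def[abs_def])
    also have "(\<Sum>i\<in>Basis. Tr (dd i u)) \<le> (\<Sum>i\<in>Basis. C_tr P * (\<kappa> / \<eta>) * I (dd i u) (dd i u))"
      by (rule sum_mono) (rule Tr_bound[OF dd_in[OF u]])
    finally show ?thesis by (simp add: Gr_eq u sum_distrib_left)
  qed
  have "\<bar>fform (\<lambda>_. 1) Xn (jump M) u u\<bar> \<le> sqrt (fform (\<lambda>_. 1) Xn Xn u u) * sqrt (fform (\<lambda>_. 1) (jump M) (jump M) u u)"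
    by (rule fform_CS[OF trace_op_Xn trace_op_jump _ u u]) simp
  also have "\<dots> \<le> sqrt (1/2 * (C_tr P * (\<kappa> / \<eta>) * Gr u u)) * sqrt (2 * real DIM('a) * jb u)"
    using X J_le_beta[of u] nn unfolding J_def
    by (intro mult_mono real_sqrt_le_mono) (use pos kappa_nonneg \<eta>_pos J_nonneg[of u, unfolded J_def] in auto)
  also have "\<dots> = sqrt (C_tr P * \<kappa>) * (real DIM('a) / \<eta>) * (x * y)"
  proof -
    have "1/2 * (C_tr P * (\<kappa> / \<eta>) * Gr u u) * (2 * real DIM('a) * jb u) = (C_tr P * \<kappa>) * ((real DIM('a) / \<eta>)\<^sup>2 * ((\<eta> / real DIM('a) * Gr u u) * jb u))"
      using \<eta>_pos d_pos by (simp add: field_simps power2_eq_square)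
    then have "sqrt (1/2 * (C_tr P * (\<kappa> / \<eta>) * Gr u u)) * sqrt (2 * real DIM('a) * jb u) =
        sqrt ((C_tr P * \<kappa>) * ((real DIM('a) / \<eta>)\<^sup>2 * ((\<eta> / real DIM('a) * Gr u u) * jb u)))"
      by (simp only: real_sqrt_mult[symmetric])
    also have "\<dots> = sqrt (C_tr P * \<kappa>) * (\<bar>real DIM('a) / \<eta>\<bar> * (x * y))"
      by (simp only: real_sqrt_mult[of "C_tr P * \<kappa>"] real_sqrt_mult[of "(real DIM('a) / \<eta>)\<^sup>2"]
          real_sqrt_mult[of _ "jb u"] real_sqrt_abs x_def y_def)
    finally show ?thesis using \<eta>_pos d_pos by (simp only: abs_of_pos divide_pos_pos mult.assoc)
  qed
  finally have "2 * (\<eta> / real DIM('a)) * \<bar>fform (\<lambda>_. 1) Xn (jump M) u u\<bar> \<le> 2 * (\<eta> / real DIM('a)) * (sqrt (C_tr P * \<kappa>) * (real DIM('a) / \<eta>) * (x * y))"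
    using \<eta>_pos d_pos by (intro mult_left_mono) auto
  also have "\<dots> = 2 * sqrt (C_tr P * \<kappa>) * (x * y)" using \<eta>_pos d_pos by simp
  also have "\<dots> \<le> 1 * (x * y)"
  proof (rule mult_right_mono)
    have "sqrt (4 * (C_tr P * \<kappa>)) \<le> sqrt 1" using small(4) by (intro real_sqrt_le_mono) simp
    then show "2 * sqrt (C_tr P * \<kappa>) \<le> 1" by (simp add: real_sqrt_mult)
    show "0 \<le> x * y" using nn \<eta>_pos d_pos by (simp add: x_def y_def)
  qed
  also have "\<dots> \<le> 1/2 * (x\<^sup>2 + y\<^sup>2)" using sum_squares_bound[of x y] by simp
  also have "\<dots> = 1/2 * (\<eta> / real DIM('a) * Gr u u + jb u)" using nn \<eta>_pos d_pos by (simp add: x_def y_def)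
  finally show ?thesis .
qed

lemma coercive:
  assumes u: "u \<in> V"
  shows "1/2 * (\<eta> / real DIM('a) * Gr u u + jb u) + \<epsilon> * sig_a P * I u u \<le> am u u"
proof -
  have "\<eta> / real DIM('a) * fform (\<lambda>_. 1) Xn (jump M) u u \<le> \<eta> / real DIM('a) * \<bar>fform (\<lambda>_. 1) Xn (jump M) u u\<bar>"
    using \<eta>_pos d_pos by (intro mult_left_mono) auto
  then show ?thesis using cross_bound[OF u] unfolding a_MIP_eq[OF u u] tau_form by argo
qed

lemma am_pd: "pd_form V am"
proof -
  have ge: "\<epsilon> * sig_a P * I v v \<le> am v v" if v: "v \<in> V" for v
    using coercive[OF v] Gr_nonneg[OF v] jb_nonneg[of v] \<eta>_pos d_pos by (smt (verit) divide_nonneg_pos mult_nonneg_nonneg)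
  show ?thesis
  proof (intro pd_form.intro psd_form.intro a_MIP_bilinear psd_form_axioms.intro pd_form_axioms.intro a_MIP_sym)
    show "0 \<le> am v v" if "v \<in> V" for v
      using ge[OF that] TR.I.psd[OF that] \<epsilon> pos by (smt (verit) mult_nonneg_nonneg)
    show "0 < am v v" if "v \<in> V" "v \<noteq> 0" for v
      using ge[OF that(1)] TR.I.pos[OF that] \<epsilon> pos by (smt (verit) mult_pos_pos)
  qed
qed

sublocale MIP: pd_form V am by (rule am_pd)

lemma energy:
  assumes u: "u \<in> V"
  shows "sqrt \<eta> * sqrt (Gr u u) \<le> sqrt (2 * real DIM('a)) * MIP.nrm u" "sqrt (J u) \<le> sqrt (4 * real DIM('a)) * MIP.nrm u"
proof -
  have nn: "0 \<le> \<eta> / real DIM('a) * Gr u u" "0 \<le> jb u" "0 \<le> \<epsilon> * sig_a P * I u u"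
    using Gr_nonneg[OF u] jb_nonneg[of u] \<eta>_pos d_pos TR.I.psd[OF u] \<epsilon> pos by auto
  have half: "x \<le> 2 * a \<and> y \<le> 2 * a" if "1/2 * (x + y) + r \<le> a" "0 \<le> x" "0 \<le> y" "0 \<le> r" for x y r a :: real
  proof -
    have "x + y + 2 * r \<le> 2 * a" using that(1) by (simp add: field_simps)
    then show ?thesis using that(2-4) by simp
  qed
  note le = half[OF coercive[OF u] nn]
  from le have "\<eta> / real DIM('a) * Gr u u \<le> 2 * am u u" by (rule conjunct1)
  then have "\<eta> * Gr u u \<le> 2 * real DIM('a) * am u u" using d_pos by (simp add: field_simps)
  then show "sqrt \<eta> * sqrt (Gr u u) \<le> sqrt (2 * real DIM('a)) * MIP.nrm u"
    unfolding MIP.nrm_def real_sqrt_mult[symmetric] by (rule real_sqrt_le_mono)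
  have "jb u \<le> 2 * am u u" using le by (rule conjunct2)
  then have "2 * real DIM('a) * jb u \<le> 2 * real DIM('a) * (2 * am u u)" using d_pos by (intro mult_left_mono) auto
  from order_trans[OF J_le_beta this] have "J u \<le> 4 * real DIM('a) * am u u" by simp
  then show "sqrt (J u) \<le> sqrt (4 * real DIM('a)) * MIP.nrm u"
    unfolding MIP.nrm_def real_sqrt_mult[symmetric] by (rule real_sqrt_le_mono)
qed

text \<open>The jumps of \<open>u\<close> can be estimated in two ways: by the energy, so that one
  trace inverse estimate yields a root of \<open>\<kappa>\<close>, or by a second trace inverse
  estimate, which yields a full power against the plain norm.\<close>

lemma lift_energy:
  assumes u: "u \<in> V" and n: "n \<le> sqrt (J u) * sqrt (2 * C_tr P * (\<kappa> / \<eta>))"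
  shows "sqrt \<eta> * n \<le> const_B P * sqrt \<kappa> * MIP.nrm u" "\<eta> * n \<le> 2 * C_tr P * \<kappa> * TR.I.nrm u"
proof -
  have s: "sqrt \<eta> * sqrt (2 * C_tr P * (\<kappa> / \<eta>)) = sqrt (2 * C_tr P * \<kappa>)"
    using \<eta>_pos by (simp flip: real_sqrt_mult)
  have "sqrt \<eta> * n \<le> sqrt \<eta> * (sqrt (J u) * sqrt (2 * C_tr P * (\<kappa> / \<eta>)))"
    using n \<eta>_pos by (intro mult_left_mono) auto
  also have "\<dots> = sqrt (J u) * sqrt (2 * C_tr P * \<kappa>)" using s by (simp add: mult.left_commute)
  finally have "sqrt \<eta> * n \<le> sqrt (J u) * sqrt (2 * C_tr P * \<kappa>)" .
  also have "\<dots> \<le> (sqrt (4 * real DIM('a)) * MIP.nrm u) * sqrt (2 * C_tr P * \<kappa>)"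
    using energy(2)[OF u] pos kappa_nonneg by (intro mult_right_mono) auto
  also have "\<dots> = const_B P * sqrt \<kappa> * MIP.nrm u"
  proof -
    have "sqrt (4 * real DIM('a)) * sqrt (2 * C_tr P * \<kappa>) = const_B P * sqrt \<kappa>"
      unfolding const_B_def real_sqrt_mult[symmetric] by (simp add: mult_ac)
    then show ?thesis by (simp add: mult_ac)
  qed
  finally show "sqrt \<eta> * n \<le> const_B P * sqrt \<kappa> * MIP.nrm u" .
  have J: "J u \<le> 2 * C_tr P * (\<kappa> / \<eta>) * I u u"
    using J_le_Tr[OF u] Tr_bound[OF u] by simp
  have "\<eta> * n \<le> \<eta> * (sqrt (J u) * sqrt (2 * C_tr P * (\<kappa> / \<eta>)))" using n \<eta>_pos by (intro mult_left_mono) auto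
  also have "\<dots> \<le> \<eta> * (sqrt (2 * C_tr P * (\<kappa> / \<eta>) * I u u) * sqrt (2 * C_tr P * (\<kappa> / \<eta>)))"
    using J \<eta>_pos pos kappa_nonneg by (intro mult_left_mono mult_right_mono real_sqrt_le_mono) auto
  also have "\<dots> = \<eta> * ((sqrt (2 * C_tr P * (\<kappa> / \<eta>)) * sqrt (2 * C_tr P * (\<kappa> / \<eta>))) * TR.I.nrm u)"
    by (simp only: real_sqrt_mult[of "2 * C_tr P * (\<kappa> / \<eta>)" "I u u"] TR.I.nrm_def) (simp only: mult_ac)
  also have "sqrt (2 * C_tr P * (\<kappa> / \<eta>)) * sqrt (2 * C_tr P * (\<kappa> / \<eta>)) = 2 * C_tr P * (\<kappa> / \<eta>)"
    using pos kappa_nonneg \<eta>_pos by (intro real_sqrt_mult_self[THEN trans]) simp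
  finally show "\<eta> * n \<le> 2 * C_tr P * \<kappa> * TR.I.nrm u" using \<eta>_pos by simp
qed

lemma dd_energy:
  assumes m: "m \<in> D" and u: "u \<in> V"
  shows "sqrt \<eta> * TR.I.nrm (dd (\<Omega> m) u) \<le> sqrt (2 * real DIM('a)) * MIP.nrm u"
    "\<eta> * TR.I.nrm (dd (\<Omega> m) u) \<le> C_inv P * \<kappa> * TR.I.nrm u"
proof -
  have n: "TR.I.nrm (dd (\<Omega> m) u) \<le> sqrt (Gr u u)"
    unfolding TR.I.nrm_def by (intro real_sqrt_le_mono dd_le_Gr u dir m)
  have "sqrt \<eta> * TR.I.nrm (dd (\<Omega> m) u) \<le> sqrt \<eta> * sqrt (Gr u u)" using n \<eta>_pos by (intro mult_left_mono) auto
  then show "sqrt \<eta> * TR.I.nrm (dd (\<Omega> m) u) \<le> sqrt (2 * real DIM('a)) * MIP.nrm u" using energy(1)[OF u] by simp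
  have "sqrt (Gr u u) \<le> sqrt ((C_inv P * (\<kappa> / \<eta>))\<^sup>2 * I u u)" by (intro real_sqrt_le_mono Gr_bound u)
  also have "\<dots> = C_inv P * (\<kappa> / \<eta>) * TR.I.nrm u"
    using pos kappa_nonneg \<eta>_pos by (simp add: real_sqrt_mult TR.I.nrm_def)
  finally have "\<eta> * TR.I.nrm (dd (\<Omega> m) u) \<le> \<eta> * (C_inv P * (\<kappa> / \<eta>) * TR.I.nrm u)"
    using n \<eta>_pos by (intro mult_left_mono) auto
  then show "\<eta> * TR.I.nrm (dd (\<Omega> m) u) \<le> C_inv P * \<kappa> * TR.I.nrm u" using \<eta>_pos by simp
qed

lemma T_nrm_le:
  assumes m: "m \<in> D" and u: "u \<in> V"
  shows "TR.I.nrm (dd (\<Omega> m) u - Rop m u + Sop m u) \<le> TR.I.nrm (dd (\<Omega> m) u) + TR.I.nrm (Rop m u) + TR.I.nrm (Sop m u)"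
proof -
  have i: "dd (\<Omega> m) u \<in> V" "Rop m u \<in> V" "Sop m u \<in> V" using dd_in[OF u] Rop(1)[OF u] Sop(1)[OF u] by auto
  show ?thesis
    using TR.I.nrm_triangle[of "dd (\<Omega> m) u - Rop m u" "Sop m u"] TR.I.nrm_triangle_diff[OF i(1,2)] i by simp
qed

lemma const_nonneg: "0 \<le> const_B P" "0 \<le> const_A P" "0 \<le> const_1 P"
  using pos by (auto simp: const_B_def const_A_def const_1_def)

sublocale DR: diffusive_response V I D w \<eta> c tform opp "\<lambda>m. dd (\<Omega> m)" Rop Sop MIP.nrm \<kappa> "const_A P" "const_B P" "const_1 P"
proof
  fix m u assume m: "m \<in> D" and u: "u \<in> V"
  show "dd (\<Omega> m) u \<in> V" "Rop m u \<in> V" "Sop m u \<in> V" using dd_in[OF u] Rop(1)[OF u] Sop(1)[OF u] by auto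
  note i = this
  show "tform m u v = I (dd (\<Omega> m) u - Rop m u + Sop m u) v" if v: "v \<in> V" for v
    using i v by (simp add: TR.I.bilin tform_def Rop(2)[OF u v] Sop(2)[OF u v])
  have "Rop (opp m) u = - Rop m u"
  proof (rule TR.I.eqI)
    fix v assume v: "v \<in> V"
    show "I (Rop (opp m) u) v = I (- Rop m u) v"
      using fform_neg[of "\<lambda>e. nrm M e \<bullet> \<Omega> m" "jump M" "avg M" u v] i v
      by (simp add: TR.I.bilin Rop(2)[OF u v] opp(2)[OF m])
  qed (use i Rop(1)[OF u] in auto)
  then show "dd (\<Omega> (opp m)) u - Rop (opp m) u = - (dd (\<Omega> m) u - Rop m u)"
    by (simp add: opp(2)[OF m] dd_minus)
  show "Sop (opp m) u = Sop m u"
    unfolding Sop_def by (simp add: opp(2)[OF m])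
  have R: "sqrt \<eta> * TR.I.nrm (Rop m u) \<le> const_B P * sqrt \<kappa> * MIP.nrm u" "\<eta> * TR.I.nrm (Rop m u) \<le> 2 * C_tr P * \<kappa> * TR.I.nrm u"
    by (rule lift_energy[OF u Rop_bound[OF m u]])+
  have S: "sqrt \<eta> * TR.I.nrm (Sop m u) \<le> const_B P * sqrt \<kappa> * MIP.nrm u" "\<eta> * TR.I.nrm (Sop m u) \<le> 2 * C_tr P * \<kappa> * TR.I.nrm u"
    by (rule lift_energy[OF u Sop_bound[OF m u]])+
  show "sqrt \<eta> * TR.I.nrm (Rop m u) \<le> const_B P * sqrt \<kappa> * MIP.nrm u" "sqrt \<eta> * TR.I.nrm (Sop m u) \<le> const_B P * sqrt \<kappa> * MIP.nrm u"
    by (rule R S)+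
  have "\<eta> * TR.I.nrm (dd (\<Omega> m) u - Rop m u + Sop m u) \<le> \<eta> * (TR.I.nrm (dd (\<Omega> m) u) + TR.I.nrm (Rop m u) + TR.I.nrm (Sop m u))"
    using T_nrm_le[OF m u] \<eta>_pos by (intro mult_left_mono) auto
  also have "\<dots> \<le> C_inv P * \<kappa> * TR.I.nrm u + 2 * C_tr P * \<kappa> * TR.I.nrm u + 2 * C_tr P * \<kappa> * TR.I.nrm u"
    using dd_energy(2)[OF m u] R(2) S(2) unfolding distrib_left by linarith
  finally show "\<eta> * TR.I.nrm (dd (\<Omega> m) u - Rop m u + Sop m u) \<le> const_1 P * \<kappa> * TR.I.nrm u"
    by (simp add: const_1_def algebra_simps)
  have B: "const_B P * sqrt \<kappa> * MIP.nrm u \<le> const_B P * 1 * MIP.nrm u"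
    using small(2) const_nonneg u by (intro mult_right_mono mult_left_mono) auto
  have "sqrt \<eta> * TR.I.nrm (dd (\<Omega> m) u - Rop m u + Sop m u) \<le> sqrt \<eta> * (TR.I.nrm (dd (\<Omega> m) u) + TR.I.nrm (Rop m u) + TR.I.nrm (Sop m u))"
    using T_nrm_le[OF m u] \<eta>_pos by (intro mult_left_mono) auto
  also have "\<dots> \<le> sqrt (2 * real DIM('a)) * MIP.nrm u + const_B P * MIP.nrm u + const_B P * MIP.nrm u"
    using dd_energy(1)[OF m u] R(1) S(1) B unfolding distrib_left mult_1_right by linarith
  finally show "sqrt \<eta> * TR.I.nrm (dd (\<Omega> m) u - Rop m u + Sop m u) \<le> const_A P * MIP.nrm u"
    by (simp add: const_A_def algebra_simps)
qed (use const_nonneg kappa_nonneg small in auto)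

text \<open>The derivative is linear in its direction and the directions weighted by their normal
  components average to the normal divided by the dimension. So the mixed terms become the
  consistency terms of the interior penalty method.\<close>

lemma lift_moment:
  assumes u: "u \<in> V" and v: "v \<in> V"
  shows "(\<Sum>m\<in>D. w m * I (Rop m u) (dd (\<Omega> m) v)) = fform (\<lambda>_. 1) (jump M) Xn u v / real DIM('a)"
proof -
  have "(\<Sum>m\<in>D. w m * I (Rop m u) (dd (\<Omega> m) v)) = (\<Sum>m\<in>D. \<Sum>e\<in>faces M. w m * ((nrm M e \<bullet> \<Omega> m) * face_ip e (jump M e u) (avg M e (dd (\<Omega> m) v))))"
    using u v by (simp add: Rop dd_in fform_def sum_distrib_left)
  also have "\<dots> = (\<Sum>e\<in>faces M. \<Sum>m\<in>D. w m * ((nrm M e \<bullet> \<Omega> m) * face_ip e (jump M e u) (avg M e (dd (\<Omega> m) v))))"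
    by (rule sum.swap)
  also have "\<dots> = (\<Sum>e\<in>faces M. face_ip e (jump M e u) (Xn e v) / real DIM('a))"
  proof (rule sum.cong[OF refl])
    fix e assume e: "e \<in> faces M"
    define \<phi> where "\<phi> = (\<lambda>\<omega>. face_ip e (jump M e u) (avg M e (dd \<omega> v)))"
    have lin: "\<phi> (s *\<^sub>R x + t *\<^sub>R y) = s * \<phi> x + t * \<phi> y" for s t x y
      unfolding \<phi>_def dd_lin_dir
      by (rule bilinear_form.comb_right[OF face_ip_bilinear[OF trace_op_jump trace_op_avg e]]) (simp_all add: u v dd_in)
    have "linear \<phi>" using lin[of 1 _ 1] lin[of _ _ 0] by (intro linearI) simp_all
    moreover have "(\<Sum>m\<in>D. (w m * (nrm M e \<bullet> \<Omega> m)) *\<^sub>R \<Omega> m) = (1 / real DIM('a)) *\<^sub>R nrm M e"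
    proof (rule vector_eq_ldot[THEN iffD1], rule allI)
      fix z
      show "z \<bullet> (\<Sum>m\<in>D. (w m * (nrm M e \<bullet> \<Omega> m)) *\<^sub>R \<Omega> m) = z \<bullet> ((1 / real DIM('a)) *\<^sub>R nrm M e)"
        using second_moment_inner[of "nrm M e" z] by (simp add: inner_sum_right inner_commute mult_ac)
    qed
    ultimately have "(\<Sum>m\<in>D. (w m * (nrm M e \<bullet> \<Omega> m)) * \<phi> (\<Omega> m)) = (1 / real DIM('a)) * \<phi> (nrm M e)"
      using linear_sum[of \<phi> "\<lambda>m. (w m * (nrm M e \<bullet> \<Omega> m)) *\<^sub>R \<Omega> m" D] by (simp add: linear_scale)
    then show "(\<Sum>m\<in>D. w m * ((nrm M e \<bullet> \<Omega> m) * face_ip e (jump M e u) (avg M e (dd (\<Omega> m) v)))) = face_ip e (jump M e u) (Xn e v) / real DIM('a)"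
      by (simp add: \<phi>_def Xn_def mult.assoc)
  qed
  finally show ?thesis by (simp add: fform_def sum_divide_distrib)
qed

text \<open>Absorption comes from \<open>1 - c\<close>, the penalty from the mean dissipation, and
  diffusion with its consistency terms from the second moments; the penalty agrees because
  \<open>tau\<close> equals \<open>beta\<close> in this regime.\<close>

lemma a0_eq:
  assumes u: "u \<in> V" and v: "v \<in> V"
  shows "DR.a0 u v = am u v"
proof -
  have 1: "(1 - c) / \<eta> = \<epsilon> * sig_a P"
    using \<epsilon> pos by (simp add: c_eq \<eta>_def field_simps power2_eq_square)
  have 2: "I (DR.Sbar u) v = fform (tau P \<epsilon> M p) (jump M) (jump M) u v"
  proof -
    have "I (DR.Sbar u) v = (\<Sum>m\<in>D. w m * I (Sop m u) v)"
      unfolding DR.Sbar_def using Sop(1)[OF u] v by (subst TR.I.sum_left) (auto simp: TR.I.scale_left)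
    then show ?thesis by (simp add: Sop(2)[OF u v] tau_form fform_beta)
  qed
  have 3: "(\<Sum>m\<in>D. w m * (I (dd (\<Omega> m) u) (dd (\<Omega> m) v) - I (Rop m u) (dd (\<Omega> m) v) - I (dd (\<Omega> m) u) (Rop m v))) =
      Gr u v / real DIM('a) - fform (\<lambda>_. 1) (jump M) Xn u v / real DIM('a) - fform (\<lambda>_. 1) (jump M) Xn v u / real DIM('a)"
    using dd_moment[OF u v] lift_moment[OF u v] lift_moment[OF v u]
    by (simp add: right_diff_distrib sum_subtractf I_sym[of "dd (\<Omega> _) u" "Rop _ v"])
  show ?thesis
    unfolding DR.a0_def 1 2 3 a_MIP_eq[OF u v] fform_sym[of _ "jump M" Xn u v] fform_sym[of _ "jump M" Xn v u]
    by (simp add: algebra_simps diff_divide_distrib)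
qed

lemma consistency:
  assumes u: "u \<in> V" and v: "v \<in> V"
  shows "\<bar>a_ex P \<epsilon> M p u v - am u v\<bar> \<le> consistency_const (const_A P) (const_B P) (const_1 P) * \<kappa> * MIP.nrm u * MIP.nrm v"
  using DR.response_expansion[OF u v] by (simp add: a_ex_eq u v a0_eq)

lemma MIP_spd: "spd_on V am"
  unfolding spd_on_def fun_comb zero_fun_def[symmetric]
  by (intro conjI ballI allI impI MIP.comb_left MIP.sym MIP.pos)

lemma MIP_boundary:
  "mip_faces P \<epsilon> M p (bd_faces M) u v =
    (\<Sum>e\<in>bd_faces M.
       tau P \<epsilon> M p e * face_ip e (trace_plus M e u) (trace_plus M e v)
       - \<epsilon> / 2 * face_ip e (trace_plus M e (\<lambda>y. D_bar P * (grad u y \<bullet> nrm M e))) (trace_plus M e v)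
       - \<epsilon> / 2 * face_ip e (trace_plus M e (\<lambda>y. D_bar P * (grad v y \<bullet> nrm M e))) (trace_plus M e u))"
proof -
  have j: "jump M e f = trace_plus M e f" "avg M e f = (\<lambda>x. (1/2) * trace_plus M e f x)" if "e \<in> bd_faces M" for e f
    using that int_bd by (auto simp: fun_eq_iff jump_def avg_def trace_minus_def)
  have half: "face_ip e (avg M e f) g = face_ip e (trace_plus M e f) g / 2" if "e \<in> bd_faces M" for e f g
    unfolding j(2)[OF that] face_ip_scale by simp
  show ?thesis
    unfolding mip_faces_def sum_distrib_left sum_subtractf[symmetric]
    by (rule sum.cong) (simp_all add: j(1) half)
qed

section \<open>Error operator of the accelerated iteration\<close>

definition \<delta> :: "('a \<Rightarrow> real) \<Rightarrow> 'a \<Rightarrow> real" where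
  "\<delta> e = (THE r. r \<in> V \<and> (\<forall>v\<in>V. am r v = a_ex P \<epsilon> M p (TR.G e) v))"

lemma \<delta>:
  assumes e: "e \<in> V"
  shows \<delta>_in: "\<delta> e \<in> V" and \<delta>_eq: "v \<in> V \<Longrightarrow> am (\<delta> e) v = a_ex P \<epsilon> M p (TR.G e) v"
proof -
  interpret ex: pd_form V "a_ex P \<epsilon> M p" by (rule a_ex_pd)
  have "\<exists>!r. r \<in> V \<and> (\<forall>v\<in>V. am r v = a_ex P \<epsilon> M p (TR.G e) v)"
    by (rule Lax_Milgram[OF fin_dim_V MIP.bilinear_form_axioms]) (simp_all add: MIP.pos ex.comb_right TR.G_in e)
  from theI'[OF this] show "\<delta> e \<in> V" "v \<in> V \<Longrightarrow> am (\<delta> e) v = a_ex P \<epsilon> M p (TR.G e) v" by (auto simp: \<delta>_def)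
qed

lemma \<delta>_lin:
  assumes "u \<in> V" "v \<in> V"
  shows "\<delta> (s *\<^sub>R u + t *\<^sub>R v) = s *\<^sub>R \<delta> u + t *\<^sub>R \<delta> v"
proof (rule MIP.eqI)
  interpret ex: pd_form V "a_ex P \<epsilon> M p" by (rule a_ex_pd)
  fix z assume z: "z \<in> V"
  show "am (\<delta> (s *\<^sub>R u + t *\<^sub>R v)) z = am (s *\<^sub>R \<delta> u + t *\<^sub>R \<delta> v) z"
    using assms z by (simp add: \<delta>_eq Vc MIP.comb_left \<delta>_in TR.G_lin ex.comb_left TR.G_in)
qed (simp_all add: assms \<delta>_in Vc)

text \<open>The predictor changes the iterate by \<open>e - G e\<close>, where \<open>e\<close> is
  the error; with the scattering coefficient \<open>c / \<eta>\<close> the source is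
  \<open>a_ex\<close> applied to \<open>G e\<close>, by \<open>TR.ax_G\<close>.\<close>

lemma MIP_correction_eq:
  assumes q: "q \<in> V" and \<phi>: "\<phi> \<in> V"
  shows "MIP_correction P \<epsilon> M p q \<phi> = \<delta> (phi_star P \<epsilon> M p q - \<phi>)"
proof -
  define e where "e = phi_star P \<epsilon> M p q - \<phi>"
  have e: "e \<in> V" unfolding e_def by (rule subspace_diff[OF subspace_V phi_star_in[OF q] \<phi>])
  have "TR.G e = TR.G (phi_star P \<epsilon> M p q) - TR.G \<phi>"
    using TR.G_lin[OF phi_star_in[OF q] \<phi>, of 1 "-1"] by (simp add: e_def)
  moreover have "TR.G (phi_star P \<epsilon> M p q) = phi_star P \<epsilon> M p q - \<eta> *\<^sub>R TR.H q"
    using phi_star_eq[OF q] by (metis add_diff_cancel_right')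
  ultimately have diff_eq: "SI_step P \<epsilon> M p q \<phi> - \<phi> = e - TR.G e"
    by (simp add: SI_step_eq[OF q \<phi>] e_def)
  have rhs: "I (\<lambda>x. sigma_s P \<epsilon> * (SI_step P \<epsilon> M p q \<phi> x - \<phi> x)) v = a_ex P \<epsilon> M p (TR.G e) v" if v: "v \<in> V" for v
  proof -
    have "I (\<lambda>x. sigma_s P \<epsilon> * (SI_step P \<epsilon> M p q \<phi> - \<phi>) x) v = sigma_s P \<epsilon> * I (e - TR.G e) v"
      by (simp only: ip_scale diff_eq)
    moreover have "sigma_s P \<epsilon> = c / \<eta>" using eta_sigma_s \<eta>_pos by (simp add: field_simps)
    ultimately show ?thesis using e v by (simp add: a_ex_eq TR.G_in TR.ax_G)
  qed
  show ?thesis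
    unfolding MIP_correction_def \<delta>_def e_def[symmetric]
    by (intro arg_cong[where f = The] ext conj_cong refl ball_cong) (simp add: rhs)
qed

lemma E_op_eq: "v \<in> V \<Longrightarrow> E_op P \<epsilon> M p v = TR.G v - \<delta> v"
  unfolding E_op_def
proof (rule error_propagator_eq)
  show "TR.G v - \<delta> v \<in> V" if "v \<in> V" for v
    using that by (intro subspace_diff[OF subspace_V]) (auto simp: TR.G_in \<delta>_in)
  show "TR.G (s *\<^sub>R u + t *\<^sub>R v) - \<delta> (s *\<^sub>R u + t *\<^sub>R v) = s *\<^sub>R (TR.G u - \<delta> u) + t *\<^sub>R (TR.G v - \<delta> v)"
    if "u \<in> V" "v \<in> V" for u v s t
    using TR.G_lin[OF that] \<delta>_lin[OF that] by (simp add: algebra_simps)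
  fix q \<phi> assume q: "q \<in> V" and \<phi>: "\<phi> \<in> V"
  have "DSA_step P \<epsilon> M p q \<phi> = SI_step P \<epsilon> M p q \<phi> + \<delta> (phi_star P \<epsilon> M p q - \<phi>)"
    by (simp add: DSA_step_def fun_eq_iff MIP_correction_eq[OF q \<phi>])
  moreover have "TR.G (phi_star P \<epsilon> M p q - \<phi>) = phi_star P \<epsilon> M p q - SI_step P \<epsilon> M p q \<phi>"
  proof -
    have "phi_star P \<epsilon> M p q - SI_step P \<epsilon> M p q \<phi> = TR.G (phi_star P \<epsilon> M p q) - TR.G \<phi>"
      by (subst phi_star_eq[OF q]) (simp add: SI_step_eq[OF q \<phi>])
    then show ?thesis using TR.G_lin[OF phi_star_in[OF q] \<phi>, of 1 "-1"] by simp
  qed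
  ultimately show "phi_star P \<epsilon> M p q - DSA_step P \<epsilon> M p q \<phi> =
      TR.G (phi_star P \<epsilon> M p q - \<phi>) - \<delta> (phi_star P \<epsilon> M p q - \<phi>)" by simp
qed assumption

lemma dsa_contraction:
  assumes C: "2 * consistency_const (const_A P) (const_B P) (const_1 P) \<le> C" "2 * C * \<kappa> \<le> 1"
  shows "norm_ex P \<epsilon> M p (E_op P \<epsilon> M p) \<le> C * \<kappa> * rho M p (G_op P \<epsilon> M p) \<and>
     rho M p (E_op P \<epsilon> M p) \<le> norm_ex P \<epsilon> M p (E_op P \<epsilon> M p) \<and>
     norm_ex P \<epsilon> M p (E_op P \<epsilon> M p) \<le> 1 / 2 * rho M p (G_op P \<epsilon> M p) \<and>
     1 / 2 * rho M p (G_op P \<epsilon> M p) < norm_ex P \<epsilon> M p (G_op P \<epsilon> M p) \<and>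
     norm_ex P \<epsilon> M p (G_op P \<epsilon> M p) = rho M p (G_op P \<epsilon> M p)"
proof -
  obtain N where N: "N > 0" "norm_ex P \<epsilon> M p (G_op P \<epsilon> M p) = N" "rho M p (G_op P \<epsilon> M p) = N"
    and bd: "\<And>v. v \<in> V \<Longrightarrow> form_norm (a_ex P \<epsilon> M p) (TR.G v) \<le> N * form_norm (a_ex P \<epsilon> M p) v"
    using G_norm by auto
  obtain z where z: "z \<in> V" "z \<noteq> 0" by (rule V_nontrivial)
  interpret ex: pd_form V "a_ex P \<epsilon> M p" by (rule a_ex_pd)
  define k where "k = consistency_const (const_A P) (const_B P) (const_1 P) * \<kappa>"
  have cc: "0 \<le> consistency_const (const_A P) (const_B P) (const_1 P)"
    using const_nonneg by (simp add: consistency_const_def)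
  \<comment> \<open>\<open>C * \<kappa> \<le> 1/2\<close> gives \<open>k \<le> 1/4\<close>, the
    range in which the two energy norms are compared.\<close>
  have k: "0 \<le> k" "2 * k \<le> C * \<kappa>" "k \<le> 1/4"
  proof -
    show "0 \<le> k" using cc kappa_nonneg by (simp add: k_def)
    show "2 * k \<le> C * \<kappa>" using mult_right_mono[OF C(1) kappa_nonneg] by (simp add: k_def)
    then show "k \<le> 1/4" using C(2) by simp
  qed
  interpret PC: preconditioned_correction V "a_ex P \<epsilon> M p" am TR.G \<delta> k N z
  proof
    show "\<bar>a_ex P \<epsilon> M p u v - am u v\<bar> \<le> k * MIP.nrm u * MIP.nrm v" if "u \<in> V" "v \<in> V" for u v
      using consistency[OF that] by (simp add: k_def)
    show "ex.nrm (TR.G v) \<le> N * ex.nrm v" if "v \<in> V" for v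
      using bd[OF that] by (simp add: form_norm_eq_nrm[OF ex.psd_form_axioms])
    show "a_ex P \<epsilon> M p (TR.G u) v = a_ex P \<epsilon> M p u (TR.G v)" if "u \<in> V" "v \<in> V" for u v
      using TR.G_sa[OF that] that by (simp add: a_ex_eq TR.G_in)
    show "0 < a_ex P \<epsilon> M p (TR.G v) v" if "v \<in> V" "v \<noteq> 0" for v
      using TR.G_pos[OF that] that by (simp add: a_ex_eq TR.G_in)
    show "0 \<le> k" "k \<le> 1/4" by (rule k)+
    show "am (\<delta> v) u = a_ex P \<epsilon> M p (TR.G v) u" if "v \<in> V" "u \<in> V" for v u
      by (rule \<delta>_eq[OF that])
  qed (simp_all add: fin_dim_V z TR.G_in TR.G_lin \<delta>_in)
  have Ein: "E_op P \<epsilon> M p v \<in> V" if "v \<in> V" for v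
    using that by (simp add: E_op_eq TR.G_in \<delta>_in subspace_diff[OF subspace_V])
  have Ebd: "form_norm (a_ex P \<epsilon> M p) (E_op P \<epsilon> M p v) \<le> (C * \<kappa> * N) * form_norm (a_ex P \<epsilon> M p) v" if v: "v \<in> V" for v
  proof -
    have "ex.nrm (TR.G v - \<delta> v) \<le> 2 * k * N * ex.nrm v" by (rule PC.correction_bound[OF v])
    also have "\<dots> \<le> (C * \<kappa>) * N * ex.nrm v" using k N v by (intro mult_right_mono) auto
    finally show ?thesis using v by (simp add: E_op_eq form_norm_eq_nrm[OF ex.psd_form_axioms])
  qed
  have 1: "norm_ex P \<epsilon> M p (E_op P \<epsilon> M p) \<le> C * \<kappa> * N"
    unfolding norm_ex_def by (rule op_norm_on_le[OF a_ex_pd Ebd z])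
  have nb: "form_norm (a_ex P \<epsilon> M p) (E_op P \<epsilon> M p v) \<le> norm_ex P \<epsilon> M p (E_op P \<epsilon> M p) * form_norm (a_ex P \<epsilon> M p) v"
    if v: "v \<in> V" for v
  proof (cases "v = 0")
    case True
    have "E_op P \<epsilon> M p 0 = 0"
      using PC.\<delta>_lin[of 0 0 0 0] TR.G_lin[of 0 0 0 0] subspace_0[OF subspace_V] by (simp add: E_op_eq)
    then show ?thesis using True ex.zero_left[of 0] subspace_0[OF subspace_V] by (simp add: form_norm_def)
  next
    case False
    show ?thesis unfolding norm_ex_def by (rule le_op_norm_on[OF a_ex_pd Ebd v False])
  qed
  have nn: "0 \<le> norm_ex P \<epsilon> M p (E_op P \<epsilon> M p)"
  proof -
    have "0 \<le> norm_ex P \<epsilon> M p (E_op P \<epsilon> M p) * form_norm (a_ex P \<epsilon> M p) z"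
      using nb[OF z(1)] ex.psd[OF Ein[OF z(1)]] by (simp add: form_norm_def) (meson order_trans real_sqrt_ge_zero)
    moreover have "0 < form_norm (a_ex P \<epsilon> M p) z" using ex.pos[OF z] by (simp add: form_norm_def)
    ultimately show ?thesis by (simp add: zero_le_mult_iff)
  qed
  \<comment> \<open>Needed for the spectral radius to be a genuine supremum.\<close>
  have ne: "complex_eigenvalues_on V (E_op P \<epsilon> M p) \<noteq> {}"
  proof -
    obtain v0 l where v0: "v0 \<in> V" "v0 \<noteq> 0" "TR.G v0 - \<delta> v0 = l *\<^sub>R v0" by (rule PC.correction_eigenvalue)
    have z0: "0 \<in> V" by (rule subspace_0[OF subspace_V])
    have "E_op P \<epsilon> M p 0 = 0"
      using PC.\<delta>_lin[OF z0 z0, of 0 0] TR.G_lin[OF z0 z0, of 0 0] by (simp add: E_op_eq z0)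
    then have "complex_of_real l \<in> complex_eigenvalues_on V (E_op P \<epsilon> M p)"
      using v0 z0 by (intro real_eigenvalue_in_complex_eigenvalues[where v = v0]) (auto simp: E_op_eq)
    then show ?thesis by blast
  qed
  have 2: "rho M p (E_op P \<epsilon> M p) \<le> norm_ex P \<epsilon> M p (E_op P \<epsilon> M p)"
    unfolding rho_def by (rule spectral_radius_le[OF a_ex_pd Ein nb nn ne])
  have "C * \<kappa> * N \<le> 1/2 * N" using C(2) N by (intro mult_right_mono) auto
  then have 3: "norm_ex P \<epsilon> M p (E_op P \<epsilon> M p) \<le> 1/2 * N" using 1 by simp
  show ?thesis using 1 2 3 N by simp
qed

end

theorem theorem4p2:
  fixes P :: "'a::euclidean_space dsa_data"
  assumes "DIM('a) \<in> {2, 3}"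
    and "admissible_data P"
  shows "(\<forall>\<Omega> \<M>. polytopal_domain \<Omega> \<and> admissible_family P \<Omega> \<M> \<longrightarrow>
           (\<forall>M\<in>\<M>. \<forall>p\<ge>1. \<forall>\<epsilon>. 0 < \<epsilon> \<and> \<epsilon> < sqrt (sig_t P / sig_a P) \<longrightarrow>
              self_adjoint_on (Vh M p) (a_ex P \<epsilon> M p) (G_op P \<epsilon> M p) \<and>
              norm_ex P \<epsilon> M p (G_op P \<epsilon> M p) = rho M p (G_op P \<epsilon> M p) \<and>
              rho M p (G_op P \<epsilon> M p) = c_ratio P \<epsilon> * lambda_max_H P \<epsilon> M p \<and>
              c_ratio P \<epsilon> * lambda_max_H P \<epsilon> M p \<le> 1 - \<epsilon>\<^sup>2 * (sig_a P / sig_t P) \<and>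
              lambda_max_H P \<epsilon> M p < 1 \<and>
              c_ratio P \<epsilon> * lambda_max_H P \<epsilon> M p < c_ratio P \<epsilon>))
       \<and> (\<exists>C Kn0. 0 < C \<and> 0 < Kn0 \<and> Kn0 \<le> min ((theta P)\<^sup>2 / C_tr P) (1 / (2 * C)) \<and>
           (\<forall>\<Omega> \<M>. polytopal_domain \<Omega> \<and> admissible_family P \<Omega> \<M> \<longrightarrow>
             (\<forall>M\<in>\<M>. \<forall>p\<ge>1. \<forall>\<epsilon>. 0 < \<epsilon> \<and> \<epsilon> < sqrt (sig_t P / sig_a P) \<and>
                Knudsen P \<epsilon> M p \<le> Kn0 \<longrightarrow>
                (\<forall>e\<in>faces M. tau P \<epsilon> M p e = beta P M e) \<and>
                (spd_on (Vh M p) (a_MIP P \<epsilon> M p) \<and>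
                 (\<forall>u\<in>Vh M p. \<forall>v\<in>Vh M p.
                    mip_faces P \<epsilon> M p (bd_faces M) u v =
                    (\<Sum>e\<in>bd_faces M.
                       tau P \<epsilon> M p e * face_ip e (trace_plus M e u) (trace_plus M e v)
                       - \<epsilon> / 2 * face_ip e
                           (trace_plus M e (\<lambda>y. D_bar P * (grad u y \<bullet> nrm M e))) (trace_plus M e v)
                       - \<epsilon> / 2 * face_ip e
                           (trace_plus M e (\<lambda>y. D_bar P * (grad v y \<bullet> nrm M e))) (trace_plus M e u)))) \<and>
                (\<forall>u\<in>Vh M p. \<forall>v\<in>Vh M p.
                   \<bar>a_ex P \<epsilon> M p u v - a_MIP P \<epsilon> M p u v\<bar>
                     \<le> C * Knudsen P \<epsilon> M p
                         * form_norm (a_MIP P \<epsilon> M p) u * form_norm (a_MIP P \<epsilon> M p) v) \<and>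
                (norm_ex P \<epsilon> M p (E_op P \<epsilon> M p)
                   \<le> C * Knudsen P \<epsilon> M p * rho M p (G_op P \<epsilon> M p) \<and>
                 rho M p (E_op P \<epsilon> M p) \<le> norm_ex P \<epsilon> M p (E_op P \<epsilon> M p) \<and>
                 norm_ex P \<epsilon> M p (E_op P \<epsilon> M p) \<le> 1 / 2 * rho M p (G_op P \<epsilon> M p) \<and>
                 1 / 2 * rho M p (G_op P \<epsilon> M p) < norm_ex P \<epsilon> M p (G_op P \<epsilon> M p) \<and>
                 norm_ex P \<epsilon> M p (G_op P \<epsilon> M p) = rho M p (G_op P \<epsilon> M p)))))"
proof -
  define c0 where "c0 = consistency_const (const_A P) (const_B P) (const_1 P)"
  have pos: "0 < C_inv P" "0 < C_tr P" "0 < theta P"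
    using assms(2) by (auto simp: admissible_data_def)
  have c0: "0 \<le> c0"
    using pos by (simp add: c0_def consistency_const_def const_A_def const_B_def const_1_def)
  have const_1: "0 < const_1 P" using pos by (simp add: const_1_def)
  \<comment> \<open>The factor 2 is the loss in \<open>correction_bound\<close>; the summand 1 keeps
    \<open>C\<close> positive.\<close>
  define C where "C = 2 * (c0 + 1)"
  \<comment> \<open>The first two entries are the required bounds; the others secure the remaining
    assumptions of \<open>low_knudsen\<close>. All depend on the fixed data alone.\<close>
  define Kn0 where
    "Kn0 = Min {(theta P)\<^sup>2 / C_tr P, 1 / (2 * C), 1, 1 / (2 * const_1 P), 1 / (4 * C_tr P)}"
  have C: "0 < C" using c0 by (simp add: C_def)
  have Kn0: "0 < Kn0" "Kn0 \<le> (theta P)\<^sup>2 / C_tr P" "Kn0 \<le> 1 / (2 * C)" "Kn0 \<le> 1"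
      "Kn0 \<le> 1 / (2 * const_1 P)" "Kn0 \<le> 1 / (4 * C_tr P)"
    using pos C const_1 by (auto simp: Kn0_def)
  have setting: "dsa_setting M p P \<epsilon>"
    if "admissible_family P \<Omega> \<M>" "M \<in> \<M>" "1 \<le> p" "0 < \<epsilon>" "\<epsilon> < sqrt (sig_t P / sig_a P)"
    for \<Omega> \<M> and M :: "'a mesh" and p \<epsilon>
    using that assms(2)
    by (auto simp: admissible_family_def intro!: dsa_setting.intro dsa_setting_axioms.intro broken_space.intro)
  have low: "low_knudsen M p P \<epsilon>" if s: "dsa_setting M p P \<epsilon>" and K: "Knudsen P \<epsilon> M p \<le> Kn0"
    for M :: "'a mesh" and p \<epsilon>
  proof (intro low_knudsen.intro s low_knudsen_axioms.intro)
    note le = K[THEN order_trans]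
    show "Knudsen P \<epsilon> M p \<le> (theta P)\<^sup>2 / C_tr P" "Knudsen P \<epsilon> M p \<le> 1"
      by (rule le[OF Kn0(2)], rule le[OF Kn0(4)])
    show "const_1 P * Knudsen P \<epsilon> M p \<le> 1 / 2" "4 * C_tr P * Knudsen P \<epsilon> M p \<le> 1"
      using le[OF Kn0(5)] le[OF Kn0(6)] const_1 pos by (simp_all add: field_simps)
  qed
  have estimate: "\<bar>a_ex P \<epsilon> M p u v - a_MIP P \<epsilon> M p u v\<bar>
        \<le> C * Knudsen P \<epsilon> M p * form_norm (a_MIP P \<epsilon> M p) u * form_norm (a_MIP P \<epsilon> M p) v"
    if l: "low_knudsen M p P \<epsilon>" and uv: "u \<in> Vh M p" "v \<in> Vh M p" for M :: "'a mesh" and p \<epsilon> u v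
  proof -
    interpret low_knudsen M p P \<epsilon> by (rule l)
    have "\<bar>a_ex P \<epsilon> M p u v - a_MIP P \<epsilon> M p u v\<bar> \<le> c0 * Knudsen P \<epsilon> M p * MIP.nrm u * MIP.nrm v"
      unfolding c0_def by (rule consistency[OF uv])
    also have "\<dots> \<le> C * Knudsen P \<epsilon> M p * MIP.nrm u * MIP.nrm v"
      using c0 kappa_nonneg uv by (intro mult_right_mono) (auto simp: C_def)
    finally show ?thesis by (simp add: form_norm_eq_nrm[OF MIP.psd_form_axioms])
  qed
  have contraction: "norm_ex P \<epsilon> M p (E_op P \<epsilon> M p) \<le> C * Knudsen P \<epsilon> M p * rho M p (G_op P \<epsilon> M p) \<and>
     rho M p (E_op P \<epsilon> M p) \<le> norm_ex P \<epsilon> M p (E_op P \<epsilon> M p) \<and>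
     norm_ex P \<epsilon> M p (E_op P \<epsilon> M p) \<le> 1 / 2 * rho M p (G_op P \<epsilon> M p) \<and>
     1 / 2 * rho M p (G_op P \<epsilon> M p) < norm_ex P \<epsilon> M p (G_op P \<epsilon> M p) \<and>
     norm_ex P \<epsilon> M p (G_op P \<epsilon> M p) = rho M p (G_op P \<epsilon> M p)"
    if l: "low_knudsen M p P \<epsilon>" and K: "Knudsen P \<epsilon> M p \<le> Kn0" for M :: "'a mesh" and p \<epsilon>
  proof (rule low_knudsen.dsa_contraction[OF l])
    show "2 * consistency_const (const_A P) (const_B P) (const_1 P) \<le> C" by (simp add: C_def c0_def)
    show "2 * C * Knudsen P \<epsilon> M p \<le> 1" using order_trans[OF K Kn0(3)] C by (simp add: field_simps)
  qed
  have tau: "tau P \<epsilon> M p e = beta P M e" if "low_knudsen M p P \<epsilon>" "e \<in> faces M" for M :: "'a mesh" and p \<epsilon> e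
    by (rule dsa_setting.tau_eq_beta[OF low_knudsen.axioms(1)[OF that(1)]
          low_knudsen.small(1)[OF that(1)] that(2)])
  show ?thesis
  proof (rule conjI, goal_cases)
    case 1
    show ?case by (intro allI impI ballI, elim conjE, rule dsa_setting.source_iteration[OF setting])
  next
    case 2
    show ?case
    proof (intro exI[of _ C] exI[of _ Kn0] conjI[OF C] conjI[OF Kn0(1)] conjI[OF min.boundedI[OF Kn0(2,3)]]
        allI impI ballI, elim conjE, goal_cases)
      case (1 \<Omega> \<M> M p \<epsilon>)
      note K = \<open>Knudsen P \<epsilon> M p \<le> Kn0\<close>
      have l: "low_knudsen M p P \<epsilon>" by (rule low[OF setting]) (use 1 in auto)
      show ?case
        by (rule contraction[OF l K] tau[OF l] estimate[OF l] low_knudsen.MIP_spd[OF l]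
            low_knudsen.MIP_boundary[OF l] conjI ballI | assumption)+
    qed
  qed
qed

end
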